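(* Let $N\in\{1,2\}$, let $\mathcal H$ and $\mathbf B$ satisfy the structural conditions stated in the context, let $\Omega\subset\mathbb R^{N+2}$ be open, and suppose there is a smooth mapping $(\mu,\boldsymbol\lambda,c)\in\Omega\mapsto(\underline{\mathbf U},\Xi)$ such that, for every $(\mu,\boldsymbol\lambda,c)\in\Omega$, $\underline{\mathbf U}$ is a $\Xi$-periodic solution of the profile equations $$\mathsf E(\mathcal H+c\mathcal Q)[\underline{\mathbf U}]+\boldsymbol\lambda=0,\qquad \mathsf L\mathcal L[\underline{\mathbf U}]=\mu,$$ with $\underline{\mathbf U}(0)=\underline{\mathbf U}(\Xi)$ and $\underline v_x(0)=\underline v_x(\Xi)=0$. Let $$\Theta(\mu,\boldsymbol\lambda,c):=\int_0^{\Xi}\big(\mathcal H(\underline{\mathbf U},\underline v_x)+c\,\mathcal Q(\underline{\mathbf U})+\boldsymbol\lambda\cdot\underline{\mathbf U}+\mu\big)\,dx .$$ Assume that $\Xi_\mu:=\partial\Xi/\partial\mu\neq0$ and that the $(N+1)\times(N+1)$ matrix $$\mathbf C:=\check\nabla^2\Theta-\frac{\check\nabla\Xi\otimes\check\nabla\Xi}{\Xi_\mu}$$ takes nonsingular values, where $\check\nabla$ denotes the gradient (and $\check\nabla^2$ the Hessian) with respect to $(\boldsymbol\lambda,c)$ at fixed $\mu$. Let $\mathscr A:=\mathsf{Hess}(\mathcal H+c\mathcal Q)[\underline{\mathbf U}]$. If $\mathsf n(\mathscr A)=\mathsf n(-\mathbf C)$, then the periodic travelling wave $(x,t)\mapsto\underline{\mathbf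 U}(x-ct)$, solution of $\partial_t\mathbf U=\partial_x(\mathbf B\,\mathsf E\mathcal H[\mathbf U])$, is (conditionally) orbitally stable to co-periodic perturbations.
   Context: The unknown $\mathbf U$ takes values in $\mathbb R^N$; its first component is $v$, so $\mathbf U=v$ if $N=1$ and $\mathbf U=(v,u)$ if $N=2$. The matrix $\mathbf B\in\mathbb R^{N\times N}$ is symmetric and nonsingular. Structural conditions ($\mathcal H$ smooth). If $N=1$: $\mathcal H=\mathcal E(v,v_x)$ with $\partial^2\mathcal E/\partial v_x^2=:\kappa(v)>0$. If $N=2$: $\mathcal H(v,u,v_x)=\mathcal E(v,v_x)+\mathcal T(v,u)$ with $\partial^2\mathcal E/\partial v_x^2=:\kappa(v)>0$, $\partial^2\mathcal T/\partial u^2=:T(v)>0$, and $\mathbf B^{-1}=\begin{pmatrix}a&b\\ b&0\end{pmatrix}$ with $b\neq0$. (Here $\kappa$ and $T$ depend on $v$ only.) Parameters are $\mu\in\mathbb R$, $\boldsymbol\lambda\in\mathbb R^N$, $c\in\mathbb R$. Impulse: $\mathcal Q(\mathbf U):=\tfrac12\,\mathbf U\cdot\mathbf B^{-1}\mathbf U$. Lagrangian: $\mathcal L(\mathbf U,v_x;c,\boldsymbol\lambda):=\mathcal H(\mathbf U,v_x)+c\,\mathcal Q(\mathbf U)+\boldsymbol\lambda\cdot\mathbf U$. Variational derivative: for $\mathcal F=\mathcal F(\mathbf U,\mathbf U_x)$, $(\mathsf E\mathcal F[\mathbf U])_\alpha:=\frac{\partial\mathcal F}{\partial U_\alpha}(\mathbf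 U,\mathbf U_x)-\frac{d}{dx}\Big(\frac{\partial\mathcal F}{\partial U_{\alpha,x}}(\mathbf U,\mathbf U_x)\Big)$, where $\frac{d}{dx}$ is the total derivative. "Legendre transform" (in the original variables): $\mathsf L\mathcal F[\mathbf U]:=\sum_\alpha U_{\alpha,x}\frac{\partial\mathcal F}{\partial U_{\alpha,x}}(\mathbf U,\mathbf U_x)-\mathcal F(\mathbf U,\mathbf U_x)$. Smoothness of $(\mu,\boldsymbol\lambda,c)\mapsto(\underline{\mathbf U},\Xi)$ means that $\Xi>0$ depends smoothly on the parameters and $\underline{\mathbf U}$ depends smoothly on $x$ and the parameters. $\underline v$ is the first component of $\underline{\mathbf U}$. Let $\mathbb H^s:=H^s(\mathbb R/\Xi\mathbb Z)\times(L^2(\mathbb R/\Xi\mathbb Z))^{N-1}$. The operator $\mathscr A=\mathsf{Hess}(\mathcal H+c\mathcal Q)[\underline{\mathbf U}]$ is the second variational derivative, $\mathscr A\mathbf V:=\frac{d}{d\theta}\big|_{\theta=0}\mathsf E(\mathcal H+c\mathcal Q)[\underline{\mathbf U}+\theta\mathbf V]$, a self-adjoint operator on $\mathbb H^0=L^2(\mathbb R/\Xi\mathbb Z;\mathbb R^N)$ with domain $\mathbb H^2$. $\mathsf n(\mathscr A)$ denotes its negative signature, i.e. the maximal dimension of a subspace of $\mathbb H^2$ on which $\mathbf V\mapsto\langle\mathbf V\cdot\mathscr A\mathbf V\rangle_{L^2}$ is negative definite; for a real symmetric matrix, $\mathsf n$ is the number of negative eigenvalues counted with multiplicity. Conditional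 orbital stability to co-periodic perturbations means the following. Let $\mathbb H\subset\mathbb H^1$ be any function space (of $\Xi$-periodic functions) in which the Cauchy problem for $\partial_t\mathbf U=\partial_x(\mathbf B\,\mathsf E\mathcal H[\mathbf U])$ is locally well-posed, the quantities $\int_0^\Xi\mathcal H(\mathbf U,v_x)\,dx$, $\int_0^\Xi\mathcal Q(\mathbf U)\,dx$ and $\int_0^\Xi\mathbf U\,dx$ being conserved along solutions. For $\mathbf U_0\in\mathbb H$ let $T(\mathbf U_0)$ be the maximal time of existence of the solution $\mathbf U$ in $\mathbb H$ with initial data $\mathbf U_0$. Then for all $\varepsilon>0$ there exists $\delta>0$ such that for all $\mathbf U_0\in\mathbb H$, $$\|\mathbf U_0-\underline{\mathbf U}\|_{\mathbb H^1}\le\delta\ \Longrightarrow\ \forall t\in[0,T(\mathbf U_0)),\quad \inf_{s\in\mathbb R}\|\mathbf U(t,\cdot)-\underline{\mathbf U}(\cdot+s)\|_{\mathbb H^1}\le\varepsilon .$$ *)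

theory Defs
  imports "HOL-Analysis.Analysis" "HOL-Library.Function_Algebras" "HOL-Library.Extended_Nat"
begin

section \<open>Functions as a real vector space\<close>

instantiation "fun" :: (type, real_vector) real_vector
begin

definition scaleR_fun :: "real \<Rightarrow> ('a \<Rightarrow> 'b) \<Rightarrow> 'a \<Rightarrow> 'b"
  where "r *\<^sub>R f = (\<lambda>x. r *\<^sub>R f x)"

instance
  by standard (simp_all add: scaleR_fun_def fun_eq_iff scaleR_add_right scaleR_add_left)

end


section \<open>Smoothness\<close>

text \<open>Meant for open \<open>S\<close>; on a finite-dimensional domain this is the class \<open>C\<^sup>k\<close>.\<close>

primrec Ck_on :: "nat \<Rightarrow> 'a::real_normed_vector set \<Rightarrow> ('a \<Rightarrow> 'b::real_normed_vector) \<Rightarrow> bool" where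
  "Ck_on 0 S f \<longleftrightarrow> continuous_on S f"
| "Ck_on (Suc k) S f \<longleftrightarrow>
    (\<forall>x\<in>S. f differentiable (at x)) \<and> (\<forall>h. Ck_on k S (\<lambda>x. frechet_derivative f (at x) h))"

definition smooth_on :: "'a::real_normed_vector set \<Rightarrow> ('a \<Rightarrow> 'b::real_normed_vector) \<Rightarrow> bool"
  where "smooth_on S f \<longleftrightarrow> (\<forall>k. Ck_on k S f)"


section \<open>Variational calculus\<close>

text \<open>A density \<open>F U P\<close> is a function of the state \<open>U\<close> and of the slot \<open>P\<close> for \<open>U\<^sub>x\<close>.\<close>

type_synonym 'n density = "real ^ 'n \<Rightarrow> real ^ 'n \<Rightarrow> real"

definition dF_dU :: "'n::finite density \<Rightarrow> 'n \<Rightarrow> 'n density"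
  where "dF_dU F \<alpha> U P = deriv (\<lambda>s. F (U + s *\<^sub>R axis \<alpha> 1) P) 0"

definition dF_dUx :: "'n::finite density \<Rightarrow> 'n \<Rightarrow> 'n density"
  where "dF_dUx F \<alpha> U P = deriv (\<lambda>s. F U (P + s *\<^sub>R axis \<alpha> 1)) 0"

text \<open>The derivative is taken componentwise, so that the derivative of the first component of a
  function is meaningful even where the second component is merely measurable. The densities
  below only depend on the first component of \<open>U\<^sub>x\<close>, so that the others never matter.\<close>

definition x_deriv :: "(real \<Rightarrow> real ^ 'n::finite) \<Rightarrow> real \<Rightarrow> real ^ 'n"
  where "x_deriv U x = (\<chi> \<alpha>. deriv (\<lambda>y. U y $ \<alpha>) x)"

definition euler :: "'n::finite density \<Rightarrow> (real \<Rightarrow> real ^ 'n) \<Rightarrow> real \<Rightarrow> real ^ 'n"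
  where "euler F U x =
    (\<chi> \<alpha>. dF_dU F \<alpha> (U x) (x_deriv U x) - deriv (\<lambda>y. dF_dUx F \<alpha> (U y) (x_deriv U y)) x)"

definition legendre :: "'n::finite density \<Rightarrow> (real \<Rightarrow> real ^ 'n) \<Rightarrow> real \<Rightarrow> real"
  where "legendre F U x =
    (\<Sum>\<alpha>\<in>UNIV. x_deriv U x $ \<alpha> * dF_dUx F \<alpha> (U x) (x_deriv U x)) - F (U x) (x_deriv U x)"

definition hess :: "'n::finite density \<Rightarrow> (real \<Rightarrow> real ^ 'n) \<Rightarrow> (real \<Rightarrow> real ^ 'n) \<Rightarrow> real \<Rightarrow> real ^ 'n"
  where "hess F U V x = (\<chi> \<alpha>. deriv (\<lambda>\<theta>. euler F (U + \<theta> *\<^sub>R V) x $ \<alpha>) 0)"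


section \<open>The Hamiltonian system\<close>

text \<open>The type \<open>'n\<close> indexes the components of the unknown, and \<open>iv\<close> is the index of the first
  component \<open>v\<close>. The Hamiltonian is a function \<open>H (U, v\<^sub>x)\<close>.\<close>

definition ham_density :: "'n::finite \<Rightarrow> ((real ^ 'n) \<times> real \<Rightarrow> real) \<Rightarrow> 'n density"
  where "ham_density iv H U P = H (U, P $ iv)"

definition impulse :: "real ^ 'n ^ 'n \<Rightarrow> real ^ 'n::finite \<Rightarrow> real"
  where "impulse B U = (1 / 2) * (U \<bullet> (matrix_inv B *v U))"

definition ham_impulse ::
    "'n::finite \<Rightarrow> ((real ^ 'n) \<times> real \<Rightarrow> real) \<Rightarrow> real ^ 'n ^ 'n \<Rightarrow> real \<Rightarrow> 'n density"
  where "ham_impulse iv H B c U P = ham_density iv H U P + c * impulse B U"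

definition lagrangian ::
    "'n::finite \<Rightarrow> ((real ^ 'n) \<times> real \<Rightarrow> real) \<Rightarrow> real ^ 'n ^ 'n \<Rightarrow> real \<Rightarrow> real ^ 'n \<Rightarrow> 'n density"
  where "lagrangian iv H B c l U P = ham_impulse iv H B c U P + l \<bullet> U"

definition scalar_structure :: "'n::finite \<Rightarrow> ((real ^ 'n) \<times> real \<Rightarrow> real) \<Rightarrow> bool"
  where "scalar_structure iv H \<longleftrightarrow>
    (\<exists>E \<kappa>. (\<forall>U w. H (U, w) = E (U $ iv) w) \<and>
           (\<forall>v w. (deriv ^^ 2) (E v) w = \<kappa> v) \<and> (\<forall>v::real. \<kappa> v > 0))"

definition system_structure ::
    "'n::finite \<Rightarrow> ((real ^ 'n) \<times> real \<Rightarrow> real) \<Rightarrow> real ^ 'n ^ 'n \<Rightarrow> bool"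
  where "system_structure iv H B \<longleftrightarrow>
    (\<exists>iu. iu \<noteq> iv \<and>
      (\<exists>E T \<kappa> \<tau>. (\<forall>U w. H (U, w) = E (U $ iv) w + T (U $ iv) (U $ iu)) \<and>
           (\<forall>v w. (deriv ^^ 2) (E v) w = \<kappa> v) \<and> (\<forall>v::real. \<kappa> v > 0) \<and>
           (\<forall>v u. (deriv ^^ 2) (T v) u = \<tau> v) \<and> (\<forall>v::real. \<tau> v > 0)) \<and>
      (\<exists>a b. b \<noteq> 0 \<and> matrix_inv B $ iv $ iv = a \<and> matrix_inv B $ iv $ iu = b \<and>
           matrix_inv B $ iu $ iv = b \<and> matrix_inv B $ iu $ iu = 0))"

definition structural_conditions ::
    "'n::finite \<Rightarrow> ((real ^ 'n) \<times> real \<Rightarrow> real) \<Rightarrow> real ^ 'n ^ 'n \<Rightarrow> bool"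
  where "structural_conditions iv H B \<longleftrightarrow>
    transpose B = B \<and> invertible B \<and> smooth_on UNIV H \<and>
    (CARD('n) = 1 \<longrightarrow> scalar_structure iv H) \<and>
    (CARD('n) = 2 \<longrightarrow> system_structure iv H B)"


section \<open>Periodic waves\<close>

definition periodic :: "real \<Rightarrow> (real \<Rightarrow> 'a) \<Rightarrow> bool"
  where "periodic X f \<longleftrightarrow> (\<forall>x. f (x + X) = f x)"

text \<open>Parameters are triples \<open>(\<mu>, \<lambda>, c)\<close>.\<close>

type_synonym 'n param = "real \<times> (real ^ 'n) \<times> real"

definition action ::
    "'n::finite \<Rightarrow> ((real ^ 'n) \<times> real \<Rightarrow> real) \<Rightarrow> real ^ 'n ^ 'n \<Rightarrow>
     ('n param \<Rightarrow> real \<Rightarrow> real ^ 'n) \<Rightarrow> ('n param \<Rightarrow> real) \<Rightarrow> 'n param \<Rightarrow> real"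
  where "action iv H B U X = (\<lambda>(\<mu>, l, c).
    LINT x:{0..X (\<mu>, l, c)}|lebesgue.
      lagrangian iv H B c l (U (\<mu>, l, c) x) (x_deriv (U (\<mu>, l, c)) x) + \<mu>)"

definition dir_deriv :: "('a::real_vector \<Rightarrow> real) \<Rightarrow> 'a \<Rightarrow> 'a \<Rightarrow> real"
  where "dir_deriv f d p = deriv (\<lambda>s. f (p + s *\<^sub>R d)) 0"

definition mu_dir :: "'n::finite param"
  where "mu_dir = (1, 0, 0)"

text \<open>The \<open>N + 1\<close> parameters \<open>(\<lambda>, c)\<close> are indexed by \<open>'n option\<close>, with \<open>None\<close> standing
  for \<open>c\<close>.\<close>

primrec check_dir :: "'n::finite option \<Rightarrow> 'n param" where
  "check_dir (Some \<alpha>) = (0, axis \<alpha> 1, 0)"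
| "check_dir None = (0, 0, 1)"

definition constraint_matrix ::
    "('n::finite param \<Rightarrow> real) \<Rightarrow> ('n param \<Rightarrow> real) \<Rightarrow> 'n param \<Rightarrow> real ^ ('n option) ^ ('n option)"
  where "constraint_matrix \<Theta> X p =
    (\<chi> i j. dir_deriv (dir_deriv \<Theta> (check_dir j)) (check_dir i) p
           - dir_deriv X (check_dir i) p * dir_deriv X (check_dir j) p / dir_deriv X mu_dir p)"


section \<open>Function spaces\<close>

text \<open>\<open>F\<close> is absolutely continuous with almost everywhere derivative \<open>f\<close>. In one dimension
  Sobolev functions are represented by such \<open>F\<close>.\<close>

definition sobolev_deriv :: "(real \<Rightarrow> real) \<Rightarrow> (real \<Rightarrow> real) \<Rightarrow> bool"
  where "sobolev_deriv F f \<longleftrightarrow>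
    (\<forall>a b. a \<le> b \<longrightarrow> set_integrable lebesgue {a..b} f \<and> F b - F a = (LINT x:{a..b}|lebesgue. f x))"

definition L2_per :: "real \<Rightarrow> (real \<Rightarrow> real) set"
  where "L2_per X = {f. periodic X f \<and> f \<in> borel_measurable lebesgue \<and>
                        set_integrable lebesgue {0..X} (\<lambda>x. (f x)\<^sup>2)}"

primrec H_per :: "nat \<Rightarrow> real \<Rightarrow> (real \<Rightarrow> real) set" where
  "H_per 0 X = L2_per X"
| "H_per (Suc s) X = {f \<in> L2_per X. \<exists>g\<in>H_per s X. sobolev_deriv f g}"

text \<open>Elements are functions rather than classes modulo equality almost everywhere; for \<open>s \<ge> 1\<close>
  the first component is the continuous representative.\<close>

definition HH :: "'n::finite \<Rightarrow> nat \<Rightarrow> real \<Rightarrow> (real \<Rightarrow> real ^ 'n) set"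
  where "HH iv s X = {V. (\<lambda>x. V x $ iv) \<in> H_per s X \<and> (\<forall>\<alpha>. \<alpha> \<noteq> iv \<longrightarrow> (\<lambda>x. V x $ \<alpha>) \<in> L2_per X)}"

text \<open>For \<open>V \<in> HH iv 1 X\<close> the first component is differentiable almost everywhere, and its
  pointwise derivative is its weak derivative.\<close>

definition HH1_norm :: "'n::finite \<Rightarrow> real \<Rightarrow> (real \<Rightarrow> real ^ 'n) \<Rightarrow> real"
  where "HH1_norm iv X V =
    sqrt (LINT x:{0..X}|lebesgue. (norm (V x))\<^sup>2 + (x_deriv V x $ iv)\<^sup>2)"


section \<open>Negative signatures\<close>

text \<open>Since the form vanishes at functions that are zero almost everywhere, a subspace of
  functions as below embeds into the space of classes, so that dimensions agree.\<close>

definition neg_signature :: "('a::real_vector) set \<Rightarrow> ('a \<Rightarrow> real) \<Rightarrow> enat"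
  where "neg_signature D q =
    Sup {enat (card S) | S. finite S \<and> independent S \<and> span S \<subseteq> D \<and>
                            (\<forall>V\<in>span S. V \<noteq> 0 \<longrightarrow> q V < 0)}"

definition hess_form ::
    "'n::finite density \<Rightarrow> real \<Rightarrow> (real \<Rightarrow> real ^ 'n) \<Rightarrow> (real \<Rightarrow> real ^ 'n) \<Rightarrow> real"
  where "hess_form F X U V = (LINT x:{0..X}|lebesgue. V x \<bullet> hess F U V x)"

text \<open>The matrices in question are symmetric, so that geometric and algebraic multiplicities
  agree.\<close>

definition matrix_neg_signature :: "real ^ 'm ^ 'm::finite \<Rightarrow> nat"
  where "matrix_neg_signature M =
    (\<Sum>r\<in>{r. r < 0 \<and> (\<exists>z. z \<noteq> 0 \<and> M *v z = r *\<^sub>R z)}. dim {z. M *v z = r *\<^sub>R z})"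


section \<open>The evolution equation and orbital stability\<close>

definition classical_solution ::
    "'n::finite \<Rightarrow> ((real ^ 'n) \<times> real \<Rightarrow> real) \<Rightarrow> real ^ 'n ^ 'n \<Rightarrow> (real \<Rightarrow> real \<Rightarrow> real ^ 'n) \<Rightarrow> bool"
  where "classical_solution iv H B U \<longleftrightarrow>
    (\<forall>t x. \<exists>d. ((\<lambda>y. B *v euler (ham_density iv H) (U t) y) has_vector_derivative d) (at x) \<and>
               ((\<lambda>s. U s x) has_vector_derivative d) (at t))"

text \<open>The duality product of the variational derivative with a smooth periodic \<open>\<psi>\<close>, obtained by an
  integration by parts so that it makes sense for \<open>U \<in> HH iv 1 X\<close>.\<close>

definition euler_pairing ::
    "'n::finite density \<Rightarrow> real \<Rightarrow> (real \<Rightarrow> real ^ 'n) \<Rightarrow> (real \<Rightarrow> real ^ 'n) \<Rightarrow> real"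
  where "euler_pairing F X U \<psi> =
    (LINT x:{0..X}|lebesgue. \<Sum>\<alpha>\<in>UNIV. dF_dU F \<alpha> (U x) (x_deriv U x) * \<psi> x $ \<alpha>
                                     + dF_dUx F \<alpha> (U x) (x_deriv U x) * x_deriv \<psi> x $ \<alpha>)"

definition times_below :: "ereal \<Rightarrow> real set"
  where "times_below \<tau> = {t. 0 \<le> t \<and> ereal t < \<tau>}"

text \<open>The equation tested against \<open>\<phi>\<close>; recall that \<open>B\<close> is symmetric.\<close>

definition weak_solution ::
    "'n::finite \<Rightarrow> ((real ^ 'n) \<times> real \<Rightarrow> real) \<Rightarrow> real ^ 'n ^ 'n \<Rightarrow> real \<Rightarrow> ereal \<Rightarrow>
     (real \<Rightarrow> real \<Rightarrow> real ^ 'n) \<Rightarrow> bool"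
  where "weak_solution iv H B X \<tau> U \<longleftrightarrow>
    (\<forall>\<phi>. smooth_on UNIV \<phi> \<and> periodic X \<phi> \<longrightarrow>
      (\<forall>t\<in>times_below \<tau>.
        ((\<lambda>s. LINT x:{0..X}|lebesgue. U s x \<bullet> \<phi> x) has_real_derivative
          - euler_pairing (ham_density iv H) X (U t) (\<lambda>x. B *v x_deriv \<phi> x))
        (at t within times_below \<tau>)))"

text \<open>A function space included in \<open>HH iv 1 X\<close> is a linear subspace equipped with a finer
  topology; this covers Banach and Frechet spaces of functions.\<close>

definition function_space :: "'n::finite \<Rightarrow> real \<Rightarrow> (real \<Rightarrow> real ^ 'n) topology \<Rightarrow> bool"
  where "function_space iv X Y \<longleftrightarrow>
    subspace (topspace Y) \<and> topspace Y \<subseteq> HH iv 1 X \<and>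
    (\<forall>V\<in>topspace Y. \<forall>e>0. \<exists>S. openin Y S \<and> V \<in> S \<and> (\<forall>W\<in>S. HH1_norm iv X (W - V) < e))"

definition solves_cauchy ::
    "'n::finite \<Rightarrow> ((real ^ 'n) \<times> real \<Rightarrow> real) \<Rightarrow> real ^ 'n ^ 'n \<Rightarrow> real \<Rightarrow>
     (real \<Rightarrow> real ^ 'n) topology \<Rightarrow> (real \<Rightarrow> real ^ 'n) \<Rightarrow> ereal \<Rightarrow> (real \<Rightarrow> real \<Rightarrow> real ^ 'n) \<Rightarrow> bool"
  where "solves_cauchy iv H B X Y U0 \<tau> U \<longleftrightarrow>
    continuous_map (top_of_set (times_below \<tau>)) Y U \<and> weak_solution iv H B X \<tau> U \<and>
    (AE x in lebesgue. U 0 x = U0 x)"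

text \<open>\<open>T U0\<close> is the maximal existence time and \<open>S U0\<close> the maximal solution. The clauses are
  existence, uniqueness together with maximality, and continuous dependence on the data. The last
  one says that the set of \<open>(t, U0)\<close> with \<open>t < T U0\<close> is open, and that the flow is jointly
  continuous there; for a normed space this amounts to lower semicontinuity of \<open>T\<close> and to
  continuity of the data-to-solution map, uniformly on compact time intervals.\<close>

definition locally_well_posed ::
    "'n::finite \<Rightarrow> ((real ^ 'n) \<times> real \<Rightarrow> real) \<Rightarrow> real ^ 'n ^ 'n \<Rightarrow> real \<Rightarrow>
     (real \<Rightarrow> real ^ 'n) topology \<Rightarrow> ((real \<Rightarrow> real ^ 'n) \<Rightarrow> ereal) \<Rightarrow>
     ((real \<Rightarrow> real ^ 'n) \<Rightarrow> real \<Rightarrow> real \<Rightarrow> real ^ 'n) \<Rightarrow> bool"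
  where "locally_well_posed iv H B X Y T S \<longleftrightarrow>
    (\<forall>U0\<in>topspace Y. 0 < T U0 \<and> solves_cauchy iv H B X Y U0 (T U0) (S U0)) \<and>
    (\<forall>U0\<in>topspace Y. \<forall>\<tau> U. 0 < \<tau> \<and> solves_cauchy iv H B X Y U0 \<tau> U \<longrightarrow>
        \<tau> \<le> T U0 \<and> (\<forall>t\<in>times_below \<tau>. AE x in lebesgue. U t x = S U0 t x)) \<and>
    (let D = {(t, U0). U0 \<in> topspace Y \<and> t \<in> times_below (T U0)};
         Z = prod_topology (top_of_set {0..}) Y
     in openin Z D \<and> continuous_map (subtopology Z D) Y (\<lambda>(t, U0). S U0 t))"

definition conserved_along ::
    "(real \<Rightarrow> real ^ 'n) topology \<Rightarrow> ((real \<Rightarrow> real ^ 'n) \<Rightarrow> ereal) \<Rightarrow>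
     ((real \<Rightarrow> real ^ 'n) \<Rightarrow> real \<Rightarrow> real \<Rightarrow> real ^ 'n) \<Rightarrow> ((real \<Rightarrow> real ^ 'n::finite) \<Rightarrow> 'b) \<Rightarrow> bool"
  where "conserved_along Y T S I \<longleftrightarrow>
    (\<forall>U0\<in>topspace Y. \<forall>t\<in>times_below (T U0). I (S U0 t) = I U0)"

definition conditionally_orbitally_stable ::
    "'n::finite \<Rightarrow> ((real ^ 'n) \<times> real \<Rightarrow> real) \<Rightarrow> real ^ 'n ^ 'n \<Rightarrow> real \<Rightarrow> (real \<Rightarrow> real ^ 'n) \<Rightarrow> bool"
  where "conditionally_orbitally_stable iv H B X Ub \<longleftrightarrow>
    (\<forall>Y T S. function_space iv X Y \<and> locally_well_posed iv H B X Y T S \<and>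
       conserved_along Y T S (\<lambda>U. LINT x:{0..X}|lebesgue. H (U x, x_deriv U x $ iv)) \<and>
       conserved_along Y T S (\<lambda>U. LINT x:{0..X}|lebesgue. impulse B (U x)) \<and>
       conserved_along Y T S (\<lambda>U. LINT x:{0..X}|lebesgue. U x) \<longrightarrow>
      (\<forall>\<epsilon>>0. \<exists>\<delta>>0. \<forall>U0\<in>topspace Y. HH1_norm iv X (U0 - Ub) \<le> \<delta> \<longrightarrow>
         (\<forall>t\<in>times_below (T U0).
            (INF s::real. HH1_norm iv X (S U0 t - (\<lambda>x. Ub (x + s)))) \<le> \<epsilon>)))"

end

theory Submission
  imports Defs
begin

text \<open>The wave is a critical point of the Lagrangian functional \<open>\<integral> \<H> + c Q + \<lambda> \<bullet> U\<close>, a combination of conserved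
quantities. It is stable as soon as the second variation \<open>\<A>\<close> is coercive on the perturbations that leave
\<open>\<integral> Q\<close> and \<open>\<integral> U\<close> unchanged to first order and are orthogonal to the translation mode \<open>U\<^sub>x\<close>: the
functional then controls the distance to the set of translates.

Nonnegativity comes from the index. Let \<open>q\<^sub>i\<close> be the first variations of the constraints. In parameter
directions along which \<open>\<Xi>\<close> is stationary, obtained by subtracting \<open>\<Xi>\<^sub>i / \<Xi>\<^sub>\<mu>\<close> times the \<open>\<mu>\<close> direction, the
derivative \<open>p\<^sub>i\<close> of the wave is periodic, and differentiating the profile equation gives \<open>\<A> p\<^sub>i = - \<nabla> q\<^sub>i\<close>
(\<open>b_tangent\<close>). Two differentiations of the action identify \<open>q\<^sub>i p\<^sub>j\<close> with the entries of \<open>C\<close>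
(\<open>constraints_tangent\<close>). So \<open>\<A>\<close> has the matrix \<open>- C\<close> on the span of the \<open>p\<^sub>i\<close>, the hypothesis says that
this span exhausts the negative directions of \<open>\<A>\<close>, and \<open>\<A>\<close> is nonnegative on its \<open>\<A>\<close>-orthogonal
complement (\<open>nonneg_on_orthogonal_complement\<close>), which is the joint kernel of the \<open>q\<^sub>i\<close>.

Coercivity is obtained from an estimate for ordinary differential equations. If the form is nonnegative and nearly
zero at \<open>Z\<close>, the Cauchy-Schwarz inequality makes \<open>Z\<close> a weak approximate solution of \<open>\<A> Z = 0\<close>. Variation of
constants in the basis \<open>U\<^sub>x, U\<^sub>\<mu>\<close> of exact solutions shows that it is close to a multiple of \<open>U\<^sub>x\<close>, because
\<open>U\<^sub>\<mu>\<close> is not periodic when \<open>\<Xi>\<^sub>\<mu> \<noteq> 0\<close> (\<open>approximate_kernel\<close>, \<open>coercive_on_constraints\<close>).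

The nonlinear part expands the Lagrangian functional to second order (\<open>Lag_expansion\<close>). Since \<open>\<H>\<close> is quadratic in
\<open>(u, v\<^sub>x)\<close>, the remainder carries a factor \<open>sup \<bar>v\<bar>\<close>, hence is cubic in the \<open>H\<^sup>1\<close> norm. Choosing the nearest
translate at each time gives the orthogonality, and continuity in time closes the argument
(\<open>nonlinear_stability\<close>).

A perturbation is represented by its jet \<open>(V, v\<^sub>x)\<close>, a square integrable function; the \<open>H\<^sup>1\<close> norm is the
\<open>L\<^sup>2\<close> norm of the jet. The structural conditions for one and two components enter through a common normal form
of \<open>\<H>\<close> and \<open>B\<^sup>-\<^sup>1\<close> (\<open>ham_form\<close>).\<close>

section \<open>Differentiation of indefinite integrals\<close>

lemma nn_integral_absolutely_continuous:
  fixes g :: "real \<Rightarrow> real"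
  assumes g: "integrable lebesgue g" and nn: "\<And>x. 0 \<le> g x" and e: "0 < \<epsilon>"
  obtains \<delta> where "0 < \<delta>"
    and "\<And>S. S \<in> sets lebesgue \<Longrightarrow> emeasure lebesgue S < ennreal \<delta> \<Longrightarrow>
           emeasure (density lebesgue g) S < ennreal \<epsilon>"
proof -
  have gm[measurable]: "g \<in> borel_measurable lebesgue"
    using g by auto
  have "(\<lambda>k. LINT x|lebesgue. g x - min (g x) (real k)) \<longlonglongrightarrow> (LINT (x::real)|lebesgue. (0::real))"
  proof (rule integral_dominated_convergence[where w=g])
    show "AE x in lebesgue. (\<lambda>k. g x - min (g x) (real k)) \<longlonglongrightarrow> 0"
    proof (intro always_eventually allI)
      fix x
      have "eventually (\<lambda>k. g x - min (g x) (real k) = 0) sequentially"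
        using eventually_ge_at_top[of "nat \<lceil>g x\<rceil>"] by eventually_elim linarith
      thus "(\<lambda>k. g x - min (g x) (real k)) \<longlonglongrightarrow> 0"
        by (rule tendsto_eventually)
    qed
  qed (use g nn in \<open>auto simp: min_def\<close>)
  hence "eventually (\<lambda>k. (LINT x|lebesgue. g x - min (g x) (real k)) < \<epsilon> / 2) sequentially"
    using e by (intro order_tendstoD) auto
  then obtain k where k: "(LINT x|lebesgue. g x - min (g x) (real k)) < \<epsilon> / 2"
    by (auto simp: eventually_sequentially)
  have int: "integrable lebesgue (\<lambda>x. g x - min (g x) (real k))"
    by (rule Bochner_Integration.integrable_bound[OF g]) (use nn in \<open>auto simp: min_def\<close>)
  show ?thesis
  proof (rule that)
    show "0 < \<epsilon> / 2 / (real k + 1)" using e by auto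
    fix S :: "real set" assume S[measurable]: "S \<in> sets lebesgue"
      and small: "emeasure lebesgue S < ennreal (\<epsilon> / 2 / (real k + 1))"
    have "emeasure (density lebesgue g) S = (\<integral>\<^sup>+x. ennreal (g x) * indicator S x \<partial>lebesgue)"
      by (subst emeasure_density) auto
    also have "\<dots> \<le> (\<integral>\<^sup>+x. ennreal (g x - min (g x) (real k)) + ennreal (real k) * indicator S x \<partial>lebesgue)"
    proof (rule nn_integral_mono)
      fix x
      have "g x \<le> (g x - min (g x) (real k)) + real k" by (auto simp: min_def)
      hence "ennreal (g x) \<le> ennreal (g x - min (g x) (real k)) + ennreal (real k)"
        by (cases "g x \<le> real k") (auto simp: min_def ennreal_leI ennreal_plus[symmetric] simp del: ennreal_plus)
      thus "ennreal (g x) * indicator S x \<le> ennreal (g x - min (g x) (real k)) + ennreal (real k) * indicator S x"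
        by (auto simp: indicator_def)
    qed
    also have "\<dots> = (\<integral>\<^sup>+x. ennreal (g x - min (g x) (real k)) \<partial>lebesgue) + ennreal (real k) * emeasure lebesgue S"
      by (subst nn_integral_add) (auto simp: nn_integral_cmult_indicator)
    also have "(\<integral>\<^sup>+x. ennreal (g x - min (g x) (real k)) \<partial>lebesgue) = ennreal (LINT x|lebesgue. g x - min (g x) (real k))"
      by (rule nn_integral_eq_integral[OF int]) auto
    also have "ennreal (LINT x|lebesgue. g x - min (g x) (real k)) + ennreal (real k) * emeasure lebesgue S
        < ennreal (\<epsilon> / 2) + ennreal (\<epsilon> / 2)"
    proof (rule add_strict_mono)
      show "ennreal (LINT x|lebesgue. g x - min (g x) (real k)) < ennreal (\<epsilon> / 2)"
        using k e by (subst ennreal_less_iff) (auto intro!: integral_nonneg)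
      have "ennreal (real k) * emeasure lebesgue S \<le> ennreal (real k) * ennreal (\<epsilon> / 2 / (real k + 1))"
        using small by (intro mult_left_mono) auto
      also have "\<dots> = ennreal (real k * (\<epsilon> / 2 / (real k + 1)))"
        using e by (subst ennreal_mult) auto
      also have "\<dots> < ennreal (\<epsilon> / 2)"
        using e by (subst ennreal_less_iff) (auto simp: field_simps)
      finally show "ennreal (real k) * emeasure lebesgue S < ennreal (\<epsilon> / 2)" .
    qed
    also have "\<dots> = ennreal \<epsilon>" using e by (subst ennreal_plus[symmetric]) auto
    finally show "emeasure (density lebesgue g) S < ennreal \<epsilon>" .
  qed
qed

lemma sobolev_deriv_set_integrable: "sobolev_deriv F f \<Longrightarrow> set_integrable lebesgue {a..b} f"
  by (cases "a \<le> b") (auto simp: sobolev_deriv_def)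

lemma sobolev_deriv_diff: "sobolev_deriv F f \<Longrightarrow> a \<le> b \<Longrightarrow> F b - F a = (LINT x:{a..b}|lebesgue. f x)"
  by (auto simp: sobolev_deriv_def)

lemma difference_quotient_min_max:
  fixes F :: "real \<Rightarrow> real"
  assumes "s \<le> (F y - F x) / (y - x)" "y \<noteq> x"
  shows "s * \<bar>y - x\<bar> \<le> F (max x y) - F (min x y)"
proof (cases "x < y")
  case True
  thus ?thesis using assms by (simp add: pos_le_divide_eq)
next
  case False
  hence "y < x" using assms by auto
  thus ?thesis using assms by (simp add: neg_le_divide_eq algebra_simps)
qed

text \<open>Intervals on which \<open>F\<close> has slope at least \<open>s\<close> cover the set finely, so Vitali's theorem extracts disjoint ones
that cover almost all of it. On each of them the mean of \<open>f - r\<close> is at least \<open>s - r\<close>, while the integral of its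
positive part is small over a neighbourhood of \<open>{f \<le> r}\<close> of nearly the same measure.\<close>

lemma negligible_large_difference_quotient:
  fixes F f :: "real \<Rightarrow> real"
  assumes sd: "sobolev_deriv F f" and rs: "r < s"
  shows "negligible {x. \<bar>x\<bar> < N \<and> f x \<le> r \<and>
           (\<forall>d>0. \<exists>y. y \<noteq> x \<and> \<bar>y - x\<bar> < d \<and> s \<le> (F y - F x) / (y - x))}" (is "negligible ?E")
  unfolding negligible_outer_le
proof (intro allI impI)
  fix e :: real assume e: "0 < e"
  define A where "A = {-N..N}"
  define g where "g x = indicator A x * max (f x - r) 0" for x
  have fA: "set_integrable lebesgue A f"
    unfolding A_def by (rule sobolev_deriv_set_integrable[OF sd])
  have "set_integrable lebesgue A (\<lambda>x. f x - r)"
    using fA by (intro set_integral_diff) (auto simp: A_def intro!: absolutely_integrable_on_const)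
  hence "integrable lebesgue (\<lambda>x. max (indicator A x *\<^sub>R (f x - r)) 0)"
    unfolding set_integrable_def by (intro integrable_max) auto
  hence g: "integrable lebesgue g"
    by (rule Bochner_Integration.integrable_cong[THEN iffD1, rotated 2]) (auto simp: g_def indicator_def)
  hence gm[measurable]: "g \<in> borel_measurable lebesgue" by auto
  have gnn: "0 \<le> g x" for x by (auto simp: g_def)
  define \<nu> where "\<nu> = density lebesgue g"
  have e': "0 < e * (s - r)" using e rs by auto
  obtain \<delta> where \<delta>: "0 < \<delta>" and small: "\<And>S. S \<in> sets lebesgue \<Longrightarrow> emeasure lebesgue S < ennreal \<delta> \<Longrightarrow>
           emeasure \<nu> S < ennreal (e * (s - r))"
    using nn_integral_absolutely_continuous[OF g gnn e'] unfolding \<nu>_def by blast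
  define Z where "Z = {x\<in>A. f x \<le> r}"
  have "Z = {x. indicator A x *\<^sub>R f x \<le> r} \<inter> A" by (auto simp: Z_def indicator_def)
  moreover have "(\<lambda>x. indicator A x *\<^sub>R f x) \<in> borel_measurable lebesgue"
    using fA unfolding set_integrable_def by auto
  hence "{x. indicator A x *\<^sub>R f x \<le> r} \<in> sets lebesgue"
    using measurable_sets[of _ lebesgue borel "{..r}"] by (simp add: vimage_def)
  ultimately have Zm[measurable]: "Z \<in> sets lebesgue" by (auto simp: A_def)
  obtain T where T: "open T" "Z \<subseteq> T" "T - Z \<in> lmeasurable" "emeasure lebesgue (T - Z) < ennreal \<delta>"
    using sets_lebesgue_outer_open[OF Zm \<delta>] .
  have Tm[measurable]: "T \<in> sets lebesgue" using T(1) by auto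
  have "emeasure \<nu> Z = 0"
  proof -
    have "ennreal (g x) * indicator Z x = 0" for x
      by (auto simp: g_def Z_def indicator_def)
    hence "(\<integral>\<^sup>+x. ennreal (g x) * indicator Z x \<partial>lebesgue) = (\<integral>\<^sup>+(x::real). 0 \<partial>lebesgue)"
      by (intro nn_integral_cong) blast
    thus ?thesis unfolding \<nu>_def by (subst emeasure_density) auto
  qed
  moreover have "emeasure \<nu> (T - Z) < ennreal (e * (s - r))"
    using T(3,4) by (intro small) auto
  moreover have "emeasure \<nu> T = emeasure \<nu> Z + emeasure \<nu> (T - Z)"
    using T(2) by (subst plus_emeasure) (auto simp: \<nu>_def Un_absorb1)
  ultimately have nuT: "emeasure \<nu> T < ennreal (e * (s - r))" by auto
  define K where "K = {(m, h). 0 < h \<and> {m - h..m + h} \<subseteq> T \<inter> {-N..N} \<and> (s * (2 * h) \<le> F (m + h) - F (m - h))}"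
  have cov: "\<exists>i. i \<in> K \<and> x \<in> cball (fst i) (snd i) \<and> snd i < d" if x: "x \<in> ?E" and d: "0 < d" for x d
  proof -
    have "x \<in> T \<inter> {-N<..<N}" using x T(2) by (auto simp: Z_def A_def)
    moreover have "open (T \<inter> {-N<..<N})" using T(1) by auto
    ultimately obtain \<eta> where \<eta>: "0 < \<eta>" "ball x \<eta> \<subseteq> T \<inter> {-N<..<N}"
      by (meson openE)
    have "0 < min d \<eta>" using d \<eta> by auto
    then obtain y where y: "y \<noteq> x" "\<bar>y - x\<bar> < min d \<eta>" "s \<le> (F y - F x) / (y - x)"
      using x by blast
    define m h where "m = (x + y) / 2" and "h = \<bar>y - x\<bar> / 2"
    have h: "0 < h" "h < d" using y by (auto simp: h_def)
    have mh: "m - h = min x y" "m + h = max x y"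
      by (cases "x < y"; simp add: m_def h_def field_simps)+
    have "{m - h..m + h} \<subseteq> ball x \<eta>"
      unfolding mh using y(2) by (auto simp: dist_real_def)
    moreover have "s * (2 * h) \<le> F (m + h) - F (m - h)"
      using difference_quotient_min_max[of s F y x] y unfolding mh by (simp add: h_def)
    moreover have "ball x \<eta> \<subseteq> T \<inter> {-N..N}"
      using \<eta>(2) by (auto simp: subset_iff)
    ultimately have "(m, h) \<in> K" unfolding K_def using h(1) by blast
    moreover have "x \<in> cball m h"
      using mh by (simp add: cball_eq_atLeastAtMost)
    ultimately show ?thesis using h(2) by (intro exI[of _ "(m, h)"]) simp
  qed
  have Kpos: "0 < snd i" if "i \<in> K" for i using that by (auto simp: K_def)
  have "\<exists>C. countable C \<and> C \<subseteq> K \<and>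
     pairwise (\<lambda>i j. disjnt (cball (fst i) (snd i)) (cball (fst j) (snd j))) C \<and>
     negligible (?E - (\<Union>i \<in> C. cball (fst i) (snd i)))"
    by (rule Vitali_covering_theorem_cballs[of K snd ?E fst, OF Kpos cov]) (assumption | (intro exI conjI; assumption))+
  then obtain C where C: "countable C" "C \<subseteq> K"
     "pairwise (\<lambda>i j. disjnt (cball (fst i) (snd i)) (cball (fst j) (snd j))) C"
     "negligible (?E - (\<Union>i \<in> C. cball (fst i) (snd i)))"
    by (elim exE conjE)
  define I where "I i = cball (fst i) (snd i)" for i :: "real \<times> real"
  have I: "I i = {fst i - snd i..fst i + snd i}" for i
    by (auto simp: I_def cball_eq_atLeastAtMost)
  have Im[measurable]: "I i \<in> sets lebesgue" for i by (auto simp: I)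
  have disj: "disjoint_family_on I C"
    using C(3) by (auto simp: disjoint_family_on_def pairwise_def disjnt_def I_def)
  define W where "W = \<Union>(I ` C)"
  have Wm[measurable]: "W \<in> sets lebesgue" unfolding W_def using C(1) by (intro sets.countable_UN') auto
  have one: "ennreal (s - r) * emeasure lebesgue (I i) \<le> emeasure \<nu> (I i)" if "i \<in> C" for i
  proof -
    obtain m h where i: "i = (m, h)" by (cases i)
    have K: "0 < h" "{m - h..m + h} \<subseteq> {-N..N}" "s * (2 * h) \<le> F (m + h) - F (m - h)"
      using that C(2) by (auto simp: K_def i)
    have fi: "set_integrable lebesgue {m-h..m+h} f" by (rule sobolev_deriv_set_integrable[OF sd])
    have gi: "set_integrable lebesgue {m-h..m+h} g"
      unfolding set_integrable_def by (rule integrable_mult_indicator[OF _ g]) auto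
    have "(s - r) * (2 * h) \<le> F (m + h) - F (m - h) - r * (2 * h)" using K by (auto simp: algebra_simps)
    also have "F (m + h) - F (m - h) = (LINT x:{m-h..m+h}|lebesgue. f x)"
      using K by (intro sobolev_deriv_diff[OF sd]) auto
    also have "(LINT x:{m-h..m+h}|lebesgue. f x) - r * (2 * h) = (LINT x:{m-h..m+h}|lebesgue. f x - r)"
      using K by (subst set_integral_diff(2)[OF fi])
        (auto simp: set_integral_const intro!: absolutely_integrable_on_const)
    also have "\<dots> \<le> (LINT x:{m-h..m+h}|lebesgue. g x)"
      by (rule set_integral_mono[OF set_integral_diff(1)[OF fi] gi])
         (use K in \<open>auto intro!: absolutely_integrable_on_const simp: g_def A_def\<close>)
    also have "ennreal (LINT x:{m-h..m+h}|lebesgue. g x) = (\<integral>\<^sup>+x. ennreal (g x) * indicator {m-h..m+h} x \<partial>lebesgue)"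
      using gi gnn unfolding set_integrable_def set_lebesgue_integral_def
      by (subst nn_integral_eq_integral[symmetric])
        (auto intro!: nn_integral_cong simp: indicator_def)
    also have "\<dots> = emeasure \<nu> (I i)" unfolding \<nu>_def I i by (subst emeasure_density) auto
    finally have "ennreal ((s - r) * (2 * h)) \<le> emeasure \<nu> (I i)"
      by (simp add: ennreal_leI)
    thus ?thesis using rs K by (subst (asm) ennreal_mult) (auto simp: I i)
  qed
  have "ennreal (s - r) * emeasure lebesgue W = ennreal (s - r) * (\<integral>\<^sup>+i. emeasure lebesgue (I i) \<partial>count_space C)"
    unfolding W_def by (subst emeasure_UN_countable[OF _ C(1) disj]) auto
  also have "\<dots> = (\<integral>\<^sup>+i. ennreal (s - r) * emeasure lebesgue (I i) \<partial>count_space C)"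
    by (subst nn_integral_cmult) auto
  also have "\<dots> \<le> (\<integral>\<^sup>+i. emeasure \<nu> (I i) \<partial>count_space C)"
    by (rule nn_integral_mono) (use one in auto)
  also have "\<dots> = emeasure \<nu> W"
    unfolding W_def by (subst emeasure_UN_countable[OF _ C(1) disj]) (auto simp: \<nu>_def)
  also have "\<dots> \<le> emeasure \<nu> T"
  proof (rule emeasure_mono)
    show "W \<subseteq> T"
    proof
      fix x assume "x \<in> W"
      then obtain m h where "(m, h) \<in> C" "x \<in> {m - h..m + h}" by (auto simp: W_def I)
      thus "x \<in> T" using C(2) unfolding K_def by blast
    qed
  qed (auto simp: \<nu>_def)
  also note nuT
  finally have "ennreal (s - r) * emeasure lebesgue W < ennreal (s - r) * ennreal e"
    using e rs by (subst ennreal_mult[symmetric]) (auto simp: mult.commute)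
  hence We: "emeasure lebesgue W < ennreal e"
    using mult_left_mono[of "ennreal e" "emeasure lebesgue W" "ennreal (s - r)"]
    by (metis not_le zero_le)
  have WL: "W \<in> lmeasurable" by (rule fmeasurableI[OF Wm less_trans[OF We ennreal_less_top, folded infinity_ennreal_def]])
  define U where "U = (?E - W) \<union> W"
  have nE: "negligible (?E - W)" using C(4) by (simp add: W_def I_def)
  show "\<exists>T. ?E \<subseteq> T \<and> T \<in> lmeasurable \<and> measure lebesgue T \<le> e"
  proof (intro exI conjI)
    show "?E \<subseteq> U" by (auto simp: U_def)
    show "U \<in> lmeasurable" unfolding U_def
      using nE WL by (intro fmeasurable.Un) (auto simp: negligible_imp_measurable)
    have "measure lebesgue U \<le> measure lebesgue (?E - W) + measure lebesgue W"
      unfolding U_def using nE WL by (intro measure_Un_le) (auto simp: negligible_imp_sets)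
    also have "measure lebesgue (?E - W) = 0" using nE by (simp add: negligible_imp_measure0)
    also have "measure lebesgue W \<le> e"
      using We e WL by (simp add: emeasure_eq_measure2 ennreal_less_iff)
    finally show "measure lebesgue U \<le> e" by simp
  qed
qed

text \<open>The exceptional sets for rational \<open>r < s\<close> and natural \<open>N\<close> are countably many.\<close>

lemma AE_eventually_difference_quotient_less:
  assumes sd: "sobolev_deriv F f"
  shows "AE x in lebesgue. \<forall>e>0. \<forall>\<^sub>F y in at x. (F y - F x) / (y - x) < f x + e"
proof -
  define E where "E r s N = {x. \<bar>x\<bar> < N \<and> f x \<le> r \<and>
           (\<forall>d>0. \<exists>y. y \<noteq> x \<and> \<bar>y - x\<bar> < d \<and> s \<le> (F y - F x) / (y - x))}" for r s N
  have "AE x in lebesgue. \<forall>i\<in>\<rat> \<times> \<rat> \<times> (\<nat> :: real set). fst i < fst (snd i) \<longrightarrow> x \<notin> E (fst i) (fst (snd i)) (snd (snd i))"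
  proof (subst AE_ball_countable)
    show "countable (\<rat> \<times> \<rat> \<times> (\<nat> :: real set))"
      by (intro countable_SIGMA countable_rat) (auto simp: Nats_def)
    show "\<forall>i\<in>\<rat> \<times> \<rat> \<times> \<nat>. AE x in lebesgue. fst i < fst (snd i) \<longrightarrow> x \<notin> E (fst i) (fst (snd i)) (snd (snd i))"
    proof safe
      fix r s N :: real
      show "AE x in lebesgue. fst (r, s, N) < fst (snd (r, s, N)) \<longrightarrow> x \<notin> E (fst (r, s, N)) (fst (snd (r, s, N))) (snd (snd (r, s, N)))"
      proof (cases "r < s")
        case True
        hence "negligible (E r s N)" unfolding E_def by (rule negligible_large_difference_quotient[OF sd])
        hence "AE x in lebesgue. x \<notin> E r s N" by (simp add: negligible_iff_null_sets AE_not_in)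
        thus ?thesis by simp
      qed auto
    qed
  qed
  thus ?thesis
  proof eventually_elim
    case (elim x)
    show ?case
    proof (intro allI impI)
      fix e :: real assume e: "0 < e"
      obtain r where r: "r \<in> \<rat>" "f x < r" "r < f x + e" using Rats_dense_in_real[of "f x" "f x + e"] e by auto
      obtain s where s: "s \<in> \<rat>" "r < s" "s < f x + e" using Rats_dense_in_real[of r "f x + e"] r by auto
      obtain n where n: "\<bar>x\<bar> < real n" using reals_Archimedean2 by blast
      have "x \<notin> E r s (real n)"
        using bspec[OF elim, of "(r, s, real n)"] r s by auto
      then obtain d where "d > 0" "\<And>y. y \<noteq> x \<Longrightarrow> \<bar>y - x\<bar> < d \<Longrightarrow> (F y - F x) / (y - x) < s"
        using n r unfolding E_def by (auto simp: not_le)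
      thus "\<forall>\<^sub>F y in at x. (F y - F x) / (y - x) < f x + e"
        unfolding eventually_at using s by (intro exI[of _ d]) (force simp: dist_real_def)
    qed
  qed
qed

lemma sobolev_deriv_uminus: "sobolev_deriv F f \<Longrightarrow> sobolev_deriv (\<lambda>x. - F x) (\<lambda>x. - f x)"
proof -
  assume sd: "sobolev_deriv F f"
  have i: "set_integrable lebesgue {a..b} f" for a b
    by (rule sobolev_deriv_set_integrable[OF sd])
  have i': "set_integrable lebesgue {a..b} (\<lambda>x. - f x)" for a b
    using set_integrable_mult_right[OF i[of a b], of "-1"] by simp
  show ?thesis
    using i' unfolding sobolev_deriv_def
    by (auto simp: set_integral_uminus[OF i] sobolev_deriv_diff[OF sd, symmetric])
qed

theorem lebesgue_differentiation:
  assumes sd: "sobolev_deriv F f"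
  shows "AE x in lebesgue. (F has_real_derivative f x) (at x)"
  using AE_eventually_difference_quotient_less[OF sd]
    AE_eventually_difference_quotient_less[OF sobolev_deriv_uminus[OF sd]]
proof eventually_elim
  case (elim x)
  show ?case unfolding has_field_derivative_iff
  proof (rule tendstoI)
    fix e :: real assume "0 < e"
    hence "\<forall>\<^sub>F y in at x. (F y - F x) / (y - x) < f x + e"
      "\<forall>\<^sub>F y in at x. (- F y - - F x) / (y - x) < - f x + e"
      using elim by blast+
    thus "\<forall>\<^sub>F y in at x. dist ((F y - F x) / (y - x)) (f x) < e"
    proof eventually_elim
      case (elim y)
      have "(- F y - - F x) / (y - x) = - ((F y - F x) / (y - x))"
        by (simp add: minus_divide_left)
      with elim show ?case by (auto simp: dist_real_def abs_less_iff)
    qed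
  qed
qed

section \<open>Calculus of absolutely continuous functions\<close>

lemma borel_measurable_lebesgue_cong_AE:
  fixes f g :: "real \<Rightarrow> 'b::topological_space"
  assumes f: "f \<in> borel_measurable lebesgue" and fg: "AE x in lebesgue. f x = g x"
  shows "g \<in> borel_measurable lebesgue"
proof (rule measurableI)
  fix A :: "'b set" assume A: "A \<in> sets borel"
  have "f -` A \<inter> space lebesgue \<in> sets lebesgue" using f A by (rule measurable_sets)
  hence 1: "f -` A \<in> sets lebesgue" by simp
  have "AE x in lebesgue. x \<in> f -` A \<longleftrightarrow> x \<in> g -` A"
    using fg by eventually_elim auto
  from completion.in_sets_AE[OF this 1] show "g -` A \<inter> space lebesgue \<in> sets lebesgue" by simp
qed auto

lemma set_integral_cong_lebesgue_AE:
  fixes f g :: "real \<Rightarrow> 'b::{banach, second_countable_topology}"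
  assumes fg: "AE x in lebesgue. f x = g x"
  shows "set_integrable lebesgue A f \<longleftrightarrow> set_integrable lebesgue A g"
    and "(LINT x:A|lebesgue. f x) = (LINT x:A|lebesgue. g x)"
proof -
  have ae: "AE x in lebesgue. indicat_real A x *\<^sub>R f x = indicat_real A x *\<^sub>R g x"
    using fg by eventually_elim auto
  have ae': "AE x in lebesgue. indicat_real A x *\<^sub>R g x = indicat_real A x *\<^sub>R f x"
    using fg by eventually_elim auto
  show 1: "set_integrable lebesgue A f \<longleftrightarrow> set_integrable lebesgue A g"
    unfolding set_integrable_def
  proof
    assume i: "integrable lebesgue (\<lambda>x. indicat_real A x *\<^sub>R f x)"
    show "integrable lebesgue (\<lambda>x. indicat_real A x *\<^sub>R g x)"
      by (rule Bochner_Integration.integrable_cong_AE_imp[OF i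
            borel_measurable_lebesgue_cong_AE[OF borel_measurable_integrable[OF i] ae] ae])
  next
    assume i: "integrable lebesgue (\<lambda>x. indicat_real A x *\<^sub>R g x)"
    show "integrable lebesgue (\<lambda>x. indicat_real A x *\<^sub>R f x)"
      by (rule Bochner_Integration.integrable_cong_AE_imp[OF i
            borel_measurable_lebesgue_cong_AE[OF borel_measurable_integrable[OF i] ae'] ae'])
  qed
  show "(LINT x:A|lebesgue. f x) = (LINT x:A|lebesgue. g x)"
  proof (cases "set_integrable lebesgue A f")
    case True
    hence "integrable lebesgue (\<lambda>x. indicat_real A x *\<^sub>R f x)" "integrable lebesgue (\<lambda>x. indicat_real A x *\<^sub>R g x)"
      using 1 by (auto simp: set_integrable_def)
    thus ?thesis unfolding set_lebesgue_integral_def by (intro integral_cong_AE ae) auto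
  next
    case False
    hence "\<not> integrable lebesgue (\<lambda>x. indicat_real A x *\<^sub>R f x)" "\<not> integrable lebesgue (\<lambda>x. indicat_real A x *\<^sub>R g x)"
      using 1 by (auto simp: set_integrable_def)
    thus ?thesis unfolding set_lebesgue_integral_def by (simp add: not_integrable_integral_eq)
  qed
qed

lemma sobolev_deriv_cong_AE:
  assumes "sobolev_deriv F f" and fg: "AE x in lebesgue. f x = g x"
  shows "sobolev_deriv F g"
  using assms(1) set_integral_cong_lebesgue_AE[OF fg] unfolding sobolev_deriv_def by simp

lemma set_integral_combine:
  fixes f :: "real \<Rightarrow> 'b::euclidean_space"
  assumes "a \<le> b" "b \<le> c" and i: "set_integrable lebesgue {a..c} f"
  shows "(LINT x:{a..c}|lebesgue. f x) = (LINT x:{a..b}|lebesgue. f x) + (LINT x:{b..c}|lebesgue. f x)"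
proof -
  have "set_integrable lebesgue {a..b} f" "set_integrable lebesgue {b..c} f"
    using assms by (auto intro: set_integrable_subset[OF i])
  thus ?thesis
    using Henstock_Kurzweil_Integration.integral_combine[OF assms(1,2)] set_lebesgue_integral_eq_integral i
    by metis
qed

lemma set_integrable_combine:
  fixes f :: "real \<Rightarrow> 'b::euclidean_space"
  assumes "a \<le> b" "b \<le> c" "set_integrable lebesgue {a..b} f" "set_integrable lebesgue {b..c} f"
  shows "set_integrable lebesgue {a..c} f"
  using set_integrable_Un[OF assms(3,4)] assms(1,2) by (simp add: ivl_disj_un)

lemma set_integral_shift:
  fixes f :: "real \<Rightarrow> 'b::euclidean_space"
  shows "set_integrable lebesgue {a..b} (\<lambda>x. f (x + s)) \<longleftrightarrow> set_integrable lebesgue {a+s..b+s} f"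
    and "(LINT x:{a..b}|lebesgue. f (x + s)) = (LINT x:{a+s..b+s}|lebesgue. f x)"
proof -
  have eq: "indicat_real {a..b} x *\<^sub>R f (x + s) = indicat_real {a+s..b+s} (s + 1 * x) *\<^sub>R f (s + 1 * x)" for x
    by (auto simp: indicator_def add.commute)
  show "set_integrable lebesgue {a..b} (\<lambda>x. f (x + s)) \<longleftrightarrow> set_integrable lebesgue {a+s..b+s} f"
    unfolding set_integrable_def eq by (rule lebesgue_integrable_real_affine_iff) auto
  show "(LINT x:{a..b}|lebesgue. f (x + s)) = (LINT x:{a+s..b+s}|lebesgue. f x)"
    unfolding set_lebesgue_integral_def eq
    by (subst (2) lebesgue_integral_real_affine[of 1 _ s]) auto
qed

lemma continuous_set_integrable:
  fixes f :: "real \<Rightarrow> 'b::euclidean_space"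
  assumes "continuous_on UNIV f"
  shows "set_integrable lebesgue {a..b} f"
  using absolutely_integrable_continuous[of a b f] continuous_on_subset[OF assms] by (auto simp: cbox_interval)

lemma sobolev_derivI:
  assumes d: "\<And>x. (F has_real_derivative f x) (at x)" and c: "continuous_on UNIV f"
  shows "sobolev_deriv F f"
  unfolding sobolev_deriv_def
proof (intro allI impI conjI)
  fix a b :: real assume ab: "a \<le> b"
  show i: "set_integrable lebesgue {a..b} f" by (rule continuous_set_integrable[OF c])
  have "(f has_integral (F b - F a)) {a..b}"
    by (rule fundamental_theorem_of_calculus[OF ab])
       (use d in \<open>auto simp: has_real_derivative_iff_has_vector_derivative[symmetric] intro: DERIV_subset\<close>)
  thus "F b - F a = (LINT x:{a..b}|lebesgue. f x)"
    using set_lebesgue_integral_eq_integral[OF i] by (simp add: integral_unique)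
qed

lemma sobolev_deriv_continuous:
  assumes sd: "sobolev_deriv F f"
  shows "continuous_on UNIV F"
proof -
  have "isCont F x" for x
  proof -
    have i: "f integrable_on {x-1..x+1}"
      by (rule set_lebesgue_integral_eq_integral(1)[OF sobolev_deriv_set_integrable[OF sd]])
    have "continuous_on {x-1..x+1} (\<lambda>y. F (x - 1) + integral {x-1..y} f)"
      by (intro continuous_intros indefinite_integral_continuous_1[OF i])
    hence "continuous_on {x-1..x+1} F"
    proof (rule continuous_on_eq)
      fix y assume "y \<in> {x-1..x+1}"
      thus "F (x - 1) + integral {x-1..y} f = F y"
        using sobolev_deriv_diff[OF sd, of "x-1" y]
          set_lebesgue_integral_eq_integral(2)[OF sobolev_deriv_set_integrable[OF sd, of "x-1" y]] by auto
    qed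
    thus "isCont F x"
      by (rule continuous_on_interior) auto
  qed
  thus ?thesis by (simp add: continuous_at_imp_continuous_on)
qed

lemma sobolev_deriv_add:
  assumes F: "sobolev_deriv F f" and G: "sobolev_deriv G g"
  shows "sobolev_deriv (\<lambda>x. F x + G x) (\<lambda>x. f x + g x)"
  unfolding sobolev_deriv_def
  using sobolev_deriv_diff[OF F] sobolev_deriv_diff[OF G]
  by (auto simp: set_integral_add(2) sobolev_deriv_set_integrable[OF F] sobolev_deriv_set_integrable[OF G] algebra_simps)

lemma sobolev_deriv_cmult:
  assumes F: "sobolev_deriv F f"
  shows "sobolev_deriv (\<lambda>x. c * F x) (\<lambda>x. c * f x)"
  unfolding sobolev_deriv_def
  using sobolev_deriv_diff[OF F]
  by (auto simp: sobolev_deriv_set_integrable[OF F] right_diff_distrib[symmetric])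

lemma sobolev_deriv_shift:
  assumes F: "sobolev_deriv F f"
  shows "sobolev_deriv (\<lambda>x. F (x + s)) (\<lambda>x. f (x + s))"
  unfolding sobolev_deriv_def set_integral_shift
  using sobolev_deriv_diff[OF F] by (auto simp: sobolev_deriv_set_integrable[OF F])

lemma set_integrable_continuous_mult:
  fixes f h :: "real \<Rightarrow> real"
  assumes f: "set_integrable lebesgue {a..b} f" and h: "continuous_on UNIV h"
  shows "set_integrable lebesgue {a..b} (\<lambda>x. h x * f x)"
proof -
  have "compact (h ` {a..b})"
    by (rule compact_continuous_image) (auto intro: continuous_on_subset[OF h])
  then obtain C where "\<forall>y\<in>h ` {a..b}. norm y \<le> C"
    by (auto dest!: compact_imp_bounded simp: bounded_iff)
  hence C: "\<And>x. x \<in> {a..b} \<Longrightarrow> \<bar>h x\<bar> \<le> C" by simp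
  have [measurable]: "h \<in> borel_measurable lebesgue"
    using borel_measurable_continuous_onI[OF h] by (simp add: measurable_completion)
  have m: "(\<lambda>x. indicat_real {a..b} x *\<^sub>R f x) \<in> borel_measurable lebesgue"
    using f unfolding set_integrable_def by auto
  have "integrable lebesgue (\<lambda>x. h x * (indicat_real {a..b} x *\<^sub>R f x))"
  proof (rule Bochner_Integration.integrable_bound)
    show "integrable lebesgue (\<lambda>x. C *\<^sub>R (indicat_real {a..b} x *\<^sub>R f x))"
      using f unfolding set_integrable_def by (rule integrable_scaleR_right)
    show "AE x in lebesgue. norm (h x * (indicat_real {a..b} x *\<^sub>R f x)) \<le> norm (C *\<^sub>R (indicat_real {a..b} x *\<^sub>R f x))"
    proof (intro always_eventually allI)
      fix x
      show "norm (h x * (indicat_real {a..b} x *\<^sub>R f x)) \<le> norm (C *\<^sub>R (indicat_real {a..b} x *\<^sub>R f x))"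
      proof (cases "x \<in> {a..b}")
        case True
        hence "\<bar>h x\<bar> \<le> \<bar>C\<bar>" using C[OF True] by linarith
        thus ?thesis using True by (simp add: abs_mult mult_right_mono)
      qed simp
    qed
  qed (use m in measurable)
  thus ?thesis unfolding set_integrable_def by (simp add: mult.left_commute)
qed

text \<open>Let \<open>h x y\<close> be the defect of the formula on an interval. It is additive, and on short intervals it is at most
\<open>\<epsilon> \<integral> \<bar>f\<bar>\<close> since \<open>F x + F y\<close> is close to \<open>2 F\<close> there.\<close>

lemma sobolev_deriv_square:
  assumes sd: "sobolev_deriv F f"
  shows "sobolev_deriv (\<lambda>x. F x * F x) (\<lambda>x. 2 * F x * f x)"
  unfolding sobolev_deriv_def
proof (intro allI impI conjI)
  have cF: "continuous_on UNIV F" by (rule sobolev_deriv_continuous[OF sd])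
  have fi: "set_integrable lebesgue {a..b} f" for a b by (rule sobolev_deriv_set_integrable[OF sd])
  have ai: "set_integrable lebesgue {a..b} (\<lambda>x. \<bar>f x\<bar>)" for a b by (rule set_integrable_abs[OF fi])
  have ii: "set_integrable lebesgue {a..b} (\<lambda>x. h x * f x)" if "continuous_on UNIV h" for h :: "real \<Rightarrow> real" and a b
    by (rule set_integrable_continuous_mult[OF fi that])
  fix a b :: real assume ab: "a \<le> b"
  show "set_integrable lebesgue {a..b} (\<lambda>x. 2 * F x * f x)" 
    by (rule ii) (intro continuous_intros cF)
  have ucont: "uniformly_continuous_on {a..b} F"
    by (rule compact_uniformly_continuous) (auto intro: continuous_on_subset[OF cF])
  define m where "m x y = (LINT z:{x..y}|lebesgue. \<bar>f z\<bar>)" for x y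
  define h where "h x y = F y * F y - F x * F x - (LINT z:{x..y}|lebesgue. 2 * F z * f z)" for x y
  have madd: "m x z = m x y + m y z" if "x \<le> y" "y \<le> z" for x y z
    unfolding m_def by (rule set_integral_combine[OF that ai])
  have hadd: "h x z = h x y + h y z" if "x \<le> y" "y \<le> z" for x y z
    unfolding h_def by (subst set_integral_combine[OF that]) (auto intro!: ii continuous_intros cF)
  have "\<bar>h a b\<bar> \<le> \<epsilon> * m a b" if \<epsilon>: "\<epsilon> > 0" for \<epsilon>
  proof -
    obtain d where d: "d > 0" "\<And>x y. x \<in> {a..b} \<Longrightarrow> y \<in> {a..b} \<Longrightarrow> \<bar>y - x\<bar> < d \<Longrightarrow> \<bar>F y - F x\<bar> < \<epsilon> / 2"
      using ucont \<epsilon> unfolding uniformly_continuous_on_def dist_real_def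
      by (elim allE[of _ "\<epsilon> / 2"]) auto
    have small: "\<bar>h x y\<bar> \<le> \<epsilon> * m x y" if xy: "a \<le> x" "x \<le> y" "y \<le> b" "y - x < d" for x y
    proof -
      have "F y * F y - F x * F x = (F y + F x) * (F y - F x)" by (simp add: algebra_simps)
      also have "\<dots> = (LINT z:{x..y}|lebesgue. (F y + F x) * f z)"
        using xy by (simp add: sobolev_deriv_diff[OF sd])
      finally have "h x y = (LINT z:{x..y}|lebesgue. (F y + F x) * f z - 2 * F z * f z)"
        unfolding h_def by (subst set_integral_diff) (auto intro!: ii continuous_intros cF fi)
      hence "\<bar>h x y\<bar> = \<bar>LINT z:{x..y}|lebesgue. (F y + F x) * f z - 2 * F z * f z\<bar>"
        by (rule arg_cong)
      also have "\<dots> \<le> (LINT z:{x..y}|lebesgue. \<bar>(F y + F x) * f z - 2 * F z * f z\<bar>)"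
      proof -
        have "set_integrable lebesgue {x..y} (\<lambda>z. (F y + F x) * f z - 2 * F z * f z)"
          by (intro set_integral_diff ii) (auto intro!: continuous_intros cF fi)
        from set_integral_norm_bound[OF this] show ?thesis by simp
      qed
      also have "\<dots> \<le> (LINT z:{x..y}|lebesgue. \<epsilon> * \<bar>f z\<bar>)"
      proof (rule set_integral_mono)
        show "set_integrable lebesgue {x..y} (\<lambda>z. \<bar>(F y + F x) * f z - 2 * F z * f z\<bar>)"
          by (intro set_integrable_abs set_integral_diff ii) (auto intro!: continuous_intros cF fi)
        show "set_integrable lebesgue {x..y} (\<lambda>z. \<epsilon> * \<bar>f z\<bar>)" using ai by auto
        fix z assume z: "z \<in> {x..y}"
        have "\<bar>F y - F z\<bar> < \<epsilon> / 2" using z xy by (intro d(2)) auto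
        moreover have "\<bar>F z - F x\<bar> < \<epsilon> / 2" using z xy by (intro d(2)) auto
        ultimately have "\<bar>F y + F x - 2 * F z\<bar> \<le> \<epsilon>" by linarith
        thus "\<bar>(F y + F x) * f z - 2 * F z * f z\<bar> \<le> \<epsilon> * \<bar>f z\<bar>"
          by (simp add: left_diff_distrib[symmetric] abs_mult mult_right_mono)
      qed
      also have "\<dots> = \<epsilon> * m x y" by (simp add: m_def)
      finally show ?thesis .
    qed
    have steps: "\<bar>h x y\<bar> \<le> \<epsilon> * m x y" if "a \<le> x" "x \<le> y" "y \<le> b" "y - x \<le> real n * (d / 2)" for x y n
      using that
    proof (induction n arbitrary: x)
      case 0
      thus ?case using d by (intro small) auto
    next
      case (Suc n)
      define z where "z = min y (x + d / 2)"
      have z: "x \<le> z" "z \<le> y" "z - x < d" "y - z \<le> real n * (d / 2)"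
        using Suc.prems d(1) by (auto simp: z_def min_def algebra_simps)
      have "\<bar>h x y\<bar> \<le> \<bar>h x z\<bar> + \<bar>h z y\<bar>" using hadd[OF z(1,2)] by simp
      also have "\<dots> \<le> \<epsilon> * m x z + \<epsilon> * m z y"
        using Suc z by (intro add_mono small Suc.IH) auto
      also have "\<dots> = \<epsilon> * m x y" using madd[OF z(1,2)] by (simp add: algebra_simps)
      finally show ?case .
    qed
    obtain n where "(b - a) / (d / 2) \<le> real n" using real_arch_simple by blast
    hence "b - a \<le> real n * (d / 2)" using d by (simp add: field_simps)
    thus ?thesis using ab by (intro steps) auto
  qed
  note * = this
  have mnn: "0 \<le> m a b" unfolding m_def set_lebesgue_integral_def by (auto intro!: integral_nonneg)
  have "\<bar>h a b\<bar> \<le> 0"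
  proof (rule field_le_epsilon)
    fix e :: real assume "e > 0"
    hence "\<bar>h a b\<bar> \<le> (e / (m a b + 1)) * m a b" using mnn by (intro *) auto
    also have "\<dots> \<le> e" using mnn \<open>e > 0\<close> by (simp add: field_simps)
    finally show "\<bar>h a b\<bar> \<le> 0 + e" by simp
  qed
  thus "F b * F b - F a * F a = (LINT x:{a..b}|lebesgue. 2 * F x * f x)" by (simp add: h_def)
qed

text \<open>By polarisation of the formula for squares.\<close>

theorem sobolev_deriv_mult:
  assumes F: "sobolev_deriv F f" and G: "sobolev_deriv G g"
  shows "sobolev_deriv (\<lambda>x. F x * G x) (\<lambda>x. F x * g x + f x * G x)"
proof -
  have "sobolev_deriv (\<lambda>x. (1/4) * ((F x + G x) * (F x + G x)) + (-1/4) * ((F x + (-1) * G x) * (F x + (-1) * G x)))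
     (\<lambda>x. (1/4) * (2 * (F x + G x) * (f x + g x)) + (-1/4) * (2 * (F x + (-1) * G x) * (f x + (-1) * g x)))"
    by (intro sobolev_deriv_add sobolev_deriv_cmult sobolev_deriv_square F G)
  thus ?thesis by (simp add: algebra_simps)
qed

section \<open>Periodic functions\<close>

abbreviation per_integrable :: "real \<Rightarrow> (real \<Rightarrow> 'b::{banach, second_countable_topology}) \<Rightarrow> bool"
  where "per_integrable X f \<equiv> set_integrable lebesgue {0..X} f"

abbreviation mean_int :: "real \<Rightarrow> (real \<Rightarrow> 'b::{banach, second_countable_topology}) \<Rightarrow> 'b"
  where "mean_int X f \<equiv> LINT x:{0..X}|lebesgue. f x"

lemma periodic_shift_nat: "periodic X f \<Longrightarrow> f (x + real n * X) = f x"
proof (induction n)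
  case (Suc n)
  have "f (x + real (Suc n) * X) = f ((x + real n * X) + X)" by (simp add: algebra_simps)
  thus ?case using Suc by (simp add: periodic_def)
qed auto

lemma periodic_shift_int: "periodic X f \<Longrightarrow> f (x + of_int k * X) = f x"
proof (cases "0 \<le> k")
  case True
  assume "periodic X f"
  thus ?thesis using periodic_shift_nat[of X f x "nat k"] True by simp
next
  case False
  assume "periodic X f"
  thus ?thesis using periodic_shift_nat[of X f "x + of_int k * X" "nat (-k)"] False by (simp add: algebra_simps)
qed

lemma periodic_set_integrable:
  fixes f :: "real \<Rightarrow> 'b::euclidean_space"
  assumes X: "0 < X" and p: "periodic X f" and i: "per_integrable X f"
  shows "set_integrable lebesgue {a..b} f"
proof -
  have sh: "set_integrable lebesgue {of_int k * X..X + of_int k * X} f" for k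
    using set_integral_shift(1)[of 0 X f "of_int k * X"] i by (simp add: periodic_shift_int[OF p])
  have n: "set_integrable lebesgue {- (real n * X)..real n * X} f" for n
  proof (induction n)
    case (Suc n)
    have nX: "0 \<le> real n * X" using X by simp
    have le: "- (real n * X) \<le> real n * X" "real n * X \<le> X + real n * X" "- (real n * X) \<le> X + real n * X"
      using nX X by linarith+
    have le': "- (real (Suc n) * X) \<le> - (real n * X)" using X by (simp add: algebra_simps)
    have e1: "X + of_int (- int (Suc n)) * X = - (real n * X)"
      by (simp add: algebra_simps)
    have e2: "of_int (- int (Suc n)) * X = - (real (Suc n) * X)" by (simp add: algebra_simps)
    have left: "set_integrable lebesgue {- (real (Suc n) * X)..- (real n * X)} f"
      using sh[of "- int (Suc n)"] unfolding e1 unfolding e2 .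
    have "set_integrable lebesgue {real n * X..X + real n * X} f"
      using sh[of "int n"] by simp
    hence "set_integrable lebesgue {- (real n * X)..X + real n * X} f"
      by (rule set_integrable_combine[OF le(1,2) Suc])
    hence "set_integrable lebesgue {- (real (Suc n) * X)..X + real n * X} f"
      by (rule set_integrable_combine[OF le' le(3) left])
    moreover have e: "X + real n * X = real (Suc n) * X" by (simp add: distrib_right)
    ultimately show ?case unfolding e by blast
  qed (simp add: set_integrable_subset[OF i] X[THEN less_imp_le])
  obtain n where "(\<bar>a\<bar> + \<bar>b\<bar>) / X \<le> real n" using real_arch_simple by blast
  hence "\<bar>a\<bar> + \<bar>b\<bar> \<le> real n * X" using X by (simp add: field_simps)
  thus ?thesis by (intro set_integrable_subset[OF n[of n]]) auto
qed

lemma periodic_integral_interval: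
  fixes f :: "real \<Rightarrow> 'b::euclidean_space"
  assumes X: "0 < X" and p: "periodic X f" and i: "per_integrable X f"
  shows "(LINT x:{s..s+X}|lebesgue. f x) = mean_int X f"
proof -
  define k where "k = \<lfloor>s / X\<rfloor>"
  define t where "t = s - of_int k * X"
  have "of_int k \<le> s / X" "s / X < of_int k + 1" by (auto simp: k_def)
  hence t: "0 \<le> t" "t \<le> X" using X by (auto simp: t_def field_simps)
  have ii: "set_integrable lebesgue {a..b} f" for a b
    by (rule periodic_set_integrable[OF assms])
  have "(LINT x:{s..s+X}|lebesgue. f x) = (LINT x:{t..t+X}|lebesgue. f (x + of_int k * X))"
    by (subst set_integral_shift) (simp add: t_def algebra_simps)
  also have "\<dots> = (LINT x:{t..t+X}|lebesgue. f x)" by (simp add: periodic_shift_int[OF p])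
  also have "\<dots> = (LINT x:{t..X}|lebesgue. f x) + (LINT x:{X..t+X}|lebesgue. f x)"
    using t by (intro set_integral_combine ii) auto
  also have "(LINT x:{X..t+X}|lebesgue. f x) = (LINT x:{0..t}|lebesgue. f (x + X))"
    by (subst set_integral_shift) simp
  also have "\<dots> = (LINT x:{0..t}|lebesgue. f x)" using p by (simp add: periodic_def)
  also have "(LINT x:{t..X}|lebesgue. f x) + (LINT x:{0..t}|lebesgue. f x) = mean_int X f"
    using set_integral_combine[OF t ii] by simp
  finally show ?thesis .
qed

lemma periodic_integral_shift:
  fixes f :: "real \<Rightarrow> 'b::euclidean_space"
  assumes X: "0 < X" and p: "periodic X f" and i: "per_integrable X f"
  shows "mean_int X (\<lambda>x. f (x + s)) = mean_int X f"
  using periodic_integral_interval[OF assms, of s] by (subst set_integral_shift) (simp add: add.commute)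

lemma sobolev_primitive:
  fixes f :: "real \<Rightarrow> real"
  assumes ii: "\<And>a b. set_integrable lebesgue {a..b} f"
  obtains F where "sobolev_deriv F f"
proof -
  define F where "F x = (if 0 \<le> x then LINT z:{0..x}|lebesgue. f z else - (LINT z:{x..0}|lebesgue. f z))" for x
  have "sobolev_deriv F f" unfolding sobolev_deriv_def
  proof (intro allI impI conjI ii)
    fix a b :: real assume ab: "a \<le> b"
    consider "0 \<le> a" | "a < 0" "0 \<le> b" | "b < 0" using ab by linarith
    thus "F b - F a = (LINT x:{a..b}|lebesgue. f x)"
    proof cases
      case 1
      thus ?thesis using ab set_integral_combine[OF 1 ab ii] by (simp add: F_def)
    next
      case 2
      thus ?thesis using set_integral_combine[of a 0 b f, OF _ _ ii] by (simp add: F_def)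
    next
      case 3
      thus ?thesis using ab set_integral_combine[of a b 0 f, OF _ _ ii] by (simp add: F_def)
    qed
  qed
  thus ?thesis by (rule that)
qed

lemma periodic_primitive:
  fixes f :: "real \<Rightarrow> real"
  assumes X: "0 < X" and p: "periodic X f" and i: "per_integrable X f" and z: "mean_int X f = 0"
  obtains F where "sobolev_deriv F f" "periodic X F" "F 0 = 0"
proof -
  obtain G where G: "sobolev_deriv G f" using sobolev_primitive[OF periodic_set_integrable[OF X p i]] .
  have "G (x + X) = G x" for x
    using sobolev_deriv_diff[OF G, of x "x + X"] X by (simp add: periodic_integral_interval[OF X p i] z)
  thus ?thesis using G by (intro that[of "\<lambda>x. G x - G 0"]) (auto simp: sobolev_deriv_def periodic_def)
qed

lemma periodic_sobolev_mean_zero: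
  assumes X: "0 < X" and "sobolev_deriv F f" and "periodic X F"
  shows "mean_int X f = 0"
proof -
  have "F X = F 0" using assms(3) unfolding periodic_def by (metis add_0)
  thus ?thesis using sobolev_deriv_diff[OF assms(2), of 0 X] X by simp
qed

lemma periodic_continuous_bounded:
  fixes f :: "real \<Rightarrow> 'b::euclidean_space"
  assumes X: "0 < X" and p: "periodic X f" and c: "continuous_on UNIV f"
  shows "\<exists>C>0. \<forall>x. norm (f x) \<le> C"
proof -
  have "compact (f ` {0..X})"
    by (rule compact_continuous_image) (auto intro: continuous_on_subset[OF c])
  then obtain C where "\<forall>y\<in>f ` {0..X}. norm y \<le> C"
    by (auto dest!: compact_imp_bounded simp: bounded_iff)
  hence C: "\<And>x. x \<in> {0..X} \<Longrightarrow> norm (f x) \<le> C" by simp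
  have "norm (f x) \<le> max C 1" for x
  proof -
    define k where "k = \<lfloor>x / X\<rfloor>"
    have "of_int k \<le> x / X" "x / X < of_int k + 1" by (auto simp: k_def)
    hence "x + of_int (- k) * X \<in> {0..X}" using X by (auto simp: field_simps)
    thus ?thesis using C periodic_shift_int[OF p, of x "-k"] by fastforce
  qed
  thus ?thesis by (intro exI[of _ "max C 1"]) auto
qed

section \<open>Periodic square-integrable functions\<close>

text \<open>Yields Cauchy-Schwarz inequalities for nonnegative forms on sets of functions.\<close>

lemma discriminant_nonpos:
  fixes a b c :: real
  assumes a0: "0 \<le> a" and q: "\<And>t. 0 \<le> a * t\<^sup>2 - 2 * b * t + c"
  shows "b\<^sup>2 \<le> a * c"
proof (cases "a = 0")
  case True
  have "b = 0"
  proof (rule ccontr)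
    assume b: "b \<noteq> 0"
    have "0 \<le> a * ((c + 1) / (2 * b))\<^sup>2 - 2 * b * ((c + 1) / (2 * b)) + c" by (rule q)
    thus False using b True by simp
  qed
  thus ?thesis using True by simp
next
  case False
  have a: "0 < a" using False a0 by simp
  have "0 \<le> a * (b / a)\<^sup>2 - 2 * b * (b / a) + c" by (rule q)
  also have "\<dots> = c - b\<^sup>2 / a" using a by (simp add: power2_eq_square field_simps)
  finally show ?thesis using a by (simp add: field_simps)
qed

definition l2per :: "real \<Rightarrow> (real \<Rightarrow> 'b::euclidean_space) set"
  where "l2per X = {f. periodic X f \<and> f \<in> borel_measurable lebesgue \<and>
                       per_integrable X (\<lambda>x. (norm (f x))\<^sup>2)}"

definition l2norm :: "real \<Rightarrow> (real \<Rightarrow> 'b::euclidean_space) \<Rightarrow> real"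
  where "l2norm X f = sqrt (mean_int X (\<lambda>x. (norm (f x))\<^sup>2))"

definition l2ip :: "real \<Rightarrow> (real \<Rightarrow> 'b::euclidean_space) \<Rightarrow> (real \<Rightarrow> 'b) \<Rightarrow> real"
  where "l2ip X f g = mean_int X (\<lambda>x. f x \<bullet> g x)"

lemma L2_per_eq_l2per: "L2_per X = l2per X"
  by (simp add: L2_per_def l2per_def)

lemma l2perD:
  assumes "f \<in> l2per X"
  shows "periodic X f" "f \<in> borel_measurable lebesgue"
    "per_integrable X (\<lambda>x. (norm (f x))\<^sup>2)"
  using assms by (auto simp: l2per_def)

lemma set_integral_nonneg_real:
  fixes f :: "real \<Rightarrow> real"
  assumes "\<And>x. x \<in> A \<Longrightarrow> 0 \<le> f x"
  shows "0 \<le> (LINT x:A|lebesgue. f x)"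
  unfolding set_lebesgue_integral_def
  by (rule Bochner_Integration.integral_nonneg) (use assms in \<open>auto simp: indicator_def\<close>)

lemma set_integrable_bound_real:
  fixes f :: "real \<Rightarrow> real" and g :: "real \<Rightarrow> 'b::euclidean_space"
  assumes f: "set_integrable lebesgue A f" and g: "g \<in> borel_measurable lebesgue" and A: "A \<in> sets lebesgue"
    and le: "\<And>x. x \<in> A \<Longrightarrow> norm (g x) \<le> f x"
  shows "set_integrable lebesgue A g"
proof (rule set_integrable_bound[OF f])
  show "set_borel_measurable lebesgue A g"
    unfolding set_borel_measurable_def using g A by (intro borel_measurable_scaleR borel_measurable_indicator) auto
  show "AE x in lebesgue. x \<in> A \<longrightarrow> norm (g x) \<le> norm (f x)"
    using le by (intro always_eventually) force
qed

lemma l2norm_nonneg[simp]: "0 \<le> l2norm X f"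
  unfolding l2norm_def by (simp add: set_integral_nonneg_real)

lemma l2norm_sq: "(l2norm X f)\<^sup>2 = mean_int X (\<lambda>x. (norm (f x))\<^sup>2)"
  unfolding l2norm_def by (simp add: set_integral_nonneg_real)

lemma l2ip_self: "l2ip X f f = (l2norm X f)\<^sup>2"
  by (simp add: l2norm_sq l2ip_def power2_norm_eq_inner)

lemma l2_product_integrable:
  assumes f: "f \<in> l2per X" and g: "g \<in> l2per X"
  shows "per_integrable X (\<lambda>x. norm (f x) * norm (g x))"
proof (rule set_integrable_bound_real)
  show "per_integrable X (\<lambda>x. (norm (f x))\<^sup>2 + (norm (g x))\<^sup>2)"
    using l2perD(3)[OF f] l2perD(3)[OF g] by (rule set_integral_add)
  show "(\<lambda>x. norm (f x) * norm (g x)) \<in> borel_measurable lebesgue"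
    using l2perD(2)[OF f] l2perD(2)[OF g] by measurable
  show "norm (norm (f x) * norm (g x)) \<le> (norm (f x))\<^sup>2 + (norm (g x))\<^sup>2" for x
  proof -
    have "0 \<le> (norm (f x) - norm (g x))\<^sup>2" "0 \<le> norm (f x) * norm (g x)" by simp_all
    hence "norm (f x) * norm (g x) \<le> (norm (f x))\<^sup>2 + (norm (g x))\<^sup>2"
      unfolding power2_diff by linarith
    thus ?thesis by simp
  qed
qed auto

theorem l2_Cauchy_Schwarz:
  assumes f: "f \<in> l2per X" and g: "g \<in> l2per X"
  shows "mean_int X (\<lambda>x. norm (f x) * norm (g x)) \<le> l2norm X f * l2norm X g"
proof -
  define B where "B = mean_int X (\<lambda>x. norm (f x) * norm (g x))"
  have "0 \<le> (l2norm X f)\<^sup>2 * t\<^sup>2 - 2 * B * t + (l2norm X g)\<^sup>2" for t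
  proof -
    have "0 \<le> mean_int X (\<lambda>x. (t * norm (f x) - norm (g x))\<^sup>2)"
      by (rule set_integral_nonneg_real) simp
    also have "(\<lambda>x. (t * norm (f x) - norm (g x))\<^sup>2) =
        (\<lambda>x. (t\<^sup>2 * (norm (f x))\<^sup>2 - (2 * t) * (norm (f x) * norm (g x))) + (norm (g x))\<^sup>2)"
      by (auto simp: power2_eq_square algebra_simps)
    also have "mean_int X \<dots> = (t\<^sup>2 * (l2norm X f)\<^sup>2 - (2 * t) * B) + (l2norm X g)\<^sup>2"
      unfolding l2norm_sq B_def
      using l2perD(3)[OF f] l2perD(3)[OF g] l2_product_integrable[OF f g]
      by (subst set_integral_add(2); (subst set_integral_diff(2))?) (auto intro!: set_integral_diff)
    finally show ?thesis by (simp add: algebra_simps)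
  qed
  hence "B\<^sup>2 \<le> (l2norm X f)\<^sup>2 * (l2norm X g)\<^sup>2" by (intro discriminant_nonpos) auto
  hence "B\<^sup>2 \<le> (l2norm X f * l2norm X g)\<^sup>2" by (simp add: power_mult_distrib)
  thus ?thesis unfolding B_def[symmetric] by (rule power2_le_imp_le) simp
qed

lemma l2_bilinear_bound:
  fixes h :: "real \<Rightarrow> real"
  assumes f: "f \<in> l2per X" and g: "g \<in> l2per X" and h: "h \<in> borel_measurable lebesgue"
    and C: "0 \<le> C" and le: "\<And>x. \<bar>h x\<bar> \<le> C * (norm (f x) * norm (g x))"
  shows "per_integrable X h" "\<bar>mean_int X h\<bar> \<le> C * (l2norm X f * l2norm X g)"
proof -
  have i: "per_integrable X (\<lambda>x. C * (norm (f x) * norm (g x)))"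
    using l2_product_integrable[OF f g] by simp
  show hi: "per_integrable X h"
    by (rule set_integrable_bound_real[OF i h]) (use le in auto)
  have "\<bar>mean_int X h\<bar> \<le> mean_int X (\<lambda>x. \<bar>h x\<bar>)" using set_integral_norm_bound[OF hi] by simp
  also have "\<dots> \<le> mean_int X (\<lambda>x. C * (norm (f x) * norm (g x)))"
    by (rule set_integral_mono[OF set_integrable_abs[OF hi] i]) (rule le)
  also have "\<dots> = C * mean_int X (\<lambda>x. norm (f x) * norm (g x))" by simp
  also have "\<dots> \<le> C * (l2norm X f * l2norm X g)"
    by (intro mult_left_mono l2_Cauchy_Schwarz f g C)
  finally show "\<bar>mean_int X h\<bar> \<le> C * (l2norm X f * l2norm X g)" .
qed

lemma l2ip_integrable: 
  assumes f: "f \<in> l2per X" and g: "g \<in> l2per X"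
  shows "per_integrable X (\<lambda>x. f x \<bullet> g x)"
proof (rule l2_bilinear_bound(1)[OF f g, of _ 1])
  show "(\<lambda>x. f x \<bullet> g x) \<in> borel_measurable lebesgue"
    using l2perD(2)[OF f] l2perD(2)[OF g] by measurable
qed (auto simp: Cauchy_Schwarz_ineq2)

lemma l2ip_bound:
  assumes f: "f \<in> l2per X" and g: "g \<in> l2per X"
  shows "\<bar>l2ip X f g\<bar> \<le> l2norm X f * l2norm X g"
proof -
  have "(\<lambda>x. f x \<bullet> g x) \<in> borel_measurable lebesgue"
    using l2perD(2)[OF f] l2perD(2)[OF g] by measurable
  from l2_bilinear_bound(2)[OF f g this, of 1] show ?thesis
    by (simp add: l2ip_def Cauchy_Schwarz_ineq2)
qed

lemma l2per_dominated:
  fixes g :: "real \<Rightarrow> 'c::euclidean_space"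
  assumes f: "f \<in> l2per X" and p: "periodic X g" and g: "g \<in> borel_measurable lebesgue"
    and C: "0 \<le> C" and le: "\<And>x. norm (g x) \<le> C * norm (f x)"
  shows "g \<in> l2per X" "l2norm X g \<le> C * l2norm X f"
proof -
  have le2: "(norm (g x))\<^sup>2 \<le> C\<^sup>2 * (norm (f x))\<^sup>2" for x
    using power_mono[OF le, of x 2] by (simp add: power_mult_distrib)
  have i: "per_integrable X (\<lambda>x. C\<^sup>2 * (norm (f x))\<^sup>2)"
    using l2perD(3)[OF f] by simp
  have gi: "per_integrable X (\<lambda>x. (norm (g x))\<^sup>2)"
    by (rule set_integrable_bound_real[OF i]) (use le2 g in auto)
  thus "g \<in> l2per X" using p g by (simp add: l2per_def)
  have "(l2norm X g)\<^sup>2 \<le> C\<^sup>2 * (l2norm X f)\<^sup>2" unfolding l2norm_sq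
    using set_integral_mono[OF gi i le2] by simp
  hence "(l2norm X g)\<^sup>2 \<le> (C * l2norm X f)\<^sup>2" by (simp add: power_mult_distrib)
  thus "l2norm X g \<le> C * l2norm X f" by (rule power2_le_imp_le) (simp add: C)
qed

lemma borel_measurable_lebesgue_continuous:
  fixes f :: "real \<Rightarrow> 'b::euclidean_space"
  assumes "continuous_on UNIV f"
  shows "f \<in> borel_measurable lebesgue"
  using borel_measurable_continuous_onI[OF assms] by (simp add: measurable_completion)

lemma l2per_continuous:
  fixes f :: "real \<Rightarrow> 'b::euclidean_space"
  assumes "periodic X f" and c: "continuous_on UNIV f"
  shows "f \<in> l2per X"
  unfolding l2per_def using assms
  by (auto intro!: borel_measurable_lebesgue_continuous continuous_set_integrable continuous_intros)

lemma l2per_scaleR: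
  assumes f: "f \<in> l2per X"
  shows "(\<lambda>x. c *\<^sub>R f x) \<in> l2per X" "l2norm X (\<lambda>x. c *\<^sub>R f x) = \<bar>c\<bar> * l2norm X f"
proof -
  show "(\<lambda>x. c *\<^sub>R f x) \<in> l2per X"
    by (rule l2per_dominated(1)[OF f, of _ "\<bar>c\<bar>"]) (use l2perD[OF f] in \<open>auto simp: periodic_def\<close>)
  show "l2norm X (\<lambda>x. c *\<^sub>R f x) = \<bar>c\<bar> * l2norm X f"
    by (simp add: l2norm_def power_mult_distrib real_sqrt_mult)
qed

lemma l2per_add:
  assumes f: "f \<in> l2per X" and g: "g \<in> l2per X"
  shows "(\<lambda>x. f x + g x) \<in> l2per X" "l2norm X (\<lambda>x. f x + g x) \<le> l2norm X f + l2norm X g"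
proof -
  have i: "per_integrable X (\<lambda>x. (norm (f x))\<^sup>2 + (norm (g x))\<^sup>2 + 2 * (norm (f x) * norm (g x)))"
    using l2perD(3)[OF f] l2perD(3)[OF g] l2_product_integrable[OF f g]
    by (intro set_integral_add) auto
  have le: "(norm (f x + g x))\<^sup>2 \<le> (norm (f x))\<^sup>2 + (norm (g x))\<^sup>2 + 2 * (norm (f x) * norm (g x))" for x
    using power_mono[OF norm_triangle_ineq[of "f x" "g x"], of 2] by (simp add: power2_sum)
  have m: "(\<lambda>x. f x + g x) \<in> borel_measurable lebesgue"
    using l2perD(2)[OF f] l2perD(2)[OF g] by measurable
  have gi: "per_integrable X (\<lambda>x. (norm (f x + g x))\<^sup>2)"
    by (rule set_integrable_bound_real[OF i]) (use le m in auto)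
  thus "(\<lambda>x. f x + g x) \<in> l2per X" using m l2perD(1)[OF f] l2perD(1)[OF g]
    by (simp add: l2per_def periodic_def)
  have "(l2norm X (\<lambda>x. f x + g x))\<^sup>2 \<le> (l2norm X f)\<^sup>2 + (l2norm X g)\<^sup>2 + 2 * mean_int X (\<lambda>x. norm (f x) * norm (g x))"
    unfolding l2norm_sq using set_integral_mono[OF gi i le] l2perD(3)[OF f] l2perD(3)[OF g] l2_product_integrable[OF f g]
    by (simp add: set_integral_add)
  also have "\<dots> \<le> (l2norm X f)\<^sup>2 + (l2norm X g)\<^sup>2 + 2 * (l2norm X f * l2norm X g)"
    using l2_Cauchy_Schwarz[OF f g] by simp
  also have "\<dots> = (l2norm X f + l2norm X g)\<^sup>2" by (simp add: power2_sum)
  finally show "l2norm X (\<lambda>x. f x + g x) \<le> l2norm X f + l2norm X g"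
    by (rule power2_le_imp_le) simp
qed

lemma l2per_diff:
  assumes f: "f \<in> l2per X" and g: "g \<in> l2per X"
  shows "(\<lambda>x. f x - g x) \<in> l2per X" "l2norm X (\<lambda>x. f x - g x) \<le> l2norm X f + l2norm X g"
  using l2per_add[OF f l2per_scaleR(1)[OF g, of "-1"]] l2per_scaleR(2)[OF g, of "-1"] by auto

lemma l2norm_diff_commute: "l2norm X (\<lambda>x. f x - g x) = l2norm X (\<lambda>x. g x - f x)"
  by (simp add: l2norm_def norm_minus_commute)

lemma l2per_zero: "(\<lambda>x. 0) \<in> l2per X"
  by (intro l2per_continuous) (auto simp: periodic_def)

lemma l2per_sum:
  assumes "finite I" "\<And>i. i \<in> I \<Longrightarrow> f i \<in> l2per X"
  shows "(\<lambda>x. \<Sum>i\<in>I. f i x) \<in> l2per X"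
  using assms by (induction I rule: finite_induct) (auto intro!: l2per_zero l2per_add)

lemma periodic_shift: "periodic X f \<Longrightarrow> periodic X (\<lambda>x. f (x + s))"
  unfolding periodic_def by (metis add.assoc add.commute)

lemma l2per_shift:
  assumes X: "0 < X" and f: "f \<in> l2per X"
  shows "(\<lambda>x. f (x + s)) \<in> l2per X" "l2norm X (\<lambda>x. f (x + s)) = l2norm X f"
proof -
  have p: "periodic X (\<lambda>x. (norm (f x))\<^sup>2)" using l2perD(1)[OF f] by (simp add: periodic_def)
  have m: "(\<lambda>x. f (x + s)) \<in> borel_measurable lebesgue"
    using borel_measurable_affine[OF l2perD(2)[OF f], of 1 s] by (simp add: add.commute)
  show "l2norm X (\<lambda>x. f (x + s)) = l2norm X f"
    unfolding l2norm_def using periodic_integral_shift[OF X p l2perD(3)[OF f]] by simp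
  have "per_integrable X (\<lambda>x. (norm (f (x + s)))\<^sup>2)"
    using set_integral_shift(1)[of 0 X "\<lambda>x. (norm (f x))\<^sup>2" s] periodic_set_integrable[OF X p l2perD(3)[OF f]] by blast
  thus "(\<lambda>x. f (x + s)) \<in> l2per X" 
    using m periodic_shift[OF l2perD(1)[OF f]] by (simp add: l2per_def)
qed

lemma l2per_cong_AE:
  assumes f: "f \<in> l2per X" and p: "periodic X g" and fg: "AE x in lebesgue. f x = g x"
  shows "g \<in> l2per X"
proof -
  have "AE x in lebesgue. (norm (f x))\<^sup>2 = (norm (g x))\<^sup>2" using fg by eventually_elim auto
  from set_integral_cong_lebesgue_AE(1)[OF this] show ?thesis
    using l2perD[OF f] p borel_measurable_lebesgue_cong_AE[OF _ fg] by (auto simp: l2per_def)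
qed

lemma l2norm_cong_AE:
  assumes fg: "AE x in lebesgue. f x = g x"
  shows "l2norm X f = l2norm X g"
proof -
  have "AE x in lebesgue. (norm (f x))\<^sup>2 = (norm (g x))\<^sup>2" using fg by eventually_elim auto
  from set_integral_cong_lebesgue_AE(2)[OF this] show ?thesis by (simp add: l2norm_def)
qed

lemma le_one_plus_square: "y \<le> 1 + y\<^sup>2" for y :: real
proof -
  have "1 + y\<^sup>2 - y = (y - 1/2)\<^sup>2 + 3/4" by (simp add: power2_eq_square field_simps)
  moreover have "0 \<le> (y - 1/2)\<^sup>2" by (rule zero_le_power2)
  ultimately show ?thesis by linarith
qed

lemma l2per_integrable:
  fixes f :: "real \<Rightarrow> 'b::euclidean_space"
  assumes f: "f \<in> l2per X"
  shows "per_integrable X f"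
proof (rule set_integrable_bound_real)
  show "per_integrable X (\<lambda>x. 1 + (norm (f x))\<^sup>2)"
    using set_integral_add(1)[OF continuous_set_integrable[OF continuous_on_const] l2perD(3)[OF f]] .
  show "norm (f x) \<le> 1 + (norm (f x))\<^sup>2" for x
    by (rule le_one_plus_square)
qed (use l2perD(2)[OF f] in auto)

lemma l2per_mean_bound:
  fixes f :: "real \<Rightarrow> real"
  assumes X: "0 < X" and f: "f \<in> l2per X"
  shows "\<bar>mean_int X f\<bar> \<le> sqrt X * l2norm X f"
proof -
  have o: "(\<lambda>x. 1::real) \<in> l2per X" by (intro l2per_continuous) (auto simp: periodic_def)
  have n: "l2norm X (\<lambda>x. 1::real) = sqrt X" using X by (simp add: l2norm_def set_integral_const)
  show ?thesis using l2ip_bound[OF o f] by (simp add: l2ip_def n)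
qed

lemma l2per_continuous_mult:
  fixes a :: "real \<Rightarrow> real"
  assumes X: "0 < X" and a: "periodic X a" "continuous_on UNIV a" and f: "f \<in> l2per X"
  shows "(\<lambda>x. a x *\<^sub>R f x) \<in> l2per X"
proof -
  obtain C where C: "0 < C" "\<And>x. norm (a x) \<le> C" using periodic_continuous_bounded[OF X a] by blast
  have [measurable]: "a \<in> borel_measurable lebesgue" by (rule borel_measurable_lebesgue_continuous[OF a(2)])
  note [measurable] = l2perD(2)[OF f]
  have p: "periodic X (\<lambda>x. a x *\<^sub>R f x)" using l2perD(1)[OF f] a(1) by (simp add: periodic_def)
  have le: "norm (a x *\<^sub>R f x) \<le> C * norm (f x)" for x
    using C(2)[of x] by (simp add: mult_right_mono)
  show ?thesis by (rule l2per_dominated(1)[OF f p _ _ le]) (use C in auto)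
qed

lemma l2per_linear_image:
  fixes T :: "'b::euclidean_space \<Rightarrow> 'c::euclidean_space"
  assumes f: "f \<in> l2per X" and T: "linear T" and le: "\<And>y. norm (T y) \<le> norm y"
  shows "(\<lambda>x. T (f x)) \<in> l2per X" "l2norm X (\<lambda>x. T (f x)) \<le> l2norm X f"
proof -
  have m: "(\<lambda>x. T (f x)) \<in> borel_measurable lebesgue"
    by (rule measurable_compose[OF l2perD(2)[OF f]])
      (intro borel_measurable_continuous_onI linear_continuous_on linear_conv_bounded_linear[THEN iffD1] T)
  have p: "periodic X (\<lambda>x. T (f x))" using l2perD(1)[OF f] by (simp add: periodic_def)
  show "(\<lambda>x. T (f x)) \<in> l2per X" "l2norm X (\<lambda>x. T (f x)) \<le> l2norm X f"
    using l2per_dominated[OF f p m, of 1] le by auto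
qed

lemma l2ip_diff_left: "f \<in> l2per X \<Longrightarrow> g \<in> l2per X \<Longrightarrow> h \<in> l2per X \<Longrightarrow> l2ip X (\<lambda>x. f x - g x) h = l2ip X f h - l2ip X g h"
  by (simp add: l2ip_def inner_diff_left set_integral_diff l2ip_integrable)

lemma l2ip_scaleR_left: "l2ip X (\<lambda>x. c *\<^sub>R f x) h = c * l2ip X f h"
  by (simp add: l2ip_def)

lemma l2ip_commute: "l2ip X f h = l2ip X h f"
  by (simp add: l2ip_def inner_commute)

section \<open>A quantitative Fredholm alternative for periodic Sturm-Liouville operators\<close>

text \<open>The second solution \<open>\<psi>\<close> below is not periodic. Composition with \<open>frac_part X\<close> restricts such functions to
one period and extends them periodically, at the price of a jump.\<close>

definition frac_part :: "real \<Rightarrow> real \<Rightarrow> real"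
  where "frac_part X x = x - X * of_int \<lfloor>x / X\<rfloor>"

lemma frac_part:
  assumes "0 < X"
  shows "0 \<le> frac_part X x" "frac_part X x < X" "frac_part X (x + X) = frac_part X x"
    and "0 \<le> x \<Longrightarrow> x < X \<Longrightarrow> frac_part X x = x"
proof -
  have "of_int \<lfloor>x / X\<rfloor> \<le> x / X" "x / X < of_int \<lfloor>x / X\<rfloor> + 1" by linarith+
  hence "of_int \<lfloor>x / X\<rfloor> * X \<le> x" "x < (of_int \<lfloor>x / X\<rfloor> + 1) * X"
    using assms by (simp_all only: pos_le_divide_eq pos_divide_less_eq)
  thus "0 \<le> frac_part X x" "frac_part X x < X" by (simp_all add: frac_part_def algebra_simps)
  have "(x + X) / X = x / X + 1" using assms by (simp add: field_simps)
  thus "frac_part X (x + X) = frac_part X x" by (simp add: frac_part_def algebra_simps)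
  assume "0 \<le> x" "x < X"
  hence "\<lfloor>x / X\<rfloor> = 0" using assms by (simp add: floor_eq_iff)
  thus "frac_part X x = x" by (simp add: frac_part_def)
qed

lemma periodic_frac_part:
  assumes "0 < X" "periodic X f"
  shows "f (frac_part X x) = f x"
  using periodic_shift_int[OF assms(2), of x "- \<lfloor>x / X\<rfloor>"] by (simp add: frac_part_def mult.commute)

lemma frac_part_borel_measurable:
  fixes c :: "real \<Rightarrow> real"
  assumes "continuous_on UNIV c"
  shows "(\<lambda>x. c (frac_part X x)) \<in> borel_measurable lebesgue"
proof -
  have [measurable]: "c \<in> borel_measurable borel" by (rule borel_measurable_continuous_onI[OF assms])
  have "(\<lambda>x. c (frac_part X x)) \<in> borel_measurable borel" unfolding frac_part_def by measurable
  thus ?thesis by (simp add: measurable_completion)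
qed

lemma mean_int_cong_halfopen:
  fixes f g :: "real \<Rightarrow> 'b::euclidean_space"
  assumes "\<And>x. 0 \<le> x \<Longrightarrow> x < X \<Longrightarrow> f x = g x"
  shows "mean_int X f = mean_int X g"
proof -
  have "AE x in lebesgue. x \<notin> {X}" by (rule AE_not_in) auto
  hence ae: "AE x in lebesgue. indicat_real {0..X} x *\<^sub>R f x = indicat_real {0..X} x *\<^sub>R g x"
    by eventually_elim (use assms in \<open>auto simp: indicator_def\<close>)
  show ?thesis
    using set_integral_cong_lebesgue_AE(2)[OF ae, of UNIV] by (simp add: set_lebesgue_integral_def)
qed

lemma l2per_bounded_mult:
  fixes a :: "real \<Rightarrow> real" and f :: "real \<Rightarrow> real"
  assumes a: "periodic X a" "a \<in> borel_measurable lebesgue" "\<And>x. \<bar>a x\<bar> \<le> C" and f: "f \<in> l2per X"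
  shows "(\<lambda>x. a x * f x) \<in> l2per X" "l2norm X (\<lambda>x. a x * f x) \<le> C * l2norm X f"
proof -
  note [measurable] = a(2) l2perD(2)[OF f]
  have C: "0 \<le> C" using a(3)[of 0] by linarith
  have p: "periodic X (\<lambda>x. a x * f x)" using a(1) l2perD(1)[OF f] by (simp add: periodic_def)
  have le: "norm (a x * f x) \<le> C * norm (f x)" for x using a(3)[of x] by (simp add: abs_mult mult_right_mono)
  show "(\<lambda>x. a x * f x) \<in> l2per X" "l2norm X (\<lambda>x. a x * f x) \<le> C * l2norm X f"
    using l2per_dominated[OF f p _ C le] by auto
qed

lemma l2per_bounded:
  fixes a :: "real \<Rightarrow> real"
  assumes X: "0 < X" and a: "periodic X a" "a \<in> borel_measurable lebesgue" "\<And>x. \<bar>a x\<bar> \<le> C"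
  shows "a \<in> l2per X" "l2norm X a \<le> C * sqrt X"
proof -
  have o: "(\<lambda>x. 1::real) \<in> l2per X" by (intro l2per_continuous) (auto simp: periodic_def)
  have n: "l2norm X (\<lambda>x. 1::real) = sqrt X" using X by (simp add: l2norm_def set_integral_const)
  show "a \<in> l2per X" "l2norm X a \<le> C * sqrt X"
    using l2per_bounded_mult[OF a o] by (auto simp: n)
qed

lemma primitive_bound:
  assumes X: "0 < X" and \<eta>: "\<eta> \<in> l2per X" and sd: "sobolev_deriv p \<eta>" and pp: "periodic X p" and p0: "p 0 = 0"
  shows "\<bar>p x\<bar> \<le> sqrt X * l2norm X \<eta>"
proof -
  define y where "y = frac_part X x"
  have y: "0 \<le> y" "y \<le> X" using frac_part[OF X, of x] by (auto simp: y_def)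
  have i: "set_integrable lebesgue {a..b} \<eta>" for a b by (rule sobolev_deriv_set_integrable[OF sd])
  have ia: "set_integrable lebesgue {a..b} (\<lambda>x. \<bar>\<eta> x\<bar>)" for a b by (rule set_integrable_abs[OF i])
  have "\<bar>p x\<bar> = \<bar>p y - p 0\<bar>" using periodic_frac_part[OF X pp] by (simp add: y_def p0)
  also have "\<dots> = \<bar>LINT t:{0..y}|lebesgue. \<eta> t\<bar>" using sobolev_deriv_diff[OF sd y(1)] by simp
  also have "\<dots> \<le> (LINT t:{0..y}|lebesgue. \<bar>\<eta> t\<bar>)" using set_integral_norm_bound[OF i] by simp
  also have "\<dots> \<le> mean_int X (\<lambda>t. \<bar>\<eta> t\<bar>)"
    using set_integral_combine[OF y ia] set_integral_nonneg_real[of "{y..X}" "\<lambda>t. \<bar>\<eta> t\<bar>"] by simp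
  also have "\<dots> \<le> sqrt X * l2norm X (\<lambda>t. \<bar>\<eta> t\<bar>)"
  proof -
    note [measurable] = l2perD(2)[OF \<eta>]
    have "(\<lambda>t. \<bar>\<eta> t\<bar>) \<in> l2per X"
      by (rule l2per_dominated(1)[OF \<eta>, of _ 1]) (use l2perD(1)[OF \<eta>] in \<open>auto simp: periodic_def\<close>)
    from l2per_mean_bound[OF X this] show ?thesis by linarith
  qed
  also have "l2norm X (\<lambda>t. \<bar>\<eta> t\<bar>) = l2norm X \<eta>" by (simp add: l2norm_def)
  finally show ?thesis .
qed

text \<open>Testing a weak solution against the product of an exact solution and a primitive of \<open>\<eta>\<close>
  isolates the Wronskian of the two.\<close>

lemma wronskian_test:
  fixes \<kappa> \<theta> \<rho> \<rho>1 v g :: "real \<Rightarrow> real"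
  assumes X: "0 < X" and \<kappa>c: "continuous_on UNIV \<kappa>" and \<theta>c: "continuous_on UNIV \<theta>"
    and d0: "\<And>x. (\<rho> has_real_derivative \<rho>1 x) (at x)" and c1: "continuous_on UNIV \<rho>1"
    and d1: "\<And>x. ((\<lambda>x. \<kappa> x * \<rho>1 x) has_real_derivative \<theta> x * \<rho> x) (at x)"
    and M: "\<And>x. 0 \<le> x \<Longrightarrow> x \<le> X \<Longrightarrow> \<bar>\<rho> x\<bar> \<le> M" "\<And>x. 0 \<le> x \<Longrightarrow> x \<le> X \<Longrightarrow> \<bar>\<rho>1 x\<bar> \<le> M"
    and g: "g \<in> l2per X" and sd: "sobolev_deriv v g"
    and \<eta>: "\<eta> \<in> l2per X" and \<eta>0: "mean_int X \<eta> = 0"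
  obtains w w1 where "w \<in> l2per X" "w1 \<in> l2per X" "sobolev_deriv w w1"
    "l2norm X w + l2norm X w1 \<le> 2 * M * (X + 1) * l2norm X \<eta>"
    "mean_int X (\<lambda>x. \<kappa> x * g x * w1 x + \<theta> x * v x * w x) = mean_int X (\<lambda>x. \<kappa> x * (\<rho> x * g x - \<rho>1 x * v x) * \<eta> x)"
proof -
  have M0: "0 \<le> M" using M(1)[of 0] X by linarith
  obtain p where p: "sobolev_deriv p \<eta>" "periodic X p" "p 0 = 0"
    using periodic_primitive[OF X l2perD(1)[OF \<eta>] l2per_integrable[OF \<eta>] \<eta>0] by blast
  have pX: "p X = 0" using p(2,3) unfolding periodic_def by (metis add_0)
  have pc: "continuous_on UNIV p" by (rule sobolev_deriv_continuous[OF p(1)])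
  have vc: "continuous_on UNIV v" by (rule sobolev_deriv_continuous[OF sd])
  have c0: "continuous_on UNIV \<rho>" using d0 by (meson DERIV_isCont continuous_at_imp_continuous_on)
  have pb: "\<bar>p x\<bar> \<le> sqrt X * l2norm X \<eta>" for x by (rule primitive_bound[OF X \<eta> p])
  have pl: "p \<in> l2per X" "l2norm X p \<le> sqrt X * l2norm X \<eta> * sqrt X"
    using l2per_bounded[OF X p(2) borel_measurable_lebesgue_continuous[OF pc] pb] by auto
  have sx: "sqrt X * a * sqrt X = X * a" for a
  proof -
    have "sqrt X * a * sqrt X = (sqrt X * sqrt X) * a" by (simp only: ac_simps)
    thus ?thesis using X by simp
  qed
  have pn: "l2norm X p \<le> X * l2norm X \<eta>" using pl(2) unfolding sx .
  \<comment> \<open>The test function is \<open>\<rho> p\<close> on one period. Its periodic extension is continuous because \<open>p\<close> vanishes at both ends, and \<open>\<zeta>\<close> is its derivative.\<close>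
  define \<zeta> where "\<zeta> x = \<rho>1 (frac_part X x) * p x + \<rho> (frac_part X x) * \<eta> x" for x
  have f1: "periodic X (\<lambda>x. \<rho>1 (frac_part X x))" "periodic X (\<lambda>x. \<rho> (frac_part X x))"
    using frac_part(3)[OF X] by (auto simp: periodic_def)
  have b1: "\<bar>\<rho>1 (frac_part X x)\<bar> \<le> M" "\<bar>\<rho> (frac_part X x)\<bar> \<le> M" for x
    using frac_part[OF X, of x] M by (auto simp: less_imp_le)
  have z1: "(\<lambda>x. \<rho>1 (frac_part X x) * p x) \<in> l2per X" "l2norm X (\<lambda>x. \<rho>1 (frac_part X x) * p x) \<le> M * l2norm X p"
    using l2per_bounded_mult[OF f1(1) frac_part_borel_measurable[OF c1] b1(1) pl(1)] by auto
  have z2: "(\<lambda>x. \<rho> (frac_part X x) * \<eta> x) \<in> l2per X" "l2norm X (\<lambda>x. \<rho> (frac_part X x) * \<eta> x) \<le> M * l2norm X \<eta>"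
    using l2per_bounded_mult[OF f1(2) frac_part_borel_measurable[OF c0] b1(2) \<eta>] by auto
  have \<zeta>: "\<zeta> \<in> l2per X" unfolding \<zeta>_def by (rule l2per_add(1)[OF z1(1) z2(1)])
  have \<zeta>n: "l2norm X \<zeta> \<le> M * (X * l2norm X \<eta>) + M * l2norm X \<eta>"
    using l2per_add(2)[OF z1(1) z2(1)] z1(2) z2(2) mult_left_mono[OF pn M0] unfolding \<zeta>_def by linarith
  have sp: "sobolev_deriv (\<lambda>x. \<rho> x * p x) (\<lambda>x. \<rho> x * \<eta> x + \<rho>1 x * p x)"
    by (rule sobolev_deriv_mult[OF sobolev_derivI[OF d0 c1] p(1)])
  have eq: "\<zeta> x = \<rho> x * \<eta> x + \<rho>1 x * p x" if "0 \<le> x" "x < X" for x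
    using frac_part(4)[OF X that] by (simp add: \<zeta>_def)
  have "mean_int X \<zeta> = mean_int X (\<lambda>x. \<rho> x * \<eta> x + \<rho>1 x * p x)"
    by (rule mean_int_cong_halfopen) (rule eq)
  also have "\<dots> = 0" using sobolev_deriv_diff[OF sp, of 0 X] X by (simp add: pX p(3))
  finally have \<zeta>0: "mean_int X \<zeta> = 0" .
  obtain w where w: "sobolev_deriv w \<zeta>" "periodic X w" "w 0 = 0"
    using periodic_primitive[OF X l2perD(1)[OF \<zeta>] l2per_integrable[OF \<zeta>] \<zeta>0] by blast
  have weq: "w x = \<rho> x * p x" if x: "0 \<le> x" "x < X" for x
  proof -
    have "w x = w x - w 0" by (simp add: w)
    also have "\<dots> = mean_int x \<zeta>" by (rule sobolev_deriv_diff[OF w(1) x(1)])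
    also have "\<dots> = mean_int x (\<lambda>x. \<rho> x * \<eta> x + \<rho>1 x * p x)"
      by (rule mean_int_cong_halfopen) (use x eq in auto)
    also have "\<dots> = \<rho> x * p x" using sobolev_deriv_diff[OF sp x(1)] by (simp add: p(3))
    finally show ?thesis .
  qed
  have wb: "\<bar>w x\<bar> \<le> M * (sqrt X * l2norm X \<eta>)" for x
  proof -
    have "w x = \<rho> (frac_part X x) * p (frac_part X x)"
      using weq[of "frac_part X x"] frac_part[OF X, of x] periodic_frac_part[OF X w(2)] by simp
    thus ?thesis using b1(2)[of x] pb M0 by (simp add: abs_mult mult_mono)
  qed
  have wc: "continuous_on UNIV w" by (rule sobolev_deriv_continuous[OF w(1)])
  have wl: "w \<in> l2per X" "l2norm X w \<le> M * (sqrt X * l2norm X \<eta>) * sqrt X"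
    using l2per_bounded[OF X w(2) borel_measurable_lebesgue_continuous[OF wc] wb] by auto
  have wn: "l2norm X w \<le> M * (X * l2norm X \<eta>)"
  proof -
    have "M * (sqrt X * l2norm X \<eta>) * sqrt X = M * (sqrt X * l2norm X \<eta> * sqrt X)" by (simp only: mult.assoc)
    also have "\<dots> = M * (X * l2norm X \<eta>)" by (simp only: sx)
    finally show ?thesis by (rule ord_le_eq_trans[OF wl(2)])
  qed
  have "l2norm X w + l2norm X \<zeta> \<le> 2 * M * (X * l2norm X \<eta>) + M * l2norm X \<eta>" using wn \<zeta>n by linarith
  also have "\<dots> \<le> 2 * M * (X + 1) * l2norm X \<eta>" using M0 by (simp add: algebra_simps)
  finally have nb: "l2norm X w + l2norm X \<zeta> \<le> 2 * M * (X + 1) * l2norm X \<eta>" .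
  have ci: "per_integrable X (\<lambda>x. h x * g x)" "per_integrable X (\<lambda>x. h x * \<eta> x)"
    "per_integrable X h"
    if "continuous_on UNIV h" for h :: "real \<Rightarrow> real"
    using set_integrable_continuous_mult[OF _ that] l2per_integrable[OF g] l2per_integrable[OF \<eta>] continuous_set_integrable[OF that] by auto
  have cg\<eta>: "per_integrable X (\<lambda>x. h x * (g x * \<eta> x))"
    if "continuous_on UNIV h" for h :: "real \<Rightarrow> real"
    using set_integrable_continuous_mult[OF l2ip_integrable[OF g \<eta>] that] by simp
  have sF: "sobolev_deriv (\<lambda>x. (\<kappa> x * \<rho>1 x) * (v x * p x))
      (\<lambda>x. (\<kappa> x * \<rho>1 x) * (v x * \<eta> x + g x * p x) + (\<theta> x * \<rho> x) * (v x * p x))"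
    by (rule sobolev_deriv_mult[OF sobolev_derivI[OF d1] sobolev_deriv_mult[OF sd p(1)]])
      (intro continuous_intros \<theta>c c0)
  have F0: "mean_int X (\<lambda>x. (\<kappa> x * \<rho>1 x) * (v x * \<eta> x + g x * p x) + (\<theta> x * \<rho> x) * (v x * p x)) = 0"
    using sobolev_deriv_diff[OF sF, of 0 X] X by (simp add: pX p(3))
  have "mean_int X (\<lambda>x. \<kappa> x * g x * \<zeta> x + \<theta> x * v x * w x)
    = mean_int X (\<lambda>x. ((\<kappa> x * \<rho>1 x) * (v x * \<eta> x + g x * p x) + (\<theta> x * \<rho> x) * (v x * p x))
         + \<kappa> x * (\<rho> x * g x - \<rho>1 x * v x) * \<eta> x)"
    by (rule mean_int_cong_halfopen) (simp add: eq weq algebra_simps)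
  also have "\<dots> = mean_int X (\<lambda>x. (\<kappa> x * \<rho>1 x) * (v x * \<eta> x + g x * p x) + (\<theta> x * \<rho> x) * (v x * p x))
         + mean_int X (\<lambda>x. \<kappa> x * (\<rho> x * g x - \<rho>1 x * v x) * \<eta> x)"
  proof (rule set_integral_add(2))
    show "per_integrable X (\<lambda>x. (\<kappa> x * \<rho>1 x) * (v x * \<eta> x + g x * p x) + (\<theta> x * \<rho> x) * (v x * p x))"
      by (rule sobolev_deriv_set_integrable[OF sF])
    have "per_integrable X (\<lambda>x. (\<kappa> x * \<rho> x) * (g x * \<eta> x) - (\<kappa> x * \<rho>1 x * v x) * \<eta> x)"
      by (intro set_integral_diff cg\<eta> ci(2) continuous_intros \<kappa>c c0 c1 vc)
    thus "per_integrable X (\<lambda>x. \<kappa> x * (\<rho> x * g x - \<rho>1 x * v x) * \<eta> x)"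
      by (simp add: algebra_simps)
  qed
  finally have "mean_int X (\<lambda>x. \<kappa> x * g x * \<zeta> x + \<theta> x * v x * w x)
      = mean_int X (\<lambda>x. \<kappa> x * (\<rho> x * g x - \<rho>1 x * v x) * \<eta> x)" using F0 by simp
  from that[OF wl(1) \<zeta> w(1) nb this] show ?thesis .
qed

text \<open>Test with \<open>D\<close> minus its mean.\<close>

lemma mean_free_dual_bound:
  assumes X: "0 < X" and D: "D \<in> l2per X" and C: "0 \<le> C"
    and bd: "\<And>\<eta>. \<eta> \<in> l2per X \<Longrightarrow> mean_int X \<eta> = 0 \<Longrightarrow> \<bar>mean_int X (\<lambda>x. D x * \<eta> x)\<bar> \<le> C * l2norm X \<eta>"
  obtains d where "(\<lambda>x. D x - d) \<in> l2per X" "l2norm X (\<lambda>x. D x - d) \<le> C"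
proof -
  define d where "d = mean_int X D / X"
  define \<eta> where "\<eta> x = D x - d" for x
  have cl: "(\<lambda>x. d) \<in> l2per X" by (intro l2per_continuous) (auto simp: periodic_def)
  have \<eta>: "\<eta> \<in> l2per X" unfolding \<eta>_def by (rule l2per_diff(1)[OF D cl])
  have m0: "mean_int X \<eta> = 0"
    unfolding \<eta>_def using X l2per_integrable[OF D] l2per_integrable[OF cl]
    by (simp add: set_integral_diff set_integral_const d_def)
  have "mean_int X (\<lambda>x. D x * \<eta> x) = mean_int X (\<lambda>x. (norm (\<eta> x))\<^sup>2 + d * \<eta> x)"
    by (simp add: \<eta>_def power2_eq_square algebra_simps)
  also have "\<dots> = (l2norm X \<eta>)\<^sup>2 + d * mean_int X \<eta>"
    using l2perD(3)[OF \<eta>] l2per_integrable[OF \<eta>] by (subst set_integral_add) (auto simp: l2norm_sq)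
  finally have "(l2norm X \<eta>)\<^sup>2 \<le> C * l2norm X \<eta>" using bd[OF \<eta> m0] m0 by simp
  hence "l2norm X \<eta> \<le> C"
    using C by (cases "l2norm X \<eta> = 0") (auto simp: power2_eq_square mult_le_cancel_right l2norm_nonneg dest: not_le_imp_less)
  thus ?thesis using that[of d] \<eta> unfolding \<eta>_def by blast
qed

text \<open>The equation \<open>(\<kappa> v')' = \<theta> v\<close> with a periodic solution \<open>\<phi>\<close> and a second solution \<open>\<psi>\<close> that satisfies
\<open>\<psi> (x + X) = \<psi> x - m \<phi> x\<close>; only the consequence of this for the derivatives at \<open>0\<close> and \<open>X\<close> is recorded. For
waves, \<open>\<phi> = v\<^sub>x\<close>, \<open>\<psi> = v\<^sub>\<mu>\<close> and \<open>m = \<Xi>\<^sub>\<mu>\<close>.\<close>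

locale sturm_liouville =
  fixes X m :: real and \<kappa> \<theta> \<phi> \<phi>1 \<psi> \<psi>1 :: "real \<Rightarrow> real"
  assumes X: "0 < X" and m: "m \<noteq> 0"
    and \<kappa>_cont: "continuous_on UNIV \<kappa>" and \<theta>_cont: "continuous_on UNIV \<theta>"
    and \<kappa>_per: "periodic X \<kappa>" and \<theta>_per: "periodic X \<theta>"
    and \<phi>_d0: "\<And>x. (\<phi> has_real_derivative \<phi>1 x) (at x)" and \<phi>1_cont: "continuous_on UNIV \<phi>1"
    and \<phi>_d1: "\<And>x. ((\<lambda>x. \<kappa> x * \<phi>1 x) has_real_derivative \<theta> x * \<phi> x) (at x)"
    and \<psi>_d0: "\<And>x. (\<psi> has_real_derivative \<psi>1 x) (at x)" and \<psi>1_cont: "continuous_on UNIV \<psi>1"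
    and \<psi>_d1: "\<And>x. ((\<lambda>x. \<kappa> x * \<psi>1 x) has_real_derivative \<theta> x * \<psi> x) (at x)"
    and wronskian: "\<And>x. \<kappa> x * (\<phi> x * \<psi>1 x - \<phi>1 x * \<psi> x) = 1"
    and \<phi>_per: "periodic X \<phi>" and \<phi>1_per: "periodic X \<phi>1" and \<phi>0: "\<phi> 0 = 0"
    and \<psi>1_shift: "\<psi>1 X - \<psi>1 0 = - m * \<phi>1 0"
begin

lemma \<phi>_cont: "continuous_on UNIV \<phi>" and \<psi>_cont: "continuous_on UNIV \<psi>"
  using \<phi>_d0 \<psi>_d0 by (meson DERIV_isCont continuous_at_imp_continuous_on)+

lemma common_bound:
  obtains M where "1 \<le> M"
    "\<And>x. 0 \<le> x \<Longrightarrow> x \<le> X \<Longrightarrow> \<bar>\<phi> x\<bar> \<le> M" "\<And>x. 0 \<le> x \<Longrightarrow> x \<le> X \<Longrightarrow> \<bar>\<phi>1 x\<bar> \<le> M"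
    "\<And>x. 0 \<le> x \<Longrightarrow> x \<le> X \<Longrightarrow> \<bar>\<psi> x\<bar> \<le> M" "\<And>x. 0 \<le> x \<Longrightarrow> x \<le> X \<Longrightarrow> \<bar>\<psi>1 x\<bar> \<le> M"
    "\<And>x. \<bar>\<theta> x\<bar> \<le> M"
proof -
  define f where "f x = \<bar>\<phi> x\<bar> + \<bar>\<phi>1 x\<bar> + \<bar>\<psi> x\<bar> + \<bar>\<psi>1 x\<bar>" for x
  have "continuous_on UNIV f" unfolding f_def
    by (intro continuous_intros \<phi>_cont \<psi>_cont \<phi>1_cont \<psi>1_cont)
  hence "compact (f ` {0..X})" by (intro compact_continuous_image) (auto intro: continuous_on_subset)
  then obtain C where C: "\<forall>y\<in>f ` {0..X}. norm y \<le> C" by (auto dest!: compact_imp_bounded simp: bounded_iff)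
  obtain D where D: "\<forall>x. norm (\<theta> x) \<le> D" using periodic_continuous_bounded[OF X \<theta>_per \<theta>_cont] by blast
  define B where "B = max 1 (max C D)"
  have B: "1 \<le> B" "C \<le> B" "D \<le> B" by (auto simp: B_def)
  have sum: "\<bar>\<phi> x\<bar> + \<bar>\<phi>1 x\<bar> + \<bar>\<psi> x\<bar> + \<bar>\<psi>1 x\<bar> \<le> B" if "0 \<le> x" "x \<le> X" for x
  proof -
    have "\<bar>f x\<bar> \<le> C" using bspec[OF C, of "f x"] that by simp
    thus ?thesis using B(2) unfolding f_def by linarith
  qed
  have "\<bar>\<theta> x\<bar> \<le> B" for x using D B(3) by (metis order_trans real_norm_def)
  moreover have "\<bar>\<phi> x\<bar> \<le> B" "\<bar>\<phi>1 x\<bar> \<le> B" "\<bar>\<psi> x\<bar> \<le> B" "\<bar>\<psi>1 x\<bar> \<le> B" if "0 \<le> x" "x \<le> X" for x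
    using sum[OF that] by linarith+
  ultimately show ?thesis using B(1) by (intro that)
qed

lemma \<phi>1_0: "\<phi>1 0 \<noteq> 0"
  using wronskian[of 0] \<phi>0 by auto

lemma \<kappa>_0: "\<kappa> 0 \<noteq> 0"
  using wronskian[of 0] by auto

text \<open>Variation of constants: the coefficients of a weak almost-solution \<open>v\<close> in the basis
  \<open>\<phi>, \<psi>\<close> are Wronskians, which are nearly constant; nearly periodic solutions have
  nearly no component along the non-periodic solution \<open>\<psi>\<close>.\<close>

theorem approximate_kernel:
  obtains K where "0 < K"
    "\<And>\<epsilon> v g. \<lbrakk>0 \<le> \<epsilon>; v \<in> l2per X; g \<in> l2per X; sobolev_deriv v g;
       \<And>w w1. \<lbrakk>w \<in> l2per X; w1 \<in> l2per X; sobolev_deriv w w1\<rbrakk> \<Longrightarrow>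
         \<bar>mean_int X (\<lambda>x. \<kappa> x * g x * w1 x + \<theta> x * v x * w x)\<bar> \<le> \<epsilon> * (l2norm X w + l2norm X w1)\<rbrakk>
     \<Longrightarrow> \<exists>a. l2norm X (\<lambda>x. v x - a * \<phi> x) \<le> K * \<epsilon> \<and> l2norm X (\<lambda>x. g x - a * \<phi>1 x) \<le> K * \<epsilon>"
proof -
  obtain M where M: "1 \<le> M"
    "\<And>x. 0 \<le> x \<Longrightarrow> x \<le> X \<Longrightarrow> \<bar>\<phi> x\<bar> \<le> M" "\<And>x. 0 \<le> x \<Longrightarrow> x \<le> X \<Longrightarrow> \<bar>\<phi>1 x\<bar> \<le> M"
    "\<And>x. 0 \<le> x \<Longrightarrow> x \<le> X \<Longrightarrow> \<bar>\<psi> x\<bar> \<le> M" "\<And>x. 0 \<le> x \<Longrightarrow> x \<le> X \<Longrightarrow> \<bar>\<psi>1 x\<bar> \<le> M"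
    "\<And>x. \<bar>\<theta> x\<bar> \<le> M"
    by (rule common_bound) blast
  define c1 where "c1 = 2 * M * (X + 1)"
  have c1: "0 < c1" using M(1) X by (simp add: c1_def)
  define q where "q = \<bar>\<kappa> 0 * m * \<phi>1 0\<bar>"
  have q: "0 < q" using m \<phi>1_0 \<kappa>_0 by (simp add: q_def)
  define c2 where "c2 = (sqrt X + sqrt X * (M * (2 * M * c1))) / q"
  have c2: "0 \<le> c2" using M(1) X q c1 by (simp add: c2_def)
  define K where "K = 2 * M * c1 + c2 * (M * sqrt X)"
  have K: "0 < K" unfolding K_def using M(1) X c1 c2 by (intro add_pos_nonneg mult_pos_pos mult_nonneg_nonneg) auto
  show ?thesis
  proof (rule that[OF K])
    fix \<epsilon> v g
    assume \<epsilon>: "0 \<le> \<epsilon>" and v: "v \<in> l2per X" and g: "g \<in> l2per X" and sd: "sobolev_deriv v g"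
      and test: "\<And>w w1. \<lbrakk>w \<in> l2per X; w1 \<in> l2per X; sobolev_deriv w w1\<rbrakk> \<Longrightarrow>
         \<bar>mean_int X (\<lambda>x. \<kappa> x * g x * w1 x + \<theta> x * v x * w x)\<bar> \<le> \<epsilon> * (l2norm X w + l2norm X w1)"
    define F where "F c x = c (frac_part X x)" for c :: "real \<Rightarrow> real" and x
    have Fper: "periodic X (F c)" for c using frac_part(3)[OF X] by (simp add: periodic_def F_def)
    have Fm: "F c \<in> borel_measurable lebesgue" if "continuous_on UNIV c" for c
      unfolding F_def by (rule frac_part_borel_measurable[OF that])
    have fp: "0 \<le> frac_part X x" "frac_part X x \<le> X" for x using frac_part[OF X, of x] by auto
    have FM: "\<bar>F \<phi> x\<bar> \<le> M" "\<bar>F \<phi>1 x\<bar> \<le> M" "\<bar>F \<psi> x\<bar> \<le> M" "\<bar>F \<psi>1 x\<bar> \<le> M" for x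
      using M(2-5) fp by (auto simp: F_def)
    have Fid: "F c x = c x" if "0 \<le> x" "x < X" for c x using frac_part(4)[OF X that] by (simp add: F_def)
    define W where "W \<rho> \<rho>1 x = \<kappa> x * (F \<rho> x * g x - F \<rho>1 x * v x)" for \<rho> \<rho>1 x
    have Wl: "W \<rho> \<rho>1 \<in> l2per X" if c: "continuous_on UNIV \<rho>" "continuous_on UNIV \<rho>1"
      and b: "\<And>x. 0 \<le> x \<Longrightarrow> x \<le> X \<Longrightarrow> \<bar>\<rho> x\<bar> \<le> M" "\<And>x. 0 \<le> x \<Longrightarrow> x \<le> X \<Longrightarrow> \<bar>\<rho>1 x\<bar> \<le> M" for \<rho> \<rho>1
    proof -
      have b': "\<bar>F \<rho> x\<bar> \<le> M" "\<bar>F \<rho>1 x\<bar> \<le> M" for x using b fp by (auto simp: F_def)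
      have "(\<lambda>x. \<kappa> x *\<^sub>R (F \<rho> x * g x - F \<rho>1 x * v x)) \<in> l2per X"
        by (intro l2per_continuous_mult[OF X \<kappa>_per \<kappa>_cont] l2per_diff(1)
            l2per_bounded_mult(1)[OF Fper Fm[OF c(1)] b'(1) g] l2per_bounded_mult(1)[OF Fper Fm[OF c(2)] b'(2) v])
      thus ?thesis by (simp add: W_def[abs_def])
    qed
    have W_bound: "\<bar>mean_int X (\<lambda>x. W \<rho> \<rho>1 x * \<eta> x)\<bar> \<le> (c1 * \<epsilon>) * l2norm X \<eta>"
      if d0: "\<And>x. (\<rho> has_real_derivative \<rho>1 x) (at x)" and cc: "continuous_on UNIV \<rho>1"
        and d1: "\<And>x. ((\<lambda>x. \<kappa> x * \<rho>1 x) has_real_derivative \<theta> x * \<rho> x) (at x)"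
        and b: "\<And>x. 0 \<le> x \<Longrightarrow> x \<le> X \<Longrightarrow> \<bar>\<rho> x\<bar> \<le> M" "\<And>x. 0 \<le> x \<Longrightarrow> x \<le> X \<Longrightarrow> \<bar>\<rho>1 x\<bar> \<le> M"
        and \<eta>: "\<eta> \<in> l2per X" "mean_int X \<eta> = 0" for \<rho> \<rho>1 \<eta>
    proof -
      obtain w w1 where w: "w \<in> l2per X" "w1 \<in> l2per X" "sobolev_deriv w w1"
        "l2norm X w + l2norm X w1 \<le> 2 * M * (X + 1) * l2norm X \<eta>"
        "mean_int X (\<lambda>x. \<kappa> x * g x * w1 x + \<theta> x * v x * w x) = mean_int X (\<lambda>x. \<kappa> x * (\<rho> x * g x - \<rho>1 x * v x) * \<eta> x)"
        using wronskian_test[OF X \<kappa>_cont \<theta>_cont d0 cc d1 b g sd \<eta>] by blast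
      have "mean_int X (\<lambda>x. W \<rho> \<rho>1 x * \<eta> x) = mean_int X (\<lambda>x. \<kappa> x * (\<rho> x * g x - \<rho>1 x * v x) * \<eta> x)"
        by (rule mean_int_cong_halfopen) (simp add: W_def Fid)
      hence "\<bar>mean_int X (\<lambda>x. W \<rho> \<rho>1 x * \<eta> x)\<bar> \<le> \<epsilon> * (l2norm X w + l2norm X w1)"
        using test[OF w(1-3)] w(5) by simp
      also have "\<dots> \<le> \<epsilon> * (c1 * l2norm X \<eta>)"
        using w(4) \<epsilon> unfolding c1_def by (rule mult_left_mono)
      finally show ?thesis by (simp add: mult.assoc mult.left_commute)
    qed
    have c\<epsilon>: "0 \<le> c1 * \<epsilon>" using c1 \<epsilon> by simp
    obtain b where b: "(\<lambda>x. W \<phi> \<phi>1 x - b) \<in> l2per X" "l2norm X (\<lambda>x. W \<phi> \<phi>1 x - b) \<le> c1 * \<epsilon>"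
      by (rule mean_free_dual_bound[OF X Wl[OF \<phi>_cont \<phi>1_cont M(2,3)] c\<epsilon> W_bound[OF \<phi>_d0 \<phi>1_cont \<phi>_d1 M(2,3)]]) blast
    obtain a where a: "(\<lambda>x. W \<psi> \<psi>1 x - a) \<in> l2per X" "l2norm X (\<lambda>x. W \<psi> \<psi>1 x - a) \<le> c1 * \<epsilon>"
      by (rule mean_free_dual_bound[OF X Wl[OF \<psi>_cont \<psi>1_cont M(4,5)] c\<epsilon> W_bound[OF \<psi>_d0 \<psi>1_cont \<psi>_d1 M(4,5)]]) blast
    have wr: "\<kappa> x * (F \<phi> x * F \<psi>1 x - F \<phi>1 x * F \<psi> x) = 1" for x
      using wronskian[of "frac_part X x"] periodic_frac_part[OF X \<kappa>_per] by (simp add: F_def)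
    have veq: "W \<phi> \<phi>1 x * F \<psi> x - W \<psi> \<psi>1 x * F \<phi> x = v x" for x
    proof -
      have "W \<phi> \<phi>1 x * F \<psi> x - W \<psi> \<psi>1 x * F \<phi> x = (\<kappa> x * (F \<phi> x * F \<psi>1 x - F \<phi>1 x * F \<psi> x)) * v x"
        by (simp add: W_def algebra_simps)
      thus ?thesis by (simp add: wr)
    qed
    have geq: "W \<phi> \<phi>1 x * F \<psi>1 x - W \<psi> \<psi>1 x * F \<phi>1 x = g x" for x
    proof -
      have "W \<phi> \<phi>1 x * F \<psi>1 x - W \<psi> \<psi>1 x * F \<phi>1 x = (\<kappa> x * (F \<phi> x * F \<psi>1 x - F \<phi>1 x * F \<psi> x)) * g x"
        by (simp add: W_def algebra_simps)
      thus ?thesis by (simp add: wr)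
    qed
    have comb: "(\<lambda>x. F p x * (W \<phi> \<phi>1 x - b) - F r x * (W \<psi> \<psi>1 x - a)) \<in> l2per X"
        "l2norm X (\<lambda>x. F p x * (W \<phi> \<phi>1 x - b) - F r x * (W \<psi> \<psi>1 x - a)) \<le> 2 * M * c1 * \<epsilon>"
      if "continuous_on UNIV p" "continuous_on UNIV r" "\<And>x. \<bar>F p x\<bar> \<le> M" "\<And>x. \<bar>F r x\<bar> \<le> M" for p r
    proof -
      note 1 = l2per_bounded_mult[OF Fper Fm[OF that(1)] that(3) b(1)]
      note 2 = l2per_bounded_mult[OF Fper Fm[OF that(2)] that(4) a(1)]
      show "(\<lambda>x. F p x * (W \<phi> \<phi>1 x - b) - F r x * (W \<psi> \<psi>1 x - a)) \<in> l2per X"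
        by (rule l2per_diff(1)[OF 1(1) 2(1)])
      have "M * l2norm X (\<lambda>x. W \<phi> \<phi>1 x - b) \<le> M * (c1 * \<epsilon>)" "M * l2norm X (\<lambda>x. W \<psi> \<psi>1 x - a) \<le> M * (c1 * \<epsilon>)"
        using a(2) b(2) M(1) by (auto intro!: mult_left_mono)
      thus "l2norm X (\<lambda>x. F p x * (W \<phi> \<phi>1 x - b) - F r x * (W \<psi> \<psi>1 x - a)) \<le> 2 * M * c1 * \<epsilon>"
        using l2per_diff(2)[OF 1(1) 2(1)] 1(2) 2(2) by linarith
    qed
    note c0 = comb[OF \<psi>_cont \<phi>_cont FM(3,1)] and cg = comb[OF \<psi>1_cont \<phi>1_cont FM(4,2)]
    have e0: "F \<psi> x * (W \<phi> \<phi>1 x - b) - F \<phi> x * (W \<psi> \<psi>1 x - a) = v x - b * F \<psi> x + a * F \<phi> x" for x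
      using veq[of x] by (simp add: algebra_simps)
    have e1: "F \<psi>1 x * (W \<phi> \<phi>1 x - b) - F \<phi>1 x * (W \<psi> \<psi>1 x - a) = g x - b * F \<psi>1 x + a * F \<phi>1 x" for x
      using geq[of x] by (simp add: algebra_simps)
    have n0: "(\<lambda>x. v x - b * F \<psi> x + a * F \<phi> x) \<in> l2per X" "l2norm X (\<lambda>x. v x - b * F \<psi> x + a * F \<phi> x) \<le> 2 * M * c1 * \<epsilon>"
      using c0 by (simp_all add: e0)
    have n1: "(\<lambda>x. g x - b * F \<psi>1 x + a * F \<phi>1 x) \<in> l2per X" "l2norm X (\<lambda>x. g x - b * F \<psi>1 x + a * F \<phi>1 x) \<le> 2 * M * c1 * \<epsilon>"
      using cg by (simp_all add: e1)
    have P: "F \<psi> \<in> l2per X" "l2norm X (F \<psi>) \<le> M * sqrt X" and P1: "F \<psi>1 \<in> l2per X" "l2norm X (F \<psi>1) \<le> M * sqrt X"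
      using l2per_bounded[OF X Fper Fm[OF \<psi>_cont] FM(3)] l2per_bounded[OF X Fper Fm[OF \<psi>1_cont] FM(4)] by auto
    have int\<theta>: "mean_int X (\<lambda>x. \<theta> x * \<rho> x) = \<kappa> X * \<rho>1 X - \<kappa> 0 * \<rho>1 0" "per_integrable X (\<lambda>x. \<theta> x * \<rho> x)"
      if "\<And>x. ((\<lambda>x. \<kappa> x * \<rho>1 x) has_real_derivative \<theta> x * \<rho> x) (at x)" "continuous_on UNIV \<rho>" for \<rho> \<rho>1
    proof -
      have "sobolev_deriv (\<lambda>x. \<kappa> x * \<rho>1 x) (\<lambda>x. \<theta> x * \<rho> x)"
        by (rule sobolev_derivI[OF that(1)]) (intro continuous_intros \<theta>_cont that)
      from sobolev_deriv_diff[OF this, of 0 X] sobolev_deriv_set_integrable[OF this]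
      show "mean_int X (\<lambda>x. \<theta> x * \<rho> x) = \<kappa> X * \<rho>1 X - \<kappa> 0 * \<rho>1 0" "per_integrable X (\<lambda>x. \<theta> x * \<rho> x)"
        using X by simp_all
    qed
    have \<kappa>X: "\<kappa> X = \<kappa> 0" "\<phi>1 X = \<phi>1 0" using \<kappa>_per \<phi>1_per unfolding periodic_def by (metis add_0)+
    have z: "(\<lambda>x. 0::real) \<in> l2per X" by (rule l2per_zero)
    have "(\<lambda>x. 1::real) \<in> l2per X" by (intro l2per_continuous) (auto simp: periodic_def)
    moreover have "sobolev_deriv (\<lambda>x. 1) (\<lambda>x. 0)" by (rule sobolev_derivI) auto
    moreover have "l2norm X (\<lambda>x. 1::real) = sqrt X" "l2norm X (\<lambda>x. 0::real) = 0"
      using X by (simp_all add: l2norm_def set_integral_const)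
    ultimately have t1: "\<bar>mean_int X (\<lambda>x. \<theta> x * v x)\<bar> \<le> \<epsilon> * sqrt X"
      using test[of "\<lambda>x. 1" "\<lambda>x. 0"] z by simp
    have th: "\<theta> \<in> borel_measurable lebesgue" by (rule borel_measurable_lebesgue_continuous[OF \<theta>_cont])
    note r = l2per_bounded_mult[OF \<theta>_per th M(6) n0(1)]
    have "mean_int X (\<lambda>x. \<theta> x * v x) = mean_int X (\<lambda>x. (\<theta> x * (v x - b * F \<psi> x + a * F \<phi> x) + b * (\<theta> x * \<psi> x)) - a * (\<theta> x * \<phi> x))"
      by (rule mean_int_cong_halfopen) (simp add: Fid algebra_simps)
    also have "\<dots> = (mean_int X (\<lambda>x. \<theta> x * (v x - b * F \<psi> x + a * F \<phi> x)) + b * mean_int X (\<lambda>x. \<theta> x * \<psi> x)) - a * mean_int X (\<lambda>x. \<theta> x * \<phi> x)"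
      using l2per_integrable[OF r(1)] int\<theta>(2)[OF \<psi>_d1 \<psi>_cont] int\<theta>(2)[OF \<phi>_d1 \<phi>_cont]
      by (subst set_integral_diff(2) set_integral_add(2))+ (auto intro!: set_integral_add(1))
    also have "mean_int X (\<lambda>x. \<theta> x * \<phi> x) = 0" by (simp add: int\<theta>(1)[OF \<phi>_d1 \<phi>_cont] \<kappa>X)
    also have "mean_int X (\<lambda>x. \<theta> x * \<psi> x) = \<kappa> 0 * (\<psi>1 X - \<psi>1 0)"
      by (simp only: int\<theta>(1)[OF \<psi>_d1 \<psi>_cont] \<kappa>X right_diff_distrib)
    also have "\<kappa> 0 * (\<psi>1 X - \<psi>1 0) = - (\<kappa> 0 * m * \<phi>1 0)" by (simp add: \<psi>1_shift)
    finally have "b * (\<kappa> 0 * m * \<phi>1 0) = mean_int X (\<lambda>x. \<theta> x * (v x - b * F \<psi> x + a * F \<phi> x)) - mean_int X (\<lambda>x. \<theta> x * v x)"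
      by simp
    moreover have "\<bar>mean_int X (\<lambda>x. \<theta> x * (v x - b * F \<psi> x + a * F \<phi> x))\<bar> \<le> sqrt X * (M * (2 * M * c1 * \<epsilon>))"
    proof -
      have "\<bar>mean_int X (\<lambda>x. \<theta> x * (v x - b * F \<psi> x + a * F \<phi> x))\<bar> \<le> sqrt X * l2norm X (\<lambda>x. \<theta> x * (v x - b * F \<psi> x + a * F \<phi> x))"
        by (rule l2per_mean_bound[OF X r(1)])
      also have "\<dots> \<le> sqrt X * (M * l2norm X (\<lambda>x. v x - b * F \<psi> x + a * F \<phi> x))"
        using r(2) X by (intro mult_left_mono) auto
      also have "\<dots> \<le> sqrt X * (M * (2 * M * c1 * \<epsilon>))"
        using n0(2) M(1) X by (intro mult_left_mono) auto
      finally show ?thesis .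
    qed
    ultimately have "\<bar>b * (\<kappa> 0 * m * \<phi>1 0)\<bar> \<le> sqrt X * (M * (2 * M * c1 * \<epsilon>)) + \<epsilon> * sqrt X"
      using t1 by linarith
    hence "\<bar>b\<bar> * q \<le> (sqrt X + sqrt X * (M * (2 * M * c1))) * \<epsilon>"
      by (simp add: q_def abs_mult algebra_simps)
    hence bb: "\<bar>b\<bar> \<le> c2 * \<epsilon>" using q by (simp add: c2_def field_simps)
    have fin: "l2norm X (\<lambda>x. (f x - b * P x + a * Q x) + b * P x) \<le> K * \<epsilon>"
      if f: "(\<lambda>x. f x - b * P x + a * Q x) \<in> l2per X" "l2norm X (\<lambda>x. f x - b * P x + a * Q x) \<le> 2 * M * c1 * \<epsilon>"
        and P: "P \<in> l2per X" "l2norm X P \<le> M * sqrt X" for f P Q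
    proof -
      have "\<bar>b\<bar> * l2norm X P \<le> (c2 * \<epsilon>) * (M * sqrt X)"
        using bb P(2) by (intro mult_mono) (use c2 \<epsilon> in auto)
      thus ?thesis
        using l2per_add(2)[OF f(1) l2per_scaleR(1)[OF P(1), of b]] l2per_scaleR(2)[OF P(1), of b] f(2)
        by (simp add: K_def algebra_simps)
    qed
    have F\<phi>: "F \<phi> x = \<phi> x" "F \<phi>1 x = \<phi>1 x" for x
      using periodic_frac_part[OF X \<phi>_per] periodic_frac_part[OF X \<phi>1_per] by (auto simp: F_def)
    show "\<exists>a. l2norm X (\<lambda>x. v x - a * \<phi> x) \<le> K * \<epsilon> \<and> l2norm X (\<lambda>x. g x - a * \<phi>1 x) \<le> K * \<epsilon>"
      using fin[OF n0 P] fin[OF n1 P1] by (intro exI[of _ "-a"]) (simp add: F\<phi>)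
  qed
qed

end

section \<open>Jets and the Jacobi form\<close>

type_synonym 'n state = "(real ^ 'n) \<times> real"

text \<open>A jet is a pair \<open>(V, g)\<close> of square integrable periodic functions such that \<open>g\<close> is the weak derivative of the component
\<open>V $ iv\<close>. Jets form a copy of \<open>HH iv 1 X\<close> in which the quadratic form of the second variation has bounded
coefficients.\<close>

definition jets :: "'n::finite \<Rightarrow> real \<Rightarrow> (real \<Rightarrow> 'n state) set"
  where "jets iv X = {Z \<in> l2per X. sobolev_deriv (\<lambda>x. fst (Z x) $ iv) (\<lambda>x. snd (Z x))}"

lemma jetsD: "Z \<in> jets iv X \<Longrightarrow> Z \<in> l2per X" "Z \<in> jets iv X \<Longrightarrow> sobolev_deriv (\<lambda>x. fst (Z x) $ iv) (\<lambda>x. snd (Z x))"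
  by (auto simp: jets_def)

lemma jets_add: "Z \<in> jets iv X \<Longrightarrow> W \<in> jets iv X \<Longrightarrow> (\<lambda>x. Z x + W x) \<in> jets iv X"
  by (simp add: jets_def l2per_add sobolev_deriv_add)

lemma jets_scaleR: "Z \<in> jets iv X \<Longrightarrow> (\<lambda>x. c *\<^sub>R Z x) \<in> jets iv X"
  by (simp add: jets_def l2per_scaleR sobolev_deriv_cmult)

lemma jets_diff: "Z \<in> jets iv X \<Longrightarrow> W \<in> jets iv X \<Longrightarrow> (\<lambda>x. Z x - W x) \<in> jets iv X"
  using jets_add[of Z iv X "\<lambda>x. (-1) *\<^sub>R W x"] jets_scaleR[of W iv X "-1"] by simp

lemma jets_zero: "(\<lambda>x. 0) \<in> jets iv X"
  by (auto simp: jets_def l2per_zero intro!: sobolev_derivI)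

lemma jets_sum: "finite I \<Longrightarrow> (\<And>i. i \<in> I \<Longrightarrow> f i \<in> jets iv X) \<Longrightarrow> (\<lambda>x. \<Sum>i\<in>I. f i x) \<in> jets iv X"
  by (induction I rule: finite_induct) (auto intro!: jets_zero jets_add)

lemma jets_shift: "0 < X \<Longrightarrow> Z \<in> jets iv X \<Longrightarrow> (\<lambda>x. Z (x + s)) \<in> jets iv X"
  using l2per_shift(1) sobolev_deriv_shift unfolding jets_def by blast

lemma l2per_fst:
  fixes Z :: "real \<Rightarrow> (real ^ 'n::finite) \<times> real"
  assumes "Z \<in> l2per X"
  shows "(\<lambda>x. fst (Z x)) \<in> l2per X" "l2norm X (\<lambda>x. fst (Z x)) \<le> l2norm X Z"
proof -
  have "norm (fst y) \<le> norm y" for y :: "'n state" using norm_fst_le[of "fst y" "snd y"] by simp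
  thus "(\<lambda>x. fst (Z x)) \<in> l2per X" "l2norm X (\<lambda>x. fst (Z x)) \<le> l2norm X Z"
    using l2per_linear_image[OF assms, of fst] bounded_linear.linear[OF bounded_linear_fst] by blast+
qed

lemma l2per_snd:
  fixes Z :: "real \<Rightarrow> (real ^ 'n::finite) \<times> real"
  assumes "Z \<in> l2per X"
  shows "(\<lambda>x. snd (Z x)) \<in> l2per X" "l2norm X (\<lambda>x. snd (Z x)) \<le> l2norm X Z"
proof -
  have "norm (snd y) \<le> norm y" for y :: "'n state" using norm_snd_le[of "snd y" "fst y"] by simp
  thus "(\<lambda>x. snd (Z x)) \<in> l2per X" "l2norm X (\<lambda>x. snd (Z x)) \<le> l2norm X Z"
    using l2per_linear_image[OF assms, of snd] bounded_linear.linear[OF bounded_linear_snd] by blast+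
qed

lemma l2per_pair:
  fixes V :: "real \<Rightarrow> real ^ 'n::finite" and g :: "real \<Rightarrow> real"
  assumes V: "V \<in> l2per X" and g: "g \<in> l2per X"
  shows "(\<lambda>x. (V x, g x)) \<in> l2per X" "l2norm X (\<lambda>x. (V x, g x)) \<le> l2norm X V + l2norm X g"
proof -
  note [measurable] = l2perD(2)[OF V] l2perD(2)[OF g]
  have 1: "(\<lambda>x. (V x, 0::real)) \<in> l2per X"
    by (rule l2per_dominated(1)[OF V, where C=1]) (use l2perD(1)[OF V] in \<open>simp_all add: periodic_def\<close>)
  have 2: "(\<lambda>x. (0 :: real ^ 'n, g x)) \<in> l2per X"
    by (rule l2per_dominated(1)[OF g, where C=1]) (use l2perD(1)[OF g] in \<open>simp_all add: periodic_def\<close>)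
  show "(\<lambda>x. (V x, g x)) \<in> l2per X" using l2per_add(1)[OF 1 2] by simp
  show "l2norm X (\<lambda>x. (V x, g x)) \<le> l2norm X V + l2norm X g"
    using l2per_add(2)[OF 1 2] by (simp add: l2norm_def)
qed

lemma l2per_axis:
  fixes w :: "real \<Rightarrow> real"
  assumes w: "w \<in> l2per X"
  shows "(\<lambda>x. w x *\<^sub>R axis \<alpha> 1 :: real ^ 'n::finite) \<in> l2per X" "l2norm X (\<lambda>x. w x *\<^sub>R axis \<alpha> 1 :: real ^ 'n) \<le> l2norm X w"
proof -
  note [measurable] = l2perD(2)[OF w]
  have "(\<lambda>x. w x *\<^sub>R axis \<alpha> 1 :: real ^ 'n) \<in> l2per X" "l2norm X (\<lambda>x. w x *\<^sub>R axis \<alpha> 1 :: real ^ 'n) \<le> 1 * l2norm X w"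
    by (rule l2per_dominated[OF w, where C=1]; use l2perD(1)[OF w] in \<open>simp add: periodic_def\<close>)+
  thus "(\<lambda>x. w x *\<^sub>R axis \<alpha> 1 :: real ^ 'n) \<in> l2per X" "l2norm X (\<lambda>x. w x *\<^sub>R axis \<alpha> 1 :: real ^ 'n) \<le> l2norm X w" by simp_all
qed

lemma l2per_component:
  fixes V :: "real \<Rightarrow> real ^ 'n::finite"
  assumes "V \<in> l2per X"
  shows "(\<lambda>x. V x $ \<alpha>) \<in> l2per X" "l2norm X (\<lambda>x. V x $ \<alpha>) \<le> l2norm X V"
  using l2per_linear_image[OF assms, of "\<lambda>y. y $ \<alpha>"]
  by (auto simp: component_le_norm_cart bounded_linear.linear[OF bounded_linear_vec_nth])

lemma l2per_first_component:
  fixes Z :: "real \<Rightarrow> (real ^ 'n::finite) \<times> real"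
  assumes "Z \<in> l2per X"
  shows "(\<lambda>x. fst (Z x) $ \<alpha>) \<in> l2per X" "l2norm X (\<lambda>x. fst (Z x) $ \<alpha>) \<le> l2norm X Z"
  using l2per_component[OF l2per_fst(1)[OF assms], of \<alpha>] l2per_fst(2)[OF assms] by auto

text \<open>The integral of \<open>\<bar>g\<bar>\<close> bounds the oscillation of \<open>v\<close>, so that the mean of \<open>v\<close> controls its values.\<close>

lemma jets_sup_bound:
  fixes Z :: "real \<Rightarrow> (real ^ 'n::finite) \<times> real"
  assumes X: "0 < X" and Z: "Z \<in> jets iv X"
  shows "\<bar>fst (Z x) $ iv\<bar> \<le> (1 / sqrt X + 2 * sqrt X) * l2norm X Z"
proof -
  define v g where "v = (\<lambda>x. fst (Z x) $ iv)" and "g = (\<lambda>x. snd (Z x))"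
  have v: "v \<in> l2per X" "l2norm X v \<le> l2norm X Z" and g: "g \<in> l2per X" "l2norm X g \<le> l2norm X Z"
    using l2per_first_component[OF jetsD(1)[OF Z]] l2per_snd[OF jetsD(1)[OF Z]] by (auto simp: v_def g_def)
  have sd: "sobolev_deriv v g" using jetsD(2)[OF Z] by (simp add: v_def g_def)
  have "sobolev_deriv (\<lambda>x. v x - v 0) g" using sd by (simp add: sobolev_deriv_def)
  from primitive_bound[OF X g(1) this] have p: "\<bar>v x - v 0\<bar> \<le> sqrt X * l2norm X g" for x
    using l2perD(1)[OF v(1)] by (simp add: periodic_def)
  have cl: "(\<lambda>x. v 0) \<in> l2per X" by (intro l2per_continuous) (auto simp: periodic_def)
  have d: "(\<lambda>x. v x - v 0) \<in> l2per X" by (rule l2per_diff(1)[OF v(1) cl])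
  have "X * v 0 = mean_int X v - mean_int X (\<lambda>x. v x - v 0)"
    using X l2per_integrable[OF v(1)] l2per_integrable[OF cl] by (simp add: set_integral_diff set_integral_const)
  hence "\<bar>X * v 0\<bar> \<le> sqrt X * l2norm X v + sqrt X * l2norm X (\<lambda>x. v x - v 0)"
    using l2per_mean_bound[OF X v(1)] l2per_mean_bound[OF X d] by linarith
  also have "l2norm X (\<lambda>x. v x - v 0) \<le> (sqrt X * l2norm X g) * sqrt X"
    by (rule l2per_bounded(2)[OF X l2perD(1,2)[OF d] p])
  finally have "X * \<bar>v 0\<bar> \<le> sqrt X * l2norm X v + sqrt X * (sqrt X * l2norm X g * sqrt X)"
    using X by (simp add: abs_mult)
  also have "\<dots> = X * (l2norm X v / sqrt X + sqrt X * l2norm X g)"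
  proof -
    define r where "r = sqrt X"
    have r: "0 < r" "X = r * r" using X by (auto simp: r_def)
    show ?thesis unfolding r_def[symmetric] unfolding r(2) using r(1) by (simp add: field_simps)
  qed
  finally have "\<bar>v 0\<bar> \<le> l2norm X v / sqrt X + sqrt X * l2norm X g" using X by simp
  hence "\<bar>v x\<bar> \<le> (1 / sqrt X) * l2norm X v + 2 * sqrt X * l2norm X g" using p[of x] by (simp add: algebra_simps)
  also have "\<dots> \<le> (1 / sqrt X) * l2norm X Z + 2 * sqrt X * l2norm X Z"
    using v(2) g(2) X by (intro add_mono mult_left_mono) auto
  finally show ?thesis by (simp add: v_def algebra_simps)
qed

definition drop_comp :: "'n::finite \<Rightarrow> real ^ 'n \<Rightarrow> real ^ 'n"
  where "drop_comp iv y = y - (y $ iv) *\<^sub>R axis iv 1"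

lemma drop_comp_inner: "drop_comp iv y \<bullet> z = drop_comp iv y \<bullet> drop_comp iv z" "drop_comp iv y $ iv = 0"
  "drop_comp iv y \<bullet> z = y \<bullet> z - y $ iv * z $ iv"
  by (simp_all add: drop_comp_def inner_diff_left inner_diff_right inner_axis inner_axis' axis_def[of iv 1, THEN arg_cong[where f="\<lambda>v. v $ iv"]])

lemma drop_comp_linear: "drop_comp iv (y + z) = drop_comp iv y + drop_comp iv z"
  "drop_comp iv (c *\<^sub>R y) = c *\<^sub>R drop_comp iv y" "drop_comp iv (y - z) = drop_comp iv y - drop_comp iv z"
  by (simp_all add: drop_comp_def algebra_simps)

lemma norm_drop_comp_le: "norm (drop_comp iv y) \<le> norm y"
proof (rule power2_le_imp_le)
  have "(norm (drop_comp iv y))\<^sup>2 = drop_comp iv y \<bullet> y"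
    using drop_comp_inner(1)[of iv y y] by (simp add: power2_norm_eq_inner)
  also have "\<dots> = (norm y)\<^sup>2 - (y $ iv)\<^sup>2" by (simp add: drop_comp_inner(3) dot_square_norm power2_eq_square)
  finally show "(norm (drop_comp iv y))\<^sup>2 \<le> (norm y)\<^sup>2" by simp
qed simp

lemma linear_drop_comp: "linear (drop_comp iv)"
  by (rule linearI) (simp_all add: drop_comp_linear)

lemma continuous_on_drop_comp[continuous_intros]: "continuous_on S f \<Longrightarrow> continuous_on S (\<lambda>x. drop_comp iv (f x))"
  unfolding drop_comp_def by (intro continuous_intros)

text \<open>The components other than \<open>iv\<close> enter the second variation without derivatives. Eliminating them by completing the
square leaves a Sturm-Liouville operator for \<open>v\<close> with this potential.\<close>

definition reduced_potential :: "'n::finite \<Rightarrow> (real \<Rightarrow> real) \<Rightarrow> (real \<Rightarrow> real ^ 'n) \<Rightarrow> real \<Rightarrow> real"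
  where "reduced_potential iv \<tau> n x = \<tau> x + 2 * (n x $ iv) - (norm (drop_comp iv (n x)))\<^sup>2 / \<tau> x"

text \<open>The second variation of a Hamiltonian in normal form is
\<open>\<A> V = \<tau> V + v n + (n \<bullet> V) e - (\<kappa> v')' e\<close> with \<open>e\<close> the basis vector of \<open>v\<close>; \<open>bd\<close> is the density
of its quadratic form.\<close>

locale jacobi_form =
  fixes iv :: "'n::finite" and X :: real and \<kappa> \<tau> :: "real \<Rightarrow> real" and n :: "real \<Rightarrow> real ^ 'n"
  assumes X_pos: "0 < X" and coeff_cont: "continuous_on UNIV \<kappa>" "continuous_on UNIV \<tau>" "continuous_on UNIV n"
    and coeff_per: "periodic X \<kappa>" "periodic X \<tau>" "periodic X n"
    and \<tau>_pos: "\<And>x. 0 < \<tau> x"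
begin

definition bd :: "real \<Rightarrow> 'n state \<Rightarrow> 'n state \<Rightarrow> real"
  where "bd x z w = \<kappa> x * snd z * snd w + \<tau> x * (fst z \<bullet> fst w)
    + fst z $ iv * (n x \<bullet> fst w) + fst w $ iv * (n x \<bullet> fst z)"

definition b :: "(real \<Rightarrow> 'n state) \<Rightarrow> (real \<Rightarrow> 'n state) \<Rightarrow> real"
  where "b Z W = mean_int X (\<lambda>x. bd x (Z x) (W x))"

lemma \<tau>_nz: "\<tau> x \<noteq> 0"
  using \<tau>_pos[of x] by simp

lemma bd_commute: "bd x z w = bd x w z"
  by (simp add: bd_def inner_commute)

lemma b_commute: "b Z W = b W Z"
  by (simp add: b_def bd_commute)

lemma bd_add: "bd x (z + z') w = bd x z w + bd x z' w"
  by (simp add: bd_def inner_add_left inner_add_right algebra_simps)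

lemma bd_scaleR: "bd x (c *\<^sub>R z) w = c * bd x z w"
  by (simp add: bd_def algebra_simps)

lemma bd_measurable:
  assumes "Z \<in> l2per X" "W \<in> l2per X"
  shows "(\<lambda>x. bd x (Z x) (W x)) \<in> borel_measurable lebesgue"
proof -
  note [measurable] = borel_measurable_lebesgue_continuous[OF coeff_cont(1)] borel_measurable_lebesgue_continuous[OF coeff_cont(2)]
    borel_measurable_lebesgue_continuous[OF coeff_cont(3)]
    l2perD(2)[OF l2per_fst(1)[OF assms(1)]] l2perD(2)[OF l2per_fst(1)[OF assms(2)]]
    l2perD(2)[OF l2per_snd(1)[OF assms(1)]] l2perD(2)[OF l2per_snd(1)[OF assms(2)]]
    l2perD(2)[OF l2per_first_component(1)[OF assms(1)]] l2perD(2)[OF l2per_first_component(1)[OF assms(2)]]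
  show ?thesis unfolding bd_def by measurable
qed

lemma b_bound:
  obtains C where "0 < C" "\<And>Z W. Z \<in> l2per X \<Longrightarrow> W \<in> l2per X \<Longrightarrow> \<bar>b Z W\<bar> \<le> C * (l2norm X Z * l2norm X W)"
    "\<And>Z W. Z \<in> l2per X \<Longrightarrow> W \<in> l2per X \<Longrightarrow> per_integrable X (\<lambda>x. bd x (Z x) (W x))"
proof -
  obtain K where K: "0 < K" "\<And>x. norm (\<kappa> x) \<le> K" using periodic_continuous_bounded[OF X_pos coeff_per(1) coeff_cont(1)] by blast
  obtain T where T: "0 < T" "\<And>x. norm (\<tau> x) \<le> T" using periodic_continuous_bounded[OF X_pos coeff_per(2) coeff_cont(2)] by blast
  obtain N where N: "0 < N" "\<And>x. norm (n x) \<le> N" using periodic_continuous_bounded[OF X_pos coeff_per(3) coeff_cont(3)] by blast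
  have le: "\<bar>bd x z w\<bar> \<le> (K + T + 2 * N) * (norm z * norm w)" for x z w
  proof -
    have f: "norm (fst z) \<le> norm z" "norm (fst w) \<le> norm w" "\<bar>snd z\<bar> \<le> norm z" "\<bar>snd w\<bar> \<le> norm w"
      "\<bar>fst z $ iv\<bar> \<le> norm z" "\<bar>fst w $ iv\<bar> \<le> norm w"
      using norm_fst_le[of "fst z" "snd z"] norm_fst_le[of "fst w" "snd w"] norm_snd_le[of "snd z" "fst z"] norm_snd_le[of "snd w" "fst w"]
        component_le_norm_cart[of "fst z" iv] component_le_norm_cart[of "fst w" iv] by auto
    have "\<bar>\<kappa> x * snd z * snd w\<bar> \<le> K * (norm z * norm w)"
      using K f by (simp add: abs_mult mult.assoc) (intro mult_mono; simp)
    moreover have "\<bar>\<tau> x * (fst z \<bullet> fst w)\<bar> \<le> T * (norm z * norm w)"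
    proof -
      have "\<bar>fst z \<bullet> fst w\<bar> \<le> norm z * norm w"
        by (rule order_trans[OF Cauchy_Schwarz_ineq2]) (intro mult_mono; use f in simp)
      thus ?thesis using T by (simp add: abs_mult) (intro mult_mono; simp)
    qed
    moreover have nn: "\<bar>p $ iv * (n x \<bullet> r)\<bar> \<le> N * (a * c)" if "\<bar>p $ iv\<bar> \<le> a" "norm r \<le> c" for p r a c
    proof -
      have "\<bar>n x \<bullet> r\<bar> \<le> N * c"
        by (rule order_trans[OF Cauchy_Schwarz_ineq2]) (intro mult_mono; use N that in \<open>simp add: less_imp_le\<close>)
      hence "\<bar>p $ iv\<bar> * \<bar>n x \<bullet> r\<bar> \<le> a * (N * c)" using that by (intro mult_mono) auto
      thus ?thesis by (simp add: abs_mult mult.left_commute)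
    qed
    ultimately have "\<bar>\<kappa> x * snd z * snd w\<bar> \<le> K * (norm z * norm w)" "\<bar>\<tau> x * (fst z \<bullet> fst w)\<bar> \<le> T * (norm z * norm w)"
      "\<bar>fst z $ iv * (n x \<bullet> fst w)\<bar> \<le> N * (norm z * norm w)" "\<bar>fst w $ iv * (n x \<bullet> fst z)\<bar> \<le> N * (norm w * norm z)"
      using nn[OF f(5,2)] nn[OF f(6,1)] by auto
    thus ?thesis unfolding bd_def by (simp add: algebra_simps)
  qed
  show ?thesis
  proof (rule that[of "K + T + 2 * N"])
    show "0 < K + T + 2 * N" using K T N by simp
    fix Z W :: "real \<Rightarrow> 'n state" assume ZW: "Z \<in> l2per X" "W \<in> l2per X"
    show "\<bar>b Z W\<bar> \<le> (K + T + 2 * N) * (l2norm X Z * l2norm X W)" "per_integrable X (\<lambda>x. bd x (Z x) (W x))"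
      using l2_bilinear_bound[OF ZW bd_measurable[OF ZW], of "K + T + 2 * N"] le K T N by (auto simp: b_def)
  qed
qed

lemma b_integrable: "Z \<in> l2per X \<Longrightarrow> W \<in> l2per X \<Longrightarrow> per_integrable X (\<lambda>x. bd x (Z x) (W x))"
  using b_bound by metis

lemma b_add: "Z \<in> l2per X \<Longrightarrow> Z' \<in> l2per X \<Longrightarrow> W \<in> l2per X \<Longrightarrow> b (\<lambda>x. Z x + Z' x) W = b Z W + b Z' W"
  by (simp add: b_def bd_add set_integral_add b_integrable)

lemma b_scaleR: "b (\<lambda>x. c *\<^sub>R Z x) W = c * b Z W"
  by (simp add: b_def bd_scaleR)

lemma b_sum: "finite I \<Longrightarrow> (\<And>i. i \<in> I \<Longrightarrow> f i \<in> l2per X) \<Longrightarrow> W \<in> l2per X \<Longrightarrow>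
    b (\<lambda>x. \<Sum>i\<in>I. f i x) W = (\<Sum>i\<in>I. b (f i) W)"
proof (induction I rule: finite_induct)
  case empty
  show ?case by (simp add: b_def bd_def)
next
  case (insert i I)
  thus ?case using b_add[of "f i" "\<lambda>x. \<Sum>i\<in>I. f i x" W] l2per_sum[of I f X] by simp
qed

end

locale jacobi = jacobi_form iv X \<kappa> \<tau> n + sturm_liouville X m \<kappa> "reduced_potential iv \<tau> n" \<phi> \<phi>1 \<psi> \<psi>1
  for iv :: "'n::finite" and X \<kappa> \<tau> n m \<phi> \<phi>1 \<psi> \<psi>1
begin

definition \<Phi> :: "real \<Rightarrow> 'n state"
  where "\<Phi> x = (\<phi> x *\<^sub>R (axis iv 1 - (1 / \<tau> x) *\<^sub>R drop_comp iv (n x)), \<phi>1 x)"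

lemma \<Phi>_jets: "\<Phi> \<in> jets iv X"
proof -
  have "continuous_on UNIV \<Phi>" unfolding \<Phi>_def
    by (intro continuous_intros \<phi>_cont coeff_cont \<phi>1_cont) (simp_all add: \<tau>_nz)
  moreover have "periodic X \<Phi>" using coeff_per \<phi>_per \<phi>1_per by (simp add: \<Phi>_def periodic_def)
  ultimately have "\<Phi> \<in> l2per X" by (intro l2per_continuous)
  moreover have "fst (\<Phi> x) $ iv = \<phi> x" for x by (simp add: \<Phi>_def drop_comp_inner(2))
  ultimately show ?thesis using sobolev_derivI[OF \<phi>_d0 \<phi>1_cont] by (simp add: jets_def) (simp add: \<Phi>_def)
qed

text \<open>Testing with jets \<open>(r, 0)\<close> for which \<open>r $ iv = 0\<close> determines the components other than \<open>v\<close> up to the error \<open>\<epsilon>\<close>.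
Substituting them, \<open>v\<close> becomes an approximate solution of the reduced Sturm-Liouville equation.\<close>

theorem jet_approximate_kernel:
  obtains K where "0 < K"
    "\<And>\<epsilon> Z. \<lbrakk>0 \<le> \<epsilon>; Z \<in> jets iv X; \<And>W. W \<in> jets iv X \<Longrightarrow> \<bar>b Z W\<bar> \<le> \<epsilon> * l2norm X W\<rbrakk>
       \<Longrightarrow> \<exists>a. l2norm X (\<lambda>x. Z x - a *\<^sub>R \<Phi> x) \<le> K * \<epsilon>"
proof -
  obtain K0 where K0: "0 < K0"
    "\<And>\<epsilon> v g. \<lbrakk>0 \<le> \<epsilon>; v \<in> l2per X; g \<in> l2per X; sobolev_deriv v g;
       \<And>w w1. \<lbrakk>w \<in> l2per X; w1 \<in> l2per X; sobolev_deriv w w1\<rbrakk> \<Longrightarrow>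
         \<bar>mean_int X (\<lambda>x. \<kappa> x * g x * w1 x + reduced_potential iv \<tau> n x * v x * w x)\<bar> \<le> \<epsilon> * (l2norm X w + l2norm X w1)\<rbrakk>
     \<Longrightarrow> \<exists>a. l2norm X (\<lambda>x. v x - a * \<phi> x) \<le> K0 * \<epsilon> \<and> l2norm X (\<lambda>x. g x - a * \<phi>1 x) \<le> K0 * \<epsilon>"
    by (rule approximate_kernel) blast
  have it: "continuous_on UNIV (\<lambda>x. 1 / \<tau> x)" "periodic X (\<lambda>x. 1 / \<tau> x)"
    using coeff_per(2) by (auto simp: periodic_def \<tau>_nz intro!: continuous_intros coeff_cont)
  obtain T where T: "0 < T" "\<And>x. norm (1 / \<tau> x) \<le> T" using periodic_continuous_bounded[OF X_pos it(2,1)] by blast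
  obtain N where N: "0 < N" "\<And>x. norm (n x) \<le> N" using periodic_continuous_bounded[OF X_pos coeff_per(3) coeff_cont(3)] by blast
  define np where "np x = drop_comp iv (n x)" for x
  have npN: "norm (np x) \<le> N" for x unfolding np_def using norm_drop_comp_le N(2) order_trans by blast
  define C1 where "C1 = 1 + T * N"
  have C1: "1 \<le> C1" using T N by (simp add: C1_def)
  define K where "K = C1 * (K0 * C1) + T + K0 * C1"
  have K: "0 < K" unfolding K_def using K0 T C1 by (intro add_nonneg_pos mult_pos_pos add_nonneg_nonneg mult_nonneg_nonneg) auto
  show ?thesis
  proof (rule that[OF K])
    fix \<epsilon> Z assume \<epsilon>: "0 \<le> \<epsilon>" and Z: "Z \<in> jets iv X"
      and test: "\<And>W. W \<in> jets iv X \<Longrightarrow> \<bar>b Z W\<bar> \<le> \<epsilon> * l2norm X W"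
    define V v g where "V = (\<lambda>x. fst (Z x))" and "v = (\<lambda>x. fst (Z x) $ iv)" and "g = (\<lambda>x. snd (Z x))"
    have V: "V \<in> l2per X" and v: "v \<in> l2per X" and g: "g \<in> l2per X" and sd: "sobolev_deriv v g"
      using l2per_fst(1)[OF jetsD(1)[OF Z]] l2per_first_component(1)[OF jetsD(1)[OF Z], of iv] l2per_snd(1)[OF jetsD(1)[OF Z]] jetsD(2)[OF Z]
      by (auto simp: V_def v_def g_def)
    define r where "r x = drop_comp iv (\<tau> x *\<^sub>R V x + v x *\<^sub>R n x)" for x
    have vn: "(\<lambda>x. v x *\<^sub>R n x) \<in> l2per X"
    proof -
      note [measurable] = l2perD(2)[OF v] borel_measurable_lebesgue_continuous[OF coeff_cont(3)]
      have p: "periodic X (\<lambda>x. v x *\<^sub>R n x)" using l2perD(1)[OF v] coeff_per(3) by (simp add: periodic_def)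
      have le: "norm (v x *\<^sub>R n x) \<le> N * norm (v x)" for x
        using N(2)[of x] by (simp add: mult.commute[of N] mult_left_mono)
      show ?thesis by (rule l2per_dominated(1)[OF v p _ _ le]) (use N in auto)
    qed
    have rl: "r \<in> l2per X" unfolding r_def
      by (rule l2per_linear_image(1)[OF l2per_add(1)[OF l2per_continuous_mult[OF X_pos coeff_per(2) coeff_cont(2) V] vn]])
        (auto simp: linear_drop_comp norm_drop_comp_le)
    have r0: "r x $ iv = 0" for x by (simp add: r_def drop_comp_inner(2))
    have r1: "(\<lambda>x. (r x, 0::real)) \<in> l2per X" "l2norm X (\<lambda>x. (r x, 0::real)) = l2norm X r"
      using l2per_pair(1)[OF rl l2per_zero] by (simp_all add: l2norm_def)
    have rj: "(\<lambda>x. (r x, 0)) \<in> jets iv X"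
      using r1(1) by (auto simp: jets_def r0 intro!: sobolev_derivI)
    have "b Z (\<lambda>x. (r x, 0)) = mean_int X (\<lambda>x. (norm (r x))\<^sup>2)"
    proof -
      have "bd x (Z x) (r x, 0) = (norm (r x))\<^sup>2" for x
      proof -
        have "bd x (Z x) (r x, 0) = r x \<bullet> (\<tau> x *\<^sub>R V x + v x *\<^sub>R n x)"
          by (simp add: bd_def r0 V_def v_def inner_add_right inner_commute)
        also have "\<dots> = r x \<bullet> r x" unfolding r_def by (rule drop_comp_inner(1))
        finally show ?thesis by (simp add: power2_norm_eq_inner)
      qed
      thus ?thesis by (simp add: b_def)
    qed
    hence "(l2norm X r)\<^sup>2 \<le> \<epsilon> * l2norm X r" using test[OF rj] r1(2) by (simp add: l2norm_sq)
    hence rn: "l2norm X r \<le> \<epsilon>"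
      using \<epsilon> by (cases "l2norm X r = 0") (auto simp: power2_eq_square mult_le_cancel_right l2norm_nonneg dest: not_le_imp_less)
    have PV: "drop_comp iv (V x) = (1 / \<tau> x) *\<^sub>R (r x - v x *\<^sub>R np x)" for x
      using \<tau>_pos[of x] by (simp add: r_def drop_comp_linear np_def)
    have scalar: "\<bar>mean_int X (\<lambda>x. \<kappa> x * g x * w1 x + reduced_potential iv \<tau> n x * v x * w x)\<bar> \<le> (C1 * \<epsilon>) * (l2norm X w + l2norm X w1)"
      if w: "w \<in> l2per X" "w1 \<in> l2per X" "sobolev_deriv w w1" for w w1
    proof -
      note [measurable] = l2perD(2)[OF w(1)] l2perD(2)[OF w(2)] l2perD(2)[OF rl] borel_measurable_lebesgue_continuous[OF it(1)]
      have [measurable]: "np \<in> borel_measurable lebesgue" unfolding np_def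
        by (intro borel_measurable_lebesgue_continuous continuous_intros coeff_cont)
      define W where "W x = (w x *\<^sub>R axis iv 1 :: real ^ 'n, w1 x)" for x
      have W: "W \<in> l2per X" "l2norm X W \<le> l2norm X w + l2norm X w1"
        using l2per_pair[OF l2per_axis(1)[OF w(1), of iv] w(2)] l2per_axis(2)[OF w(1), of iv] by (auto simp: W_def[abs_def])
      have Wj: "W \<in> jets iv X" using W(1) w(3) by (simp add: jets_def W_def axis_def)
      define e where "e x = (1 / \<tau> x) * (np x \<bullet> r x) * w x" for x
      have em: "e \<in> borel_measurable lebesgue" unfolding e_def by measurable
      have ele: "\<bar>e x\<bar> \<le> (T * N) * (norm (r x) * norm (w x))" for x
      proof -
        have "\<bar>np x \<bullet> r x\<bar> \<le> N * norm (r x)"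
          by (rule order_trans[OF Cauchy_Schwarz_ineq2]) (intro mult_right_mono npN; simp)
        hence "\<bar>1 / \<tau> x\<bar> * \<bar>np x \<bullet> r x\<bar> \<le> T * (N * norm (r x))"
          using T by (intro mult_mono) auto
        hence "\<bar>1 / \<tau> x\<bar> * \<bar>np x \<bullet> r x\<bar> * \<bar>w x\<bar> \<le> T * (N * norm (r x)) * \<bar>w x\<bar>" by (rule mult_right_mono) simp
        thus ?thesis unfolding e_def by (simp only: abs_mult real_norm_def mult.assoc)
      qed
      have TN: "0 \<le> T * N" using T N by simp
      have ei: "per_integrable X e" "\<bar>mean_int X e\<bar> \<le> (T * N) * (l2norm X r * l2norm X w)"
        using l2_bilinear_bound[OF rl w(1) em TN ele] by auto
      have dens: "bd x (Z x) (W x) - e x = \<kappa> x * g x * w1 x + reduced_potential iv \<tau> n x * v x * w x" for x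
      proof -
        have "V x = drop_comp iv (V x) + v x *\<^sub>R axis iv 1" by (simp add: drop_comp_def V_def v_def)
        hence "n x \<bullet> V x = n x \<bullet> drop_comp iv (V x) + v x * n x $ iv"
          by (metis inner_add_right inner_axis inner_scaleR_right real_inner_1_right)
        also have "n x \<bullet> drop_comp iv (V x) = np x \<bullet> drop_comp iv (V x)"
          unfolding np_def using drop_comp_inner(1)[of iv "V x" "n x"] by (simp add: inner_commute)
        also have "\<dots> = (1 / \<tau> x) * (np x \<bullet> r x) - v x * ((norm (np x))\<^sup>2 / \<tau> x)"
          unfolding PV by (simp add: inner_diff_right power2_norm_eq_inner diff_divide_distrib)
        finally have nV: "n x \<bullet> V x = (1 / \<tau> x) * (np x \<bullet> r x) - v x * ((norm (np x))\<^sup>2 / \<tau> x) + v x * n x $ iv" .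
        have "bd x (Z x) (W x) = \<kappa> x * g x * w1 x + \<tau> x * (v x * w x) + v x * (w x * n x $ iv) + w x * (n x \<bullet> V x)"
          by (simp add: bd_def W_def V_def v_def g_def inner_axis axis_def[of iv 1, THEN arg_cong[where f="\<lambda>v. v $ iv"]])
        thus ?thesis unfolding nV e_def reduced_potential_def np_def[symmetric] by (simp add: algebra_simps)
      qed
      have "mean_int X (\<lambda>x. \<kappa> x * g x * w1 x + reduced_potential iv \<tau> n x * v x * w x) = b Z W - mean_int X e"
        unfolding dens[symmetric] b_def using b_integrable[OF jetsD(1)[OF Z] W(1)] ei(1) by (rule set_integral_diff(2))
      also have "\<bar>\<dots>\<bar> \<le> \<epsilon> * l2norm X W + (T * N) * (l2norm X r * l2norm X w)"
        using test[OF Wj] ei(2) by linarith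
      also have "\<dots> \<le> \<epsilon> * (l2norm X w + l2norm X w1) + (T * N) * (\<epsilon> * (l2norm X w + l2norm X w1))"
        using W(2) rn \<epsilon> T N by (intro add_mono mult_left_mono mult_mono) auto
      finally show ?thesis by (simp add: C1_def algebra_simps)
    qed
    have "0 \<le> C1 * \<epsilon>" using C1 \<epsilon> by simp
    from K0(2)[OF this v g sd scalar] obtain a where a:
      "l2norm X (\<lambda>x. v x - a * \<phi> x) \<le> K0 * (C1 * \<epsilon>)" "l2norm X (\<lambda>x. g x - a * \<phi>1 x) \<le> K0 * (C1 * \<epsilon>)" by blast
    have \<phi>l: "(\<lambda>x. a * \<phi> x) \<in> l2per X" "(\<lambda>x. a * \<phi>1 x) \<in> l2per X"
      using \<phi>_per \<phi>1_per by (auto simp: periodic_def intro!: l2per_continuous continuous_intros \<phi>_cont \<phi>1_cont)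
    have dv: "(\<lambda>x. v x - a * \<phi> x) \<in> l2per X" and dg: "(\<lambda>x. g x - a * \<phi>1 x) \<in> l2per X"
      using l2per_diff(1)[OF v \<phi>l(1)] l2per_diff(1)[OF g \<phi>l(2)] by auto
    define A where "A x = ((v x - a * \<phi> x) *\<^sub>R (axis iv 1 - (1 / \<tau> x) *\<^sub>R np x), 0::real)" for x
    define B where "B x = ((1 / \<tau> x) *\<^sub>R r x, 0::real)" for x
    define D where "D x = (0 :: real ^ 'n, g x - a * \<phi>1 x)" for x
    note [measurable] = l2perD(2)[OF dv] l2perD(2)[OF dg] l2perD(2)[OF rl] borel_measurable_lebesgue_continuous[OF it(1)]
    have [measurable]: "np \<in> borel_measurable lebesgue" unfolding np_def
      by (intro borel_measurable_lebesgue_continuous continuous_intros coeff_cont)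
    have Am: "A \<in> borel_measurable lebesgue" unfolding A_def by measurable
    have Bm: "B \<in> borel_measurable lebesgue" unfolding B_def by measurable
    have Dm: "D \<in> borel_measurable lebesgue" unfolding D_def by measurable
    have per: "periodic X A" "periodic X B" "periodic X D"
      using l2perD(1)[OF dv] l2perD(1)[OF dg] l2perD(1)[OF rl] coeff_per by (auto simp: periodic_def A_def B_def D_def np_def)
    have Ale: "norm (A x) \<le> C1 * norm (v x - a * \<phi> x)" for x
    proof -
      have "norm ((1 / \<tau> x) *\<^sub>R np x) \<le> T * N"
        using T npN[of x] by (simp only: norm_scaleR real_norm_def[symmetric]) (intro mult_mono; simp)
      hence "norm (axis iv 1 - (1 / \<tau> x) *\<^sub>R np x :: real ^ 'n) \<le> C1"
        using norm_triangle_ineq4[of "axis iv 1 :: real ^ 'n" "(1 / \<tau> x) *\<^sub>R np x"] by (simp add: C1_def)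
      thus ?thesis by (simp add: A_def mult.commute[of C1] mult_left_mono)
    qed
    have Ble: "norm (B x) \<le> T * norm (r x)" for x
      using T(2)[of x] by (simp add: B_def) (metis mult_right_mono norm_ge_zero divide_inverse mult.commute mult_1)
    have A: "A \<in> l2per X" "l2norm X A \<le> C1 * l2norm X (\<lambda>x. v x - a * \<phi> x)"
      using l2per_dominated[OF dv per(1) Am _ Ale] C1 by auto
    have B: "B \<in> l2per X" "l2norm X B \<le> T * l2norm X r"
      using l2per_dominated[OF rl per(2) Bm _ Ble] T by auto
    have D: "D \<in> l2per X" "l2norm X D \<le> 1 * l2norm X (\<lambda>x. g x - a * \<phi>1 x)"
      using l2per_dominated[OF dg per(3) Dm, of 1] by (auto simp: D_def)
    have "Z x - a *\<^sub>R \<Phi> x = (A x + B x) + D x" for x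
    proof -
      have "V x = drop_comp iv (V x) + v x *\<^sub>R axis iv 1" by (simp add: drop_comp_def V_def v_def)
      hence "V x = (1 / \<tau> x) *\<^sub>R (r x - v x *\<^sub>R np x) + v x *\<^sub>R axis iv 1" unfolding PV .
      hence "Z x = ((1 / \<tau> x) *\<^sub>R (r x - v x *\<^sub>R np x) + v x *\<^sub>R axis iv 1, g x)"
        by (simp add: V_def g_def prod_eq_iff)
      thus ?thesis by (simp add: \<Phi>_def A_def B_def D_def np_def algebra_simps)
    qed
    hence "l2norm X (\<lambda>x. Z x - a *\<^sub>R \<Phi> x) \<le> l2norm X A + l2norm X B + l2norm X D"
      using l2per_add(2)[OF l2per_add(1)[OF A(1) B(1)] D(1)] l2per_add(2)[OF A(1) B(1)] by simp
    also have "\<dots> \<le> C1 * (K0 * (C1 * \<epsilon>)) + T * \<epsilon> + K0 * (C1 * \<epsilon>)"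
    proof (intro add_mono)
      show "l2norm X A \<le> C1 * (K0 * (C1 * \<epsilon>))" using A(2) a(1) C1 by (meson mult_left_mono order_trans zero_le_one)
      show "l2norm X B \<le> T * \<epsilon>" using B(2) rn T by (meson mult_left_mono order_trans less_imp_le)
      show "l2norm X D \<le> K0 * (C1 * \<epsilon>)" using D(2) a(2) by simp
    qed
    also have "\<dots> = K * \<epsilon>" by (simp add: K_def algebra_simps)
    finally show "\<exists>a. l2norm X (\<lambda>x. Z x - a *\<^sub>R \<Phi> x) \<le> K * \<epsilon>" by blast
  qed
qed

end

section \<open>Negative directions\<close>

text \<open>Orthonormal bases of the eigenspaces with negative eigenvalues, united, since eigenspaces of a symmetric matrix are mutually
orthogonal.\<close>

lemma matrix_neg_signature_witness:
  fixes G :: "real ^ 'm ^ 'm::finite"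
  assumes sym: "transpose G = G"
  obtains S where "finite S" "independent S" "card S = matrix_neg_signature G"
    "\<And>z. z \<in> span S \<Longrightarrow> z \<noteq> 0 \<Longrightarrow> z \<bullet> (G *v z) < 0"
proof -
  define R where "R = {r. r < 0 \<and> (\<exists>z. z \<noteq> 0 \<and> G *v z = r *\<^sub>R z)}"
  define E where "E r = {z. G *v z = r *\<^sub>R z}" for r
  show ?thesis
  proof (cases "finite R")
    case False
    hence "matrix_neg_signature G = 0" by (simp add: matrix_neg_signature_def R_def)
    thus ?thesis by (intro that[of "{}"]) (auto simp: independent_empty)
  next
    case finR: True
    have subE: "subspace (E r)" for r
      by (auto simp: subspace_def E_def matrix_vector_right_distrib matrix_vector_mult_scaleR algebra_simps)
    have "\<exists>B. B \<subseteq> E r \<and> pairwise orthogonal B \<and> (\<forall>x\<in>B. norm x = 1) \<and> independent B \<and> card B = dim (E r)" for r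
      by (rule orthonormal_basis_subspace[OF subE[of r]]) blast
    then obtain B where B: "\<And>r. B r \<subseteq> E r" "\<And>r. pairwise orthogonal (B r)" "\<And>r x. x \<in> B r \<Longrightarrow> norm x = 1"
      "\<And>r. independent (B r)" "\<And>r. card (B r) = dim (E r)" by metis
    have finB: "finite (B r)" for r using B(4) by (rule independent_imp_finite)
    have cross: "x \<bullet> y = 0" if "x \<in> E r" "y \<in> E s" "r \<noteq> s" for x y r s
    proof -
      have "r * (x \<bullet> y) = (G *v x) \<bullet> y" using that by (simp add: E_def)
      also have "\<dots> = x \<bullet> (G *v y)" using sym by (metis dot_lmul_matrix vector_transpose_matrix)
      also have "\<dots> = s * (x \<bullet> y)" using that by (simp add: E_def)
      finally show ?thesis using that(3) by simp
    qed
    define S where "S = (\<Union>r\<in>R. B r)"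
    have finS: "finite S" using finR finB by (simp add: S_def)
    have disj: "B r \<inter> B s = {}" if "r \<noteq> s" for r s
    proof (rule ccontr)
      assume "B r \<inter> B s \<noteq> {}"
      then obtain x where x: "x \<in> B r" "x \<in> B s" by blast
      hence "x \<bullet> x = 0" using cross[of x r x s] B(1) that by blast
      thus False using B(3)[OF x(1)] by simp
    qed
    have orth: "x \<bullet> y = (if x = y then 1 else 0)" if "x \<in> S" "y \<in> S" for x y
    proof -
      obtain r s where rs: "x \<in> B r" "y \<in> B s" using \<open>x \<in> S\<close> \<open>y \<in> S\<close> unfolding S_def by blast
      have "x \<bullet> x = 1" using B(3)[OF rs(1)] by (simp add: dot_square_norm)
      moreover have "x \<bullet> y = 0" if "x \<noteq> y"
      proof (cases "r = s")
        case True
        thus ?thesis using B(2)[of r] rs that by (auto simp: pairwise_def orthogonal_def)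
      next
        case False
        thus ?thesis using cross[of x r y s] rs B(1) by blast
      qed
      ultimately show ?thesis by auto
    qed
    have ind: "independent S"
    proof (rule pairwise_orthogonal_independent)
      show "pairwise orthogonal S" by (simp add: pairwise_def orthogonal_def orth)
      show "0 \<notin> S" using orth[of 0 0] by auto
    qed
    have "card S = (\<Sum>r\<in>R. card (B r))"
      unfolding S_def using finR finB disj by (intro card_UN_disjoint) auto
    hence card: "card S = matrix_neg_signature G" by (simp add: B(5) matrix_neg_signature_def R_def E_def)
    have "z \<bullet> (G *v z) < 0" if z: "z \<in> span S" "z \<noteq> 0" for z
    proof -
      obtain c where c: "z = (\<Sum>s\<in>S. c s *\<^sub>R s)" using z(1) span_finite[OF finS] by auto
      have "\<forall>s\<in>S. \<exists>r. r < 0 \<and> G *v s = r *\<^sub>R s" using B(1) unfolding S_def R_def E_def by blast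
      then obtain e where e: "\<And>s. s \<in> S \<Longrightarrow> e s < 0" "\<And>s. s \<in> S \<Longrightarrow> G *v s = e s *\<^sub>R s" by metis
      have zl: "z \<bullet> y = (\<Sum>s\<in>S. (c s *\<^sub>R s) \<bullet> y)" for y
        by (subst c) (rule inner_sum_left)
      have "G *v z = (\<Sum>s\<in>S. c s *\<^sub>R (e s *\<^sub>R s))"
      proof -
        have "G *v z = (\<Sum>s\<in>S. G *v (c s *\<^sub>R s))"
          unfolding c by (rule linear_sum[OF matrix_vector_mul_linear])
        also have "\<dots> = (\<Sum>s\<in>S. c s *\<^sub>R (e s *\<^sub>R s))"
          by (rule sum.cong[OF refl]) (simp only: matrix_vector_mult_scaleR e(2))
        finally show ?thesis .
      qed
      hence "z \<bullet> (G *v z) = (\<Sum>s\<in>S. (c s *\<^sub>R s) \<bullet> (\<Sum>t\<in>S. c t *\<^sub>R (e t *\<^sub>R t)))"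
        by (simp only: zl)
      also have "\<dots> = (\<Sum>s\<in>S. \<Sum>t\<in>S. c s * (c t * e t) * (s \<bullet> t))"
        by (simp add: inner_sum_right sum_distrib_left ac_simps)
      also have "\<dots> = (\<Sum>s\<in>S. c s * (c s * e s))"
      proof (rule sum.cong[OF refl])
        fix s assume s: "s \<in> S"
        have "(\<Sum>t\<in>S. c s * (c t * e t) * (s \<bullet> t)) = (\<Sum>t\<in>S. if s = t then c s * (c t * e t) else 0)"
          by (rule sum.cong) (use s in \<open>auto simp: orth\<close>)
        thus "(\<Sum>t\<in>S. c s * (c t * e t) * (s \<bullet> t)) = c s * (c s * e s)" using s finS by simp
      qed
      also have "\<dots> < 0"
      proof -
        obtain s where s: "s \<in> S" "c s \<noteq> 0"
        proof (rule ccontr)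
          assume a: "\<not> thesis"
          have "z = 0" unfolding c using a that by (intro sum.neutral) auto
          thus False using z by simp
        qed
        have "0 < (\<Sum>s\<in>S. - (c s * (c s * e s)))"
        proof (rule sum_pos2[OF finS s(1)])
          show "0 < - (c s * (c s * e s))"
            using mult_pos_neg[of "c s * c s" "e s"] s e(1)[OF s(1)] by (simp add: mult.assoc) (metis not_real_square_gt_zero mult.assoc)
          show "0 \<le> - (c t * (c t * e t))" if "t \<in> S" for t
            using mult_nonneg_nonpos[of "c t * c t" "e t"] e(1)[OF that] by (simp add: mult.assoc)
        qed
        thus ?thesis by (simp add: sum_negf)
      qed
      finally show ?thesis .
    qed
    thus ?thesis using that[OF finS ind card] by blast
  qed
qed

text \<open>A negative vector orthogonal to all \<open>p i\<close> would extend the negative subspace that \<open>G\<close> provides in their span by one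
dimension, exceeding the signature. Negative definiteness on coefficient vectors makes the map from these to \<open>D\<close>
injective.\<close>

lemma nonneg_on_orthogonal_complement:
  fixes D :: "'a::real_vector set" and p :: "'i::finite \<Rightarrow> 'a" and G :: "real ^ 'i ^ 'i"
  assumes D: "subspace D" and p: "\<And>i. p i \<in> D"
    and qB: "\<And>V. V \<in> D \<Longrightarrow> q V = B V V"
    and add: "\<And>U V W. U \<in> D \<Longrightarrow> V \<in> D \<Longrightarrow> W \<in> D \<Longrightarrow> B (U + V) W = B U W + B V W"
    and scale: "\<And>c U W. U \<in> D \<Longrightarrow> W \<in> D \<Longrightarrow> B (c *\<^sub>R U) W = c * B U W"
    and comm: "\<And>U V. U \<in> D \<Longrightarrow> V \<in> D \<Longrightarrow> B U V = B V U"
    and G: "\<And>i j. B (p i) (p j) = G $ i $ j"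
    and sig: "neg_signature D q = enat (matrix_neg_signature G)"
    and V: "V \<in> D" and orth: "\<And>i. B (p i) V = 0"
  shows "0 \<le> q V"
proof (rule ccontr)
  assume "\<not> 0 \<le> q V"
  hence neg: "B V V < 0" using qB[OF V] by simp
  have "transpose G = G" unfolding transpose_def vec_eq_iff using G comm p by (metis vec_lambda_beta)
  then obtain S where S: "finite S" "independent S" "card S = matrix_neg_signature G"
    "\<And>z. z \<in> span S \<Longrightarrow> z \<noteq> 0 \<Longrightarrow> z \<bullet> (G *v z) < 0"
    by (rule matrix_neg_signature_witness) blast
  define pp where "pp z = (\<Sum>i\<in>UNIV. (z $ i) *\<^sub>R p i)" for z :: "real ^ 'i"
  define L where "L = (\<lambda>(z, s). pp z + s *\<^sub>R V)"
  have Dsum: "(\<Sum>i\<in>I. c i *\<^sub>R p i) \<in> D" for I c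
    using D p by (intro subspace_sum subspace_scale)
  have ppD: "pp z \<in> D" for z unfolding pp_def by (rule Dsum)
  have LD: "L z \<in> D" for z using D ppD V by (auto simp: L_def split: prod.splits intro!: subspace_add subspace_scale)
  have linL: "linear L"
    by (rule linearI) (auto simp: L_def pp_def scaleR_add_left sum.distrib scaleR_sum_right algebra_simps split: prod.splits)
  have Bsum: "B (\<Sum>i\<in>I. c i *\<^sub>R p i) W = (\<Sum>i\<in>I. c i * B (p i) W)" if "W \<in> D" "finite I" for I c W
    using that(2)
  proof (induction I rule: finite_induct)
    case empty
    have "B (0 *\<^sub>R V) W = 0" using scale[OF V that(1), of 0] by simp
    thus ?case by simp
  next
    case (insert i I)
    thus ?case using add[of "c i *\<^sub>R p i" "\<Sum>i\<in>I. c i *\<^sub>R p i" W] scale[OF p that(1)] Dsum that(1) p D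
      by (simp add: subspace_scale)
  qed
  have Bpp: "B (pp z) W = (\<Sum>i\<in>UNIV. z $ i * B (p i) W)" if "W \<in> D" for z W
    unfolding pp_def by (rule Bsum[OF that]) simp
  have ppV: "B (pp z) V = 0" for z using Bpp[OF V] orth by simp
  have ppp: "B (pp z) (pp z) = z \<bullet> (G *v z)" for z
  proof -
    have "B (p i) (pp z) = (\<Sum>j\<in>UNIV. G $ i $ j * z $ j)" for i
      using Bpp[OF p, of z i] comm[OF p ppD] G comm[OF p p] by (simp add: mult.commute)
    thus ?thesis using Bpp[OF ppD] by (simp add: inner_vec_def matrix_vector_mult_def)
  qed
  have BL: "B (L (z, s)) (L (z, s)) = z \<bullet> (G *v z) + s\<^sup>2 * B V V" for z s
  proof -
    have sV: "s *\<^sub>R V \<in> D" using D V by (rule subspace_scale)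
    have ws: "pp z + s *\<^sub>R V \<in> D" using D ppD sV by (rule subspace_add)
    have "B (L (z, s)) (L (z, s)) = B (pp z) (pp z + s *\<^sub>R V) + B (s *\<^sub>R V) (pp z + s *\<^sub>R V)"
      unfolding L_def prod.case by (rule add[OF ppD sV ws])
    also have "B (pp z) (pp z + s *\<^sub>R V) = B (pp z + s *\<^sub>R V) (pp z)" by (rule comm[OF ppD ws])
    also have "\<dots> = B (pp z) (pp z) + B (s *\<^sub>R V) (pp z)" by (rule add[OF ppD sV ppD])
    also have "B (s *\<^sub>R V) (pp z) = s * B V (pp z)" by (rule scale[OF V ppD])
    also have "B V (pp z) = B (pp z) V" by (rule comm[OF V ppD])
    also have "B (s *\<^sub>R V) (pp z + s *\<^sub>R V) = s * B V (pp z + s *\<^sub>R V)" by (rule scale[OF V ws])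
    also have "B V (pp z + s *\<^sub>R V) = B (pp z + s *\<^sub>R V) V" by (rule comm[OF V ws])
    also have "\<dots> = B (pp z) V + B (s *\<^sub>R V) V" by (rule add[OF ppD sV V])
    also have "B (s *\<^sub>R V) V = s * B V V" by (rule scale[OF V V])
    finally show ?thesis by (simp add: ppV ppp power2_eq_square)
  qed
  define S' where "S' = insert (0, 1) ((\<lambda>z. (z, 0::real)) ` S)"
  have z0: "(0, 1) \<notin> span ((\<lambda>z. (z, 0::real)) ` S)"
  proof -
    have "span ((\<lambda>z. (z, 0::real)) ` S) \<subseteq> {y. snd y = 0}"
      by (rule span_minimal) (auto simp: subspace_def)
    thus ?thesis by auto
  qed
  have lin1: "linear (\<lambda>z::real ^ 'i. (z, 0::real))" by (rule linearI) auto
  have ind1: "independent ((\<lambda>z. (z, 0::real)) ` S)"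
    by (rule linear_independent_injective_image[OF lin1 S(2)]) (auto simp: inj_on_def)
  have ind': "independent S'" unfolding S'_def using ind1 z0 by (simp add: independent_insert)
  have card': "card S' = Suc (card S)"
  proof -
    have "card ((\<lambda>z. (z, 0::real)) ` S) = card S" by (rule card_image) (auto simp: inj_on_def)
    moreover have "(0, 1) \<notin> (\<lambda>z. (z, 0::real)) ` S" by auto
    ultimately show ?thesis using S(1) by (simp add: S'_def)
  qed
  have spanS': "fst y \<in> span S" if "y \<in> span S'" for y
  proof -
    have "span S' \<subseteq> {y. fst y \<in> span S}"
      by (rule span_minimal) (auto simp: S'_def span_base subspace_def span_add span_scale span_zero)
    thus ?thesis using that by auto
  qed
  have negL: "B (L y) (L y) < 0" if "y \<in> span S'" "y \<noteq> 0" for y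
  proof -
    obtain z s where y: "y = (z, s)" by (cases y)
    have z: "z \<in> span S" using spanS'[OF that(1)] y by simp
    show ?thesis
    proof (cases "z = 0")
      case True
      hence "s \<noteq> 0" using that y by (auto simp: zero_prod_def)
      thus ?thesis unfolding y BL using True neg by (simp add: mult_pos_neg)
    next
      case False
      have "s\<^sup>2 * B V V \<le> 0" using neg by (simp add: mult_nonneg_nonpos)
      thus ?thesis unfolding y BL using S(4)[OF z False] by simp
    qed
  qed
  have B0: "B 0 0 = 0" using scale[OF V V, of 0] scale[of V 0 0] D V by (simp add: subspace_0)
  have inj: "inj_on L (span S')"
    unfolding linear_injective_on_subspace_0[OF linL subspace_span]
    using negL B0 by (metis less_irrefl)
  have "independent (L ` S')" 
    by (rule linear_independent_injective_image[OF linL ind' inj])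
  moreover have "card (L ` S') = Suc (card S)"
    using card' card_image[OF inj_on_subset[OF inj span_superset]] by simp
  moreover have sp: "span (L ` S') = L ` span S'" by (rule linear_span_image[OF linL])
  moreover have "q W < 0" if "W \<in> span (L ` S')" "W \<noteq> 0" for W
  proof -
    obtain y where y: "y \<in> span S'" "W = L y"
      using \<open>W \<in> span (L ` S')\<close> unfolding sp by blast
    have "y \<noteq> 0" using that(2) y linear_0[OF linL] by auto
    thus ?thesis using negL[OF y(1)] y(2) qB[OF LD] by simp
  qed
  moreover have "span (L ` S') \<subseteq> D" using sp LD by auto
  ultimately have "enat (Suc (card S)) \<in> {enat (card S) | S. finite S \<and> independent S \<and> span S \<subseteq> D \<and>
                            (\<forall>V\<in>span S. V \<noteq> 0 \<longrightarrow> q V < 0)}"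
    using S(1) by (intro CollectI exI[of _ "L ` S'"]) (auto simp: S'_def)
  hence "enat (Suc (card S)) \<le> neg_signature D q" unfolding neg_signature_def by (rule Sup_upper)
  thus False using sig S(3) by simp
qed

section \<open>Density of regular jets\<close>

lemma sobolev_deriv_continuous_imp_deriv:
  assumes sd: "sobolev_deriv F f" and c: "continuous_on UNIV f"
  shows "(F has_real_derivative f x) (at x)"
proof -
  have cc: "continuous_on {x-1..x+1} f" using c by (rule continuous_on_subset) simp
  have "((\<lambda>y. F (x - 1) + integral {x-1..y} f) has_real_derivative 0 + f x) (at x within {x-1..x+1})"
    by (intro DERIV_add DERIV_const integral_has_real_derivative[OF cc]) auto
  hence "((\<lambda>y. F (x - 1) + integral {x-1..y} f) has_real_derivative f x) (at x within {x-1..x+1})" by simp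
  hence "(F has_real_derivative f x) (at x within {x-1..x+1})"
  proof (rule has_field_derivative_transform_within[of _ _ _ _ 1])
    fix y assume "y \<in> {x-1..x+1}"
    thus "F (x - 1) + integral {x-1..y} f = F y"
      using sobolev_deriv_diff[OF sd, of "x-1" y]
        set_lebesgue_integral_eq_integral(2)[OF sobolev_deriv_set_integrable[OF sd, of "x-1" y]] by auto
  qed auto
  moreover have "at x within {x-1..x+1} = at x" by (rule at_within_interior) auto
  ultimately show ?thesis by simp
qed

lemma interval_Cauchy_Schwarz:
  fixes f :: "real \<Rightarrow> real"
  assumes h: "0 < h" and f: "set_integrable lebesgue {x..x+h} f" and f2: "set_integrable lebesgue {x..x+h} (\<lambda>t. (f t)\<^sup>2)"
  shows "(LINT t:{x..x+h}|lebesgue. f t)\<^sup>2 \<le> h * (LINT t:{x..x+h}|lebesgue. (f t)\<^sup>2)"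
proof -
  define m where "m = (LINT t:{x..x+h}|lebesgue. f t) / h"
  have c: "set_integrable lebesgue {x..x+h} (\<lambda>t. m\<^sup>2)" by (rule continuous_set_integrable) auto
  have "0 \<le> (LINT t:{x..x+h}|lebesgue. (f t - m)\<^sup>2)" by (rule set_integral_nonneg_real) simp
  also have "(\<lambda>t. (f t - m)\<^sup>2) = (\<lambda>t. ((f t)\<^sup>2 - (2 * m) * f t) + m\<^sup>2)" by (simp add: power2_eq_square algebra_simps)
  also have "(LINT t:{x..x+h}|lebesgue. \<dots> t) = ((LINT t:{x..x+h}|lebesgue. (f t)\<^sup>2) - (2 * m) * (LINT t:{x..x+h}|lebesgue. f t)) + h * m\<^sup>2"
    using f f2 c h by (subst set_integral_add(2); (subst set_integral_diff(2))?) (auto intro!: set_integral_diff simp: set_integral_const)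
  also have "(LINT t:{x..x+h}|lebesgue. f t) = h * m" using h by (simp add: m_def)
  finally have "h * m\<^sup>2 \<le> (LINT t:{x..x+h}|lebesgue. (f t)\<^sup>2)" by (simp add: power2_eq_square algebra_simps)
  hence "h * (h * m\<^sup>2) \<le> h * (LINT t:{x..x+h}|lebesgue. (f t)\<^sup>2)" using h by simp
  moreover have "(LINT t:{x..x+h}|lebesgue. f t)\<^sup>2 = h * (h * m\<^sup>2)" using h by (simp add: m_def power2_eq_square)
  ultimately show ?thesis by simp
qed

text \<open>The Cauchy-Schwarz inequality on \<open>[x, x + h]\<close>, integrated over a period. Primitives \<open>G\<close> of \<open>f\<^sup>2\<close> and \<open>\<Gamma>\<close>
of \<open>G\<close> replace an exchange of integrals.\<close>

lemma steklov_average: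
  fixes f :: "real \<Rightarrow> real"
  assumes X: "0 < X" and f: "f \<in> l2per X" and sd: "sobolev_deriv F f" and h: "0 < h"
  shows "(\<lambda>x. (F (x + h) - F x) / h) \<in> l2per X" "l2norm X (\<lambda>x. (F (x + h) - F x) / h) \<le> l2norm X f"
proof -
  define fh where "fh x = (F (x + h) - F x) / h" for x
  have Fc: "continuous_on UNIV F" by (rule sobolev_deriv_continuous[OF sd])
  have fi: "set_integrable lebesgue {a..b} f" for a b by (rule sobolev_deriv_set_integrable[OF sd])
  have fp: "f (x + X) = f x" for x using l2perD(1)[OF f] by (simp add: periodic_def)
  have Fh: "F (x + h) - F x = (LINT t:{x..x+h}|lebesgue. f t)" for x using h by (intro sobolev_deriv_diff[OF sd]) simp
  have per: "periodic X fh" unfolding periodic_def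
  proof
    fix x
    have "F (x + X + h) - F (x + X) = (LINT t:{x+X..x+h+X}|lebesgue. f t)" using Fh[of "x + X"] by (simp add: add.assoc add.commute[of X h])
    also have "\<dots> = (LINT t:{x..x+h}|lebesgue. f (t + X))" by (rule set_integral_shift(2)[symmetric])
    also have "\<dots> = F (x + h) - F x" by (simp add: fp Fh)
    finally show "fh (x + X) = fh x" by (simp add: fh_def)
  qed
  have cont: "continuous_on UNIV fh" unfolding fh_def
    by (intro continuous_intros continuous_on_compose2[OF Fc]) (use h in auto)
  show 1: "(\<lambda>x. (F (x + h) - F x) / h) \<in> l2per X"
    using l2per_continuous[OF per cont] by (simp add: fh_def[abs_def])
  have p2: "periodic X (\<lambda>x. (f x)\<^sup>2)" using l2perD(1)[OF f] by (simp add: periodic_def)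
  have f2: "set_integrable lebesgue {a..b} (\<lambda>x. (f x)\<^sup>2)" for a b
    using periodic_set_integrable[OF X p2] l2perD(3)[OF f] by simp
  obtain G where G: "sobolev_deriv G (\<lambda>x. (f x)\<^sup>2)" using sobolev_primitive[OF f2] .
  have Gc: "continuous_on UNIV G" by (rule sobolev_deriv_continuous[OF G])
  have GX: "G (x + X) - G x = (l2norm X f)\<^sup>2" for x
    using sobolev_deriv_diff[OF G, of x "x + X"] X periodic_integral_interval[OF X p2 f2, of x] by (simp add: l2norm_sq)
  obtain \<Gamma> where \<Gamma>: "sobolev_deriv \<Gamma> G" using sobolev_primitive[OF continuous_set_integrable[OF Gc]] .
  have Gh: "continuous_on UNIV (\<lambda>x. G (x + s))" for s by (intro continuous_on_compose2[OF Gc] continuous_intros) auto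
  have le: "(fh x)\<^sup>2 \<le> (G (x + h) - G x) / h" for x
  proof -
    have "(F (x + h) - F x)\<^sup>2 \<le> h * (G (x + h) - G x)"
      unfolding Fh using interval_Cauchy_Schwarz[OF h fi f2] sobolev_deriv_diff[OF G, of x "x + h"] h by simp
    hence "(F (x + h) - F x)\<^sup>2 / (h * h) \<le> (h * (G (x + h) - G x)) / (h * h)" using h by (intro divide_right_mono) auto
    thus ?thesis using h unfolding fh_def by (simp add: power_divide power2_eq_square)
  qed
  have "(l2norm X fh)\<^sup>2 \<le> mean_int X (\<lambda>x. (G (x + h) - G x) / h)"
    unfolding l2norm_sq
    by (rule set_integral_mono) (use le h in \<open>auto intro!: continuous_set_integrable continuous_intros cont Gc Gh\<close>)
  also have "\<dots> = (mean_int X (\<lambda>x. G (x + h)) - mean_int X G) / h"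
    by (simp add: set_integral_diff continuous_set_integrable Gh Gc)
  also have "mean_int X (\<lambda>x. G (x + h)) - mean_int X G = (\<Gamma> (X + h) - \<Gamma> h) - (\<Gamma> X - \<Gamma> 0)"
    using sobolev_deriv_diff[OF \<Gamma>, of h "X + h"] sobolev_deriv_diff[OF \<Gamma>, of 0 X] X
    by (simp add: set_integral_shift(2))
  also have "\<dots> = (\<Gamma> (X + h) - \<Gamma> X) - (\<Gamma> h - \<Gamma> 0)" by simp
  also have "\<dots> = mean_int h (\<lambda>x. G (x + X)) - mean_int h G"
    using sobolev_deriv_diff[OF \<Gamma>, of X "X + h"] sobolev_deriv_diff[OF \<Gamma>, of 0 h] h
    by (simp add: set_integral_shift(2) add.commute)
  also have "\<dots> = mean_int h (\<lambda>x. G (x + X) - G x)"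
    by (simp add: set_integral_diff continuous_set_integrable Gh Gc)
  also have "\<dots> = h * (l2norm X f)\<^sup>2" using h by (simp add: GX set_integral_const)
  finally have "(l2norm X fh)\<^sup>2 \<le> (l2norm X f)\<^sup>2" using h by simp
  hence "l2norm X fh \<le> l2norm X f" by (rule power2_le_imp_le) simp
  thus "l2norm X (\<lambda>x. (F (x + h) - F x) / h) \<le> l2norm X f" by (simp add: fh_def[abs_def])
qed

text \<open>Almost everywhere convergence and norms that do not exceed that of the limit force strong
  convergence: Fatou's lemma for \<open>2 f\<^sub>k\<^sup>2 + 2 f\<^sup>2 - (f\<^sub>k - f)\<^sup>2\<close>.\<close>

lemma l2_convergence_of_norm_bound:
  fixes f :: "real \<Rightarrow> real"
  assumes f: "f \<in> l2per X" and fk: "\<And>k. F k \<in> l2per X" and n: "\<And>k. l2norm X (F k) \<le> l2norm X f"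
    and ae: "AE x in lebesgue. (\<lambda>k. F k x) \<longlonglongrightarrow> f x"
  shows "(\<lambda>k. l2norm X (\<lambda>x. F k x - f x)) \<longlonglongrightarrow> 0"
proof -
  define A where "A = (l2norm X f)\<^sup>2"
  define a where "a k = (l2norm X (\<lambda>x. F k x - f x))\<^sup>2" for k
  define u where "u k x = indicat_real {0..X} x * (2 * (F k x)\<^sup>2 + 2 * (f x)\<^sup>2 - (F k x - f x)\<^sup>2)" for k x
  have u_nn: "0 \<le> u k x" for k x
  proof -
    have "2 * (F k x)\<^sup>2 + 2 * (f x)\<^sup>2 - (F k x - f x)\<^sup>2 = (F k x + f x)\<^sup>2" by (simp add: power2_eq_square algebra_simps)
    thus ?thesis by (simp add: u_def)
  qed
  note [measurable] = l2perD(2)[OF f] l2perD(2)[OF fk]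
  have um[measurable]: "u k \<in> borel_measurable lebesgue" for k
    unfolding u_def[abs_def]
    by (intro borel_measurable_times borel_measurable_diff borel_measurable_add borel_measurable_power
        borel_measurable_const borel_measurable_indicator l2perD(2)[OF f] l2perD(2)[OF fk]) auto
  have i1: "per_integrable X (\<lambda>x. 2 * (F k x)\<^sup>2 + 2 * (f x)\<^sup>2)" for k
    using l2perD(3)[OF f] l2perD(3)[OF fk, of k] by (intro set_integral_add) auto
  have i2: "per_integrable X (\<lambda>x. (F k x - f x)\<^sup>2)" for k
    using l2perD(3)[OF l2per_diff(1)[OF fk f], of k] by simp
  have ui: "integrable lebesgue (u k)" for k
    using set_integral_diff(1)[OF i1 i2] unfolding set_integrable_def u_def[abs_def] by simp
  have uint: "(LINT x|lebesgue. u k x) = 2 * (l2norm X (F k))\<^sup>2 + 2 * A - a k" for k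
  proof -
    have "(LINT x|lebesgue. u k x) = mean_int X (\<lambda>x. (2 * (F k x)\<^sup>2 + 2 * (f x)\<^sup>2) - (F k x - f x)\<^sup>2)"
      by (simp add: set_lebesgue_integral_def u_def)
    also have "\<dots> = mean_int X (\<lambda>x. 2 * (F k x)\<^sup>2 + 2 * (f x)\<^sup>2) - a k"
      using set_integral_diff(2)[OF i1 i2] by (simp add: a_def l2norm_sq)
    also have "mean_int X (\<lambda>x. 2 * (F k x)\<^sup>2 + 2 * (f x)\<^sup>2) = 2 * (l2norm X (F k))\<^sup>2 + 2 * A"
      using l2perD(3)[OF f] l2perD(3)[OF fk, of k] by (subst set_integral_add(2)) (auto simp: A_def l2norm_sq)
    finally show ?thesis .
  qed
  have ule: "(LINT x|lebesgue. u k x) \<le> 4 * A - a k" for k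
    using power_mono[OF n, of k 2] unfolding uint A_def by simp
  have "ennreal (4 * A) = (\<integral>\<^sup>+x. ennreal (indicat_real {0..X} x * (4 * (f x)\<^sup>2)) \<partial>lebesgue)"
  proof -
    have "integrable lebesgue (\<lambda>x. indicat_real {0..X} x * (4 * (f x)\<^sup>2))"
    proof -
      have "per_integrable X (\<lambda>x. 4 * (norm (f x))\<^sup>2)"
        by (rule set_integrable_mult_right[OF l2perD(3)[OF f]])
      thus ?thesis unfolding set_integrable_def by simp
    qed
    from nn_integral_eq_integral[OF this] show ?thesis
      by (simp add: A_def l2norm_sq set_lebesgue_integral_def mult.left_commute)
  qed
  also have "\<dots> = (\<integral>\<^sup>+x. liminf (\<lambda>k. ennreal (u k x)) \<partial>lebesgue)"
  proof (rule nn_integral_cong_AE)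
    show "AE x in lebesgue. ennreal (indicat_real {0..X} x * (4 * (f x)\<^sup>2)) = liminf (\<lambda>k. ennreal (u k x))"
      using ae
    proof eventually_elim
      case (elim x)
      have "(\<lambda>k. u k x) \<longlonglongrightarrow> indicat_real {0..X} x * (2 * (f x)\<^sup>2 + 2 * (f x)\<^sup>2 - (f x - f x)\<^sup>2)"
        unfolding u_def by (intro tendsto_intros elim)
      hence "(\<lambda>k. ennreal (u k x)) \<longlonglongrightarrow> ennreal (indicat_real {0..X} x * (4 * (f x)\<^sup>2))"
        by (intro tendsto_ennrealI) simp
      from lim_imp_Liminf[OF _ this] show ?case by simp
    qed
  qed
  also have "\<dots> \<le> liminf (\<lambda>k. \<integral>\<^sup>+x. ennreal (u k x) \<partial>lebesgue)" by (rule nn_integral_liminf) auto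
  finally have lim: "ennreal (4 * A) \<le> liminf (\<lambda>k. ennreal (LINT x|lebesgue. u k x))"
    using nn_integral_eq_integral[OF ui] u_nn by simp
  have an: "0 \<le> a k" for k by (simp add: a_def)
  have "a \<longlonglongrightarrow> 0"
  proof (cases "A = 0")
    case True
    have "a k = 0" for k
    proof -
      have "0 \<le> (LINT x|lebesgue. u k x)" using u_nn by (intro Bochner_Integration.integral_nonneg) auto
      thus ?thesis using ule[of k] an[of k] True by simp
    qed
    hence "a = (\<lambda>k. 0)" by auto
    thus ?thesis by simp
  next
    case False
    hence A: "0 < A" by (simp add: A_def)
    show ?thesis
    proof (rule tendstoI)
      fix e :: real assume e: "0 < e"
      define e' where "e' = min e (4 * A)"
      have e': "0 < e'" "e' \<le> e" "e' \<le> 4 * A" using e A by (auto simp: e'_def)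
      have "ennreal (4 * A - e') < ennreal (4 * A)" using e' A by (subst ennreal_less_iff) auto
      hence "eventually (\<lambda>k. ennreal (4 * A - e') < ennreal (LINT x|lebesgue. u k x)) sequentially"
        using lim by (simp add: le_Liminf_iff)
      thus "eventually (\<lambda>k. dist (a k) 0 < e) sequentially"
      proof eventually_elim
        case (elim k)
        hence "4 * A - e' < (LINT x|lebesgue. u k x)" using e' by (subst (asm) ennreal_less_iff) auto
        thus ?case using ule[of k] e' an[of k] by simp
      qed
    qed
  qed
  hence "(\<lambda>k. sqrt (a k)) \<longlonglongrightarrow> sqrt 0" by (rule tendsto_real_sqrt)
  thus ?thesis by (simp add: a_def)
qed

lemma steklov_convergence:
  fixes f :: "real \<Rightarrow> real"
  assumes X: "0 < X" and f: "f \<in> l2per X" and sd: "sobolev_deriv F f"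
  shows "(\<lambda>k. l2norm X (\<lambda>x. (F (x + 1 / real (Suc k)) - F x) / (1 / real (Suc k)) - f x)) \<longlonglongrightarrow> 0"
proof (rule l2_convergence_of_norm_bound[OF f])
  show "(\<lambda>x. (F (x + 1 / real (Suc k)) - F x) / (1 / real (Suc k))) \<in> l2per X"
    "l2norm X (\<lambda>x. (F (x + 1 / real (Suc k)) - F x) / (1 / real (Suc k))) \<le> l2norm X f" for k
    using steklov_average[OF X f sd, of "1 / real (Suc k)"] by auto
  show "AE x in lebesgue. (\<lambda>k. (F (x + 1 / real (Suc k)) - F x) / (1 / real (Suc k))) \<longlonglongrightarrow> f x"
    using lebesgue_differentiation[OF sd]
  proof eventually_elim
    case (elim x)
    hence "(\<lambda>h. (F (x + h) - F x) / h) \<midarrow>0\<rightarrow> f x" by (simp add: DERIV_def)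
    moreover have "filterlim (\<lambda>k. 1 / real (Suc k)) (at 0) sequentially"
      using LIMSEQ_inverse_real_of_nat by (auto simp: filterlim_at inverse_eq_divide)
    ultimately show ?case by (rule filterlim_compose)
  qed
qed

definition regular_jets :: "'n::finite \<Rightarrow> real \<Rightarrow> (real \<Rightarrow> 'n state) set"
  where "regular_jets iv X = {Z \<in> jets iv X. \<exists>g'\<in>l2per X. sobolev_deriv (\<lambda>x. snd (Z x)) g'}"

text \<open>The index hypothesis concerns twice differentiable perturbations, while the stability norm sees one derivative; averaging
bridges the gap.\<close>

theorem regular_jets_dense:
  fixes Z :: "real \<Rightarrow> (real ^ 'n::finite) \<times> real"
  assumes X: "0 < X" and Z: "Z \<in> jets iv X"
  obtains Zk where "\<And>k::nat. Zk k \<in> regular_jets iv X" "(\<lambda>k. l2norm X (\<lambda>x. Zk k x - Z x)) \<longlonglongrightarrow> 0"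
proof -
  define v g where "v = (\<lambda>x. fst (Z x) $ iv)" and "g = (\<lambda>x. snd (Z x))"
  have v: "v \<in> l2per X" and g: "g \<in> l2per X"
    using l2per_first_component(1)[OF jetsD(1)[OF Z], of iv] l2per_snd(1)[OF jetsD(1)[OF Z]] by (auto simp: v_def g_def)
  have sd: "sobolev_deriv v g" using jetsD(2)[OF Z] by (simp add: v_def g_def)
  have vc: "continuous_on UNIV v" by (rule sobolev_deriv_continuous[OF sd])
  obtain P where P: "sobolev_deriv P v" using sobolev_primitive[OF continuous_set_integrable[OF vc]] .
  have Pd: "(P has_real_derivative v x) (at x)" for x by (rule sobolev_deriv_continuous_imp_deriv[OF P vc])
  define h where "h k = 1 / real (Suc k)" for k
  have h: "0 < h k" for k by (simp add: h_def)
  define vk gk where "vk k x = (P (x + h k) - P x) / h k" and "gk k x = (v (x + h k) - v x) / h k" for k x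
  have vkl: "vk k \<in> l2per X" and gkl: "gk k \<in> l2per X" for k
    using steklov_average(1)[OF X v P h] steklov_average(1)[OF X g sd h] by (auto simp: vk_def[abs_def] gk_def[abs_def])
  have conv: "(\<lambda>k. l2norm X (\<lambda>x. vk k x - v x)) \<longlonglongrightarrow> 0" "(\<lambda>k. l2norm X (\<lambda>x. gk k x - g x)) \<longlonglongrightarrow> 0"
    using steklov_convergence[OF X v P] steklov_convergence[OF X g sd] by (auto simp: vk_def gk_def h_def)
  have gkc: "continuous_on UNIV (gk k)" for k
    unfolding gk_def by (intro continuous_intros continuous_on_compose2[OF vc]) (use h[of k] in auto)
  have vkd: "(vk k has_real_derivative gk k x) (at x)" for k x
  proof -
    have "((\<lambda>x. P (x + h k)) has_real_derivative v (x + h k)) (at x)" using Pd by (rule DERIV_shift[THEN iffD1])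
    thus ?thesis unfolding vk_def[abs_def] gk_def by (intro DERIV_cdivide DERIV_diff Pd)
  qed
  have vks: "sobolev_deriv (vk k) (gk k)" for k by (rule sobolev_derivI[OF vkd gkc])
  have gks: "sobolev_deriv (gk k) (\<lambda>x. (1 / h k) * (g (x + h k) + (-1) * g x))" for k
  proof -
    have "sobolev_deriv (\<lambda>x. (1 / h k) * (v (x + h k) + (-1) * v x)) (\<lambda>x. (1 / h k) * (g (x + h k) + (-1) * g x))"
      by (intro sobolev_deriv_cmult sobolev_deriv_add sobolev_deriv_shift sd)
    thus ?thesis by (simp add: gk_def[abs_def])
  qed
  define D where "D k x = ((vk k x - v x) *\<^sub>R axis iv 1 :: real ^ 'n, gk k x - g x)" for k x
  define Zk where "Zk k x = Z x + D k x" for k x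
  have dv: "(\<lambda>x. vk k x - v x) \<in> l2per X" and dg: "(\<lambda>x. gk k x - g x) \<in> l2per X" for k
    using l2per_diff(1)[OF vkl v] l2per_diff(1)[OF gkl g] by auto
  have D: "D k \<in> l2per X" "l2norm X (D k) \<le> l2norm X (\<lambda>x. vk k x - v x) + l2norm X (\<lambda>x. gk k x - g x)" for k
    using l2per_pair[OF l2per_axis(1)[OF dv[of k], of iv] dg[of k]] l2per_axis(2)[OF dv[of k], of iv] by (auto simp: D_def[abs_def])
  have comp: "fst (Zk k x) $ iv = vk k x" "snd (Zk k x) = gk k x" for k x
    by (simp_all add: Zk_def D_def v_def g_def axis_def)
  have "Zk k \<in> l2per X" for k unfolding Zk_def using l2per_add(1)[OF jetsD(1)[OF Z] D(1)] .
  hence Zj: "Zk k \<in> jets iv X" for k using vks by (simp add: jets_def comp)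
  have hl: "(\<lambda>x. (1 / h k) * (g (x + h k) + (-1) * g x)) \<in> l2per X" for k
    using l2per_scaleR(1)[OF l2per_add(1)[OF l2per_shift(1)[OF X g, of "h k"] l2per_scaleR(1)[OF g, of "-1"]], of "1 / h k"] by simp
  have "Zk k \<in> regular_jets iv X" for k
  proof -
    have "\<exists>g'\<in>l2per X. sobolev_deriv (\<lambda>x. snd (Zk k x)) g'"
      unfolding comp using gks[of k] hl[of k] by blast
    thus ?thesis using Zj by (simp add: regular_jets_def)
  qed
  moreover have "(\<lambda>k. l2norm X (\<lambda>x. Zk k x - Z x)) \<longlonglongrightarrow> 0"
  proof (rule tendsto_sandwich[OF _ _ tendsto_const])
    show "(\<lambda>k. l2norm X (\<lambda>x. vk k x - v x) + l2norm X (\<lambda>x. gk k x - g x)) \<longlonglongrightarrow> 0"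
      using tendsto_add[OF conv] by simp
    show "\<forall>\<^sub>F k in sequentially. l2norm X (\<lambda>x. Zk k x - Z x) \<le> l2norm X (\<lambda>x. vk k x - v x) + l2norm X (\<lambda>x. gk k x - g x)"
      using D(2) by (intro always_eventually allI) (simp add: Zk_def[abs_def])
  qed auto
  ultimately show ?thesis by (rule that)
qed

section \<open>Coercivity under constraints\<close>

lemma invertible_matrix_inv:
  fixes C :: "real ^ 'i ^ 'i::finite"
  assumes "invertible C"
  shows "C *v (matrix_inv C *v y) = y" "matrix_inv C *v (C *v y) = y"
proof -
  have "C ** matrix_inv C = mat 1 \<and> matrix_inv C ** C = mat 1"
    using assms unfolding invertible_def matrix_inv_def by (rule someI_ex)
  thus "C *v (matrix_inv C *v y) = y" "matrix_inv C *v (C *v y) = y"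
    by (simp_all add: matrix_vector_mul_assoc)
qed

text \<open>The constraints \<open>q\<close> are represented, through the form \<open>b\<close>, by the vectors \<open>- p i\<close>, and \<open>C\<close> is the matrix of
\<open>q\<close> on these vectors. Being invertible, it allows projecting onto the kernel of \<open>q\<close> along the \<open>p i\<close>.\<close>

locale constrained_jacobi = jacobi iv X \<kappa> \<tau> n m \<phi> \<phi>1 \<psi> \<psi>1
  for iv :: "'n::finite" and X \<kappa> \<tau> n m \<phi> \<phi>1 \<psi> \<psi>1 +
  fixes p :: "'i::finite \<Rightarrow> real \<Rightarrow> 'n state" and q :: "(real \<Rightarrow> 'n state) \<Rightarrow> real ^ 'i"
    and C :: "real ^ 'i ^ 'i" and Cq :: real
  assumes p_jets: "\<And>i. p i \<in> jets iv X"
    and q_add: "\<And>Z W. Z \<in> jets iv X \<Longrightarrow> W \<in> jets iv X \<Longrightarrow> q (\<lambda>x. Z x + W x) = q Z + q W"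
    and q_scaleR: "\<And>c Z. Z \<in> jets iv X \<Longrightarrow> q (\<lambda>x. c *\<^sub>R Z x) = c *\<^sub>R q Z"
    and q_bound: "\<And>Z. Z \<in> jets iv X \<Longrightarrow> norm (q Z) \<le> Cq * l2norm X Z"
    and b_p: "\<And>i W. W \<in> jets iv X \<Longrightarrow> b (p i) W = - (q W $ i)"
    and q_p: "\<And>i j. q (p j) $ i = C $ i $ j"
    and C_inv: "invertible C"
begin

abbreviation A where "A \<equiv> matrix_inv C"

lemma C_sym: "C $ i $ j = C $ j $ i"
  using b_p[OF p_jets, of i j] b_p[OF p_jets, of j i] b_commute[of "p i" "p j"] q_p by simp

lemma C_selfadjoint: "(C *v y) \<bullet> z = y \<bullet> (C *v z)"
proof -
  have "transpose C = C" unfolding transpose_def vec_eq_iff using C_sym by simp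
  thus ?thesis by (metis dot_lmul_matrix vector_transpose_matrix)
qed

lemma A_selfadjoint: "(A *v y) \<bullet> z = y \<bullet> (A *v z)"
  by (metis C_selfadjoint C_inv invertible_matrix_inv(1))

text \<open>The form \<open>N\<close> is the Jacobi form after removal of the components along the \<open>p i\<close>.\<close>

definition N where "N Z W = b Z W + q Z \<bullet> (A *v q W)"

lemma N_commute: "N Z W = N W Z"
  unfolding N_def by (metis A_selfadjoint b_commute inner_commute)

lemma N_add: "Z \<in> jets iv X \<Longrightarrow> Z' \<in> jets iv X \<Longrightarrow> W \<in> jets iv X \<Longrightarrow> N (\<lambda>x. Z x + Z' x) W = N Z W + N Z' W"
  by (simp add: N_def b_add jetsD q_add inner_add_left)

lemma N_scaleR: "Z \<in> jets iv X \<Longrightarrow> N (\<lambda>x. c *\<^sub>R Z x) W = c * N Z W"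
  by (simp add: N_def b_scaleR q_scaleR algebra_simps)

lemma Cq_nonneg: "0 \<le> Cq * l2norm X Z" if "Z \<in> jets iv X"
  using q_bound[OF that] norm_ge_zero order_trans by blast

lemma qA_bound:
  obtains K where "0 < K" "\<And>y z. \<bar>y \<bullet> (A *v z)\<bar> \<le> K * (norm y * norm z)"
proof -
  obtain K where K: "0 < K" "\<And>z. norm (A *v z) \<le> norm z * K"
    using bounded_linear.pos_bounded[OF matrix_vector_mul_bounded_linear[of A]] by blast
  have "\<bar>y \<bullet> (A *v z)\<bar> \<le> K * (norm y * norm z)" for y z
  proof -
    have "\<bar>y \<bullet> (A *v z)\<bar> \<le> norm y * norm (A *v z)" by (rule Cauchy_Schwarz_ineq2)
    also have "\<dots> \<le> norm y * (norm z * K)" by (intro mult_left_mono K(2)) simp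
    finally show ?thesis by (simp add: ac_simps)
  qed
  thus ?thesis using K(1) that by blast
qed

lemma N_bound:
  obtains K where "0 < K" "\<And>Z W. Z \<in> jets iv X \<Longrightarrow> W \<in> jets iv X \<Longrightarrow> \<bar>N Z W\<bar> \<le> K * (l2norm X Z * l2norm X W)"
proof -
  obtain K1 where K1: "0 < K1" "\<And>Z W. Z \<in> l2per X \<Longrightarrow> W \<in> l2per X \<Longrightarrow> \<bar>b Z W\<bar> \<le> K1 * (l2norm X Z * l2norm X W)"
    using b_bound by metis
  obtain K2 where K2: "0 < K2" "\<And>y z. \<bar>y \<bullet> (A *v z)\<bar> \<le> K2 * (norm y * norm z)" using qA_bound by blast
  have "\<bar>N Z W\<bar> \<le> (K1 + K2 * Cq\<^sup>2) * (l2norm X Z * l2norm X W)" if "Z \<in> jets iv X" "W \<in> jets iv X" for Z W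
  proof -
    have "norm (q Z) * norm (q W) \<le> (Cq * l2norm X Z) * (Cq * l2norm X W)"
      using q_bound Cq_nonneg that by (intro mult_mono) auto
    hence "K2 * (norm (q Z) * norm (q W)) \<le> K2 * ((Cq * l2norm X Z) * (Cq * l2norm X W))"
      using K2(1) by (intro mult_left_mono) auto
    moreover have "\<bar>q Z \<bullet> (A *v q W)\<bar> \<le> K2 * (norm (q Z) * norm (q W))" by (rule K2(2))
    moreover have "\<bar>b Z W\<bar> \<le> K1 * (l2norm X Z * l2norm X W)" by (rule K1(2)[OF jetsD(1)[OF that(1)] jetsD(1)[OF that(2)]])
    ultimately have "\<bar>N Z W\<bar> \<le> K1 * (l2norm X Z * l2norm X W) + K2 * ((Cq * l2norm X Z) * (Cq * l2norm X W))"
      unfolding N_def by linarith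
    also have "\<dots> = (K1 + K2 * Cq\<^sup>2) * (l2norm X Z * l2norm X W)" by (simp add: power2_eq_square algebra_simps)
    finally show ?thesis .
  qed
  moreover have "0 < K1 + K2 * Cq\<^sup>2" using K1 K2 by (simp add: add_pos_nonneg)
  ultimately show ?thesis using that by blast
qed

lemma N_nonneg_by_density:
  assumes reg: "\<And>Z. Z \<in> regular_jets iv X \<Longrightarrow> 0 \<le> N Z Z" and Z: "Z \<in> jets iv X"
  shows "0 \<le> N Z Z"
proof -
  obtain Zk where Zk: "\<And>k::nat. Zk k \<in> regular_jets iv X" "(\<lambda>k. l2norm X (\<lambda>x. Zk k x - Z x)) \<longlonglongrightarrow> 0"
    by (rule regular_jets_dense[OF X_pos Z]) blast
  obtain K where K: "0 < K" "\<And>Z W. Z \<in> jets iv X \<Longrightarrow> W \<in> jets iv X \<Longrightarrow> \<bar>N Z W\<bar> \<le> K * (l2norm X Z * l2norm X W)"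
    using N_bound by blast
  define d where "d k = (\<lambda>x. Zk k x - Z x)" for k
  have Zkj: "Zk k \<in> jets iv X" for k using Zk(1) by (simp add: regular_jets_def)
  have dj: "d k \<in> jets iv X" for k unfolding d_def by (rule jets_diff[OF Zkj Z])
  have exp: "N (Zk k) (Zk k) = N Z Z + 2 * N Z (d k) + N (d k) (d k)" for k
  proof -
    have e: "Zk k = (\<lambda>x. Z x + d k x)" by (simp add: d_def)
    have "N (Zk k) (Zk k) = N Z (Zk k) + N (d k) (Zk k)" by (subst (1) e) (rule N_add[OF Z dj Zkj])
    also have "N Z (Zk k) = N Z Z + N Z (d k)" 
      using N_add[OF Z dj Z, of k] N_commute[of "Zk k" Z] N_commute[of "d k" Z] e by simp
    also have "N (d k) (Zk k) = N Z (d k) + N (d k) (d k)"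
      using N_add[OF Z dj dj, of k k] N_commute[of "Zk k" "d k"] e by simp
    finally show ?thesis by simp
  qed
  have "- (2 * (K * (l2norm X Z * l2norm X (d k))) + K * (l2norm X (d k) * l2norm X (d k))) \<le> N Z Z" for k
    using reg[OF Zk(1)[of k]] exp[of k] K(2)[OF Z dj, of k] K(2)[OF dj dj, of k k] by linarith
  note le = this
  have "(\<lambda>k. - (2 * (K * (l2norm X Z * l2norm X (d k))) + K * (l2norm X (d k) * l2norm X (d k)))) \<longlonglongrightarrow>
      - (2 * (K * (l2norm X Z * 0)) + K * (0 * 0))"
    unfolding d_def by (intro tendsto_intros Zk(2))
  hence "(\<lambda>k. - (2 * (K * (l2norm X Z * l2norm X (d k))) + K * (l2norm X (d k) * l2norm X (d k)))) \<longlonglongrightarrow> 0"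
    by simp
  from LIMSEQ_le_const2[OF this] show ?thesis using le by blast
qed

text \<open>By the Cauchy-Schwarz inequality for \<open>N\<close>, \<open>\<bar>b Z W\<bar>\<close> is at most \<open>\<epsilon> \<parallel>W\<parallel>\<close> with \<open>\<epsilon>\<close> of the order of
\<open>sqrt (N Z Z) + \<parallel>q Z\<parallel>\<close>. So \<open>Z\<close> is within \<open>K \<epsilon>\<close> of a multiple of \<open>\<Phi>\<close>, and being orthogonal to \<open>\<Phi>\<close> it is
itself of that size.\<close>

theorem coercive_on_constraints:
  assumes nn: "\<And>Z. Z \<in> jets iv X \<Longrightarrow> 0 \<le> N Z Z"
  obtains \<alpha> K where "0 < \<alpha>" "0 \<le> K"
    "\<And>Z. Z \<in> jets iv X \<Longrightarrow> l2ip X Z \<Phi> = 0 \<Longrightarrow> \<alpha> * (l2norm X Z)\<^sup>2 \<le> b Z Z + K * (norm (q Z))\<^sup>2"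
proof -
  obtain K where K: "0 < K" "\<And>Z W. Z \<in> jets iv X \<Longrightarrow> W \<in> jets iv X \<Longrightarrow> \<bar>N Z W\<bar> \<le> K * (l2norm X Z * l2norm X W)"
    using N_bound by blast
  obtain K2 where K2: "0 < K2" "\<And>y z. \<bar>y \<bullet> (A *v z)\<bar> \<le> K2 * (norm y * norm z)" using qA_bound by blast
  obtain K0 where K0: "0 < K0" "\<And>\<epsilon> Z. \<lbrakk>0 \<le> \<epsilon>; Z \<in> jets iv X; \<And>W. W \<in> jets iv X \<Longrightarrow> \<bar>b Z W\<bar> \<le> \<epsilon> * l2norm X W\<rbrakk>
       \<Longrightarrow> \<exists>a. l2norm X (\<lambda>x. Z x - a *\<^sub>R \<Phi> x) \<le> K0 * \<epsilon>"
    by (rule jet_approximate_kernel) blast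
  have CS: "(N Z W)\<^sup>2 \<le> N Z Z * N W W" if Z: "Z \<in> jets iv X" and W: "W \<in> jets iv X" for Z W
  proof (rule discriminant_nonpos[OF nn[OF Z]])
    fix t :: real
    have tZ: "(\<lambda>x. t *\<^sub>R Z x) \<in> jets iv X" and mW: "(\<lambda>x. (-1) *\<^sub>R W x) \<in> jets iv X"
      by (intro jets_scaleR Z W)+
    define S where "S = (\<lambda>x. t *\<^sub>R Z x + (-1) *\<^sub>R W x)"
    have S: "S \<in> jets iv X" unfolding S_def by (rule jets_add[OF tZ mW])
    have l: "N S V = t * N Z V - N W V" if "V \<in> jets iv X" for V
      using N_add[OF tZ mW that] N_scaleR[OF Z, of t V] N_scaleR[OF W, of "-1" V] by (simp add: S_def)
    have "0 \<le> N S S" by (rule nn[OF S])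
    also have "N S S = t * N Z S - N W S" by (rule l[OF S])
    also have "\<dots> = t * (t * N Z Z - N W Z) - (t * N Z W - N W W)"
      using l[OF Z] l[OF W] N_commute by metis
    also have "\<dots> = N Z Z * t\<^sup>2 - 2 * N Z W * t + N W W"
      using N_commute[of W Z] by (simp add: power2_eq_square algebra_simps)
    finally show "0 \<le> N Z Z * t\<^sup>2 - 2 * N Z W * t + N W W" .
  qed
  define c where "c = max 0 Cq"
  have c: "0 \<le> c" "\<And>Z. Z \<in> jets iv X \<Longrightarrow> norm (q Z) \<le> c * l2norm X Z"
  proof -
    fix Z assume "Z \<in> jets iv X"
    hence "norm (q Z) \<le> Cq * l2norm X Z" by (rule q_bound)
    also have "\<dots> \<le> c * l2norm X Z" by (intro mult_right_mono) (auto simp: c_def)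
    finally show "norm (q Z) \<le> c * l2norm X Z" .
  qed (simp add: c_def)
  define D where "D = 2 * K0\<^sup>2 * K"
  have D: "0 < D" using K K0 by (simp add: D_def)
  define Kc where "Kc = K2 + 2 * K0\<^sup>2 * (K2 * c)\<^sup>2 / D"
  show ?thesis
  proof (rule that[of "1 / D" Kc])
    show "0 < 1 / D" "0 \<le> Kc" using D K2 by (auto simp: Kc_def)
    fix Z assume Z: "Z \<in> jets iv X" and orth: "l2ip X Z \<Phi> = 0"
    define \<epsilon> where "\<epsilon> = sqrt (K * N Z Z) + K2 * norm (q Z) * c"
    have \<epsilon>: "0 \<le> \<epsilon>" unfolding \<epsilon>_def using K K2 nn[OF Z] c by simp
    have test: "\<bar>b Z W\<bar> \<le> \<epsilon> * l2norm X W" if W: "W \<in> jets iv X" for W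
    proof -
      have "N W W \<le> K * (l2norm X W * l2norm X W)" using K(2)[OF W W] by linarith
      from order_trans[OF CS[OF Z W] mult_left_mono[OF this nn[OF Z]]]
      have "(N Z W)\<^sup>2 \<le> N Z Z * (K * (l2norm X W * l2norm X W))" .
      also have "\<dots> = (sqrt (K * N Z Z) * l2norm X W)\<^sup>2"
        using K nn[OF Z] by (simp add: power_mult_distrib power2_eq_square[of "l2norm X W"])
      finally have 1: "\<bar>N Z W\<bar> \<le> sqrt (K * N Z Z) * l2norm X W"
        using K nn[OF Z] power2_le_imp_le[of "\<bar>N Z W\<bar>" "sqrt (K * N Z Z) * l2norm X W"] by simp
      have "\<bar>q Z \<bullet> (A *v q W)\<bar> \<le> K2 * (norm (q Z) * norm (q W))" by (rule K2(2))
      also have "\<dots> \<le> K2 * (norm (q Z) * (c * l2norm X W))"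
        using K2 c(2)[OF W] by (intro mult_left_mono) auto
      finally have "\<bar>b Z W\<bar> \<le> sqrt (K * N Z Z) * l2norm X W + K2 * (norm (q Z) * (c * l2norm X W))"
        using 1 unfolding N_def by linarith
      thus ?thesis by (simp add: \<epsilon>_def algebra_simps)
    qed
    obtain a where a: "l2norm X (\<lambda>x. Z x - a *\<^sub>R \<Phi> x) \<le> K0 * \<epsilon>" using K0(2)[OF \<epsilon> Z test] by blast
    have \<Phi>l: "\<Phi> \<in> l2per X" and Zl: "Z \<in> l2per X" using \<Phi>_jets Z by (auto simp: jetsD)
    have dl: "(\<lambda>x. Z x - a *\<^sub>R \<Phi> x) \<in> l2per X" by (intro l2per_diff(1) l2per_scaleR(1) Zl \<Phi>l)
    have "(l2norm X Z)\<^sup>2 = l2ip X (\<lambda>x. Z x - a *\<^sub>R \<Phi> x) Z"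
      using orth by (simp add: l2ip_diff_left Zl \<Phi>l l2per_scaleR l2ip_scaleR_left l2ip_self l2ip_commute[of X \<Phi> Z])
    also have "\<dots> \<le> l2norm X (\<lambda>x. Z x - a *\<^sub>R \<Phi> x) * l2norm X Z"
      using l2ip_bound[OF dl Zl] by linarith
    finally have sq: "(l2norm X Z)\<^sup>2 \<le> l2norm X (\<lambda>x. Z x - a *\<^sub>R \<Phi> x) * l2norm X Z" .
    have "l2norm X Z \<le> l2norm X (\<lambda>x. Z x - a *\<^sub>R \<Phi> x)"
    proof (cases "l2norm X Z = 0")
      case False
      hence "0 < l2norm X Z" using l2norm_nonneg[of X Z] by linarith
      moreover have "l2norm X Z * l2norm X Z \<le> l2norm X (\<lambda>x. Z x - a *\<^sub>R \<Phi> x) * l2norm X Z"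
        using sq by (simp add: power2_eq_square)
      ultimately show ?thesis by (rule mult_right_le_imp_le[rotated])
    qed simp
    hence "l2norm X Z \<le> K0 * \<epsilon>" using a by simp
    hence "(l2norm X Z)\<^sup>2 \<le> (K0 * \<epsilon>)\<^sup>2" by (rule power_mono) simp
    also have "\<dots> = K0\<^sup>2 * \<epsilon>\<^sup>2" by (simp add: power_mult_distrib)
    also have "\<dots> \<le> K0\<^sup>2 * (2 * (K * N Z Z) + 2 * (K2 * norm (q Z) * c)\<^sup>2)"
    proof (rule mult_left_mono)
      have "\<epsilon>\<^sup>2 + (sqrt (K * N Z Z) - K2 * norm (q Z) * c)\<^sup>2 = 2 * (sqrt (K * N Z Z))\<^sup>2 + 2 * (K2 * norm (q Z) * c)\<^sup>2"
        by (simp add: \<epsilon>_def power2_eq_square algebra_simps)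
      moreover have "(sqrt (K * N Z Z))\<^sup>2 = K * N Z Z" using K nn[OF Z] by simp
      moreover have "0 \<le> (sqrt (K * N Z Z) - K2 * norm (q Z) * c)\<^sup>2" by (rule zero_le_power2)
      ultimately show "\<epsilon>\<^sup>2 \<le> 2 * (K * N Z Z) + 2 * (K2 * norm (q Z) * c)\<^sup>2" by linarith
    qed simp
    also have "\<dots> = D * N Z Z + 2 * K0\<^sup>2 * (K2 * c)\<^sup>2 * (norm (q Z))\<^sup>2"
      by (simp add: D_def power_mult_distrib algebra_simps)
    finally have "1 / D * (l2norm X Z)\<^sup>2 \<le> 1 / D * (D * N Z Z + 2 * K0\<^sup>2 * (K2 * c)\<^sup>2 * (norm (q Z))\<^sup>2)"
      using D by (intro mult_left_mono) auto
    also have "\<dots> = N Z Z + 2 * K0\<^sup>2 * (K2 * c)\<^sup>2 / D * (norm (q Z))\<^sup>2" using D by (simp add: field_simps)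
    also have "N Z Z \<le> b Z Z + K2 * (norm (q Z))\<^sup>2"
      using K2(2)[of "q Z" "q Z"] unfolding N_def by (simp add: power2_eq_square)
    finally show "1 / D * (l2norm X Z)\<^sup>2 \<le> b Z Z + Kc * (norm (q Z))\<^sup>2"
      by (simp add: Kc_def algebra_simps)
  qed
qed

text \<open>The projection \<open>Z - \<Sum> a\<^sub>i p\<^sub>i\<close> that satisfies the constraints realises \<open>N\<close>.\<close>

definition proj where "proj Z x = Z x - (\<Sum>i\<in>UNIV. ((A *v q Z) $ i) *\<^sub>R p i x)"

lemma proj_jets: "Z \<in> jets iv X \<Longrightarrow> proj Z \<in> jets iv X"
  unfolding proj_def[abs_def] by (intro jets_diff jets_sum jets_scaleR p_jets) auto

lemma b_proj:
  assumes Z: "Z \<in> jets iv X" and W: "W \<in> jets iv X"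
  shows "b (proj Z) W = b Z W + (A *v q Z) \<bullet> q W"
proof -
  define a where "a = A *v q Z"
  have pl: "(\<lambda>x. a $ i *\<^sub>R p i x) \<in> l2per X" for i by (intro l2per_scaleR jetsD(1)[OF p_jets])
  have sl: "(\<lambda>x. (-1) *\<^sub>R (\<Sum>i\<in>UNIV. a $ i *\<^sub>R p i x)) \<in> l2per X" by (intro l2per_scaleR l2per_sum pl) auto
  have "b (proj Z) W = b (\<lambda>x. Z x + (-1) *\<^sub>R (\<Sum>i\<in>UNIV. a $ i *\<^sub>R p i x)) W" by (simp add: proj_def[abs_def] a_def)
  also have "\<dots> = b Z W + b (\<lambda>x. (-1) *\<^sub>R (\<Sum>i\<in>UNIV. a $ i *\<^sub>R p i x)) W" by (rule b_add[OF jetsD(1)[OF Z] sl jetsD(1)[OF W]])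
  also have "b (\<lambda>x. (-1) *\<^sub>R (\<Sum>i\<in>UNIV. a $ i *\<^sub>R p i x)) W = - b (\<lambda>x. \<Sum>i\<in>UNIV. a $ i *\<^sub>R p i x) W"
    by (simp only: b_scaleR mult_minus1)
  also have "b (\<lambda>x. \<Sum>i\<in>UNIV. a $ i *\<^sub>R p i x) W = (\<Sum>i\<in>UNIV. a $ i * b (p i) W)"
    by (subst b_sum) (auto simp: b_scaleR pl jetsD(1)[OF W])
  also have "\<dots> = - (a \<bullet> q W)" by (simp add: b_p[OF W] inner_vec_def sum_negf)
  finally show ?thesis by (simp add: a_def)
qed

lemma q_proj: "Z \<in> jets iv X \<Longrightarrow> b (p i) (proj Z) = 0"
proof -
  assume Z: "Z \<in> jets iv X"
  have "b (p i) (proj Z) = b (proj Z) (p i)" by (rule b_commute)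
  also have "\<dots> = b Z (p i) + (A *v q Z) \<bullet> q (p i)" by (rule b_proj[OF Z p_jets])
  also have "b Z (p i) = - (q Z $ i)" using b_p[OF Z] b_commute by metis
  also have "(A *v q Z) \<bullet> q (p i) = (C *v (A *v q Z)) $ i"
    by (simp add: inner_vec_def matrix_vector_mult_def q_p C_sym[of _ i] mult.commute)
  also have "C *v (A *v q Z) = q Z" by (rule invertible_matrix_inv(1)[OF C_inv])
  finally show ?thesis by simp
qed

lemma N_eq_proj: "Z \<in> jets iv X \<Longrightarrow> N Z Z = b (proj Z) (proj Z)"
proof -
  assume Z: "Z \<in> jets iv X"
  have "q (proj Z) = 0"
    using q_proj[OF Z] b_p[OF proj_jets[OF Z]] by (simp add: vec_eq_iff)
  hence "b (proj Z) (proj Z) = b Z (proj Z)" using b_proj[OF Z proj_jets[OF Z]] by simp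
  also have "\<dots> = b (proj Z) Z" by (rule b_commute)
  also have "\<dots> = b Z Z + (A *v q Z) \<bullet> q Z" by (rule b_proj[OF Z Z])
  finally show ?thesis by (simp add: N_def inner_commute)
qed

end

section \<open>The normal form of the Hamiltonian\<close>

definition C3 :: "(real \<Rightarrow> real) \<Rightarrow> bool"
  where "C3 g \<longleftrightarrow> (\<forall>x. (g has_real_derivative deriv g x) (at x)) \<and>
    (\<forall>x. (deriv g has_real_derivative deriv (deriv g) x) (at x)) \<and>
    (\<forall>x. (deriv (deriv g) has_real_derivative deriv (deriv (deriv g)) x) (at x)) \<and>
    continuous_on UNIV (deriv (deriv (deriv g)))"

lemma C3I:
  assumes 1: "\<And>x. (g has_real_derivative g1 x) (at x)" and 2: "\<And>x. (g1 has_real_derivative g2 x) (at x)"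
    and 3: "\<And>x. (g2 has_real_derivative g3 x) (at x)" and c: "continuous_on UNIV g3"
  shows "C3 g"
proof -
  have "deriv g = g1" "deriv g1 = g2" "deriv g2 = g3" using 1 2 3 by (auto intro!: DERIV_imp_deriv)
  thus ?thesis using assms by (simp add: C3_def)
qed

lemma C3D:
  assumes "C3 g"
  shows "(g has_real_derivative deriv g x) (at x)" "(deriv g has_real_derivative deriv (deriv g) x) (at x)"
    "continuous_on UNIV g" "continuous_on UNIV (deriv g)" "continuous_on UNIV (deriv (deriv g))"
  using assms unfolding C3_def by (auto intro!: continuous_at_imp_continuous_on DERIV_isCont)

lemma C3_diff_square:
  assumes f: "C3 f" and t: "C3 t"
  shows "C3 (\<lambda>v. f v - t v * v\<^sup>2 / 2)"
proof -
  let ?d = "deriv"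
  have f': "\<And>x. (?d (?d f) has_real_derivative ?d (?d (?d f)) x) (at x)" "continuous_on UNIV (?d (?d (?d f)))"
    and t': "\<And>x. (?d (?d t) has_real_derivative ?d (?d (?d t)) x) (at x)" "continuous_on UNIV (?d (?d (?d t)))"
    using f t by (auto simp: C3_def)
  note fd = C3D(1,2)[OF f] f'(1) and td = C3D(1,2)[OF t] t'(1)
  show ?thesis
  proof (rule C3I)
    show "((\<lambda>v. f v - t v * v\<^sup>2 / 2) has_real_derivative ?d f x - (?d t x * x\<^sup>2 / 2 + t x * x)) (at x)" for x
      by (auto intro!: derivative_eq_intros fd td simp: field_simps)
    show "((\<lambda>x. ?d f x - (?d t x * x\<^sup>2 / 2 + t x * x)) has_real_derivative
        ?d (?d f) x - (?d (?d t) x * x\<^sup>2 / 2 + 2 * ?d t x * x + t x)) (at x)" for x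
      by (auto intro!: derivative_eq_intros fd td simp: field_simps)
    show "((\<lambda>x. ?d (?d f) x - (?d (?d t) x * x\<^sup>2 / 2 + 2 * ?d t x * x + t x)) has_real_derivative
        ?d (?d (?d f)) x - (?d (?d (?d t)) x * x\<^sup>2 / 2 + 3 * ?d (?d t) x * x + 3 * ?d t x)) (at x)" for x
      by (auto intro!: derivative_eq_intros fd td simp: field_simps)
    show "continuous_on UNIV (\<lambda>x. ?d (?d (?d f)) x - (?d (?d (?d t)) x * x\<^sup>2 / 2 + 3 * ?d (?d t) x * x + 3 * ?d t x))"
      by (intro continuous_intros f' t' C3D[OF t]) auto
  qed
qed

lemma C3_const: "C3 (\<lambda>x. c)"
  by (rule C3I[of _ "\<lambda>x. 0" "\<lambda>x. 0" "\<lambda>x. 0"]) auto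

definition taylor_bound :: "(real \<Rightarrow> real) \<Rightarrow> real \<Rightarrow> real \<Rightarrow> bool"
  where "taylor_bound g R C \<longleftrightarrow> 0 < C \<and> (\<forall>x. \<bar>x\<bar> \<le> R \<longrightarrow> \<bar>deriv g x\<bar> \<le> C \<and> \<bar>deriv (deriv g) x\<bar> \<le> C \<and>
    (\<forall>h. \<bar>h\<bar> \<le> 1 \<longrightarrow> \<bar>g (x + h) - g x - deriv g x * h - deriv (deriv g) x * h\<^sup>2 / 2\<bar> \<le> C * \<bar>h\<bar> ^ 3))"

lemma C3_Taylor:
  assumes g: "C3 g" and R: "0 \<le> R"
  obtains C where "taylor_bound g R C"
proof -
  define S where "S = {- R - 1..R + 1}"
  have bdd: "\<exists>C. \<forall>x\<in>S. \<bar>h x\<bar> \<le> C" if "continuous_on UNIV h" for h :: "real \<Rightarrow> real"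
  proof -
    have "compact (h ` S)" by (rule compact_continuous_image) (auto simp: S_def intro: continuous_on_subset[OF that])
    then obtain C where "\<forall>y\<in>h ` S. norm y \<le> C" by (auto dest!: compact_imp_bounded simp: bounded_iff)
    thus ?thesis by auto
  qed
  have c3: "continuous_on UNIV (deriv (deriv (deriv g)))" using g by (simp add: C3_def)
  obtain C1 where C1: "\<forall>x\<in>S. \<bar>deriv g x\<bar> \<le> C1" using bdd[OF C3D(4)[OF g]] by blast
  obtain C2 where C2: "\<forall>x\<in>S. \<bar>deriv (deriv g) x\<bar> \<le> C2" using bdd[OF C3D(5)[OF g]] by blast
  obtain Cc where Cc: "\<forall>x\<in>S. \<bar>deriv (deriv (deriv g)) x\<bar> \<le> Cc" using bdd[OF c3] by blast
  define C where "C = 1 + \<bar>C1\<bar> + \<bar>C2\<bar> + \<bar>Cc\<bar>"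
  define diff where "diff m = (deriv ^^ m) g" for m
  have diff: "diff 0 = g" "diff 1 = deriv g" "diff 2 = deriv (deriv g)" "diff 3 = deriv (deriv (deriv g))"
    by (simp_all add: diff_def eval_nat_numeral)
  have C0: "0 < C" by (simp add: C_def)
  have "taylor_bound g R C" unfolding taylor_bound_def
  proof (intro conjI allI impI)
    show "0 < C" by (rule C0)
    show "\<bar>deriv g x\<bar> \<le> C" if "\<bar>x\<bar> \<le> R" for x
    proof -
      have "x \<in> S" using that R by (auto simp: S_def)
      hence "\<bar>deriv g x\<bar> \<le> C1" using C1 by blast
      thus ?thesis by (simp add: C_def)
    qed
    show "\<bar>deriv (deriv g) x\<bar> \<le> C" if "\<bar>x\<bar> \<le> R" for x
    proof -
      have "x \<in> S" using that R by (auto simp: S_def)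
      hence "\<bar>deriv (deriv g) x\<bar> \<le> C2" using C2 by blast
      thus ?thesis by (simp add: C_def)
    qed
    fix x h :: real assume x: "\<bar>x\<bar> \<le> R" and h: "\<bar>h\<bar> \<le> 1"
    show "\<bar>g (x + h) - g x - deriv g x * h - deriv (deriv g) x * h\<^sup>2 / 2\<bar> \<le> C * \<bar>h\<bar> ^ 3"
    proof (cases "h = 0")
      case False
      have D: "\<forall>m t. m < 3 \<and> - R - 1 \<le> t \<and> t \<le> R + 1 \<longrightarrow> DERIV (diff m) t :> diff (Suc m) t"
      proof (intro allI impI)
        fix m :: nat and t :: real assume "m < 3 \<and> - R - 1 \<le> t \<and> t \<le> R + 1"
        hence "m = 0 \<or> m = 1 \<or> m = 2" by auto
        thus "DERIV (diff m) t :> diff (Suc m) t"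
          using g unfolding C3_def by (auto simp: diff_def eval_nat_numeral)
      qed
      have "\<exists>t. (if x + h < x then x + h < t \<and> t < x else x < t \<and> t < x + h) \<and>
          g (x + h) = (\<Sum>m<3. diff m x / fact m * (x + h - x) ^ m) + diff 3 t / fact 3 * (x + h - x) ^ 3"
        by (rule Taylor[OF _ diff(1) D]) (use x h False in auto)
      then obtain t where t: "if x + h < x then x + h < t \<and> t < x else x < t \<and> t < x + h"
        and eq: "g (x + h) = (\<Sum>m<3. diff m x / fact m * h ^ m) + diff 3 t / fact 3 * h ^ 3" by auto
      have "t \<in> S" using t x h by (auto simp: S_def split: if_splits)
      hence b: "\<bar>deriv (deriv (deriv g)) t\<bar> \<le> C" using Cc by (force simp: C_def)
      have "(\<Sum>m<3. diff m x / fact m * h ^ m) = g x + deriv g x * h + deriv (deriv g) x * h\<^sup>2 / 2"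
        by (simp add: eval_nat_numeral diff_def)
      hence "g (x + h) - g x - deriv g x * h - deriv (deriv g) x * h\<^sup>2 / 2 = deriv (deriv (deriv g)) t / 6 * h ^ 3"
        using eq diff(4) by (simp add: fact_numeral)
      hence "\<bar>g (x + h) - g x - deriv g x * h - deriv (deriv g) x * h\<^sup>2 / 2\<bar> = \<bar>deriv (deriv (deriv g)) t\<bar> / 6 * \<bar>h\<bar> ^ 3"
        by (simp only: abs_mult power_abs abs_divide abs_numeral)
      also have "\<dots> \<le> C * \<bar>h\<bar> ^ 3" using b by (intro mult_right_mono) auto
      finally show ?thesis .
    qed (use C0 in auto)
  qed
  thus ?thesis by (rule that)
qed

lemma abs_mult_mono: "\<bar>a\<bar> \<le> A \<Longrightarrow> \<bar>b\<bar> \<le> B \<Longrightarrow> \<bar>a * b\<bar> \<le> A * B" for a b :: real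
  unfolding abs_mult by (rule mult_mono) auto

text \<open>The Hamiltonian is a sum of products \<open>g v * P\<close> with \<open>P\<close> a polynomial of degree at most two in \<open>(U, v\<^sub>x)\<close>, whose
homogeneous parts in the increment are \<open>p0, p1, p2\<close>. Every term of the remainder contains a power of \<open>v\<close>, and the
total degree is at least three.\<close>

lemma Taylor_product_remainder:
  fixes v z :: real
  assumes g: "taylor_bound g \<rho> C" and v0: "\<bar>v0\<bar> \<le> \<rho>" and v: "\<bar>v\<bar> \<le> 1" "\<bar>v\<bar> \<le> z" and D: "0 \<le> D"
    and p: "\<bar>p0\<bar> \<le> D" "\<bar>p1\<bar> \<le> D * z" "\<bar>p2\<bar> \<le> D * z\<^sup>2"
  shows "\<bar>g (v0 + v) * (p0 + p1 + p2) - g v0 * p0 - (deriv g v0 * v * p0 + g v0 * p1)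
     - (deriv (deriv g) v0 * v\<^sup>2 * p0 / 2 + deriv g v0 * v * p1 + g v0 * p2)\<bar> \<le> 5 * C * D * (\<bar>v\<bar> * z\<^sup>2)"
proof -
  define A a0 a1 a2 where "A = g (v0 + v)" and "a0 = g v0" and "a1 = deriv g v0" and "a2 = deriv (deriv g) v0"
  note defs = A_def[symmetric] a0_def[symmetric] a1_def[symmetric] a2_def[symmetric]
  have C: "0 \<le> C" "0 \<le> D" and A: "\<bar>A - a0 - a1 * v - a2 * v\<^sup>2 / 2\<bar> \<le> C * \<bar>v\<bar> ^ 3" and a: "\<bar>a1\<bar> \<le> C" "\<bar>a2\<bar> \<le> C"
    using g v0 v(1) D unfolding taylor_bound_def defs[symmetric] by auto
  define R where "R = A - a0 - a1 * v - a2 * v\<^sup>2 / 2"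
  have z: "0 \<le> z" using v by linarith
  have v2: "\<bar>v\<bar> * \<bar>v\<bar> \<le> \<bar>v\<bar> * z" "\<bar>v\<bar> * \<bar>v\<bar> \<le> z * z"
    by (rule mult_left_mono[OF v(2) abs_ge_zero], rule mult_mono[OF v(2) v(2) z abs_ge_zero])
  have v3: "\<bar>v\<bar> ^ 3 \<le> \<bar>v\<bar> * z\<^sup>2" 
    using mult_left_mono[OF v2(2), of "\<bar>v\<bar>"] by (simp add: power2_eq_square power3_eq_cube)
  have v31: "\<bar>v\<bar> ^ 3 \<le> \<bar>v\<bar>" 
    using mult_mono[OF v(1) v(1)] mult_left_mono[of "\<bar>v\<bar> * \<bar>v\<bar>" 1 "\<bar>v\<bar>"] by (simp add: power3_eq_cube)
  have v32: "\<bar>v\<bar> ^ 3 * z \<le> \<bar>v\<bar> * z\<^sup>2"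
  proof -
    have "\<bar>v\<bar> * \<bar>v\<bar> \<le> 1 * z" using v by (intro mult_mono) auto
    hence "(\<bar>v\<bar> * \<bar>v\<bar>) * (\<bar>v\<bar> * z) \<le> z * (\<bar>v\<bar> * z)" using z by (intro mult_right_mono) auto
    thus ?thesis by (simp add: power2_eq_square power3_eq_cube ac_simps)
  qed
  have RA: "\<bar>R\<bar> \<le> C * \<bar>v\<bar> ^ 3" using A by (simp add: R_def)
  have vv1: "\<bar>v\<^sup>2\<bar> \<le> \<bar>v\<bar> * z" and vv2: "\<bar>v\<^sup>2\<bar> \<le> \<bar>v\<bar>"
    using v2(1) mult_left_mono[OF v(1) abs_ge_zero[of v]] by (simp_all add: power2_eq_square abs_mult)
  have CD: "0 \<le> C * D" using C by simp
  have b1: "\<bar>R * p0\<bar> \<le> C * D * (\<bar>v\<bar> * z\<^sup>2)"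
  proof -
    have "\<bar>R * p0\<bar> \<le> (C * \<bar>v\<bar> ^ 3) * D" by (rule abs_mult_mono[OF RA p(1)])
    also have "\<dots> = C * D * \<bar>v\<bar> ^ 3" by (simp only: ac_simps)
    also have "\<dots> \<le> C * D * (\<bar>v\<bar> * z\<^sup>2)" by (rule mult_left_mono[OF v3 CD])
    finally show ?thesis .
  qed
  have b2: "\<bar>R * p1\<bar> \<le> C * D * (\<bar>v\<bar> * z\<^sup>2)"
  proof -
    have "\<bar>R * p1\<bar> \<le> (C * \<bar>v\<bar> ^ 3) * (D * z)" by (rule abs_mult_mono[OF RA p(2)])
    also have "\<dots> = C * D * (\<bar>v\<bar> ^ 3 * z)" by (simp only: ac_simps)
    also have "\<dots> \<le> C * D * (\<bar>v\<bar> * z\<^sup>2)" by (rule mult_left_mono[OF v32 CD])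
    finally show ?thesis .
  qed
  have b3: "\<bar>R * p2\<bar> \<le> C * D * (\<bar>v\<bar> * z\<^sup>2)"
  proof -
    have "\<bar>R * p2\<bar> \<le> (C * \<bar>v\<bar> ^ 3) * (D * z\<^sup>2)" by (rule abs_mult_mono[OF RA p(3)])
    also have "\<dots> = C * D * (\<bar>v\<bar> ^ 3 * z\<^sup>2)" by (simp only: ac_simps)
    also have "\<dots> \<le> C * D * (\<bar>v\<bar> * z\<^sup>2)"
      by (intro mult_left_mono[OF mult_right_mono[OF v31] CD]) simp
    finally show ?thesis .
  qed
  have b4: "\<bar>a2 * v\<^sup>2 * p1\<bar> \<le> C * D * (\<bar>v\<bar> * z\<^sup>2)"
    using abs_mult_mono[OF abs_mult_mono[OF a(2) vv1] p(2)] by (simp only: power2_eq_square ac_simps)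
  have b5: "\<bar>a2 * v\<^sup>2 * p2\<bar> \<le> C * D * (\<bar>v\<bar> * z\<^sup>2)"
    using abs_mult_mono[OF abs_mult_mono[OF a(2) vv2] p(3)] by (simp only: ac_simps)
  have b6: "\<bar>a1 * v * p2\<bar> \<le> C * D * (\<bar>v\<bar> * z\<^sup>2)"
    using abs_mult_mono[OF abs_mult_mono[OF a(1) order_refl[of "\<bar>v\<bar>"]] p(3)] by (simp only: ac_simps)
  have "A * (p0 + p1 + p2) - a0 * p0 - (a1 * v * p0 + a0 * p1) - (a2 * v\<^sup>2 * p0 / 2 + a1 * v * p1 + a0 * p2)
    = R * p0 + R * p1 + R * p2 + (a2 * v\<^sup>2 * p1) / 2 + (a2 * v\<^sup>2 * p2) / 2 + a1 * v * p2"
    by (simp add: R_def field_simps)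
  moreover have "\<bar>R * p0 + R * p1 + R * p2 + (a2 * v\<^sup>2 * p1) / 2 + (a2 * v\<^sup>2 * p2) / 2 + a1 * v * p2\<bar>
      \<le> C * D * (\<bar>v\<bar> * z\<^sup>2) + C * D * (\<bar>v\<bar> * z\<^sup>2) + C * D * (\<bar>v\<bar> * z\<^sup>2)
       + C * D * (\<bar>v\<bar> * z\<^sup>2) / 2 + C * D * (\<bar>v\<bar> * z\<^sup>2) / 2 + C * D * (\<bar>v\<bar> * z\<^sup>2)"
    by (intro order_trans[OF abs_triangle_ineq] add_mono b1 b2 b3 b6) (use b4 b5 in \<open>simp_all add: abs_divide\<close>)
  ultimately show ?thesis unfolding defs by simp
qed

text \<open>A normal form that covers one and two components. For one component \<open>\<tau> = 1\<close>, with \<open>v\<^sup>2 / 2\<close> subtracted from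
\<open>f\<close>, so that the term with \<open>\<tau>\<close> is positive definite in all components. The vector \<open>or\<close> selects
the component \<open>u\<close>, and \<open>M_eq\<close> says that \<open>Q = v (k \<bullet> U)\<close>.\<close>

locale ham_form =
  fixes iv :: "'n::finite" and H :: "'n state \<Rightarrow> real" and B :: "real ^ 'n ^ 'n"
    and f e \<kappa> \<tau> t :: "real \<Rightarrow> real" and or k :: "real ^ 'n"
  assumes H_eq: "\<And>U w. H (U, w) = f (U $ iv) + e (U $ iv) * w + \<kappa> (U $ iv) * w\<^sup>2 / 2
      + t (U $ iv) * (or \<bullet> U) + \<tau> (U $ iv) * (U \<bullet> U) / 2"
    and smooth: "C3 f" "C3 e" "C3 \<kappa>" "C3 \<tau>" "C3 t"
    and \<kappa>_positive: "\<And>v. 0 < \<kappa> v" and \<tau>_positive: "\<And>v. 0 < \<tau> v" and or_iv: "or $ iv = 0"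
    and M_eq: "\<And>U. matrix_inv B *v U = (U $ iv) *\<^sub>R k + (k \<bullet> U) *\<^sub>R axis iv 1"
begin

lemmas cont0 = smooth[THEN C3D(3)] and cont1 = smooth[THEN C3D(4)] and cont2 = smooth[THEN C3D(5)]

lemma impulse_eq: "impulse B U = (U $ iv) * (k \<bullet> U)"
  by (simp add: impulse_def M_eq inner_add_right inner_axis inner_commute)

text \<open>\<open>EU\<close> is the gradient of \<open>\<H> + c Q\<close> in \<open>U\<close>, \<open>EL\<close> the variational derivative as a function of \<open>U, v\<^sub>x, v\<^sub>x\<^sub>x\<close>, and
\<open>nvec\<close> the coefficient \<open>n\<close> of its linearisation. The factor \<open>1 / 2\<close> in \<open>nvec\<close> is due to \<open>n\<close> entering twice.\<close>

definition EU :: "real ^ 'n \<Rightarrow> real \<Rightarrow> real \<Rightarrow> real ^ 'n"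
  where "EU U w c = (deriv f (U $ iv) + deriv e (U $ iv) * w + deriv \<kappa> (U $ iv) * w\<^sup>2 / 2
      + deriv t (U $ iv) * (or \<bullet> U) + deriv \<tau> (U $ iv) * (U \<bullet> U) / 2) *\<^sub>R axis iv 1
      + t (U $ iv) *\<^sub>R or + \<tau> (U $ iv) *\<^sub>R U + c *\<^sub>R ((U $ iv) *\<^sub>R k + (k \<bullet> U) *\<^sub>R axis iv 1)"

definition EL :: "real ^ 'n \<Rightarrow> real \<Rightarrow> real \<Rightarrow> real \<Rightarrow> real ^ 'n"
  where "EL U w w' c = (deriv f (U $ iv) - deriv \<kappa> (U $ iv) * w\<^sup>2 / 2 - \<kappa> (U $ iv) * w'
      + deriv t (U $ iv) * (or \<bullet> U) + deriv \<tau> (U $ iv) * (U \<bullet> U) / 2) *\<^sub>R axis iv 1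
      + t (U $ iv) *\<^sub>R or + \<tau> (U $ iv) *\<^sub>R U + c *\<^sub>R ((U $ iv) *\<^sub>R k + (k \<bullet> U) *\<^sub>R axis iv 1)"

definition nvec :: "real ^ 'n \<Rightarrow> real \<Rightarrow> real \<Rightarrow> real \<Rightarrow> real ^ 'n"
  where "nvec U w w' c = deriv t (U $ iv) *\<^sub>R or + deriv \<tau> (U $ iv) *\<^sub>R U + c *\<^sub>R k
      + ((deriv (deriv f) (U $ iv) - deriv (deriv \<kappa>) (U $ iv) * w\<^sup>2 / 2 - deriv \<kappa> (U $ iv) * w'
         + deriv (deriv t) (U $ iv) * (or \<bullet> U) + deriv (deriv \<tau>) (U $ iv) * (U \<bullet> U) / 2) / 2) *\<^sub>R axis iv 1"

lemma has_real_derivative_comp: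
  assumes "C3 g" "(h has_real_derivative h') (at x)"
  shows "((\<lambda>x. g (h x)) has_real_derivative deriv g (h x) * h') (at x)"
    "((\<lambda>x. deriv g (h x)) has_real_derivative deriv (deriv g) (h x) * h') (at x)"
  using DERIV_chain2[OF C3D(1)[OF assms(1)] assms(2)] DERIV_chain2[OF C3D(2)[OF assms(1)] assms(2)] by auto

lemma has_derivative_inner_vec:
  fixes U :: "real \<Rightarrow> real ^ 'n"
  assumes "(U has_vector_derivative U') (at s)"
  shows "((\<lambda>s. y \<bullet> U s) has_real_derivative y \<bullet> U') (at s)"
    "((\<lambda>s. U s $ \<alpha>) has_real_derivative U' $ \<alpha>) (at s)"
    "((\<lambda>s. U s \<bullet> U s) has_real_derivative 2 * (U s \<bullet> U')) (at s)"
proof -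
  show "((\<lambda>s. y \<bullet> U s) has_real_derivative y \<bullet> U') (at s)"
    using bounded_linear.has_vector_derivative[OF bounded_linear_inner_right assms]
    by (simp add: has_real_derivative_iff_has_vector_derivative)
  show "((\<lambda>s. U s $ \<alpha>) has_real_derivative U' $ \<alpha>) (at s)"
    using bounded_linear.has_vector_derivative[OF bounded_linear_vec_nth assms]
    by (simp add: has_real_derivative_iff_has_vector_derivative)
  show "((\<lambda>s. U s \<bullet> U s) has_real_derivative 2 * (U s \<bullet> U')) (at s)"
    using bounded_bilinear.has_vector_derivative[OF bounded_bilinear_inner assms assms]
    by (simp add: has_real_derivative_iff_has_vector_derivative inner_commute)
qed

lemma ham_impulse_eq: "ham_impulse iv H B c U P = H (U, P $ iv) + c * ((U $ iv) * (k \<bullet> U))"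
  by (simp add: ham_impulse_def ham_density_def impulse_eq)

lemma dF_dU_ham_impulse: "dF_dU (ham_impulse iv H B c) \<alpha> U P = EU U (P $ iv) c $ \<alpha>"
proof -
  define d :: "real ^ 'n" where "d = axis \<alpha> 1"
  have "((\<lambda>s. U + s *\<^sub>R d) has_vector_derivative d) (at 0)"
    by (auto intro!: derivative_eq_intros)
  note v = has_derivative_inner_vec[OF this]
  have "((\<lambda>s. ham_impulse iv H B c (U + s *\<^sub>R d) P) has_real_derivative EU U (P $ iv) c \<bullet> d) (at 0)"
    unfolding ham_impulse_eq H_eq
    by (rule smooth[THEN has_real_derivative_comp(1)] v DERIV_cdivide DERIV_const derivative_eq_intros refl)+
      (simp add: EU_def inner_add_left inner_axis inner_axis' algebra_simps inner_commute)
  from DERIV_imp_deriv[OF this] show ?thesis by (simp add: dF_dU_def d_def inner_axis)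
qed

lemma dF_dUx_ham_impulse:
  "dF_dUx (ham_impulse iv H B c) \<alpha> U P = (if \<alpha> = iv then e (U $ iv) + \<kappa> (U $ iv) * P $ iv else 0)"
proof -
  define j :: real where "j = axis \<alpha> 1 $ iv"
  have j: "j = (if \<alpha> = iv then 1 else 0)" by (simp add: j_def axis_def)
  have "((\<lambda>s. ham_impulse iv H B c U (P + s *\<^sub>R axis \<alpha> 1)) has_real_derivative (e (U $ iv) + \<kappa> (U $ iv) * P $ iv) * j) (at 0)"
    unfolding ham_impulse_eq H_eq vector_add_component vector_scaleR_component j_def[symmetric]
    by (auto intro!: derivative_eq_intros simp: algebra_simps)
  from DERIV_imp_deriv[OF this] show ?thesis by (simp add: dF_dUx_def j)
qed

lemma euler_formula:
  assumes v: "\<And>y. ((\<lambda>y. U y $ iv) has_real_derivative w y) (at y)" and w: "(w has_real_derivative w') (at x)"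
  shows "euler (ham_impulse iv H B c) U x = EL (U x) (w x) w' c"
proof -
  have xd: "x_deriv U y $ iv = w y" for y
    using DERIV_imp_deriv[OF v] by (simp add: x_deriv_def)
  have "((\<lambda>y. e (U y $ iv) + \<kappa> (U y $ iv) * w y) has_real_derivative
      deriv e (U x $ iv) * w x + (deriv \<kappa> (U x $ iv) * w x * w x + \<kappa> (U x $ iv) * w')) (at x)"
    by (rule smooth[THEN has_real_derivative_comp(1)] v w DERIV_cdivide DERIV_const derivative_eq_intros refl)+ (simp add: algebra_simps)
  hence 1: "deriv (\<lambda>y. e (U y $ iv) + \<kappa> (U y $ iv) * w y) x =
      deriv e (U x $ iv) * w x + (deriv \<kappa> (U x $ iv) * w x * w x + \<kappa> (U x $ iv) * w')" by (rule DERIV_imp_deriv)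
  have ax: "axis iv (1::real) $ \<alpha> = (if \<alpha> = iv then 1 else 0)" for \<alpha> by (simp add: axis_def)
  have "euler (ham_impulse iv H B c) U x $ \<alpha> = EL (U x) (w x) w' c $ \<alpha>" for \<alpha>
  proof (cases "\<alpha> = iv")
    case True
    show ?thesis unfolding True
      by (simp add: euler_def dF_dU_ham_impulse dF_dUx_ham_impulse xd 1 EU_def EL_def ax) (simp add: power2_eq_square algebra_simps)
  next
    case False
    thus ?thesis by (simp add: euler_def dF_dU_ham_impulse dF_dUx_ham_impulse xd EU_def EL_def ax)
  qed
  thus ?thesis by (simp add: vec_eq_iff)
qed

lemma EL_derivative:
  fixes U :: "real \<Rightarrow> real ^ 'n"
  assumes U: "(U has_vector_derivative V) (at s)" and w: "(w has_real_derivative g) (at s)"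
    and w': "(w' has_real_derivative g') (at s)" and c: "(c has_real_derivative dc) (at s)"
  shows "((\<lambda>s. EL (U s) (w s) (w' s) (c s) $ \<alpha>) has_real_derivative
     (\<tau> (U s $ iv) *\<^sub>R V + (V $ iv) *\<^sub>R nvec (U s) (w s) (w' s) (c s) + (nvec (U s) (w s) (w' s) (c s) \<bullet> V) *\<^sub>R axis iv 1
      - (deriv \<kappa> (U s $ iv) * w s * g + \<kappa> (U s $ iv) * g') *\<^sub>R axis iv 1
      + dc *\<^sub>R ((U s $ iv) *\<^sub>R k + (k \<bullet> U s) *\<^sub>R axis iv 1)) $ \<alpha>) (at s)"
proof -
  note v = has_derivative_inner_vec[OF U]
  define a :: real where "a = axis iv 1 $ \<alpha>"
  have ni: "nvec (U s) (w s) (w' s) (c s) \<bullet> V = deriv t (U s $ iv) * (or \<bullet> V) + deriv \<tau> (U s $ iv) * (U s \<bullet> V) + c s * (k \<bullet> V)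
      + ((deriv (deriv f) (U s $ iv) - deriv (deriv \<kappa>) (U s $ iv) * (w s)\<^sup>2 / 2 - deriv \<kappa> (U s $ iv) * w' s
         + deriv (deriv t) (U s $ iv) * (or \<bullet> U s) + deriv (deriv \<tau>) (U s $ iv) * (U s \<bullet> U s) / 2) / 2) * V $ iv"
    by (simp add: nvec_def inner_add_left inner_axis')
  have nc: "nvec (U s) (w s) (w' s) (c s) $ \<alpha> = deriv t (U s $ iv) * or $ \<alpha> + deriv \<tau> (U s $ iv) * U s $ \<alpha> + c s * k $ \<alpha>
      + ((deriv (deriv f) (U s $ iv) - deriv (deriv \<kappa>) (U s $ iv) * (w s)\<^sup>2 / 2 - deriv \<kappa> (U s $ iv) * w' s
         + deriv (deriv t) (U s $ iv) * (or \<bullet> U s) + deriv (deriv \<tau>) (U s $ iv) * (U s \<bullet> U s) / 2) / 2) * a"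
    by (simp add: nvec_def a_def)
  show ?thesis
    unfolding EL_def vector_add_component vector_minus_component vector_scaleR_component real_scaleR_def ni nc a_def[symmetric]
    by (rule smooth[THEN has_real_derivative_comp(1)] smooth[THEN has_real_derivative_comp(2)] v w w' c DERIV_cdivide DERIV_const derivative_eq_intros refl)+
       (simp add: field_simps power2_eq_square)
qed

lemma hess_formula:
  fixes U V :: "real \<Rightarrow> real ^ 'n"
  assumes v: "\<And>y. ((\<lambda>y. U y $ iv) has_real_derivative w y) (at y)" and w: "(w has_real_derivative w') (at x)"
    and Vv: "\<And>y. ((\<lambda>y. V y $ iv) has_real_derivative g y) (at y)" and g: "(g has_real_derivative g') (at x)"
  shows "hess (ham_impulse iv H B c) U V x =
     \<tau> (U x $ iv) *\<^sub>R V x + (V x $ iv) *\<^sub>R nvec (U x) (w x) w' c + (nvec (U x) (w x) w' c \<bullet> V x) *\<^sub>R axis iv 1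
      - (deriv \<kappa> (U x $ iv) * w x * g x + \<kappa> (U x $ iv) * g') *\<^sub>R axis iv 1"
proof -
  have eu: "euler (ham_impulse iv H B c) (U + \<theta> *\<^sub>R V) x = EL (U x + \<theta> *\<^sub>R V x) (w x + \<theta> * g x) (w' + \<theta> * g') c" for \<theta>
  proof -
    have "((\<lambda>y. (U + \<theta> *\<^sub>R V) y $ iv) has_real_derivative w y + \<theta> * g y) (at y)" for y
      unfolding plus_fun_def scaleR_fun_def vector_add_component vector_scaleR_component real_scaleR_def
      by (intro DERIV_add v DERIV_cmult Vv)
    moreover have "((\<lambda>y. w y + \<theta> * g y) has_real_derivative w' + \<theta> * g') (at x)"
      by (intro DERIV_add w DERIV_cmult g)
    ultimately have "euler (ham_impulse iv H B c) (U + \<theta> *\<^sub>R V) x = EL ((U + \<theta> *\<^sub>R V) x) (w x + \<theta> * g x) (w' + \<theta> * g') c"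
      by (rule euler_formula)
    thus ?thesis by (simp add: plus_fun_def scaleR_fun_def)
  qed
  have 1: "((\<lambda>\<theta>. U x + \<theta> *\<^sub>R V x) has_vector_derivative V x) (at 0)"
    by (auto intro!: derivative_eq_intros)
  have 2: "((\<lambda>\<theta>. w x + \<theta> * g x) has_real_derivative g x) (at 0)" "((\<lambda>\<theta>. w' + \<theta> * g') has_real_derivative g') (at 0)"
    "((\<lambda>\<theta>. c) has_real_derivative 0) (at 0)"
    by (auto intro!: derivative_eq_intros)
  have "hess (ham_impulse iv H B c) U V x $ \<alpha> =
     (\<tau> (U x $ iv) *\<^sub>R V x + (V x $ iv) *\<^sub>R nvec (U x) (w x) w' c + (nvec (U x) (w x) w' c \<bullet> V x) *\<^sub>R axis iv 1
      - (deriv \<kappa> (U x $ iv) * w x * g x + \<kappa> (U x $ iv) * g') *\<^sub>R axis iv 1) $ \<alpha>" for \<alpha>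
    using DERIV_imp_deriv[OF EL_derivative[OF 1 2, of \<alpha>]] by (simp add: hess_def eu)
  thus ?thesis by (simp only: vec_eq_iff) simp
qed

definition D2H :: "'n state \<Rightarrow> 'n state \<Rightarrow> real"
  where "D2H y z = (let v0 = fst y $ iv; v = fst z $ iv; w = snd y; g = snd z in
     deriv (deriv f) v0 * v\<^sup>2 + (deriv (deriv e) v0 * v\<^sup>2 * w + 2 * deriv e v0 * v * g)
     + (deriv (deriv \<kappa>) v0 * v\<^sup>2 * w\<^sup>2 / 2 + 2 * deriv \<kappa> v0 * v * w * g + \<kappa> v0 * g\<^sup>2)
     + (deriv (deriv t) v0 * v\<^sup>2 * (or \<bullet> fst y) + 2 * deriv t v0 * v * (or \<bullet> fst z))
     + (deriv (deriv \<tau>) v0 * v\<^sup>2 * (fst y \<bullet> fst y) / 2 + 2 * deriv \<tau> v0 * v * (fst y \<bullet> fst z) + \<tau> v0 * (fst z \<bullet> fst z)))"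

definition DH :: "'n state \<Rightarrow> 'n state \<Rightarrow> real"
  where "DH y z = EU (fst y) (snd y) 0 \<bullet> fst z + (e (fst y $ iv) + \<kappa> (fst y $ iv) * snd y) * snd z"

text \<open>The bound is linear in \<open>v\<close> and quadratic in the full increment, for increments whose \<open>v\<^sub>x\<close> and \<open>u\<close> are not
bounded. This is what an \<open>H\<^sup>1\<close> argument can use.\<close>

theorem H_Taylor:
  assumes R: "0 \<le> R"
  obtains C where "0 < C"
    "\<And>y z. norm y \<le> R \<Longrightarrow> \<bar>fst z $ iv\<bar> \<le> 1 \<Longrightarrow>
       \<bar>H (y + z) - H y - DH y z - D2H y z / 2\<bar> \<le> C * (\<bar>fst z $ iv\<bar> * (norm z)\<^sup>2)"
proof -
  obtain Cf where Cf: "taylor_bound f R Cf" by (rule C3_Taylor[OF smooth(1) R])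
  obtain Ce where Ce: "taylor_bound e R Ce" by (rule C3_Taylor[OF smooth(2) R])
  obtain Ck where Ck: "taylor_bound \<kappa> R Ck" by (rule C3_Taylor[OF smooth(3) R])
  obtain Cu where Cu: "taylor_bound \<tau> R Cu" by (rule C3_Taylor[OF smooth(4) R])
  obtain Ct where Ct: "taylor_bound t R Ct" by (rule C3_Taylor[OF smooth(5) R])
  define D where "D = 1 + R + R\<^sup>2 + norm or + norm or * R"
  have D0: "0 \<le> norm or * R" "0 \<le> R\<^sup>2" using R by auto
  have D: "1 \<le> D" "R \<le> D" "R\<^sup>2 \<le> D" "norm or \<le> D" "norm or * R \<le> D"
    using R D0 norm_ge_zero[of or] unfolding D_def by linarith+
  define C where "C = 5 * (Cf + Ce + Ck + Ct + Cu) * D"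
  show ?thesis
  proof (rule that[of C])
    show "0 < C" unfolding C_def using Cf Ce Ck Ct Cu D(1) by (simp add: taylor_bound_def)
    fix y z :: "'n state" assume y: "norm y \<le> R" and v1: "\<bar>fst z $ iv\<bar> \<le> 1"
    define v0 v w g U V where "v0 = fst y $ iv" and "v = fst z $ iv" and "w = snd y" and "g = snd z" and "U = fst y" and "V = fst z"
    have yn: "norm U \<le> R" "\<bar>w\<bar> \<le> R" "\<bar>v0\<bar> \<le> R"
      using y norm_fst_le[of "fst y" "snd y"] norm_snd_le[of "snd y" "fst y"] component_le_norm_cart[of "fst y" iv]
      by (auto simp: U_def w_def v0_def)
    have zn: "norm V \<le> norm z" "\<bar>g\<bar> \<le> norm z" "\<bar>v\<bar> \<le> norm z"
      using norm_fst_le[of "fst z" "snd z"] norm_snd_le[of "snd z" "fst z"] component_le_norm_cart[of "fst z" iv]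
      by (auto simp: V_def g_def v_def)
    have v: "\<bar>v\<bar> \<le> 1" "\<bar>v\<bar> \<le> norm z" using v1 zn by (auto simp: v_def)
    have z0: "0 \<le> norm z" by simp
    have Dz: "norm z \<le> D * norm z" "(norm z)\<^sup>2 \<le> D * (norm z)\<^sup>2" "0 \<le> D * norm z" "0 \<le> D * (norm z)\<^sup>2" "0 \<le> D"
      using mult_right_mono[OF D(1), of "norm z"] mult_right_mono[OF D(1), of "(norm z)\<^sup>2"] D(1) by auto
    have inn: "\<bar>a \<bullet> b\<bar> \<le> A * B" if "norm a \<le> A" "norm b \<le> B" for a b :: "real ^ 'n" and A B
      by (rule order_trans[OF Cauchy_Schwarz_ineq2 mult_mono]) (use that in \<open>auto intro: order_trans[OF norm_ge_zero]\<close>)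
    have Rz: "R * norm z \<le> D * norm z" using D(2) by (rule mult_right_mono) simp
    note rule = Taylor_product_remainder[OF _ yn(3) v Dz(5)]
    have 1: "\<bar>f (v0 + v) * (1 + 0 + 0) - f v0 * 1 - (deriv f v0 * v * 1 + f v0 * 0) - (deriv (deriv f) v0 * v\<^sup>2 * 1 / 2 + deriv f v0 * v * 0 + f v0 * 0)\<bar>
        \<le> 5 * Cf * D * (\<bar>v\<bar> * (norm z)\<^sup>2)"
      by (rule rule[OF Cf]) (use D Dz in auto)
    have 2: "\<bar>e (v0 + v) * (w + g + 0) - e v0 * w - (deriv e v0 * v * w + e v0 * g) - (deriv (deriv e) v0 * v\<^sup>2 * w / 2 + deriv e v0 * v * g + e v0 * 0)\<bar>
        \<le> 5 * Ce * D * (\<bar>v\<bar> * (norm z)\<^sup>2)"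
      by (rule rule[OF Ce]) (use D Dz yn zn in auto)
    have 3: "\<bar>\<kappa> (v0 + v) * (w\<^sup>2 / 2 + w * g + g\<^sup>2 / 2) - \<kappa> v0 * (w\<^sup>2 / 2) - (deriv \<kappa> v0 * v * (w\<^sup>2 / 2) + \<kappa> v0 * (w * g)) - (deriv (deriv \<kappa>) v0 * v\<^sup>2 * (w\<^sup>2 / 2) / 2 + deriv \<kappa> v0 * v * (w * g) + \<kappa> v0 * (g\<^sup>2 / 2))\<bar>
        \<le> 5 * Ck * D * (\<bar>v\<bar> * (norm z)\<^sup>2)"
    proof (rule rule[OF Ck])
      have "\<bar>w * w\<bar> \<le> R * R" "\<bar>w * g\<bar> \<le> R * norm z" "\<bar>g * g\<bar> \<le> norm z * norm z" by (intro abs_mult_mono yn zn)+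
      thus "\<bar>w\<^sup>2 / 2\<bar> \<le> D" "\<bar>w * g\<bar> \<le> D * norm z" "\<bar>g\<^sup>2 / 2\<bar> \<le> D * (norm z)\<^sup>2"
        using D(3) Rz Dz(2,4,5) zero_le_square[of w] zero_le_square[of g] unfolding power2_eq_square abs_divide abs_numeral
        by linarith+
    qed
    have 4: "\<bar>t (v0 + v) * ((or \<bullet> U) + (or \<bullet> V) + 0) - t v0 * (or \<bullet> U) - (deriv t v0 * v * (or \<bullet> U) + t v0 * (or \<bullet> V)) - (deriv (deriv t) v0 * v\<^sup>2 * (or \<bullet> U) / 2 + deriv t v0 * v * (or \<bullet> V) + t v0 * 0)\<bar>
        \<le> 5 * Ct * D * (\<bar>v\<bar> * (norm z)\<^sup>2)"
    proof (rule rule[OF Ct])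
      have "\<bar>or \<bullet> U\<bar> \<le> norm or * R" "\<bar>or \<bullet> V\<bar> \<le> norm or * norm z" by (intro inn yn zn order_refl)+
      moreover have "norm or * norm z \<le> D * norm z" using D(4) by (rule mult_right_mono) simp
      ultimately show "\<bar>or \<bullet> U\<bar> \<le> D" "\<bar>or \<bullet> V\<bar> \<le> D * norm z" using D(5) by linarith+
    qed (use Dz in auto)
    have 5: "\<bar>\<tau> (v0 + v) * ((U \<bullet> U) / 2 + (U \<bullet> V) + (V \<bullet> V) / 2) - \<tau> v0 * ((U \<bullet> U) / 2) - (deriv \<tau> v0 * v * ((U \<bullet> U) / 2) + \<tau> v0 * (U \<bullet> V)) - (deriv (deriv \<tau>) v0 * v\<^sup>2 * ((U \<bullet> U) / 2) / 2 + deriv \<tau> v0 * v * (U \<bullet> V) + \<tau> v0 * ((V \<bullet> V) / 2))\<bar>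
        \<le> 5 * Cu * D * (\<bar>v\<bar> * (norm z)\<^sup>2)"
    proof (rule rule[OF Cu])
      have "\<bar>U \<bullet> U\<bar> \<le> R * R" "\<bar>U \<bullet> V\<bar> \<le> R * norm z" "\<bar>V \<bullet> V\<bar> \<le> norm z * norm z" by (intro inn yn zn)+
      thus "\<bar>(U \<bullet> U) / 2\<bar> \<le> D" "\<bar>U \<bullet> V\<bar> \<le> D * norm z" "\<bar>(V \<bullet> V) / 2\<bar> \<le> D * (norm z)\<^sup>2"
        using D(3) Rz Dz(2,4,5) inner_ge_zero[of U] inner_ge_zero[of V] unfolding power2_eq_square abs_divide abs_numeral
        by linarith+
    qed
    have Hyz: "H (y + z) = f (v0 + v) + e (v0 + v) * (w + g) + \<kappa> (v0 + v) * (w\<^sup>2 / 2 + w * g + g\<^sup>2 / 2)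
        + t (v0 + v) * ((or \<bullet> U) + (or \<bullet> V)) + \<tau> (v0 + v) * ((U \<bullet> U) / 2 + (U \<bullet> V) + (V \<bullet> V) / 2)"
    proof -
      have "y + z = (U + V, w + g)" by (simp add: U_def V_def w_def g_def prod_eq_iff)
      hence "H (y + z) = f (v0 + v) + e (v0 + v) * (w + g) + \<kappa> (v0 + v) * (w + g)\<^sup>2 / 2
        + t (v0 + v) * (or \<bullet> (U + V)) + \<tau> (v0 + v) * ((U + V) \<bullet> (U + V)) / 2"
        by (simp only: H_eq) (simp add: U_def V_def v0_def v_def)
      thus ?thesis by (simp add: inner_add_right inner_add_left inner_commute[of V U] power2_eq_square field_simps)
    qed
    have Hy: "H y = f v0 + e v0 * w + \<kappa> v0 * (w\<^sup>2 / 2) + t v0 * (or \<bullet> U) + \<tau> v0 * ((U \<bullet> U) / 2)"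
      using H_eq[of "fst y" "snd y"] by (simp add: U_def w_def v0_def)
    have DHy: "DH y z = deriv f v0 * v + (deriv e v0 * v * w + e v0 * g) + (deriv \<kappa> v0 * v * (w\<^sup>2 / 2) + \<kappa> v0 * (w * g))
        + (deriv t v0 * v * (or \<bullet> U) + t v0 * (or \<bullet> V)) + (deriv \<tau> v0 * v * ((U \<bullet> U) / 2) + \<tau> v0 * (U \<bullet> V))"
      by (simp add: DH_def EU_def U_def[symmetric] V_def[symmetric] w_def[symmetric] g_def[symmetric] v0_def[symmetric] inner_add_left inner_axis' algebra_simps)
         (simp add: v0_def v_def U_def V_def algebra_simps)
    have D2y: "D2H y z / 2 = deriv (deriv f) v0 * v\<^sup>2 / 2 + (deriv (deriv e) v0 * v\<^sup>2 * w / 2 + deriv e v0 * v * g)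
        + (deriv (deriv \<kappa>) v0 * v\<^sup>2 * (w\<^sup>2 / 2) / 2 + deriv \<kappa> v0 * v * (w * g) + \<kappa> v0 * (g\<^sup>2 / 2))
        + (deriv (deriv t) v0 * v\<^sup>2 * (or \<bullet> U) / 2 + deriv t v0 * v * (or \<bullet> V))
        + (deriv (deriv \<tau>) v0 * v\<^sup>2 * ((U \<bullet> U) / 2) / 2 + deriv \<tau> v0 * v * (U \<bullet> V) + \<tau> v0 * ((V \<bullet> V) / 2))"
      unfolding D2H_def Let_def U_def V_def w_def g_def v0_def v_def by (simp add: field_simps)
    have sum: "5 * Cf * D * (\<bar>v\<bar> * (norm z)\<^sup>2) + 5 * Ce * D * (\<bar>v\<bar> * (norm z)\<^sup>2) + 5 * Ck * D * (\<bar>v\<bar> * (norm z)\<^sup>2)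
       + 5 * Ct * D * (\<bar>v\<bar> * (norm z)\<^sup>2) + 5 * Cu * D * (\<bar>v\<bar> * (norm z)\<^sup>2) = C * (\<bar>v\<bar> * (norm z)\<^sup>2)"
      by (simp add: C_def algebra_simps)
    have abs5: "\<bar>a1 + a2 + a3 + a4 + a5\<bar> \<le> A1 + A2 + A3 + A4 + A5"
      if "\<bar>a1\<bar> \<le> A1" "\<bar>a2\<bar> \<le> A2" "\<bar>a3\<bar> \<le> A3" "\<bar>a4\<bar> \<le> A4" "\<bar>a5\<bar> \<le> A5"
      for a1 a2 a3 a4 a5 A1 A2 A3 A4 A5 :: real
      by (intro order_trans[OF abs_triangle_ineq] add_mono that)
    show "\<bar>H (y + z) - H y - DH y z - D2H y z / 2\<bar> \<le> C * (\<bar>fst z $ iv\<bar> * (norm z)\<^sup>2)"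
      unfolding v_def[symmetric] sum[symmetric] Hyz Hy DHy D2y
      by (rule order_trans[OF eq_refl abs5[OF 1 2 3 4 5]], rule arg_cong[of _ _ abs])
         (simp add: field_simps)
  qed
qed

end

section \<open>Calculus of smooth families\<close>

definition dd :: "'a::real_normed_vector \<Rightarrow> ('a \<Rightarrow> 'b::real_normed_vector) \<Rightarrow> 'a \<Rightarrow> 'b"
  where "dd h f = (\<lambda>x. frechet_derivative f (at x) h)"

lemma smooth_on_has_derivative:
  assumes "smooth_on S f" "x \<in> S"
  shows "(f has_derivative (\<lambda>h. dd h f x)) (at x)"
proof -
  have "Ck_on (Suc 0) S f" using assms(1) unfolding smooth_on_def by blast
  hence "f differentiable (at x)" using assms(2) by simp
  thus ?thesis unfolding dd_def by (simp add: frechet_derivative_works[symmetric])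
qed

lemma smooth_on_dd: "smooth_on S f \<Longrightarrow> smooth_on S (dd h f)"
  unfolding smooth_on_def dd_def by (metis Ck_on.simps(2))

lemma smooth_on_continuous: "smooth_on S f \<Longrightarrow> continuous_on S f"
  unfolding smooth_on_def by (metis Ck_on.simps(1))

lemma dd_linear:
  assumes "smooth_on S f" "x \<in> S"
  shows "dd (a + b) f x = dd a f x + dd b f x" "dd (r *\<^sub>R a) f x = r *\<^sub>R dd a f x"
proof -
  have l: "linear (\<lambda>h. dd h f x)" by (rule has_derivative_linear[OF smooth_on_has_derivative[OF assms]])
  show "dd (a + b) f x = dd a f x + dd b f x" "dd (r *\<^sub>R a) f x = r *\<^sub>R dd a f x"
    using linear_add[OF l, of a b] linear_scale[OF l, of r a] by simp_all
qed

lemma smooth_on_curve: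
  assumes f: "smooth_on S f" "c s \<in> S" and c: "(c has_vector_derivative c') (at s)"
  shows "((\<lambda>s. f (c s)) has_vector_derivative dd c' f (c s)) (at s)"
proof -
  have "((\<lambda>s. f (c s)) has_derivative (\<lambda>h. dd (h *\<^sub>R c') f (c s))) (at s)"
    using has_derivative_compose[OF c[unfolded has_vector_derivative_def] smooth_on_has_derivative[OF f]] .
  moreover have "(\<lambda>h. dd (h *\<^sub>R c') f (c s)) = (\<lambda>h. h *\<^sub>R dd c' f (c s))"
    using dd_linear(2)[OF f] by blast
  ultimately show ?thesis by (simp add: has_vector_derivative_def)
qed

lemma smooth_on_line:
  assumes f: "smooth_on S f" "x + s *\<^sub>R h \<in> S"
  shows "((\<lambda>s. f (x + s *\<^sub>R h)) has_vector_derivative dd h f (x + s *\<^sub>R h)) (at s)"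
  by (rule smooth_on_curve[OF f(1), of "\<lambda>s. x + s *\<^sub>R h"]) (use f in \<open>auto intro!: derivative_eq_intros\<close>)

text \<open>Both iterated derivatives are derivatives of \<open>t \<mapsto> dd h f (x + t k)\<close> at \<open>0\<close>: one by definition, the other by
differentiating \<open>f (x + s h + t k) - f (x + s h) = \<integral> dd k f\<close> under the integral sign.\<close>

theorem dd_commute:
  fixes f :: "'a::real_normed_vector \<Rightarrow> 'b::euclidean_space"
  assumes S: "open S" and f: "smooth_on S f" and x: "x \<in> S"
  shows "dd h (dd k f) x = dd k (dd h f) x"
proof -
  define F where "F = (\<lambda>(s, t). x + s *\<^sub>R h + t *\<^sub>R k)"
  have Fc: "continuous_on UNIV F" unfolding F_def split_beta by (intro continuous_intros)
  have "open (F -` S)" by (rule open_vimage[OF S Fc])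
  moreover have "(0, 0) \<in> F -` S" using x by (simp add: F_def)
  ultimately obtain A B where AB: "open A" "open B" "(0::real) \<in> A" "(0::real) \<in> B" "A \<times> B \<subseteq> F -` S"
    by (auto elim!: open_prod_elim)
  obtain a where a: "0 < a" "cball 0 a \<subseteq> A" using AB open_contains_cball by blast
  obtain b where b: "0 < b" "cball 0 b \<subseteq> B" using AB open_contains_cball by blast
  define \<delta> where "\<delta> = min a b"
  have \<delta>: "0 < \<delta>" using a b by (simp add: \<delta>_def)
  have inS: "x + s *\<^sub>R h + t *\<^sub>R k \<in> S" if "\<bar>s\<bar> \<le> \<delta>" "\<bar>t\<bar> \<le> \<delta>" for s t
  proof -
    have "s \<in> A" "t \<in> B" using a b that by (auto simp: \<delta>_def subset_iff)
    thus ?thesis using AB(5) by (auto simp: F_def)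
  qed
  note dk = smooth_on_dd[OF f, of k] and dh = smooth_on_dd[OF f, of h]
  note dhk = smooth_on_dd[OF dk, of h] and dkh = smooth_on_dd[OF dh, of k]
  have FTC: "integral (cbox 0 t) (\<lambda>r. dd k f (x + s *\<^sub>R h + r *\<^sub>R k)) = f (x + s *\<^sub>R h + t *\<^sub>R k) - f (x + s *\<^sub>R h)"
    if "\<bar>s\<bar> \<le> \<delta>" "0 \<le> t" "t \<le> \<delta>" for s t
  proof -
    have "((\<lambda>r. dd k f (x + s *\<^sub>R h + r *\<^sub>R k)) has_integral (f (x + s *\<^sub>R h + t *\<^sub>R k) - f (x + s *\<^sub>R h + 0 *\<^sub>R k))) {0..t}"
    proof (rule fundamental_theorem_of_calculus[OF that(2)])
      fix r assume r: "r \<in> {0..t}"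
      have "(x + s *\<^sub>R h) + r *\<^sub>R k \<in> S" by (rule inS) (use that r in auto)
      from smooth_on_line[OF f this]
      show "((\<lambda>r. f (x + s *\<^sub>R h + r *\<^sub>R k)) has_vector_derivative dd k f (x + s *\<^sub>R h + r *\<^sub>R k)) (at r within {0..t})"
        by (rule has_vector_derivative_at_within)
    qed
    thus ?thesis by (simp add: integral_unique cbox_interval)
  qed
  have cont: "continuous_on ({-\<delta>..\<delta>} \<times> cbox 0 t) (\<lambda>(s, r). g (x + s *\<^sub>R h + r *\<^sub>R k))"
    if "continuous_on S g" "t \<le> \<delta>" for g :: "'a \<Rightarrow> 'b" and t
    unfolding split_beta
    by (rule continuous_on_compose2[OF that(1)]) (use inS that(2) in \<open>auto intro!: continuous_intros\<close>)
  have main: "dd h f (x + t *\<^sub>R k) - dd h f x = integral (cbox 0 t) (\<lambda>r. dd h (dd k f) (x + r *\<^sub>R k))"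
    if t: "0 \<le> t" "t \<le> \<delta>" for t
  proof -
    have "((\<lambda>s. integral (cbox 0 t) (\<lambda>r. dd k f (x + s *\<^sub>R h + r *\<^sub>R k))) has_vector_derivative
        integral (cbox 0 t) (\<lambda>r. dd h (dd k f) (x + 0 *\<^sub>R h + r *\<^sub>R k))) (at 0 within {-\<delta>..\<delta>})"
    proof (rule leibniz_rule_vector_derivative)
      fix s r assume sr: "s \<in> {-\<delta>..\<delta>}" "r \<in> cbox 0 t"
      have eq: "(x + r *\<^sub>R k) + s *\<^sub>R h = x + s *\<^sub>R h + r *\<^sub>R k" for s by simp
      have "(x + r *\<^sub>R k) + s *\<^sub>R h \<in> S" unfolding eq by (rule inS) (use sr t in auto)
      from smooth_on_line[OF dk this]
      show "((\<lambda>s. dd k f (x + s *\<^sub>R h + r *\<^sub>R k)) has_vector_derivative dd h (dd k f) (x + s *\<^sub>R h + r *\<^sub>R k)) (at s within {-\<delta>..\<delta>})"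
        unfolding eq by (rule has_vector_derivative_at_within)
    next
      show "(\<lambda>r. dd k f (x + s *\<^sub>R h + r *\<^sub>R k)) integrable_on cbox 0 t" if "s \<in> {-\<delta>..\<delta>}" for s
      proof (rule integrable_continuous)
        show "continuous_on (cbox 0 t) (\<lambda>r. dd k f (x + s *\<^sub>R h + r *\<^sub>R k))"
          by (rule continuous_on_compose2[OF smooth_on_continuous[OF dk]]) (use inS that t in \<open>auto intro!: continuous_intros\<close>)
      qed
    next
      show "continuous_on ({-\<delta>..\<delta>} \<times> cbox 0 t) (\<lambda>(s, r). dd h (dd k f) (x + s *\<^sub>R h + r *\<^sub>R k))"
        by (rule cont[OF smooth_on_continuous[OF dhk] t(2)])
    qed (use \<delta> in auto)
    moreover have at0: "at (0::real) within {-\<delta>..\<delta>} = at 0" using \<delta> by (intro at_within_interior) auto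
    ultimately have 1: "((\<lambda>s. integral (cbox 0 t) (\<lambda>r. dd k f (x + s *\<^sub>R h + r *\<^sub>R k))) has_vector_derivative
        integral (cbox 0 t) (\<lambda>r. dd h (dd k f) (x + r *\<^sub>R k))) (at 0)" by simp
    have V1: "((\<lambda>s. f (x + s *\<^sub>R h + t *\<^sub>R k) - f (x + s *\<^sub>R h)) has_vector_derivative
        integral (cbox 0 t) (\<lambda>r. dd h (dd k f) (x + r *\<^sub>R k))) (at 0)"
    proof (rule has_vector_derivative_transform_within_open[OF 1, of "{-\<delta><..<\<delta>}"])
      show "integral (cbox 0 t) (\<lambda>r. dd k f (x + s *\<^sub>R h + r *\<^sub>R k)) = f (x + s *\<^sub>R h + t *\<^sub>R k) - f (x + s *\<^sub>R h)"
        if "s \<in> {-\<delta><..<\<delta>}" for s using that t by (intro FTC) auto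
    qed (use \<delta> in auto)
    have V2: "((\<lambda>s. f (x + s *\<^sub>R h + t *\<^sub>R k) - f (x + s *\<^sub>R h)) has_vector_derivative
        dd h f ((x + t *\<^sub>R k) + 0 *\<^sub>R h) - dd h f (x + 0 *\<^sub>R h)) (at 0)"
    proof (rule has_vector_derivative_diff)
      have eq: "(x + t *\<^sub>R k) + s *\<^sub>R h = x + s *\<^sub>R h + t *\<^sub>R k" for s by simp
      have "(x + t *\<^sub>R k) + 0 *\<^sub>R h \<in> S" using inS[of 0 t] t \<delta> by simp
      from smooth_on_line[OF f this]
      show "((\<lambda>s. f (x + s *\<^sub>R h + t *\<^sub>R k)) has_vector_derivative dd h f ((x + t *\<^sub>R k) + 0 *\<^sub>R h)) (at 0)"
        unfolding eq .
      show "((\<lambda>s. f (x + s *\<^sub>R h)) has_vector_derivative dd h f (x + 0 *\<^sub>R h)) (at 0)"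
        by (rule smooth_on_line[OF f]) (use x in auto)
    qed
    show ?thesis using vector_derivative_unique_at[OF V1 V2] by simp
  qed
  have c1: "continuous_on {0..\<delta>} (\<lambda>r. dd h (dd k f) (x + r *\<^sub>R k))"
    by (rule continuous_on_compose2[OF smooth_on_continuous[OF dhk]]) (use inS[of 0] \<delta> in \<open>auto intro!: continuous_intros\<close>)
  have "((\<lambda>t. dd h f x + integral {0..t} (\<lambda>r. dd h (dd k f) (x + r *\<^sub>R k))) has_vector_derivative 0 + dd h (dd k f) (x + 0 *\<^sub>R k)) (at 0 within {0..\<delta>})"
    by (intro has_vector_derivative_add has_vector_derivative_const integral_has_vector_derivative[OF c1]) (use \<delta> in auto)
  hence V0: "((\<lambda>t. dd h f x + integral {0..t} (\<lambda>r. dd h (dd k f) (x + r *\<^sub>R k))) has_vector_derivative dd h (dd k f) x) (at 0 within {0..\<delta>})"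
    by simp
  have V1: "((\<lambda>t. dd h f (x + t *\<^sub>R k)) has_vector_derivative dd h (dd k f) x) (at 0 within {0..\<delta>})"
  proof (rule has_vector_derivative_transform[OF _ _ V0])
    show "dd h f (x + t *\<^sub>R k) = dd h f x + integral {0..t} (\<lambda>r. dd h (dd k f) (x + r *\<^sub>R k))" if "t \<in> {0..\<delta>}" for t
      using main[of t] that by (simp add: cbox_interval algebra_simps)
  qed (use \<delta> in auto)
  have V2: "((\<lambda>t. dd h f (x + t *\<^sub>R k)) has_vector_derivative dd k (dd h f) (x + 0 *\<^sub>R k)) (at 0 within {0..\<delta>})"
  proof -
    have "x + 0 *\<^sub>R k \<in> S" using x by simp
    from smooth_on_line[OF dh this] show ?thesis by (rule has_vector_derivative_at_within)
  qed
  have "at (0::real) within {0..\<delta>} \<noteq> bot" using at_within_Icc_at_right[OF \<delta>] by simp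
  from vector_derivative_unique_within[OF this V1 V2] show ?thesis by simp
qed

lemma smooth_line_real:
  fixes F :: "'a::real_normed_vector \<Rightarrow> real"
  assumes F: "smooth_on UNIV F"
  shows "((\<lambda>v. F (a + v *\<^sub>R d)) has_real_derivative dd d F (a + v *\<^sub>R d)) (at v)"
    "continuous_on UNIV (\<lambda>v. F (a + v *\<^sub>R d))"
proof -
  show "((\<lambda>v. F (a + v *\<^sub>R d)) has_real_derivative dd d F (a + v *\<^sub>R d)) (at v)" for v
    using smooth_on_line[OF F, of a v d] by (simp add: has_real_derivative_iff_has_vector_derivative)
  thus "continuous_on UNIV (\<lambda>v. F (a + v *\<^sub>R d))" by (meson DERIV_isCont continuous_at_imp_continuous_on)
qed

theorem Leibniz_moving_endpoint:
  fixes \<gamma> \<gamma>s :: "real \<Rightarrow> real \<Rightarrow> real"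
  assumes \<delta>: "0 < \<delta>" and X: "0 < X 0" and X': "(X has_real_derivative X') (at 0)"
    and d: "\<And>s x. \<bar>s\<bar> < \<delta> \<Longrightarrow> ((\<lambda>s. \<gamma> s x) has_real_derivative \<gamma>s s x) (at s)"
    and c: "continuous_on ({-\<delta><..<\<delta>} \<times> UNIV) (\<lambda>(s, x). \<gamma> s x)"
    and cs: "continuous_on ({-\<delta><..<\<delta>} \<times> UNIV) (\<lambda>(s, x). \<gamma>s s x)"
  shows "((\<lambda>s. integral {0..X s} (\<gamma> s)) has_real_derivative integral {0..X 0} (\<gamma>s 0) + \<gamma> 0 (X 0) * X') (at 0)"
proof -
  define A B where "A = {-\<delta><..<\<delta>}" and "B = {0<..<X 0 + 1}"
  have ABo: "open A" "open B" "0 \<in> A" "X 0 \<in> B" using \<delta> X by (auto simp: A_def B_def)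
  have c1: "continuous_on UNIV (\<gamma> s)" if "s \<in> A" for s
  proof -
    have "continuous_on UNIV (\<lambda>x. case (s, x) of (s, x) \<Rightarrow> \<gamma> s x)"
      by (rule continuous_on_compose2[OF c]) (use that in \<open>auto simp: A_def intro: continuous_on_Pair continuous_on_const continuous_on_id\<close>)
    thus ?thesis by simp
  qed
  have fx: "((\<lambda>s. integral {0..X 0} (\<gamma> s)) has_derivative (\<lambda>h. integral {0..X 0} (\<gamma>s 0) * h)) (at 0 within A)"
  proof -
    have "((\<lambda>s. integral (cbox 0 (X 0)) (\<gamma> s)) has_field_derivative integral (cbox 0 (X 0)) (\<gamma>s 0)) (at 0 within A)"
    proof (rule leibniz_rule_field_derivative)
      show "((\<lambda>s. \<gamma> s t) has_real_derivative \<gamma>s s t) (at s within A)" if "s \<in> A" for s t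
        using d[of s t] that by (auto simp: A_def abs_less_iff intro: has_field_derivative_at_within)
      show "\<gamma> s integrable_on cbox 0 (X 0)" if "s \<in> A" for s
        using c1[OF that] by (intro integrable_continuous) (auto intro: continuous_on_subset)
      show "continuous_on (A \<times> cbox 0 (X 0)) (\<lambda>(s, t). \<gamma>s s t)"
        by (rule continuous_on_subset[OF cs]) (auto simp: A_def)
    qed (use ABo in \<open>auto simp: A_def\<close>)
    thus ?thesis by (simp add: has_field_derivative_def cbox_interval mult_commute_abs)
  qed
  have fy: "((\<lambda>y. integral {0..y} (\<gamma> s)) has_derivative blinfun_apply (blinfun_mult_right (\<gamma> s y))) (at y within B)"
    if "s \<in> A" "y \<in> B" for s y
  proof -
    have "((\<lambda>y. integral {0..y} (\<gamma> s)) has_real_derivative \<gamma> s y) (at y within {0..X 0 + 1})"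
      by (rule integral_has_real_derivative) (use that in \<open>auto simp: B_def intro: continuous_on_subset[OF c1]\<close>)
    hence "((\<lambda>y. integral {0..y} (\<gamma> s)) has_real_derivative \<gamma> s y) (at y within B)"
      by (rule has_field_derivative_subset) (auto simp: B_def)
    thus ?thesis by (simp add: has_field_derivative_def blinfun_mult_right.rep_eq)
  qed
  have cc: "continuous (at (0, X 0) within A \<times> B) (\<lambda>(s, y). blinfun_mult_right (\<gamma> s y))"
  proof -
    have "continuous_on (A \<times> B) (\<lambda>z. \<gamma> (fst z) (snd z))"
      using continuous_on_subset[OF c, of "A \<times> B"] by (auto simp: A_def split_beta)
    hence "continuous_on (A \<times> B) (\<lambda>(s, y). blinfun_mult_right (\<gamma> s y))"
      unfolding split_beta by (intro bounded_linear.continuous_on[OF bounded_linear_blinfun_mult_right])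
    thus ?thesis using ABo by (simp add: continuous_on_eq_continuous_within)
  qed
  have "((\<lambda>(s, y). integral {0..y} (\<gamma> s)) has_derivative (\<lambda>(ts, ty). integral {0..X 0} (\<gamma>s 0) * ts + blinfun_apply (blinfun_mult_right (\<gamma> 0 (X 0))) ty)) (at (0, X 0) within A \<times> B)"
    by (rule has_derivative_partialsI[OF fx fy cc ABo(4)]) (auto simp: B_def)
  moreover have "at (0, X 0) within A \<times> B = at (0, X 0)" using ABo by (intro at_within_open) (auto intro: open_Times)
  ultimately have P: "((\<lambda>(s, y). integral {0..y} (\<gamma> s)) has_derivative (\<lambda>(ts, ty). integral {0..X 0} (\<gamma>s 0) * ts + \<gamma> 0 (X 0) * ty)) (at (0, X 0))"
    by (simp add: blinfun_mult_right.rep_eq)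
  have "((\<lambda>s. (s, X s)) has_derivative (\<lambda>h. (h, X' * h))) (at 0)"
    using X' by (auto intro!: derivative_eq_intros simp: has_field_derivative_def)
  from has_derivative_compose[OF this P]
  have "((\<lambda>s. integral {0..X s} (\<gamma> s)) has_derivative (\<lambda>h. integral {0..X 0} (\<gamma>s 0) * h + \<gamma> 0 (X 0) * (X' * h))) (at 0)"
    by simp
  thus ?thesis unfolding has_field_derivative_def
    by (rule has_derivative_eq_rhs) (auto simp: fun_eq_iff algebra_simps)
qed

section \<open>Families of periodic waves\<close>

text \<open>Directions \<open>(d, \<xi>)\<close> in the space of parameters and positions are treated uniformly: \<open>dd (d, 0) u\<close> is a parameter
derivative of the wave, \<open>dd (0, 1) u\<close> its derivative in \<open>x\<close>.\<close>

locale wave_family = ham_form iv H B f e \<kappa> \<tau> t or k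
  for iv :: "'n::finite" and H B f e \<kappa> \<tau> t or k +
  fixes \<Omega> :: "'n param set" and U :: "'n param \<Rightarrow> real \<Rightarrow> real ^ 'n" and \<Xi> :: "'n param \<Rightarrow> real"
  assumes \<Omega>_open: "open \<Omega>" and \<Xi>_smooth: "smooth_on \<Omega> \<Xi>"
    and U_smooth: "smooth_on (\<Omega> \<times> UNIV) (\<lambda>(p, x). U p x)"
    and \<Xi>_pos: "\<And>p. p \<in> \<Omega> \<Longrightarrow> 0 < \<Xi> p" and U_per: "\<And>p. p \<in> \<Omega> \<Longrightarrow> periodic (\<Xi> p) (U p)"
    and euler_eq: "\<And>p x. p \<in> \<Omega> \<Longrightarrow> euler (ham_impulse iv H B (snd (snd p))) (U p) x + fst (snd p) = 0"
    and legendre_eq: "\<And>p x. p \<in> \<Omega> \<Longrightarrow> legendre (lagrangian iv H B (snd (snd p)) (fst (snd p))) (U p) x = fst p"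
    and turning: "\<And>p. p \<in> \<Omega> \<Longrightarrow> deriv (\<lambda>x. U p x $ iv) 0 = 0"
    and \<Xi>_mu: "\<And>p. p \<in> \<Omega> \<Longrightarrow> dir_deriv \<Xi> mu_dir p \<noteq> 0"
begin

definition u :: "'n param \<times> real \<Rightarrow> real ^ 'n" where "u = (\<lambda>(p, x). U p x)"
definition ux where "ux = dd (0, 1) u"
definition uxx where "uxx = dd (0, 1) ux"

abbreviation S where "S \<equiv> \<Omega> \<times> (UNIV :: real set)"

lemma u_apply: "u (p, x) = U p x" by (simp add: u_def)
lemma S_open: "open S" by (intro open_Times \<Omega>_open) simp
lemma u_smooth: "smooth_on S u" using U_smooth by (simp add: u_def)
lemma ux_smooth: "smooth_on S ux" unfolding ux_def by (rule smooth_on_dd[OF u_smooth])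
lemma uxx_smooth: "smooth_on S uxx" unfolding uxx_def by (rule smooth_on_dd[OF ux_smooth])
lemmas duD_smooth = smooth_on_dd[OF u_smooth] smooth_on_dd[OF ux_smooth] smooth_on_dd[OF uxx_smooth]

lemma x_derivative:
  assumes g: "smooth_on S g" and p: "p \<in> \<Omega>"
  shows "((\<lambda>y. g (p, y)) has_vector_derivative dd (0, 1) g (p, x)) (at x)"
proof (rule smooth_on_curve[OF g])
  show "((\<lambda>y. (p, y)) has_vector_derivative (0, 1)) (at x)"
    by (auto intro!: derivative_eq_intros has_vector_derivative_Pair)
qed (use p in auto)

lemma x_continuous:
  assumes g: "smooth_on S g" and p: "p \<in> \<Omega>"
  shows "continuous_on A (\<lambda>y. g (p, y))"
  by (rule continuous_on_compose2[OF smooth_on_continuous[OF g]])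
     (use p in \<open>auto intro!: continuous_intros\<close>)

lemma u_x: "p \<in> \<Omega> \<Longrightarrow> ((\<lambda>y. u (p, y)) has_vector_derivative ux (p, x)) (at x)"
  unfolding ux_def by (rule x_derivative[OF u_smooth])

lemma ux_x: "p \<in> \<Omega> \<Longrightarrow> ((\<lambda>y. ux (p, y)) has_vector_derivative uxx (p, x)) (at x)"
  unfolding uxx_def by (rule x_derivative[OF ux_smooth])

lemma dd_u_x: "p \<in> \<Omega> \<Longrightarrow> ((\<lambda>y. dd D u (p, y)) has_vector_derivative dd D ux (p, x)) (at x)"
  using x_derivative[OF duD_smooth(1)[of D], of p x] dd_commute[OF S_open u_smooth, of "(p, x)" "(0, 1)" D] by (simp add: ux_def)

lemma dd_ux_x: "p \<in> \<Omega> \<Longrightarrow> ((\<lambda>y. dd D ux (p, y)) has_vector_derivative dd D uxx (p, x)) (at x)"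
  using x_derivative[OF duD_smooth(2)[of D], of p x] dd_commute[OF S_open ux_smooth, of "(p, x)" "(0, 1)" D] by (simp add: uxx_def)

lemmas u_x_comp = has_derivative_inner_vec(2)[OF u_x] and ux_x_comp = has_derivative_inner_vec(2)[OF ux_x]
lemmas dd_u_x_comp = has_derivative_inner_vec(2)[OF dd_u_x] and dd_ux_x_comp = has_derivative_inner_vec(2)[OF dd_ux_x]

lemma U_fun: "U p = (\<lambda>y. u (p, y))" by (simp add: u_apply)

lemma profile_euler:
  assumes p: "p \<in> \<Omega>"
  shows "EL (u (p, x)) (ux (p, x) $ iv) (uxx (p, x) $ iv) (snd (snd p)) + fst (snd p) = 0"
  using euler_eq[OF p, of x] euler_formula[OF u_x_comp[OF p] ux_x_comp[OF p], of "snd (snd p)" x]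
  by (simp add: U_fun)

abbreviation vb where "vb p x \<equiv> u (p, x) $ iv"
abbreviation wb where "wb p x \<equiv> ux (p, x) $ iv"
abbreviation wb' where "wb' p x \<equiv> uxx (p, x) $ iv"

text \<open>By the Euler equation; the right-hand side is the total derivative of \<open>\<partial>\<H>/\<partial>v\<^sub>x\<close> along the wave.\<close>

lemma EU_flux:
  assumes p: "p \<in> \<Omega>"
  shows "EU (u (p, x)) (wb p x) (snd (snd p)) + fst (snd p) =
   (deriv e (vb p x) * wb p x + deriv \<kappa> (vb p x) * (wb p x)\<^sup>2 + \<kappa> (vb p x) * wb' p x) *\<^sub>R axis iv 1"
proof -
  have l: "fst (snd p) = - EL (u (p, x)) (wb p x) (wb' p x) (snd (snd p))"
    unfolding eq_neg_iff_add_eq_0 using profile_euler[OF p, of x] by (simp only: add.commute)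
  show ?thesis unfolding l EU_def EL_def diff_conv_add_uminus[symmetric] add_diff_add diff_self add_0_right scaleR_diff_left[symmetric]
    by (rule arg_cong[of _ _ "\<lambda>r. r *\<^sub>R axis iv 1"]) (simp add: algebra_simps)
qed

text \<open>\<open>qd d\<close> is the derivative of \<open>c Q + \<lambda> \<bullet> U\<close> with respect to the parameters in the direction \<open>d\<close>, and \<open>grad d\<close> its
gradient in \<open>U\<close>.\<close>

definition grad :: "'n param \<Rightarrow> real ^ 'n \<Rightarrow> real ^ 'n"
  where "grad d y = snd (snd d) *\<^sub>R ((y $ iv) *\<^sub>R k + (k \<bullet> y) *\<^sub>R axis iv 1) + fst (snd d)"

definition qd :: "'n param \<Rightarrow> real ^ 'n \<Rightarrow> real"
  where "qd d y = fst (snd d) \<bullet> y + snd (snd d) * ((y $ iv) * (k \<bullet> y))"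

definition nx :: "'n param \<Rightarrow> real \<Rightarrow> real ^ 'n"
  where "nx p x = nvec (u (p, x)) (wb p x) (wb' p x) (snd (snd p))"

lemma line_in_S:
  assumes "p \<in> \<Omega>"
  obtains \<delta> where "0 < \<delta>" "\<And>s. \<bar>s\<bar> < \<delta> \<Longrightarrow> (p, x) + s *\<^sub>R D \<in> S"
proof -
  have "open ((\<lambda>s::real. (p, x) + s *\<^sub>R D) -` S)" by (rule open_vimage[OF S_open]) (intro continuous_intros)
  moreover have "0 \<in> (\<lambda>s::real. (p, x) + s *\<^sub>R D) -` S" using assms by simp
  ultimately obtain \<delta> where "0 < \<delta>" "ball 0 \<delta> \<subseteq> (\<lambda>s::real. (p, x) + s *\<^sub>R D) -` S" by (meson openE)
  thus ?thesis by (intro that[of \<delta>]) (auto simp: subset_iff dist_real_def)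
qed

lemma derivative_of_constant:
  fixes g :: "real \<Rightarrow> real"
  assumes "(g has_real_derivative g') (at 0)" "0 < \<delta>" "\<And>s. \<bar>s\<bar> < \<delta> \<Longrightarrow> g s = c0"
  shows "g' = 0"
proof -
  have "((\<lambda>s. c0) has_real_derivative g') (at 0)"
    by (rule has_field_derivative_transform_within_open[OF assms(1), of "{-\<delta><..<\<delta>}"]) (use assms in auto)
  thus ?thesis using DERIV_unique[OF _ DERIV_const] by blast
qed

lemma D_line:
  assumes p: "p \<in> \<Omega>" and g: "smooth_on S g"
  shows "((\<lambda>s. g ((p, x) + s *\<^sub>R D)) has_vector_derivative dd D g (p, x)) (at 0)"
proof -
  have "(p, x) + 0 *\<^sub>R D \<in> S" using p by simp
  from smooth_on_line[OF g this] show ?thesis by simp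
qed

text \<open>The derivative of the Euler equation: \<open>\<A> (dd (d, \<xi>) u) = - grad d\<close>. It yields the kernel elements \<open>U\<^sub>x\<close> and
\<open>U\<^sub>\<mu>\<close> as well as the tangent vectors of the family.\<close>

theorem linearised_profile:
  assumes p: "p \<in> \<Omega>"
  shows "\<tau> (vb p x) *\<^sub>R dd (d, \<xi>) u (p, x) + (dd (d, \<xi>) u (p, x) $ iv) *\<^sub>R nx p x
    + (nx p x \<bullet> dd (d, \<xi>) u (p, x)) *\<^sub>R axis iv 1
    - (deriv \<kappa> (vb p x) * wb p x * dd (d, \<xi>) ux (p, x) $ iv + \<kappa> (vb p x) * dd (d, \<xi>) uxx (p, x) $ iv) *\<^sub>R axis iv 1
    + grad d (u (p, x)) = 0" (is "?E = 0")
proof -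
  define D where "D = (d, \<xi>)"
  obtain \<delta> where \<delta>: "0 < \<delta>" "\<And>s. \<bar>s\<bar> < \<delta> \<Longrightarrow> (p, x) + s *\<^sub>R D \<in> S" by (rule line_in_S[OF p]) blast
  note 1 = D_line[OF p u_smooth, of x D] and 2 = has_derivative_inner_vec(2)[OF D_line[OF p ux_smooth, of x D], of iv]
    and 3 = has_derivative_inner_vec(2)[OF D_line[OF p uxx_smooth, of x D], of iv]
  have 4: "((\<lambda>s. snd (snd p) + s * snd (snd d)) has_real_derivative snd (snd d)) (at 0)"
    by (auto intro!: derivative_eq_intros)
  have "?E $ \<alpha> = 0" for \<alpha>
  proof -
    have "((\<lambda>s. EL (u ((p, x) + s *\<^sub>R D)) (ux ((p, x) + s *\<^sub>R D) $ iv) (uxx ((p, x) + s *\<^sub>R D) $ iv) (snd (snd p) + s * snd (snd d)) $ \<alpha>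
        + (fst (snd p) $ \<alpha> + s * fst (snd d) $ \<alpha>)) has_real_derivative ?E $ \<alpha>) (at 0)"
      by (rule DERIV_cong[OF DERIV_add[OF EL_derivative[OF 1 2 3 4] DERIV_add[OF DERIV_const DERIV_cmult_right[OF DERIV_ident]]]])
        (simp add: D_def nx_def grad_def)
    moreover have "EL (u ((p, x) + s *\<^sub>R D)) (ux ((p, x) + s *\<^sub>R D) $ iv) (uxx ((p, x) + s *\<^sub>R D) $ iv) (snd (snd p) + s * snd (snd d)) $ \<alpha>
        + (fst (snd p) $ \<alpha> + s * fst (snd d) $ \<alpha>) = 0" if "\<bar>s\<bar> < \<delta>" for s
    proof -
      have z: "(p, x) + s *\<^sub>R D = (p + s *\<^sub>R d, x + s * \<xi>)" by (simp add: D_def)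
      have "p + s *\<^sub>R d \<in> \<Omega>" using \<delta>(2)[OF that] by (simp add: z)
      from arg_cong[OF profile_euler[OF this, of "x + s * \<xi>"], of "\<lambda>y. y $ \<alpha>"]
      show ?thesis by (simp add: z)
    qed
    ultimately show ?thesis by (rule derivative_of_constant[OF _ \<delta>(1)])
  qed
  thus ?thesis by (simp only: vec_eq_iff zero_index) blast
qed

lemma dF_dUx_lagrangian: "dF_dUx (lagrangian iv H B c l) \<alpha> y P = dF_dUx (ham_impulse iv H B c) \<alpha> y P"
proof -
  have "((\<lambda>s. ham_impulse iv H B c y (P + s *\<^sub>R axis \<alpha> 1) + l \<bullet> y) has_real_derivative D) (at 0) \<longleftrightarrow>
      ((\<lambda>s. ham_impulse iv H B c y (P + s *\<^sub>R axis \<alpha> 1)) has_real_derivative D) (at 0)" for D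
    using DERIV_add[OF _ DERIV_const[of "l \<bullet> y"]] DERIV_add[OF _ DERIV_const[of "- (l \<bullet> y)"]] by fastforce
  thus ?thesis by (simp add: dF_dUx_def deriv_def lagrangian_def)
qed

lemma profile_legendre:
  assumes p: "p \<in> \<Omega>"
  shows "\<kappa> (vb p x) * (wb p x)\<^sup>2 / 2 - (f (vb p x) + t (vb p x) * (or \<bullet> u (p, x))
     + \<tau> (vb p x) * (u (p, x) \<bullet> u (p, x)) / 2 + snd (snd p) * (vb p x * (k \<bullet> u (p, x))) + fst (snd p) \<bullet> u (p, x)) = fst p"
proof -
  have xd: "x_deriv (U p) x $ iv = wb p x"
    using DERIV_imp_deriv[OF u_x_comp[OF p]] by (simp add: x_deriv_def U_fun)
  have "(\<Sum>\<alpha>\<in>UNIV. x_deriv (U p) x $ \<alpha> * (if \<alpha> = iv then e (U p x $ iv) + \<kappa> (U p x $ iv) * x_deriv (U p) x $ iv else 0))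
      = x_deriv (U p) x $ iv * (e (U p x $ iv) + \<kappa> (U p x $ iv) * x_deriv (U p) x $ iv)"
    by (simp add: if_distrib[of "\<lambda>y. _ * y"] cong: if_cong)
  hence "legendre (lagrangian iv H B (snd (snd p)) (fst (snd p))) (U p) x =
     wb p x * (e (vb p x) + \<kappa> (vb p x) * wb p x)
     - (H (u (p, x), wb p x) + snd (snd p) * (vb p x * (k \<bullet> u (p, x))) + fst (snd p) \<bullet> u (p, x))"
    by (simp only: legendre_def dF_dUx_lagrangian dF_dUx_ham_impulse xd u_apply lagrangian_def ham_impulse_eq)
  thus ?thesis using legendre_eq[OF p, of x] by (simp add: H_eq power2_eq_square algebra_simps)
qed

text \<open>The derivative of the first integral. For \<open>\<mu>\<close> it normalises the Wronskian of \<open>v\<^sub>x\<close> and \<open>v\<^sub>\<mu>\<close> to \<open>1\<close>.\<close>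

theorem linearised_legendre:
  assumes p: "p \<in> \<Omega>"
  shows "\<kappa> (vb p x) * (wb p x * dd (d, \<xi>) ux (p, x) $ iv - wb' p x * dd (d, \<xi>) u (p, x) $ iv)
    = fst d + qd d (u (p, x))"
proof -
  define D where "D = (d, \<xi>)"
  obtain \<delta> where \<delta>: "0 < \<delta>" "\<And>s. \<bar>s\<bar> < \<delta> \<Longrightarrow> (p, x) + s *\<^sub>R D \<in> S" by (rule line_in_S[OF p]) blast
  define y w w' Y W l c where "y = u (p, x)" and "w = wb p x" and "w' = wb' p x"
    and "Y = dd D u (p, x)" and "W = dd D ux (p, x) $ iv" and "l = fst (snd p)" and "c = snd (snd p)"
  define us ws ls where "us s = u ((p, x) + s *\<^sub>R D)" and "ws s = ux ((p, x) + s *\<^sub>R D) $ iv"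
    and "ls s = fst (snd p) + s *\<^sub>R fst (snd d)" for s
  have us: "(us has_vector_derivative Y) (at 0)" "us 0 = y"
    using D_line[OF p u_smooth, of x D] by (auto simp: us_def[abs_def] Y_def y_def)
  have ws: "(ws has_real_derivative W) (at 0)" "ws 0 = w"
    using has_derivative_inner_vec(2)[OF D_line[OF p ux_smooth, of x D], of iv] by (auto simp: ws_def[abs_def] W_def w_def)
  note v = has_derivative_inner_vec[OF us(1)]
  have lu: "((\<lambda>s. ls s \<bullet> us s) has_real_derivative fst (snd d) \<bullet> y + l \<bullet> Y) (at 0)"
  proof -
    have "(ls has_vector_derivative fst (snd d)) (at 0)" unfolding ls_def[abs_def] by (auto intro!: derivative_eq_intros)
    from bounded_bilinear.has_vector_derivative[OF bounded_bilinear_inner this us(1)]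
    show ?thesis by (simp add: has_real_derivative_iff_has_vector_derivative us(2) ls_def l_def add.commute)
  qed
  define L where "L s = \<kappa> (us s $ iv) * (ws s)\<^sup>2 / 2 - (f (us s $ iv) + t (us s $ iv) * (or \<bullet> us s)
     + \<tau> (us s $ iv) * (us s \<bullet> us s) / 2 + (c + s * snd (snd d)) * (us s $ iv * (k \<bullet> us s)) + ls s \<bullet> us s)" for s
  have "((\<lambda>s. L s - s * fst d) has_real_derivative
     (deriv \<kappa> (y $ iv) * Y $ iv * w\<^sup>2 / 2 + \<kappa> (y $ iv) * w * W - (deriv f (y $ iv) * Y $ iv
      + (deriv t (y $ iv) * Y $ iv * (or \<bullet> y) + t (y $ iv) * (or \<bullet> Y))
      + (deriv \<tau> (y $ iv) * Y $ iv * (y \<bullet> y) / 2 + \<tau> (y $ iv) * (y \<bullet> Y))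
      + (snd (snd d) * (y $ iv * (k \<bullet> y)) + c * (Y $ iv * (k \<bullet> y) + y $ iv * (k \<bullet> Y))) + (fst (snd d) \<bullet> y + l \<bullet> Y))) - fst d) (at 0)"
    unfolding L_def
    by (rule smooth[THEN has_real_derivative_comp(1)] v ws lu DERIV_cdivide DERIV_const derivative_eq_intros refl)+
      (simp add: us(2) ws(2) field_simps power2_eq_square)
  moreover have "L s - s * fst d = fst p" if "\<bar>s\<bar> < \<delta>" for s
  proof -
    have z: "(p, x) + s *\<^sub>R D = (p + s *\<^sub>R d, x + s * \<xi>)" by (simp add: D_def)
    have "p + s *\<^sub>R d \<in> \<Omega>" using \<delta>(2)[OF that] by (simp add: z)
    from profile_legendre[OF this, of "x + s * \<xi>"]
    show ?thesis by (simp add: L_def us_def ws_def ls_def z c_def)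
  qed
  ultimately have 1: "(deriv \<kappa> (y $ iv) * Y $ iv * w\<^sup>2 / 2 + \<kappa> (y $ iv) * w * W - (deriv f (y $ iv) * Y $ iv
      + (deriv t (y $ iv) * Y $ iv * (or \<bullet> y) + t (y $ iv) * (or \<bullet> Y))
      + (deriv \<tau> (y $ iv) * Y $ iv * (y \<bullet> y) / 2 + \<tau> (y $ iv) * (y \<bullet> Y))
      + (snd (snd d) * (y $ iv * (k \<bullet> y)) + c * (Y $ iv * (k \<bullet> y) + y $ iv * (k \<bullet> Y))) + (fst (snd d) \<bullet> y + l \<bullet> Y))) - fst d = 0"
    by (rule derivative_of_constant[OF _ \<delta>(1)])
  have "(EL y w w' c + l) \<bullet> Y = 0"
    using profile_euler[OF p, of x] by (simp add: y_def w_def w'_def c_def l_def)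
  hence 2: "(deriv f (y $ iv) - deriv \<kappa> (y $ iv) * w\<^sup>2 / 2 - \<kappa> (y $ iv) * w'
      + deriv t (y $ iv) * (or \<bullet> y) + deriv \<tau> (y $ iv) * (y \<bullet> y) / 2) * Y $ iv + t (y $ iv) * (or \<bullet> Y) + \<tau> (y $ iv) * (y \<bullet> Y)
      + c * (y $ iv * (k \<bullet> Y) + (k \<bullet> y) * Y $ iv) + l \<bullet> Y = 0"
    by (simp add: EL_def inner_add_left inner_axis')
  show ?thesis
    unfolding qd_def D_def[symmetric] y_def[symmetric] w_def[symmetric] w'_def[symmetric] Y_def[symmetric] W_def[symmetric]
    using 1 2 by (simp add: algebra_simps)
qed

text \<open>Differentiation of \<open>g (p, x + \<Xi> p) = g (p, x)\<close>: parameter derivatives are periodic only if the period is stationary.\<close>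

lemma period_derivative:
  assumes p: "p \<in> \<Omega>" and g: "smooth_on S g" and per: "\<And>p x. p \<in> \<Omega> \<Longrightarrow> g (p, x + \<Xi> p) = g (p, x)"
  shows "dd (d, \<xi>) g (p, x + \<Xi> p) + dd d \<Xi> p *\<^sub>R dd (0, 1) g (p, x + \<Xi> p) = dd (d, \<xi>) g (p, x)"
proof -
  obtain \<delta> where \<delta>: "0 < \<delta>" "\<And>s. \<bar>s\<bar> < \<delta> \<Longrightarrow> (p, x) + s *\<^sub>R (d, \<xi>) \<in> S" by (rule line_in_S[OF p]) blast
  have p0: "p + 0 *\<^sub>R d \<in> \<Omega>" using p by simp
  have \<Xi>': "((\<lambda>s. \<Xi> (p + s *\<^sub>R d)) has_vector_derivative dd d \<Xi> p) (at 0)"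
    using smooth_on_line[OF \<Xi>_smooth p0] by simp
  have "((\<lambda>s. (p + s *\<^sub>R d, x + s * \<xi> + \<Xi> (p + s *\<^sub>R d))) has_vector_derivative (d, \<xi> + dd d \<Xi> p)) (at 0)"
    by (intro has_vector_derivative_Pair has_vector_derivative_add \<Xi>') (auto intro!: derivative_eq_intros)
  from smooth_on_curve[OF g _ this] p
  have "((\<lambda>s. g (p + s *\<^sub>R d, x + s * \<xi> + \<Xi> (p + s *\<^sub>R d))) has_vector_derivative dd (d, \<xi> + dd d \<Xi> p) g (p, x + \<Xi> p)) (at 0)"
    by simp
  hence "((\<lambda>s. g ((p, x) + s *\<^sub>R (d, \<xi>))) has_vector_derivative dd (d, \<xi> + dd d \<Xi> p) g (p, x + \<Xi> p)) (at 0)"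
  proof (rule has_vector_derivative_transform_within_open[of _ _ _ "{-\<delta><..<\<delta>}"])
    fix s assume "s \<in> {-\<delta><..<\<delta>}"
    hence "\<bar>s\<bar> < \<delta>" by auto
    from \<delta>(2)[OF this] have "p + s *\<^sub>R d \<in> \<Omega>" by simp
    from per[OF this, of "x + s * \<xi>"]
    show "g (p + s *\<^sub>R d, x + s * \<xi> + \<Xi> (p + s *\<^sub>R d)) = g ((p, x) + s *\<^sub>R (d, \<xi>))" by simp
  qed (use \<delta> in auto)
  from vector_derivative_unique_at[OF this D_line[OF p g]]
  have "dd (d, \<xi> + dd d \<Xi> p) g (p, x + \<Xi> p) = dd (d, \<xi>) g (p, x)" .
  moreover have "(d, \<xi> + dd d \<Xi> p) = (d, \<xi>) + dd d \<Xi> p *\<^sub>R (0, 1)" by simp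
  moreover have z: "(p, x + \<Xi> p) \<in> S" using p by simp
  ultimately show ?thesis
    using dd_linear(1)[OF g z, of "(d, \<xi>)" "dd d \<Xi> p *\<^sub>R (0, 1)"] dd_linear(2)[OF g z, of "dd d \<Xi> p" "(0, 1)"]
    by (simp only:)
qed

lemma dd_zero_\<Xi>: "p \<in> \<Omega> \<Longrightarrow> dd 0 \<Xi> p = 0"
  using dd_linear(2)[OF \<Xi>_smooth, of p 0 0] by simp

lemma u_per: "p \<in> \<Omega> \<Longrightarrow> u (p, x + \<Xi> p) = u (p, x)"
  using U_per[of p] by (simp add: u_apply periodic_def)

lemma ux_per: "p \<in> \<Omega> \<Longrightarrow> ux (p, x + \<Xi> p) = ux (p, x)"
  using period_derivative[OF _ u_smooth u_per, of p 0 1 x] by (simp add: ux_def dd_zero_\<Xi>)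

lemma uxx_per: "p \<in> \<Omega> \<Longrightarrow> uxx (p, x + \<Xi> p) = uxx (p, x)"
  using period_derivative[OF _ ux_smooth ux_per, of p 0 1 x] by (simp add: uxx_def dd_zero_\<Xi>)

lemma dd_u_shift: "p \<in> \<Omega> \<Longrightarrow> dd (d, \<xi>) u (p, x + \<Xi> p) = dd (d, \<xi>) u (p, x) - dd d \<Xi> p *\<^sub>R ux (p, x)"
  using period_derivative[OF _ u_smooth u_per, of p d \<xi> x] ux_per[of p x] by (simp add: ux_def[symmetric] algebra_simps)

lemma dd_ux_shift: "p \<in> \<Omega> \<Longrightarrow> dd (d, \<xi>) ux (p, x + \<Xi> p) = dd (d, \<xi>) ux (p, x) - dd d \<Xi> p *\<^sub>R uxx (p, x)"
  using period_derivative[OF _ ux_smooth ux_per, of p d \<xi> x] uxx_per[of p x] by (simp add: uxx_def[symmetric] algebra_simps)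

lemma ux_0: "p \<in> \<Omega> \<Longrightarrow> ux (p, 0) $ iv = 0"
  using turning[of p] DERIV_imp_deriv[OF u_x_comp[of p iv 0]] by (simp add: U_fun)

lemma dir_deriv_\<Xi>: "p \<in> \<Omega> \<Longrightarrow> dir_deriv \<Xi> d p = dd d \<Xi> p"
  using smooth_on_line[OF \<Xi>_smooth, of p 0 d] unfolding dir_deriv_def
  by (intro DERIV_imp_deriv) (simp add: has_real_derivative_iff_has_vector_derivative)

lemma flux_derivative:
  assumes p: "p \<in> \<Omega>"
  shows "((\<lambda>x. \<kappa> (vb p x) * dd D ux (p, x) $ iv) has_real_derivative
    deriv \<kappa> (vb p x) * wb p x * dd D ux (p, x) $ iv + \<kappa> (vb p x) * dd D uxx (p, x) $ iv) (at x)"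
  by (rule DERIV_cong[OF DERIV_mult[OF has_real_derivative_comp(1)[OF smooth(3) u_x_comp[OF p]] dd_ux_x_comp[OF p]]])
     simp

lemma drop_comp_axis: "drop_comp iv (axis iv 1) = 0"
  by (simp add: drop_comp_def axis_def)

lemma grad_mu: "grad mu_dir y = 0" "grad 0 y = 0"
  by (simp_all add: grad_def mu_dir_def)

lemma linearised_transverse:
  assumes p: "p \<in> \<Omega>" and g: "grad d (u (p, x)) = 0"
  shows "drop_comp iv (dd (d, \<xi>) u (p, x)) = - (dd (d, \<xi>) u (p, x) $ iv / \<tau> (vb p x)) *\<^sub>R drop_comp iv (nx p x)"
proof -
  define Y where "Y = dd (d, \<xi>) u (p, x)"
  have "drop_comp iv (\<tau> (vb p x) *\<^sub>R Y + (Y $ iv) *\<^sub>R nx p x) = 0"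
    using arg_cong[OF linearised_profile[OF p, of x d \<xi>], of "drop_comp iv"] g
    by (simp add: Y_def[symmetric] drop_comp_linear drop_comp_axis) (simp add: drop_comp_def)
  hence "\<tau> (vb p x) *\<^sub>R drop_comp iv Y = - (Y $ iv) *\<^sub>R drop_comp iv (nx p x)"
    by (simp add: drop_comp_linear eq_neg_iff_add_eq_0)
  hence "(1 / \<tau> (vb p x)) *\<^sub>R (\<tau> (vb p x) *\<^sub>R drop_comp iv Y) = (1 / \<tau> (vb p x)) *\<^sub>R (- (Y $ iv) *\<^sub>R drop_comp iv (nx p x))"
    by simp
  thus ?thesis using \<tau>_positive[of "vb p x"] by (simp add: Y_def)
qed

text \<open>The components other than \<open>v\<close> are eliminated by \<open>linearised_transverse\<close>.\<close>

lemma sturm_liouville_equation: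
  assumes p: "p \<in> \<Omega>" and g: "grad d (u (p, x)) = 0"
  shows "((\<lambda>x. \<kappa> (vb p x) * dd (d, \<xi>) ux (p, x) $ iv) has_real_derivative
     reduced_potential iv (\<lambda>x. \<tau> (vb p x)) (nx p) x * dd (d, \<xi>) u (p, x) $ iv) (at x)"
proof (rule DERIV_cong[OF flux_derivative[OF p]])
  define Y n T where "Y = dd (d, \<xi>) u (p, x)" and "n = nx p x" and "T = \<tau> (vb p x)"
  have T: "0 < T" by (simp add: T_def \<tau>_positive)
  have "Y = drop_comp iv Y + Y $ iv *\<^sub>R axis iv 1" by (simp add: drop_comp_def)
  hence "n \<bullet> Y = n \<bullet> drop_comp iv Y + Y $ iv * n $ iv"
    by (metis inner_add_right inner_axis inner_scaleR_right real_inner_1_right)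
  also have "drop_comp iv Y = - (Y $ iv / T) *\<^sub>R drop_comp iv n"
    using linearised_transverse[OF p g, of \<xi>] by (simp add: Y_def n_def T_def)
  also have "n \<bullet> (- (Y $ iv / T) *\<^sub>R drop_comp iv n) = - (Y $ iv / T) * (norm (drop_comp iv n))\<^sup>2"
    using drop_comp_inner(1)[of iv n n] by (simp add: inner_commute power2_norm_eq_inner)
  finally have nY: "n \<bullet> Y = - (Y $ iv / T) * (norm (drop_comp iv n))\<^sup>2 + Y $ iv * n $ iv" .
  have ax: "axis iv (1::real) $ iv = 1" by (simp add: axis_def)
  show "deriv \<kappa> (vb p x) * wb p x * dd (d, \<xi>) ux (p, x) $ iv + \<kappa> (vb p x) * dd (d, \<xi>) uxx (p, x) $ iv
     = reduced_potential iv (\<lambda>x. \<tau> (vb p x)) (nx p) x * dd (d, \<xi>) u (p, x) $ iv"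
    using arg_cong[OF linearised_profile[OF p, of x d \<xi>], of "\<lambda>y. y $ iv"] g
    unfolding reduced_potential_def Y_def[symmetric] n_def[symmetric] T_def[symmetric] nY
    using T by (simp add: ax nY field_simps)
qed

lemma nx_continuous: "p \<in> \<Omega> \<Longrightarrow> continuous_on A (nx p)"
proof -
  assume p: "p \<in> \<Omega>"
  have c: "continuous_on A (\<lambda>x. vb p x)" by (intro continuous_intros x_continuous[OF u_smooth p])
  have g: "continuous_on A (\<lambda>x. g (vb p x))" if "continuous_on UNIV g" for g :: "real \<Rightarrow> real"
    by (rule continuous_on_compose2[OF that c]) simp
  show ?thesis unfolding nx_def[abs_def] nvec_def
    by (intro continuous_intros g cont1 cont2 x_continuous[OF u_smooth p] x_continuous[OF ux_smooth p] x_continuous[OF uxx_smooth p]) auto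
qed

lemma nx_per: "p \<in> \<Omega> \<Longrightarrow> periodic (\<Xi> p) (nx p)"
  by (simp add: periodic_def nx_def u_per ux_per uxx_per)

abbreviation \<psi>d :: "'n param \<times> real" where "\<psi>d \<equiv> (mu_dir, 0)"

lemma coefficient_continuous:
  "p \<in> \<Omega> \<Longrightarrow> continuous_on UNIV g \<Longrightarrow> continuous_on A (\<lambda>x. g (vb p x))"
  by (rule continuous_on_compose2[of UNIV g]) (auto intro!: continuous_intros x_continuous[OF u_smooth])

theorem wave_jacobi:
  assumes p: "p \<in> \<Omega>"
  shows "jacobi iv (\<Xi> p) (\<lambda>x. \<kappa> (vb p x)) (\<lambda>x. \<tau> (vb p x)) (nx p) (dd mu_dir \<Xi> p)
    (\<lambda>x. wb p x) (\<lambda>x. wb' p x) (\<lambda>x. dd \<psi>d u (p, x) $ iv) (\<lambda>x. dd \<psi>d ux (p, x) $ iv)"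
proof -
  have jf: "jacobi_form (\<Xi> p) (\<lambda>x. \<kappa> (vb p x)) (\<lambda>x. \<tau> (vb p x)) (nx p)"
    by unfold_locales (use \<Xi>_pos[OF p] nx_continuous[OF p] nx_per[OF p] \<tau>_positive in
        \<open>auto intro!: coefficient_continuous[OF p] cont0 simp: periodic_def u_per[OF p]\<close>)
  have potc: "continuous_on UNIV (reduced_potential iv (\<lambda>x. \<tau> (vb p x)) (nx p))"
    unfolding reduced_potential_def[abs_def]
    by (intro continuous_intros nx_continuous[OF p] coefficient_continuous[OF p] cont0) (use \<tau>_positive in \<open>simp add: less_imp_neq[THEN not_sym]\<close>)
  have "sturm_liouville (\<Xi> p) (dd mu_dir \<Xi> p) (\<lambda>x. \<kappa> (vb p x)) (reduced_potential iv (\<lambda>x. \<tau> (vb p x)) (nx p))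
    (\<lambda>x. wb p x) (\<lambda>x. wb' p x) (\<lambda>x. dd \<psi>d u (p, x) $ iv) (\<lambda>x. dd \<psi>d ux (p, x) $ iv)"
  proof
    show "0 < \<Xi> p" by (rule \<Xi>_pos[OF p])
    show "dd mu_dir \<Xi> p \<noteq> 0" using \<Xi>_mu[OF p] dir_deriv_\<Xi>[OF p] by simp
    show "continuous_on UNIV (\<lambda>x. \<kappa> (vb p x))" by (intro coefficient_continuous[OF p] cont0)
    show "continuous_on UNIV (reduced_potential iv (\<lambda>x. \<tau> (vb p x)) (nx p))" by (rule potc)
    show "periodic (\<Xi> p) (\<lambda>x. \<kappa> (vb p x))" by (simp add: periodic_def u_per[OF p])
    show "periodic (\<Xi> p) (reduced_potential iv (\<lambda>x. \<tau> (vb p x)) (nx p))"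
      using nx_per[OF p] by (simp add: periodic_def reduced_potential_def u_per[OF p])
    show "((\<lambda>x. wb p x) has_real_derivative wb' p x) (at x)" for x by (rule ux_x_comp[OF p])
    show "continuous_on UNIV (\<lambda>x. wb' p x)" by (intro continuous_intros x_continuous[OF uxx_smooth p])
    show "((\<lambda>x. \<kappa> (vb p x) * wb' p x) has_real_derivative
       reduced_potential iv (\<lambda>x. \<tau> (vb p x)) (nx p) x * wb p x) (at x)" for x
      using sturm_liouville_equation[OF p grad_mu(2), of 1 x] by (simp add: ux_def[symmetric] uxx_def[symmetric])
    show "((\<lambda>x. dd \<psi>d u (p, x) $ iv) has_real_derivative dd \<psi>d ux (p, x) $ iv) (at x)" for x by (rule dd_u_x_comp[OF p])
    show "continuous_on UNIV (\<lambda>x. dd \<psi>d ux (p, x) $ iv)" by (intro continuous_intros x_continuous[OF duD_smooth(2) p])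
    show "((\<lambda>x. \<kappa> (vb p x) * dd \<psi>d ux (p, x) $ iv) has_real_derivative
       reduced_potential iv (\<lambda>x. \<tau> (vb p x)) (nx p) x * dd \<psi>d u (p, x) $ iv) (at x)" for x
      by (rule sturm_liouville_equation[OF p grad_mu(1)])
    show "\<kappa> (vb p x) * (wb p x * dd \<psi>d ux (p, x) $ iv - wb' p x * dd \<psi>d u (p, x) $ iv) = 1" for x
      using linearised_legendre[OF p, of x mu_dir 0] by (simp add: mu_dir_def qd_def)
    show "periodic (\<Xi> p) (\<lambda>x. wb p x)" "periodic (\<Xi> p) (\<lambda>x. wb' p x)"
      by (simp_all add: periodic_def ux_per[OF p] uxx_per[OF p])
    show "ux (p, 0) $ iv = 0" by (rule ux_0[OF p])
    show "dd \<psi>d ux (p, \<Xi> p) $ iv - dd \<psi>d ux (p, 0) $ iv = - dd mu_dir \<Xi> p * uxx (p, 0) $ iv"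
      using dd_ux_shift[OF p, of mu_dir 0 0] by simp
  qed
  with jf show ?thesis by (simp add: jacobi_def)
qed

lemma Phi_eq:
  assumes p: "p \<in> \<Omega>"
  shows "jacobi.\<Phi> iv (\<lambda>x. \<tau> (vb p x)) (nx p) (\<lambda>x. wb p x) (\<lambda>x. wb' p x) x = (ux (p, x), wb' p x)"
proof -
  have "ux (p, x) = drop_comp iv (ux (p, x)) + wb p x *\<^sub>R axis iv 1" by (simp add: drop_comp_def)
  also have "drop_comp iv (ux (p, x)) = - (wb p x / \<tau> (vb p x)) *\<^sub>R drop_comp iv (nx p x)"
    using linearised_transverse[OF p grad_mu(2), where \<xi>=1 and x=x] by (simp add: ux_def[symmetric])
  finally show ?thesis unfolding jacobi.\<Phi>_def[OF wave_jacobi[OF p]] by (simp add: algebra_simps)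
qed

end

section \<open>Parameter derivatives of the action\<close>

lemma mean_int_continuous:
  fixes g :: "real \<Rightarrow> 'b::euclidean_space"
  assumes "continuous_on UNIV g"
  shows "mean_int X g = integral {0..X} g"
  by (rule set_lebesgue_integral_eq_integral(2)[OF continuous_set_integrable[OF assms]])

lemma integral_derivative:
  fixes F :: "real \<Rightarrow> real"
  assumes "0 \<le> X" "\<And>x. (F has_real_derivative g x) (at x)"
  shows "integral {0..X} g = F X - F 0"
proof (rule integral_unique, rule fundamental_theorem_of_calculus[OF assms(1)])
  show "(F has_vector_derivative g x) (at x within {0..X})" for x
    using has_field_derivative_at_within[OF assms(2)] by (simp add: has_real_derivative_iff_has_vector_derivative)
qed

context wave_family
begin

definition lag :: "'n param \<times> real \<Rightarrow> real" where
  "lag z = H (u z, ux z $ iv) + snd (snd (fst z)) * (u z $ iv * (k \<bullet> u z)) + fst (snd (fst z)) \<bullet> u z + fst (fst z)"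

definition lag' :: "'n param \<Rightarrow> 'n param \<times> real \<Rightarrow> real" where
  "lag' d z = (EU (u z) (ux z $ iv) (snd (snd (fst z))) + fst (snd (fst z))) \<bullet> dd (d, 0) u z
     + (e (u z $ iv) + \<kappa> (u z $ iv) * ux z $ iv) * dd (d, 0) ux z $ iv + qd d (u z) + fst d"

lemma line_point: "(p, x) + s *\<^sub>R (d, 0) = (p + s *\<^sub>R d, x)" for p d :: "'n param" and x s :: real
  by simp

lemma lag_derivative:
  assumes p: "p + s *\<^sub>R d \<in> \<Omega>"
  shows "((\<lambda>s. lag (p + s *\<^sub>R d, x)) has_real_derivative lag' d (p + s *\<^sub>R d, x)) (at s)"
proof -
  have z: "(p, x) + s *\<^sub>R (d, 0) \<in> S" using p by simp
  define us ws where "us s = u (p + s *\<^sub>R d, x)" and "ws s = ux (p + s *\<^sub>R d, x) $ iv" for s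
  define ls where "ls s = fst (snd p) + s *\<^sub>R fst (snd d)" for s
  define Y W where "Y = dd (d, 0) u (p + s *\<^sub>R d, x)" and "W = dd (d, 0) ux (p + s *\<^sub>R d, x) $ iv"
  have us: "(us has_vector_derivative Y) (at s)"
    using smooth_on_line[OF u_smooth z] unfolding line_point us_def Y_def .
  have ws: "(ws has_real_derivative W) (at s)"
    using has_derivative_inner_vec(2)[OF smooth_on_line[OF ux_smooth z]] unfolding line_point ws_def W_def .
  note v = has_derivative_inner_vec[OF us]
  have lu: "((\<lambda>s. ls s \<bullet> us s) has_real_derivative fst (snd d) \<bullet> us s + ls s \<bullet> Y) (at s)"
  proof -
    have "(ls has_vector_derivative fst (snd d)) (at s)" unfolding ls_def[abs_def] by (auto intro!: derivative_eq_intros)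
    from bounded_bilinear.has_vector_derivative[OF bounded_bilinear_inner this us]
    show ?thesis by (simp add: has_real_derivative_iff_has_vector_derivative add.commute)
  qed
  have eq: "lag (p + s *\<^sub>R d, x) = f (us s $ iv) + e (us s $ iv) * ws s + \<kappa> (us s $ iv) * (ws s)\<^sup>2 / 2 + t (us s $ iv) * (or \<bullet> us s)
     + \<tau> (us s $ iv) * (us s \<bullet> us s) / 2 + (snd (snd p) + s * snd (snd d)) * (us s $ iv * (k \<bullet> us s)) + ls s \<bullet> us s + (fst p + s * fst d)" for s
    by (simp add: lag_def H_eq us_def ws_def ls_def)
  have eq': "lag' d (p + s *\<^sub>R d, x) = (EU (us s) (ws s) (snd (snd p) + s * snd (snd d)) + ls s) \<bullet> Y
     + (e (us s $ iv) + \<kappa> (us s $ iv) * ws s) * W + qd d (us s) + fst d"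
    by (simp add: lag'_def us_def ws_def ls_def Y_def W_def)
  show ?thesis unfolding eq eq'
    by (rule smooth[THEN has_real_derivative_comp(1)] v ws lu DERIV_cdivide DERIV_const derivative_eq_intros refl)+
       (simp add: EU_def qd_def inner_add_left inner_axis' field_simps power2_eq_square)
qed

lemmas S_continuous = smooth_on_continuous[of S]

lemma coefficient_S_continuous: "continuous_on UNIV g \<Longrightarrow> continuous_on S (\<lambda>z. g (u z $ iv))"
  by (rule continuous_on_compose2[of UNIV g]) (auto intro!: continuous_intros S_continuous[OF u_smooth])

lemmas coefficients_S = cont0[THEN coefficient_S_continuous] cont1[THEN coefficient_S_continuous]
lemmas u_S = S_continuous[OF u_smooth] S_continuous[OF ux_smooth] S_continuous[OF duD_smooth(1)] S_continuous[OF duD_smooth(2)]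

lemma continuous_on_divide_const: "continuous_on A g \<Longrightarrow> continuous_on A (\<lambda>z. g z / (2::real))" for g :: "'a::topological_space \<Rightarrow> real"
  by (intro continuous_intros) auto

lemma lag_continuous: "continuous_on S lag"
proof -
  have "lag = (\<lambda>z. f (u z $ iv) + e (u z $ iv) * ux z $ iv + \<kappa> (u z $ iv) * (ux z $ iv)\<^sup>2 / 2 + t (u z $ iv) * (or \<bullet> u z)
     + \<tau> (u z $ iv) * (u z \<bullet> u z) / 2 + snd (snd (fst z)) * (u z $ iv * (k \<bullet> u z)) + fst (snd (fst z)) \<bullet> u z + fst (fst z))"
    by (simp add: lag_def[abs_def] H_eq)
  thus ?thesis
    by (simp only:) (intro continuous_intros coefficient_S_continuous cont0 S_continuous u_smooth ux_smooth; simp)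
qed

lemma qd_continuous: "continuous_on S (\<lambda>z. qd d (u z))"
  unfolding qd_def by (intro continuous_intros S_continuous u_smooth)

lemma grad_continuous: "continuous_on S (\<lambda>z. grad d (u z))"
  unfolding grad_def by (intro continuous_intros S_continuous u_smooth)

lemma lag'_continuous: "continuous_on S (lag' d)"
  unfolding lag'_def[abs_def] EU_def
  by (intro coefficients_S u_S(1,2) u_S(3,4)[of "(d, 0)"] qd_continuous continuous_on_add continuous_on_mult continuous_on_scaleR continuous_on_inner
      continuous_on_power continuous_on_const continuous_on_divide_const continuous_on_component continuous_on_fst continuous_on_snd continuous_on_id)

lemma line_near:
  assumes "p \<in> \<Omega>"
  obtains \<delta> where "0 < \<delta>" "\<And>s. \<bar>s\<bar> < \<delta> \<Longrightarrow> p + s *\<^sub>R d \<in> \<Omega>"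
proof -
  obtain \<delta> where "0 < \<delta>" "\<And>s. \<bar>s\<bar> < \<delta> \<Longrightarrow> (p, 0::real) + s *\<^sub>R (d, 0) \<in> S" by (rule line_in_S[OF assms]) blast
  thus ?thesis by (intro that[of \<delta>]) auto
qed

lemma derivative_of_period_integral:
  assumes p: "p \<in> \<Omega>" and g: "continuous_on S g" "continuous_on S g'"
    and d: "\<And>s x. p + s *\<^sub>R d \<in> \<Omega> \<Longrightarrow> ((\<lambda>s. g (p + s *\<^sub>R d, x)) has_real_derivative g' (p + s *\<^sub>R d, x)) (at s)"
  shows "((\<lambda>s. integral {0..\<Xi> (p + s *\<^sub>R d)} (\<lambda>x. g (p + s *\<^sub>R d, x))) has_real_derivative
     integral {0..\<Xi> p} (\<lambda>x. g' (p, x)) + g (p, \<Xi> p) * dd d \<Xi> p) (at 0)"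
proof -
  obtain \<delta> where \<delta>: "0 < \<delta>" "\<And>s. \<bar>s\<bar> < \<delta> \<Longrightarrow> p + s *\<^sub>R d \<in> \<Omega>" by (rule line_near[OF p]) blast
  have p0: "p + 0 *\<^sub>R d \<in> \<Omega>" using p by simp
  have c: "continuous_on ({-\<delta><..<\<delta>} \<times> UNIV) (\<lambda>(s, x). h (p + s *\<^sub>R d, x))" if "continuous_on S h" for h :: "'n param \<times> real \<Rightarrow> real"
    unfolding split_beta
  proof (rule continuous_on_compose2[OF that])
    show "(\<lambda>sx::real \<times> real. (p + fst sx *\<^sub>R d, snd sx)) ` ({-\<delta><..<\<delta>} \<times> UNIV) \<subseteq> S"
    proof
      fix z :: "'n param \<times> real" assume "z \<in> (\<lambda>sx::real \<times> real. (p + fst sx *\<^sub>R d, snd sx)) ` ({-\<delta><..<\<delta>} \<times> UNIV)"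
      then obtain sx :: "real \<times> real" where sx: "z = (p + fst sx *\<^sub>R d, snd sx)" and m: "sx \<in> {-\<delta><..<\<delta>} \<times> UNIV" by (rule imageE)
      have "fst sx \<in> {-\<delta><..<\<delta>}" using m by (rule SigmaE) simp
      hence "\<bar>fst sx\<bar> < \<delta>" by auto
      from \<delta>(2)[OF this] show "z \<in> S" unfolding sx by simp
    qed
  qed (intro continuous_intros)
  have \<Xi>': "((\<lambda>s. \<Xi> (p + s *\<^sub>R d)) has_real_derivative dd d \<Xi> p) (at 0)"
    using smooth_on_line[OF \<Xi>_smooth p0] by (simp add: has_real_derivative_iff_has_vector_derivative)
  have X0: "0 < \<Xi> (p + 0 *\<^sub>R d)" using \<Xi>_pos[OF p0] .
  have "((\<lambda>s. integral {0..\<Xi> (p + s *\<^sub>R d)} (\<lambda>x. g (p + s *\<^sub>R d, x))) has_real_derivative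
     integral {0..\<Xi> (p + 0 *\<^sub>R d)} (\<lambda>x. g' (p + 0 *\<^sub>R d, x)) + g (p + 0 *\<^sub>R d, \<Xi> (p + 0 *\<^sub>R d)) * dd d \<Xi> p) (at 0)"
    by (rule Leibniz_moving_endpoint[OF \<delta>(1) X0 \<Xi>' d[OF \<delta>(2)] c[OF g(1)] c[OF g(2)]])
  thus ?thesis by simp
qed

lemma action_eq: "p \<in> \<Omega> \<Longrightarrow> action iv H B U \<Xi> p = integral {0..\<Xi> p} (\<lambda>x. lag (p, x))"
proof -
  assume p: "p \<in> \<Omega>"
  have xd: "x_deriv (U p) x $ iv = wb p x" for x
    using DERIV_imp_deriv[OF u_x_comp[OF p]] by (simp add: x_deriv_def U_fun)
  have "continuous_on UNIV (\<lambda>x. lag (p, x))"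
    by (rule continuous_on_compose2[OF lag_continuous]) (use p in \<open>auto intro!: continuous_intros\<close>)
  note m = mean_int_continuous[OF this]
  obtain a b c where pe: "p = (a, b, c)" by (cases p) blast
  show "action iv H B U \<Xi> p = integral {0..\<Xi> p} (\<lambda>x. lag (p, x))"
    unfolding m[symmetric] using xd by (simp add: pe action_def lagrangian_def ham_impulse_eq lag_def u_apply)
qed

lemma lag_endpoint: "p \<in> \<Omega> \<Longrightarrow> lag (p, \<Xi> p) = 0"
  using profile_legendre[of p "\<Xi> p"] ux_0[of p] ux_per[of p 0] u_per[of p 0]
  by (simp add: lag_def H_eq)

lemma DERIV_cong_near:
  fixes F :: "real \<Rightarrow> real"
  assumes "(F has_real_derivative D) (at 0)" "0 < \<delta>" "\<And>s. \<bar>s\<bar> < \<delta> \<Longrightarrow> F s = G s"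
  shows "(G has_real_derivative D) (at 0)"
  by (rule has_field_derivative_transform_within_open[OF assms(1), of "{-\<delta><..<\<delta>}"]) (use assms(2,3) in auto)

lemma qd_derivative:
  assumes p: "p + s *\<^sub>R d \<in> \<Omega>"
  shows "((\<lambda>s. qd d' (u (p + s *\<^sub>R d, x))) has_real_derivative grad d' (u (p + s *\<^sub>R d, x)) \<bullet> dd (d, 0) u (p + s *\<^sub>R d, x)) (at s)"
proof -
  have z: "(p, x) + s *\<^sub>R (d, 0) \<in> S" using p by simp
  note us = smooth_on_line[OF u_smooth z, unfolded line_point]
  note v = has_derivative_inner_vec[OF us]
  show ?thesis unfolding qd_def
    by (rule v DERIV_const derivative_eq_intros refl)+ (simp add: grad_def inner_add_left inner_axis' algebra_simps)
qed

text \<open>The wave is a critical point, so only the explicit dependence on the parameters contributes; the boundary terms vanish since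
\<open>v\<^sub>x\<close> does at both ends, where also the integrand \<open>lag = v\<^sub>x \<partial>\<H>/\<partial>v\<^sub>x\<close> is zero.\<close>

theorem action_derivative:
  assumes p: "p \<in> \<Omega>" and d: "fst d = 0"
  shows "dir_deriv (action iv H B U \<Xi>) d p = integral {0..\<Xi> p} (\<lambda>x. qd d (u (p, x)))"
proof -
  obtain \<delta> where \<delta>: "0 < \<delta>" "\<And>s. \<bar>s\<bar> < \<delta> \<Longrightarrow> p + s *\<^sub>R d \<in> \<Omega>" by (rule line_near[OF p]) blast
  define Y where "Y x = dd (d, 0) u (p, x) $ iv" for x
  define W where "W x = dd (d, 0) ux (p, x) $ iv" for x
  define v where "v x = vb p x" for x
  define w where "w x = wb p x" for x
  define w' where "w' x = wb' p x" for x
  define fl where "fl x = (e (v x) + \<kappa> (v x) * w x) * Y x" for x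
  define fl' where "fl' x = (deriv e (v x) * w x + deriv \<kappa> (v x) * (w x)\<^sup>2 + \<kappa> (v x) * w' x) * Y x + (e (v x) + \<kappa> (v x) * w x) * W x" for x
  have fl: "(fl has_real_derivative fl' x) (at x)" for x
    unfolding fl_def[abs_def] fl'_def v_def w_def w'_def Y_def W_def
    by (rule smooth[THEN has_real_derivative_comp(1)] u_x_comp[OF p] ux_x_comp[OF p] dd_u_x_comp[OF p] derivative_eq_intros refl)+
       (simp add: power2_eq_square algebra_simps)
  have lag'_eq: "lag' d (p, x) = fl' x + qd d (u (p, x))" for x
  proof -
    have "lag' d (p, x) = (EU (u (p, x)) (w x) (snd (snd p)) + fst (snd p)) \<bullet> dd (d, 0) u (p, x)
     + (e (v x) + \<kappa> (v x) * w x) * W x + qd d (u (p, x))"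
      by (simp add: lag'_def d v_def w_def W_def)
    thus ?thesis unfolding w_def EU_flux[OF p] by (simp add: fl'_def inner_axis' Y_def v_def w_def w'_def)
  qed
  have qc: "continuous_on UNIV (\<lambda>x. qd d (u (p, x)))"
    by (rule continuous_on_compose2[OF qd_continuous]) (use p in \<open>auto intro!: continuous_intros\<close>)
  have "(\<lambda>x. lag' d (p, x) - qd d (u (p, x))) = fl'" by (simp add: lag'_eq fun_eq_iff)
  moreover have "continuous_on UNIV (\<lambda>x. lag' d (p, x))"
    by (rule continuous_on_compose2[OF lag'_continuous]) (use p in \<open>auto intro!: continuous_intros\<close>)
  ultimately have fc: "continuous_on UNIV fl'" using continuous_on_diff[OF _ qc] by metis
  have i: "g integrable_on {0..\<Xi> p}" if "continuous_on UNIV g" for g :: "real \<Rightarrow> real"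
    by (rule integrable_continuous_real[OF continuous_on_subset[OF that]]) simp
  have "integral {0..\<Xi> p} (\<lambda>x. lag' d (p, x)) = integral {0..\<Xi> p} fl' + integral {0..\<Xi> p} (\<lambda>x. qd d (u (p, x)))"
    unfolding lag'_eq by (rule Henstock_Kurzweil_Integration.integral_add[OF i[OF fc] i[OF qc]])
  also have "integral {0..\<Xi> p} fl' = fl (\<Xi> p) - fl 0"
    by (rule integral_derivative[OF less_imp_le[OF \<Xi>_pos[OF p]] fl])
  also have "\<dots> = 0"
    using ux_0[OF p] ux_per[OF p, of 0] u_per[OF p, of 0] dd_u_shift[OF p, of d 0 0]
    by (simp add: fl_def v_def w_def Y_def)
  finally have I: "integral {0..\<Xi> p} (\<lambda>x. lag' d (p, x)) = integral {0..\<Xi> p} (\<lambda>x. qd d (u (p, x)))" by simp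
  have "((\<lambda>s. integral {0..\<Xi> (p + s *\<^sub>R d)} (\<lambda>x. lag (p + s *\<^sub>R d, x))) has_real_derivative
     integral {0..\<Xi> p} (\<lambda>x. lag' d (p, x)) + lag (p, \<Xi> p) * dd d \<Xi> p) (at 0)"
    by (rule derivative_of_period_integral[OF p lag_continuous lag'_continuous lag_derivative])
  from DERIV_cong_near[OF this \<delta>(1) action_eq[OF \<delta>(2), symmetric]]
  have "((\<lambda>s. action iv H B U \<Xi> (p + s *\<^sub>R d)) has_real_derivative integral {0..\<Xi> p} (\<lambda>x. qd d (u (p, x)))) (at 0)"
    by (simp add: I lag_endpoint[OF p])
  thus ?thesis unfolding dir_deriv_def by (rule DERIV_imp_deriv)
qed

theorem action_second_derivative:
  assumes p: "p \<in> \<Omega>" and d': "fst d' = 0"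
  shows "dir_deriv (dir_deriv (action iv H B U \<Xi>) d') d p =
    integral {0..\<Xi> p} (\<lambda>x. grad d' (u (p, x)) \<bullet> dd (d, 0) u (p, x)) + qd d' (u (p, 0)) * dd d \<Xi> p"
proof -
  obtain \<delta> where \<delta>: "0 < \<delta>" "\<And>s. \<bar>s\<bar> < \<delta> \<Longrightarrow> p + s *\<^sub>R d \<in> \<Omega>" by (rule line_near[OF p]) blast
  have c: "continuous_on S (\<lambda>z. grad d' (u z) \<bullet> dd (d, 0) u z)"
    by (intro continuous_intros grad_continuous S_continuous duD_smooth)
  have "((\<lambda>s. integral {0..\<Xi> (p + s *\<^sub>R d)} (\<lambda>x. qd d' (u (p + s *\<^sub>R d, x)))) has_real_derivative
     integral {0..\<Xi> p} (\<lambda>x. grad d' (u (p, x)) \<bullet> dd (d, 0) u (p, x)) + qd d' (u (p, \<Xi> p)) * dd d \<Xi> p) (at 0)"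
    by (rule derivative_of_period_integral[OF p qd_continuous c qd_derivative])
  from DERIV_cong_near[OF this \<delta>(1) action_derivative[OF \<delta>(2) d', symmetric]]
  have "((\<lambda>s. dir_deriv (action iv H B U \<Xi>) d' (p + s *\<^sub>R d)) has_real_derivative
     integral {0..\<Xi> p} (\<lambda>x. grad d' (u (p, x)) \<bullet> dd (d, 0) u (p, x)) + qd d' (u (p, 0)) * dd d \<Xi> p) (at 0)"
    using u_per[OF p, of 0] by simp
  from DERIV_imp_deriv[OF this] show ?thesis by (simp add: dir_deriv_def)
qed

text \<open>The integrand is the derivative of the Wronskian of \<open>v\<^sub>d\<close> and \<open>v\<^sub>\<mu>\<close>. Its increment over a period comes from the
variation of the period, and the derivative of the first integral evaluates it.\<close>

theorem mu_derivative_identity: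
  assumes p: "p \<in> \<Omega>" and d: "fst d = 0"
  shows "integral {0..\<Xi> p} (\<lambda>x. grad d (u (p, x)) \<bullet> dd \<psi>d u (p, x)) = dd d \<Xi> p - dd mu_dir \<Xi> p * qd d (u (p, 0))"
proof -
  define Wr where "Wr x = (\<kappa> (vb p x) * dd (d, 0) ux (p, x) $ iv) * dd \<psi>d u (p, x) $ iv
    - (\<kappa> (vb p x) * dd \<psi>d ux (p, x) $ iv) * dd (d, 0) u (p, x) $ iv" for x
  have Wr: "(Wr has_real_derivative grad d (u (p, x)) \<bullet> dd \<psi>d u (p, x)) (at x)" for x
  proof -
    define Yd Ym n T Fd Fm where "Yd = dd (d, 0) u (p, x)" and "Ym = dd \<psi>d u (p, x)" and "n = nx p x" and "T = \<tau> (vb p x)"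
      and "Fd = deriv \<kappa> (vb p x) * wb p x * dd (d, 0) ux (p, x) $ iv + \<kappa> (vb p x) * dd (d, 0) uxx (p, x) $ iv"
      and "Fm = deriv \<kappa> (vb p x) * wb p x * dd \<psi>d ux (p, x) $ iv + \<kappa> (vb p x) * dd \<psi>d uxx (p, x) $ iv"
    have 1: "T * (Yd \<bullet> Ym) + Yd $ iv * (n \<bullet> Ym) + (n \<bullet> Yd) * Ym $ iv - Fd * Ym $ iv + grad d (u (p, x)) \<bullet> Ym = 0"
      using arg_cong[OF linearised_profile[OF p, of x d 0], of "\<lambda>y. y \<bullet> Ym"]
      by (simp only: Yd_def[symmetric] n_def[symmetric] T_def[symmetric] Fd_def[symmetric])
         (simp add: inner_add_left inner_diff_left inner_axis')
    have 2: "T * (Ym \<bullet> Yd) + Ym $ iv * (n \<bullet> Yd) + (n \<bullet> Ym) * Yd $ iv - Fm * Yd $ iv = 0"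
      using arg_cong[OF linearised_profile[OF p, of x mu_dir 0], of "\<lambda>y. y \<bullet> Yd"]
      by (simp only: Ym_def[symmetric] n_def[symmetric] T_def[symmetric] Fm_def[symmetric] grad_mu)
         (simp add: inner_add_left inner_diff_left inner_axis')
    have "(Wr has_real_derivative Fd * Ym $ iv - Fm * Yd $ iv) (at x)"
      unfolding Wr_def[abs_def]
      by (rule DERIV_cong[OF DERIV_diff[OF DERIV_mult[OF flux_derivative[OF p] dd_u_x_comp[OF p]] DERIV_mult[OF flux_derivative[OF p] dd_u_x_comp[OF p]]]])
         (simp add: Fd_def Fm_def Yd_def Ym_def algebra_simps)
    moreover have "Fd * Ym $ iv - Fm * Yd $ iv = grad d (u (p, x)) \<bullet> Ym" using 1 2 by (simp add: inner_commute algebra_simps)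
    ultimately show ?thesis by (simp add: Ym_def)
  qed
  have sh: "dd (d, 0) u (p, \<Xi> p) $ iv = dd (d, 0) u (p, 0) $ iv"
    "dd (d, 0) ux (p, \<Xi> p) $ iv = dd (d, 0) ux (p, 0) $ iv - dd d \<Xi> p * uxx (p, 0) $ iv" for d
    using arg_cong[OF dd_u_shift[OF p, of d 0 0], of "\<lambda>y. y $ iv"] arg_cong[OF dd_ux_shift[OF p, of d 0 0], of "\<lambda>y. y $ iv"] ux_0[OF p]
    by simp_all
  have "integral {0..\<Xi> p} (\<lambda>x. grad d (u (p, x)) \<bullet> dd \<psi>d u (p, x)) = Wr (\<Xi> p) - Wr 0"
    by (rule integral_derivative[OF less_imp_le[OF \<Xi>_pos[OF p]] Wr])
  also have "\<dots> = dd d \<Xi> p * (- (\<kappa> (u (p, 0) $ iv) * uxx (p, 0) $ iv * dd \<psi>d u (p, 0) $ iv))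
      - dd mu_dir \<Xi> p * (- (\<kappa> (u (p, 0) $ iv) * uxx (p, 0) $ iv * dd (d, 0) u (p, 0) $ iv))"
    unfolding Wr_def sh using u_per[OF p, of 0] by (simp add: algebra_simps)
  also have "- (\<kappa> (u (p, 0) $ iv) * uxx (p, 0) $ iv * dd \<psi>d u (p, 0) $ iv) = 1"
    using linearised_legendre[OF p, of 0 mu_dir 0] ux_0[OF p] by (simp add: mu_dir_def qd_def)
  also have "- (\<kappa> (u (p, 0) $ iv) * uxx (p, 0) $ iv * dd (d, 0) u (p, 0) $ iv) = qd d (u (p, 0))"
    using linearised_legendre[OF p, of 0 d 0] ux_0[OF p] d by simp
  finally show ?thesis by simp
qed

end

section \<open>The tangent directions along the family\<close>

locale wave = wave_family iv H B f e \<kappa> \<tau> t or k \<Omega> U \<Xi>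
  for iv :: "'n::finite" and H B f e \<kappa> \<tau> t or k \<Omega> U \<Xi> + fixes p :: "'n param" assumes p: "p \<in> \<Omega>"
begin

abbreviation X where "X \<equiv> \<Xi> p"
abbreviation \<Xi>\<mu> where "\<Xi>\<mu> \<equiv> dd mu_dir \<Xi> p"
abbreviation ub where "ub \<equiv> (\<lambda>x. u (p, x))"
abbreviation Zbx where "Zbx \<equiv> (\<lambda>x. (ux (p, x), wb' p x))"
abbreviation Cmat where "Cmat \<equiv> constraint_matrix (action iv H B U \<Xi>) \<Xi> p"
abbreviation index_condition where
  "index_condition \<equiv> neg_signature (HH iv 2 X) (hess_form (ham_impulse iv H B (snd (snd p))) X (U p)) = enat (matrix_neg_signature (- Cmat))"

end

sublocale wave \<subseteq> J: jacobi iv "\<Xi> p" "\<lambda>x. \<kappa> (vb p x)" "\<lambda>x. \<tau> (vb p x)" "nx p" "dd mu_dir \<Xi> p"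
    "\<lambda>x. wb p x" "\<lambda>x. wb' p x" "\<lambda>x. dd (mu_dir, 0) u (p, x) $ iv" "\<lambda>x. dd (mu_dir, 0) ux (p, x) $ iv"
  by (rule wave_jacobi[OF p])

context wave
begin

lemma \<Xi>\<mu>_nz: "\<Xi>\<mu> \<noteq> 0"
  unfolding dir_deriv_\<Xi>[OF p, symmetric] by (rule \<Xi>_mu[OF p])

text \<open>The correction makes the period stationary, so that \<open>tangent i\<close> is periodic.\<close>

definition tangent_dir :: "'n option \<Rightarrow> 'n param"
  where "tangent_dir i = check_dir i + (- (dd (check_dir i) \<Xi> p / \<Xi>\<mu>)) *\<^sub>R mu_dir"

definition tangent :: "'n option \<Rightarrow> real \<Rightarrow> 'n state"
  where "tangent i x = (dd (tangent_dir i, 0) u (p, x), dd (tangent_dir i, 0) ux (p, x) $ iv)"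

definition constraints :: "(real \<Rightarrow> 'n state) \<Rightarrow> real ^ ('n option)"
  where "constraints Z = (\<chi> i. mean_int X (\<lambda>x. grad (check_dir i) (u (p, x)) \<bullet> fst (Z x)))"

lemma check_dir_fst: "fst (check_dir i) = 0" by (cases i) auto

lemma tangent_dir_\<Xi>: "dd (tangent_dir i) \<Xi> p = 0"
  unfolding tangent_dir_def dd_linear[OF \<Xi>_smooth p] using \<Xi>\<mu>_nz by simp

lemma tangent_dir_u: "dd (tangent_dir i, 0) u (p, x) = dd (check_dir i, 0) u (p, x) - (dd (check_dir i) \<Xi> p / \<Xi>\<mu>) *\<^sub>R dd \<psi>d u (p, x)"
proof -
  have z: "(p, x) \<in> S" using p by simp
  have "(tangent_dir i, 0::real) = (check_dir i, 0) + (- (dd (check_dir i) \<Xi> p / \<Xi>\<mu>)) *\<^sub>R \<psi>d" by (simp add: tangent_dir_def)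
  thus ?thesis by (simp only: dd_linear[OF u_smooth z]) simp
qed

lemma grad_tangent_dir: "grad (tangent_dir i) y = grad (check_dir i) y"
  by (simp add: grad_def tangent_dir_def mu_dir_def)

lemma ub_continuous: "continuous_on A ub" by (rule x_continuous[OF u_smooth p])
lemma grad_ub: "continuous_on A (\<lambda>x. grad d (u (p, x)))" "periodic X (\<lambda>x. grad d (u (p, x)))"
  unfolding grad_def by (intro continuous_intros ub_continuous) (simp add: periodic_def u_per[OF p])

lemma tangent_per:
  "dd (tangent_dir i, 0) u (p, x + X) = dd (tangent_dir i, 0) u (p, x)"
  "dd (tangent_dir i, 0) ux (p, x + X) = dd (tangent_dir i, 0) ux (p, x)"
  by (simp_all add: dd_u_shift[OF p] dd_ux_shift[OF p] tangent_dir_\<Xi>)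

lemma tangent_jets: "tangent i \<in> jets iv X"
proof -
  have "tangent i \<in> l2per X"
  proof (rule l2per_continuous)
    show "periodic X (tangent i)" by (simp add: periodic_def tangent_def tangent_per)
    show "continuous_on UNIV (tangent i)" unfolding tangent_def[abs_def]
      by (intro continuous_intros x_continuous[OF duD_smooth(1) p] x_continuous[OF duD_smooth(2) p])
  qed
  moreover have "sobolev_deriv (\<lambda>x. fst (tangent i x) $ iv) (\<lambda>x. snd (tangent i x))"
    unfolding tangent_def fst_conv snd_conv
    by (rule sobolev_derivI[OF dd_u_x_comp[OF p]]) (intro continuous_intros x_continuous[OF duD_smooth(2) p])
  ultimately show ?thesis by (simp add: jets_def)
qed

text \<open>Pair the linearised equation for \<open>tangent i\<close> with \<open>W\<close> and integrate \<open>(\<kappa> v\<^sub>x)\<^sub>x\<close> by parts.\<close>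

theorem b_tangent:
  assumes W: "W \<in> jets iv X"
  shows "J.b (tangent i) W = - (constraints W $ i)"
proof -
  define Y G where "Y x = dd (tangent_dir i, 0) u (p, x)" and "G x = dd (tangent_dir i, 0) ux (p, x) $ iv" for x
  define V v g where "V x = fst (W x)" and "v x = fst (W x) $ iv" and "g x = snd (W x)" for x
  define Fl where "Fl x = \<kappa> (vb p x) * G x" for x
  define Fl' where "Fl' x = deriv \<kappa> (vb p x) * wb p x * G x + \<kappa> (vb p x) * dd (tangent_dir i, 0) uxx (p, x) $ iv" for x
  have Fl: "(Fl has_real_derivative Fl' x) (at x)" for x
    unfolding Fl_def[abs_def] Fl'_def G_def by (rule flux_derivative[OF p])
  have Fc: "continuous_on UNIV Fl'" unfolding Fl'_def[abs_def] G_def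
    by (intro continuous_intros coefficient_continuous[OF p] cont0 cont1 x_continuous[OF ux_smooth p] x_continuous[OF duD_smooth(2) p] x_continuous[OF duD_smooth(3) p])
  have sd: "sobolev_deriv (\<lambda>x. Fl x * v x) (\<lambda>x. Fl x * g x + Fl' x * v x)"
    by (rule sobolev_deriv_mult[OF sobolev_derivI[OF Fl Fc]]) (use jetsD(2)[OF W] in \<open>simp add: v_def[abs_def] g_def[abs_def]\<close>)
  have per: "periodic X (\<lambda>x. Fl x * v x)"
    using l2perD(1)[OF jetsD(1)[OF W]] by (simp add: periodic_def Fl_def G_def v_def tangent_per u_per[OF p])
  have h0: "mean_int X (\<lambda>x. Fl x * g x + Fl' x * v x) = 0" by (rule periodic_sobolev_mean_zero[OF \<Xi>_pos[OF p] sd per])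
  have hi: "per_integrable X (\<lambda>x. Fl x * g x + Fl' x * v x)"
    using sd \<Xi>_pos[OF p] unfolding sobolev_deriv_def by (meson less_imp_le)
  have bi: "per_integrable X (\<lambda>x. J.bd x (tangent i x) (W x))"
    by (rule J.b_integrable[OF jetsD(1)[OF tangent_jets] jetsD(1)[OF W]])
  have eq: "grad (check_dir i) (u (p, x)) \<bullet> V x = (Fl x * g x + Fl' x * v x) - J.bd x (tangent i x) (W x)" for x
  proof -
    have "\<tau> (vb p x) * (Y x \<bullet> V x) + Y x $ iv * (nx p x \<bullet> V x) + (nx p x \<bullet> Y x) * V x $ iv - Fl' x * V x $ iv
       + grad (check_dir i) (u (p, x)) \<bullet> V x = 0"
      using arg_cong[OF linearised_profile[OF p, of x "tangent_dir i" 0], of "\<lambda>y. y \<bullet> V x"]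
      by (simp only: Y_def[symmetric] Fl'_def[symmetric] G_def[symmetric] grad_tangent_dir)
         (simp add: inner_add_left inner_diff_left inner_axis')
    thus ?thesis by (simp add: J.bd_def tangent_def Y_def[symmetric] G_def[symmetric] V_def v_def g_def Fl_def algebra_simps)
  qed
  have "mean_int X (\<lambda>x. grad (check_dir i) (u (p, x)) \<bullet> V x) = mean_int X (\<lambda>x. Fl x * g x + Fl' x * v x) - J.b (tangent i) W"
    unfolding eq J.b_def by (rule set_integral_diff(2)[OF hi bi])
  thus ?thesis by (simp add: constraints_def V_def h0)
qed

text \<open>The second derivative of the action has the boundary term \<open>qd (u (p, 0)) \<Xi>\<^sub>i\<close>. It cancels against the one from the
\<open>\<mu>\<close> component of \<open>tangent_dir i\<close>, whose remaining part is the rank one correction in the constraint matrix.\<close>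

theorem constraints_tangent: "constraints (tangent j) $ i = Cmat $ i $ j"
proof -
  have c: "continuous_on UNIV (\<lambda>x. grad (check_dir j) (u (p, x)) \<bullet> dd D u (p, x))" for D
    by (intro continuous_intros grad_ub x_continuous[OF duD_smooth(1) p])
  have int: "g integrable_on {0..X}" if "continuous_on UNIV g" for g :: "real \<Rightarrow> real"
    by (rule integrable_continuous_real[OF continuous_on_subset[OF that]]) simp
  have "constraints (tangent j) $ i = constraints (tangent i) $ j"
    using b_tangent[OF tangent_jets, of i j] b_tangent[OF tangent_jets, of j i] J.b_commute[of "tangent i" "tangent j"] by simp
  also have "\<dots> = mean_int X (\<lambda>x. grad (check_dir j) (u (p, x)) \<bullet> dd (tangent_dir i, 0) u (p, x))"
    by (simp add: constraints_def tangent_def)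
  also have "\<dots> = integral {0..X} (\<lambda>x. grad (check_dir j) (u (p, x)) \<bullet> dd (tangent_dir i, 0) u (p, x))"
    by (rule mean_int_continuous[OF c])
  also have "\<dots> = integral {0..X} (\<lambda>x. grad (check_dir j) (u (p, x)) \<bullet> dd (check_dir i, 0) u (p, x)
      - (dd (check_dir i) \<Xi> p / \<Xi>\<mu>) * (grad (check_dir j) (u (p, x)) \<bullet> dd \<psi>d u (p, x)))"
    by (simp add: tangent_dir_u inner_diff_right)
  also have "\<dots> = integral {0..X} (\<lambda>x. grad (check_dir j) (u (p, x)) \<bullet> dd (check_dir i, 0) u (p, x))
      - (dd (check_dir i) \<Xi> p / \<Xi>\<mu>) * integral {0..X} (\<lambda>x. grad (check_dir j) (u (p, x)) \<bullet> dd \<psi>d u (p, x))"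
    by (subst Henstock_Kurzweil_Integration.integral_diff[OF int[OF c] int[OF continuous_on_mult_left[OF c]]]) simp
  also have "\<dots> = Cmat $ i $ j"
    unfolding mu_derivative_identity[OF p check_dir_fst]
    using \<Xi>\<mu>_nz by (simp add: constraint_matrix_def action_second_derivative[OF p check_dir_fst] dir_deriv_\<Xi>[OF p] field_simps)
  finally show ?thesis .
qed

lemma constraints_add:
  assumes "Z \<in> jets iv X" "W \<in> jets iv X"
  shows "constraints (\<lambda>x. Z x + W x) = constraints Z + constraints W"
proof -
  have i: "per_integrable X (\<lambda>x. grad d (u (p, x)) \<bullet> fst (Z x))" if "Z \<in> jets iv X" for Z d
    by (rule l2ip_integrable[OF l2per_continuous[OF grad_ub(2,1)] l2per_fst(1)[OF jetsD(1)[OF that]]])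
  show ?thesis by (simp add: vec_eq_iff constraints_def inner_add_right set_integral_add(2)[OF i[OF assms(1)] i[OF assms(2)]])
qed

lemma constraints_scaleR: "constraints (\<lambda>x. c *\<^sub>R Z x) = c *\<^sub>R constraints Z"
  by (simp add: vec_eq_iff constraints_def)

lemma constraints_bound:
  assumes Z: "Z \<in> jets iv X"
  shows "norm (constraints Z) \<le> (\<Sum>i\<in>UNIV. l2norm X (\<lambda>x. grad (check_dir i) (u (p, x)))) * l2norm X Z"
proof -
  have "norm (constraints Z) \<le> (\<Sum>i\<in>UNIV. \<bar>constraints Z $ i\<bar>)" by (rule norm_le_l1_cart)
  also have "\<dots> \<le> (\<Sum>i\<in>UNIV. l2norm X (\<lambda>x. grad (check_dir i) (u (p, x))) * l2norm X Z)"
  proof (rule sum_mono)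
    fix i
    have "\<bar>constraints Z $ i\<bar> \<le> l2norm X (\<lambda>x. grad (check_dir i) (u (p, x))) * l2norm X (\<lambda>x. fst (Z x))"
      using l2ip_bound[OF l2per_continuous[OF grad_ub(2,1)] l2per_fst(1)[OF jetsD(1)[OF Z]], of "check_dir i"]
      by (simp add: constraints_def l2ip_def)
    also have "\<dots> \<le> l2norm X (\<lambda>x. grad (check_dir i) (u (p, x))) * l2norm X Z"
      by (rule mult_left_mono[OF l2per_fst(2)[OF jetsD(1)[OF Z]]]) simp
    finally show "\<bar>constraints Z $ i\<bar> \<le> \<dots>" .
  qed
  finally show ?thesis by (simp add: sum_distrib_right)
qed

theorem wave_constrained_jacobi:
  assumes "invertible Cmat"
  shows "constrained_jacobi iv (\<Xi> p) (\<lambda>x. \<kappa> (vb p x)) (\<lambda>x. \<tau> (vb p x)) (nx p) (dd mu_dir \<Xi> p)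
    (\<lambda>x. wb p x) (\<lambda>x. wb' p x) (\<lambda>x. dd (mu_dir, 0) u (p, x) $ iv) (\<lambda>x. dd (mu_dir, 0) ux (p, x) $ iv)
    tangent constraints Cmat (\<Sum>i\<in>UNIV. l2norm X (\<lambda>x. grad (check_dir i) (u (p, x))))"
  by (intro constrained_jacobi.intro wave_jacobi[OF p] constrained_jacobi_axioms.intro tangent_jets constraints_add
      constraints_scaleR constraints_bound b_tangent constraints_tangent assms)

end

section \<open>Jets of Sobolev functions\<close>

text \<open>The pointwise derivative is used also for functions in \<open>HH iv 1 X\<close>, where it exists almost everywhere and agrees with the
weak one.\<close>

definition jet :: "'n::finite \<Rightarrow> (real \<Rightarrow> real ^ 'n) \<Rightarrow> real \<Rightarrow> 'n state"
  where "jet iv V x = (V x, x_deriv V x $ iv)"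

lemma x_deriv_component: "x_deriv V x $ iv = deriv (\<lambda>y. V y $ iv) x"
  by (simp add: x_deriv_def)

lemma jet_fst: "fst (jet iv V x) = V x" and jet_snd: "snd (jet iv V x) = deriv (\<lambda>y. V y $ iv) x"
  by (simp_all add: jet_def x_deriv_component)

lemma periodic_deriv:
  fixes v :: "real \<Rightarrow> real"
  assumes "periodic X v"
  shows "periodic X (deriv v)"
proof -
  have "(\<lambda>x. v (x + X)) = v" using assms by (simp add: periodic_def)
  thus ?thesis by (simp add: periodic_def deriv_def DERIV_shift)
qed

lemma l2per_vec:
  fixes V :: "real \<Rightarrow> real ^ 'n::finite"
  assumes c: "\<And>\<alpha>. (\<lambda>x. V x $ \<alpha>) \<in> l2per X"
  shows "V \<in> l2per X"
proof -
  have "(\<lambda>x. \<Sum>\<alpha>\<in>UNIV. (V x $ \<alpha>) *\<^sub>R axis \<alpha> 1 :: real ^ 'n) \<in> l2per X"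
    by (rule l2per_sum) (simp_all add: l2per_axis(1)[OF c])
  moreover have "(\<Sum>\<alpha>\<in>UNIV. (V x $ \<alpha>) *\<^sub>R axis \<alpha> 1) = V x" for x
    using basis_expansion[of "V x"] by (simp add: scalar_mult_eq_scaleR)
  ultimately show ?thesis by simp
qed

lemma H_per_L2: "f \<in> H_per s X \<Longrightarrow> f \<in> l2per X"
  by (cases s) (simp_all add: L2_per_eq_l2per)

lemma HH_l2per: "V \<in> HH iv s X \<Longrightarrow> V \<in> l2per X"
proof (rule l2per_vec)
  fix \<alpha> assume "V \<in> HH iv s X"
  thus "(\<lambda>x. V x $ \<alpha>) \<in> l2per X"
    using H_per_L2 by (cases "\<alpha> = iv") (auto simp: HH_def L2_per_eq_l2per)
qed

lemma HH1_weak_derivative: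
  assumes "V \<in> HH iv 1 X"
  obtains g where "g \<in> l2per X" "sobolev_deriv (\<lambda>x. V x $ iv) g"
  using assms by (auto simp: HH_def L2_per_eq_l2per)

lemma jet_jets:
  assumes V: "V \<in> HH iv 1 X"
  shows "jet iv V \<in> jets iv X"
    and "AE x in lebesgue. ((\<lambda>y. V y $ iv) has_real_derivative snd (jet iv V x)) (at x)"
proof -
  obtain g where g: "g \<in> l2per X" "sobolev_deriv (\<lambda>x. V x $ iv) g" by (rule HH1_weak_derivative[OF V]) blast
  have ae: "AE x in lebesgue. ((\<lambda>y. V y $ iv) has_real_derivative g x) (at x)" by (rule lebesgue_differentiation[OF g(2)])
  have eq: "AE x in lebesgue. g x = deriv (\<lambda>y. V y $ iv) x" using ae by (rule AE_mp) (simp add: DERIV_imp_deriv)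
  have Vl: "V \<in> l2per X" by (rule HH_l2per[OF V])
  have "periodic X (\<lambda>x. V x $ iv)" using l2perD(1)[OF Vl] by (simp add: periodic_def)
  from l2per_pair(1)[OF Vl l2per_cong_AE[OF g(1) periodic_deriv[OF this] eq]]
  have "jet iv V \<in> l2per X" by (simp add: jet_def[abs_def] x_deriv_component)
  thus "jet iv V \<in> jets iv X"
    using sobolev_deriv_cong_AE[OF g(2) eq] by (simp add: jets_def jet_def x_deriv_component)
  show "AE x in lebesgue. ((\<lambda>y. V y $ iv) has_real_derivative snd (jet iv V x)) (at x)"
    using ae by (rule AE_mp) (simp add: DERIV_imp_deriv jet_snd)
qed

lemma HH1_norm_jet: "HH1_norm iv X V = l2norm X (jet iv V)"
  by (simp add: HH1_norm_def l2norm_def jet_def norm_Pair)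

lemma jet_diff_AE:
  assumes V: "V \<in> HH iv 1 X" and W: "W \<in> HH iv 1 X"
  shows "AE x in lebesgue. jet iv (V - W) x = jet iv V x - jet iv W x"
  using jet_jets(2)[OF V] jet_jets(2)[OF W]
proof eventually_elim
  fix x assume "((\<lambda>y. V y $ iv) has_real_derivative snd (jet iv V x)) (at x)"
    "((\<lambda>y. W y $ iv) has_real_derivative snd (jet iv W x)) (at x)"
  from DERIV_imp_deriv[OF DERIV_diff[OF this]]
  show "jet iv (V - W) x = jet iv V x - jet iv W x"
    by (simp add: prod_eq_iff jet_fst jet_snd fun_diff_def)
qed

lemma HH1_norm_diff:
  assumes "V \<in> HH iv 1 X" "W \<in> HH iv 1 X"
  shows "HH1_norm iv X (V - W) = l2norm X (\<lambda>x. jet iv V x - jet iv W x)"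
  unfolding HH1_norm_jet by (rule l2norm_cong_AE[OF jet_diff_AE[OF assms]])

lemma HH2_jet:
  assumes V: "V \<in> HH iv 2 X"
  shows "jet iv V \<in> regular_jets iv X" "((\<lambda>y. V y $ iv) has_real_derivative snd (jet iv V x)) (at x)"
proof -
  obtain g g' where g: "g \<in> l2per X" "sobolev_deriv (\<lambda>x. V x $ iv) g" "g' \<in> l2per X" "sobolev_deriv g g'"
    using V by (auto simp: HH_def L2_per_eq_l2per numeral_2_eq_2)
  have d: "((\<lambda>y. V y $ iv) has_real_derivative g x) (at x)" for x
    by (rule sobolev_deriv_continuous_imp_deriv[OF g(2) sobolev_deriv_continuous[OF g(4)]])
  have s: "snd (jet iv V x) = g x" for x using DERIV_imp_deriv[OF d] by (simp add: jet_snd)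
  have "V \<in> HH iv 1 X" using V g by (auto simp: HH_def L2_per_eq_l2per numeral_2_eq_2)
  from jet_jets(1)[OF this] show "jet iv V \<in> regular_jets iv X" using g by (auto simp: regular_jets_def s)
  show "((\<lambda>y. V y $ iv) has_real_derivative snd (jet iv V x)) (at x)" using d s by simp
qed

lemma regular_jet_HH2:
  assumes Z: "Z \<in> regular_jets iv X"
  shows "(\<lambda>x. fst (Z x)) \<in> HH iv 2 X" "jet iv (\<lambda>x. fst (Z x)) = Z"
proof -
  obtain g' where g': "g' \<in> l2per X" "sobolev_deriv (\<lambda>x. snd (Z x)) g'" and Zj: "Z \<in> jets iv X"
    using Z by (auto simp: regular_jets_def)
  note l = l2per_first_component(1)[OF jetsD(1)[OF Zj]] l2per_snd(1)[OF jetsD(1)[OF Zj]]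
  show "(\<lambda>x. fst (Z x)) \<in> HH iv 2 X"
    using l g' jetsD(2)[OF Zj] by (auto simp: HH_def L2_per_eq_l2per numeral_2_eq_2)
  have "((\<lambda>y. fst (Z y) $ iv) has_real_derivative snd (Z x)) (at x)" for x
    by (rule sobolev_deriv_continuous_imp_deriv[OF jetsD(2)[OF Zj] sobolev_deriv_continuous[OF g'(2)]])
  thus "jet iv (\<lambda>x. fst (Z x)) = Z"
    by (simp add: fun_eq_iff prod_eq_iff jet_fst jet_snd DERIV_imp_deriv)
qed

lemma regular_jets_add: "Z \<in> regular_jets iv X \<Longrightarrow> W \<in> regular_jets iv X \<Longrightarrow> (\<lambda>x. Z x + W x) \<in> regular_jets iv X"
proof -
  assume Z: "Z \<in> regular_jets iv X" and W: "W \<in> regular_jets iv X"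
  obtain z' where z: "z' \<in> l2per X" "sobolev_deriv (\<lambda>x. snd (Z x)) z'" "Z \<in> jets iv X" using Z unfolding regular_jets_def by blast
  obtain w' where w: "w' \<in> l2per X" "sobolev_deriv (\<lambda>x. snd (W x)) w'" "W \<in> jets iv X" using W unfolding regular_jets_def by blast
  have "sobolev_deriv (\<lambda>x. snd (Z x + W x)) (\<lambda>x. z' x + w' x)" using sobolev_deriv_add[OF z(2) w(2)] by simp
  thus "(\<lambda>x. Z x + W x) \<in> regular_jets iv X" 
    using jets_add[OF z(3) w(3)] l2per_add(1)[OF z(1) w(1)] unfolding regular_jets_def by blast
qed

lemma regular_jets_scaleR: "Z \<in> regular_jets iv X \<Longrightarrow> (\<lambda>x. c *\<^sub>R Z x) \<in> regular_jets iv X"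
proof -
  assume "Z \<in> regular_jets iv X"
  then obtain g' where g': "g' \<in> l2per X" "sobolev_deriv (\<lambda>x. snd (Z x)) g'" and Zj: "Z \<in> jets iv X"
    unfolding regular_jets_def by blast
  have "(\<lambda>x. c * g' x) \<in> l2per X" using l2per_scaleR(1)[OF g'(1), of c] by simp
  moreover have "sobolev_deriv (\<lambda>x. snd (c *\<^sub>R Z x)) (\<lambda>x. c * g' x)" using sobolev_deriv_cmult[OF g'(2), of c] by simp
  ultimately show ?thesis using jets_scaleR[OF Zj, of c] unfolding regular_jets_def by blast
qed

lemma regular_jets_zero: "(\<lambda>x. 0 :: (real ^ 'a::finite) \<times> real) \<in> regular_jets iv X"
proof -
  have "sobolev_deriv (\<lambda>x. snd (0 :: (real ^ 'a) \<times> real)) (\<lambda>x. 0)" by (rule sobolev_derivI) auto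
  thus ?thesis using jets_zero[of iv X] l2per_zero unfolding regular_jets_def by blast
qed

lemma regular_jets_sum: "finite I \<Longrightarrow> (\<And>i. i \<in> I \<Longrightarrow> h i \<in> regular_jets iv X) \<Longrightarrow> (\<lambda>x. \<Sum>i\<in>I. h i x) \<in> regular_jets iv X"
proof (induction I rule: finite_induct)
  case empty
  show ?case by (simp add: regular_jets_zero)
next
  case (insert i I)
  have "(\<lambda>x. h i x + (\<Sum>i\<in>I. h i x)) \<in> regular_jets iv X"
    by (rule regular_jets_add[OF insert.prems insert.IH]) (use insert.prems in simp_all)
  thus ?case using insert.hyps by simp
qed

lemma HH2_iff_jet: "V \<in> HH iv 2 X \<longleftrightarrow> jet iv V \<in> regular_jets iv X"
  using HH2_jet(1)[of V iv X] regular_jet_HH2(1)[of "jet iv V" iv X] by (auto simp: jet_fst)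

lemma jet_add:
  assumes V: "V \<in> HH iv 2 X" and W: "W \<in> HH iv 2 X"
  shows "jet iv (V + W) = (\<lambda>x. jet iv V x + jet iv W x)"
  using DERIV_imp_deriv[OF DERIV_add[OF HH2_jet(2)[OF V] HH2_jet(2)[OF W]]]
  by (simp add: fun_eq_iff prod_eq_iff jet_fst jet_snd plus_fun_def)

lemma jet_scaleR:
  assumes V: "V \<in> HH iv 2 X"
  shows "jet iv (c *\<^sub>R V) = (\<lambda>x. c *\<^sub>R jet iv V x)"
  using DERIV_imp_deriv[OF DERIV_cmult[OF HH2_jet(2)[OF V], of c]]
  by (simp add: fun_eq_iff prod_eq_iff jet_fst jet_snd scaleR_fun_def)

lemma subspace_HH2: "subspace (HH iv 2 X)"
proof (rule subspaceI)
  have "jet iv (0 :: real \<Rightarrow> real ^ 'a) = (\<lambda>x. 0)" by (simp add: fun_eq_iff prod_eq_iff jet_fst jet_snd)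
  thus "0 \<in> HH iv 2 X" by (simp add: HH2_iff_jet regular_jets_zero)
  show "V + W \<in> HH iv 2 X" if "V \<in> HH iv 2 X" "W \<in> HH iv 2 X" for V W :: "real \<Rightarrow> real ^ 'a"
    unfolding HH2_iff_jet jet_add[OF that] by (rule regular_jets_add[OF HH2_jet(1)[OF that(1)] HH2_jet(1)[OF that(2)]])
  show "c *\<^sub>R V \<in> HH iv 2 X" if "V \<in> HH iv 2 X" for c and V :: "real \<Rightarrow> real ^ 'a"
    unfolding HH2_iff_jet jet_scaleR[OF that] by (rule regular_jets_scaleR[OF HH2_jet(1)[OF that]])
qed

section \<open>The index condition and coercivity\<close>

context wave
begin

text \<open>An integration by parts of \<open>(\<kappa> v\<^sub>x)\<^sub>x v\<close>.\<close>

theorem hess_form_jet: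
  assumes V: "V \<in> HH iv 2 X"
  shows "hess_form (ham_impulse iv H B (snd (snd p))) X (U p) V = J.b (jet iv V) (jet iv V)"
proof -
  define v g where "v x = V x $ iv" and "g x = snd (jet iv V x)" for x
  have jr: "jet iv V \<in> regular_jets iv X" by (rule HH2_jet(1)[OF V])
  hence jj: "jet iv V \<in> jets iv X" by (simp add: regular_jets_def)
  obtain g' where g': "sobolev_deriv g g'" using jr by (auto simp: regular_jets_def g_def[abs_def])
  have vd: "(v has_real_derivative g x) (at x)" for x using HH2_jet(2)[OF V] by (simp add: v_def[abs_def] g_def)
  have sv: "sobolev_deriv v g" by (rule sobolev_derivI[OF vd sobolev_deriv_continuous[OF g']])
  define K' where "K' x = deriv \<kappa> (vb p x) * wb p x" for x
  have sk: "sobolev_deriv (\<lambda>x. \<kappa> (vb p x)) K'" unfolding K'_def[abs_def]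
    by (rule sobolev_derivI[OF has_real_derivative_comp(1)[OF smooth(3) u_x_comp[OF p]]])
       (intro continuous_intros coefficient_continuous[OF p] cont1 x_continuous[OF ux_smooth p])
  define h where "h x = (\<kappa> (vb p x) * g x) * g x + (\<kappa> (vb p x) * g' x + K' x * g x) * v x" for x
  have sh: "sobolev_deriv (\<lambda>x. (\<kappa> (vb p x) * g x) * v x) h" unfolding h_def
    by (rule sobolev_deriv_mult[OF sobolev_deriv_mult[OF sk g'] sv])
  have "periodic X (jet iv V)" by (rule l2perD(1)[OF jetsD(1)[OF jj]])
  hence jp: "jet iv V (x + X) = jet iv V x" for x by (simp add: periodic_def)
  have "periodic X (\<lambda>x. (\<kappa> (vb p x) * g x) * v x)"
    using jp by (simp add: periodic_def u_per[OF p] v_def g_def jet_fst[of iv V, symmetric])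
  from periodic_sobolev_mean_zero[OF \<Xi>_pos[OF p] sh this] have h0: "mean_int X h = 0" .
  have hi: "per_integrable X h"
    using sh \<Xi>_pos[OF p] unfolding sobolev_deriv_def by (meson less_imp_le)
  have ae: "AE x in lebesgue. J.bd x (jet iv V x) (jet iv V x) - h x = V x \<bullet> hess (ham_impulse iv H B (snd (snd p))) (U p) V x"
    using lebesgue_differentiation[OF g']
  proof eventually_elim
    fix x assume g'x: "(g has_real_derivative g' x) (at x)"
    define T n m y where "T = \<tau> (vb p x)" and "n = nx p x" and "m = \<kappa> (vb p x)" and "y = V x"
    have eq: "hess (ham_impulse iv H B (snd (snd p))) (\<lambda>y. u (p, y)) V x =
     \<tau> (vb p x) *\<^sub>R V x + (V x $ iv) *\<^sub>R nx p x + (nx p x \<bullet> V x) *\<^sub>R axis iv 1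
      - (deriv \<kappa> (vb p x) * wb p x * g x + \<kappa> (vb p x) * g' x) *\<^sub>R axis iv 1"
      unfolding nx_def by (rule hess_formula[OF u_x_comp[OF p] ux_x_comp[OF p] _ g'x]) (use vd in \<open>simp add: v_def[abs_def]\<close>)
    have "hess (ham_impulse iv H B (snd (snd p))) (U p) V x = T *\<^sub>R y + (y $ iv) *\<^sub>R n + (n \<bullet> y) *\<^sub>R axis iv 1
      - (K' x * g x + m * g' x) *\<^sub>R axis iv 1"
      using eq by (simp only: T_def n_def m_def y_def K'_def U_fun[of p])
    note eq = this
    show "J.bd x (jet iv V x) (jet iv V x) - h x = V x \<bullet> hess (ham_impulse iv H B (snd (snd p))) (U p) V x"
      unfolding eq J.bd_def jet_fst g_def[symmetric] h_def v_def y_def[symmetric] T_def[symmetric] n_def[symmetric] m_def[symmetric]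
        inner_add_right inner_diff_right inner_scaleR_right inner_axis inner_real_def
      by (simp add: inner_commute[of y n] algebra_simps)
  qed
  have bi: "per_integrable X (\<lambda>x. J.bd x (jet iv V x) (jet iv V x))"
    by (rule J.b_integrable[OF jetsD(1)[OF jj] jetsD(1)[OF jj]])
  have "hess_form (ham_impulse iv H B (snd (snd p))) X (U p) V = mean_int X (\<lambda>x. J.bd x (jet iv V x) (jet iv V x) - h x)"
    unfolding hess_form_def by (rule set_integral_cong_lebesgue_AE(2)[OF ae, symmetric])
  also have "\<dots> = J.b (jet iv V) (jet iv V)"
    unfolding set_integral_diff(2)[OF bi hi] h0 J.b_def by simp
  finally show ?thesis .
qed

lemma tangent_regular: "tangent i \<in> regular_jets iv X"
proof -
  have c: "continuous_on UNIV (\<lambda>x. dd (tangent_dir i, 0) uxx (p, x) $ iv)"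
    by (intro continuous_intros x_continuous[OF duD_smooth(3) p])
  have "dd (tangent_dir i, 0) uxx (p, x + X) = dd (tangent_dir i, 0) uxx (p, x)" for x
    using period_derivative[OF p uxx_smooth uxx_per, of "tangent_dir i" 0 x] by (simp add: tangent_dir_\<Xi>)
  hence "(\<lambda>x. dd (tangent_dir i, 0) uxx (p, x) $ iv) \<in> l2per X"
    by (intro l2per_continuous c) (simp add: periodic_def)
  moreover have "sobolev_deriv (\<lambda>x. snd (tangent i x)) (\<lambda>x. dd (tangent_dir i, 0) uxx (p, x) $ iv)"
    unfolding tangent_def snd_conv by (rule sobolev_derivI[OF dd_ux_x_comp[OF p] c])
  ultimately show ?thesis using tangent_jets by (auto simp: regular_jets_def)
qed

theorem nonneg_of_index:
  assumes index: index_condition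
    and Z: "Z \<in> regular_jets iv X" and orth: "\<And>i. J.b (tangent i) Z = 0"
  shows "0 \<le> J.b Z Z"
proof -
  let ?D = "HH iv 2 X"
  have jl: "jet iv V \<in> l2per X" if "V \<in> ?D" for V using HH2_jet(1)[OF that] by (simp add: regular_jets_def jets_def)
  have tj: "jet iv (\<lambda>x. fst (tangent i x)) = tangent i" for i by (rule regular_jet_HH2(2)[OF tangent_regular])
  have Zj: "jet iv (\<lambda>x. fst (Z x)) = Z" by (rule regular_jet_HH2(2)[OF Z])
  have "0 \<le> hess_form (ham_impulse iv H B (snd (snd p))) X (U p) (\<lambda>x. fst (Z x))"
  proof (rule nonneg_on_orthogonal_complement[where B="\<lambda>V W. J.b (jet iv V) (jet iv W)" and p="\<lambda>i x. fst (tangent i x)",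
        OF subspace_HH2 _ hess_form_jet _ _ _ _ index])
    show "(\<lambda>x. fst (tangent i x)) \<in> ?D" for i by (rule regular_jet_HH2(1)[OF tangent_regular])
    show "J.b (jet iv (U + V)) (jet iv W) = J.b (jet iv U) (jet iv W) + J.b (jet iv V) (jet iv W)"
      if "U \<in> ?D" "V \<in> ?D" "W \<in> ?D" for U V W
      unfolding jet_add[OF that(1,2)] by (rule J.b_add[OF jl[OF that(1)] jl[OF that(2)] jl[OF that(3)]])
    show "J.b (jet iv (c *\<^sub>R U)) (jet iv W) = c * J.b (jet iv U) (jet iv W)" if "U \<in> ?D" for c U W
      unfolding jet_scaleR[OF that] by (rule J.b_scaleR)
    show "J.b (jet iv U) (jet iv V) = J.b (jet iv V) (jet iv U)" for U V by (rule J.b_commute)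
    show "J.b (jet iv (\<lambda>x. fst (tangent i x))) (jet iv (\<lambda>x. fst (tangent j x))) =
        (- Cmat) $ i $ j" for i j
      unfolding tj b_tangent[OF tangent_jets] constraints_tangent by simp
    show "(\<lambda>x. fst (Z x)) \<in> ?D" by (rule regular_jet_HH2(1)[OF Z])
    show "J.b (jet iv (\<lambda>x. fst (tangent i x))) (jet iv (\<lambda>x. fst (Z x))) = 0" for i
      unfolding tj Zj by (rule orth)
  qed
  thus ?thesis unfolding hess_form_jet[OF regular_jet_HH2(1)[OF Z]] Zj .
qed

theorem wave_coercive:
  assumes index: index_condition
    and inv: "invertible Cmat"
  obtains \<alpha> K where "0 < \<alpha>" "0 \<le> K"
    "\<And>Z. Z \<in> jets iv X \<Longrightarrow> l2ip X Z Zbx = 0 \<Longrightarrow>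
       \<alpha> * (l2norm X Z)\<^sup>2 \<le> J.b Z Z + K * (norm (constraints Z))\<^sup>2"
proof -
  interpret C: constrained_jacobi iv "\<Xi> p" "\<lambda>x. \<kappa> (vb p x)" "\<lambda>x. \<tau> (vb p x)" "nx p" "dd mu_dir \<Xi> p"
    "\<lambda>x. wb p x" "\<lambda>x. wb' p x" "\<lambda>x. dd (mu_dir, 0) u (p, x) $ iv" "\<lambda>x. dd (mu_dir, 0) ux (p, x) $ iv"
    tangent constraints "Cmat" "\<Sum>i\<in>UNIV. l2norm X (\<lambda>x. grad (check_dir i) (u (p, x)))"
    by (rule wave_constrained_jacobi[OF inv])
  have reg: "0 \<le> C.N Z Z" if Z: "Z \<in> regular_jets iv X" for Z
  proof -
    have Zj: "Z \<in> jets iv X" using Z by (simp add: regular_jets_def)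
    have "(\<lambda>x. Z x + (-1) *\<^sub>R (\<Sum>i\<in>UNIV. ((C.A *v constraints Z) $ i) *\<^sub>R tangent i x)) \<in> regular_jets iv X"
      by (intro regular_jets_add[OF Z] regular_jets_scaleR regular_jets_sum tangent_regular) simp
    hence "C.proj Z \<in> regular_jets iv X" by (simp add: C.proj_def[abs_def])
    from nonneg_of_index[OF index this C.q_proj[OF Zj]] show ?thesis by (simp add: C.N_eq_proj[OF Zj])
  qed
  have \<Phi>: "J.\<Phi> = Zbx" using Phi_eq[OF p] by (simp add: fun_eq_iff)
  from C.coercive_on_constraints[OF C.N_nonneg_by_density[OF reg]] that show thesis unfolding \<Phi> by blast
qed

end

section \<open>Modulation\<close>

lemma vector_mean_value_bound:
  fixes F :: "real \<Rightarrow> 'a::euclidean_space"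
  assumes d: "\<And>x. (F has_vector_derivative F' x) (at x)"
    and C: "\<And>x. min a b \<le> x \<Longrightarrow> x \<le> max a b \<Longrightarrow> norm (F' x) \<le> C"
  shows "norm (F b - F a) \<le> C * \<bar>b - a\<bar>"
proof -
  have c: "continuous_on A F" for A
    by (meson continuous_at_imp_continuous_on d has_vector_derivative_continuous)
  have main: "norm (F y - F x) \<le> C * (y - x)" if xy: "x < y" "\<And>z. x \<le> z \<Longrightarrow> z \<le> y \<Longrightarrow> norm (F' z) \<le> C" for x y
  proof -
    have "\<exists>z\<in>{x<..<y}. norm (F y - F x) \<le> norm ((y - x) *\<^sub>R F' z)"
      by (rule mvt_general[OF xy(1) c]) (use d in \<open>simp add: has_vector_derivative_def\<close>)
    then obtain z where z: "z \<in> {x<..<y}" "norm (F y - F x) \<le> norm ((y - x) *\<^sub>R F' z)" by blast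
    have "norm (F' z) * (y - x) \<le> C * (y - x)" using z(1) xy by (intro mult_right_mono) auto
    moreover have "norm ((y - x) *\<^sub>R F' z) = norm (F' z) * (y - x)" using xy(1) by simp
    ultimately show ?thesis using z(2) by linarith
  qed
  consider "a < b" | "b < a" | "a = b" by linarith
  thus ?thesis
  proof cases
    case 1 thus ?thesis using main[of a b] C by simp
  next
    case 2 thus ?thesis using main[of b a] C by (simp add: norm_minus_commute)
  qed simp
qed

lemma l2per_norm_bounded:
  fixes f :: "real \<Rightarrow> 'b::euclidean_space"
  assumes X: "0 < X" and f: "f \<in> l2per X" and C: "0 \<le> C" "\<And>x. norm (f x) \<le> C"
  shows "l2norm X f \<le> C * sqrt X"
proof -
  have o: "(\<lambda>x. 1::real) \<in> l2per X" by (intro l2per_continuous) (auto simp: periodic_def)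
  have n: "l2norm X (\<lambda>x. 1::real) = sqrt X" using X by (simp add: l2norm_def set_integral_const)
  show ?thesis using l2per_dominated(2)[OF o l2perD(1,2)[OF f] C(1)] C(2) n by simp
qed

lemma linear_le_quadratic_imp_zero:
  fixes a C :: real
  assumes C: "0 \<le> C" and le: "\<And>h. h * a \<le> C * h\<^sup>2"
  shows "a = 0"
proof (rule ccontr)
  assume a: "a \<noteq> 0"
  define t where "t = 1 / (C + 1)"
  have t: "0 < t" "C * t = 1 - t" using C by (simp_all add: t_def field_simps)
  have "1 * (t * a\<^sup>2) \<le> (C * t) * (t * a\<^sup>2)" using le[of "t * a"] by (simp add: power2_eq_square ac_simps)
  hence "1 \<le> C * t" by (rule mult_right_le_imp_le) (use t a in simp)
  thus False using t by simp
qed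

text \<open>Minimising the distance over translations amounts to maximising the scalar product with the translate, a periodic function
of \<open>s\<close>. Its derivative vanishes at a maximum; the quadratic estimate \<open>quad\<close> takes the place of differentiation under the
integral.\<close>

theorem orbit_minimiser:
  fixes W Z \<Phi> \<Psi> :: "real \<Rightarrow> 'b::euclidean_space"
  assumes X: "0 < X" and W: "W \<in> l2per X" and per: "periodic X Z" "periodic X \<Phi>" "periodic X \<Psi>"
    and d: "\<And>x. (Z has_vector_derivative \<Phi> x) (at x)" "\<And>x. (\<Phi> has_vector_derivative \<Psi> x) (at x)"
    and c: "continuous_on UNIV \<Psi>"
  obtains s where "\<And>s'. l2norm X (\<lambda>x. W x - Z (x + s)) \<le> l2norm X (\<lambda>x. W x - Z (x + s'))"
    "l2ip X (\<lambda>x. W x - Z (x + s)) (\<lambda>x. \<Phi> (x + s)) = 0"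
proof -
  have cZ: "continuous_on UNIV Z" and c\<Phi>: "continuous_on UNIV \<Phi>"
    using d by (meson continuous_at_imp_continuous_on has_vector_derivative_continuous)+
  have Zl: "Z \<in> l2per X" and \<Phi>l: "\<Phi> \<in> l2per X" by (intro l2per_continuous per cZ c\<Phi>)+
  have Zs: "(\<lambda>x. Z (x + s)) \<in> l2per X" and \<Phi>s: "(\<lambda>x. \<Phi> (x + s)) \<in> l2per X" for s
    by (intro l2per_shift(1) X Zl \<Phi>l)+
  obtain C1 where C1: "0 < C1" "\<And>x. norm (\<Phi> x) \<le> C1" using periodic_continuous_bounded[OF X per(2) c\<Phi>] by blast
  obtain C2 where C2: "0 < C2" "\<And>x. norm (\<Psi> x) \<le> C2" using periodic_continuous_bounded[OF X per(3) c] by blast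
  define ell where "ell s = l2ip X W (\<lambda>x. Z (x + s))" for s
  define ell' where "ell' s = l2ip X W (\<lambda>x. \<Phi> (x + s))" for s
  have sq: "(l2norm X (\<lambda>x. W x - Z (x + s)))\<^sup>2 = (l2norm X W)\<^sup>2 - 2 * ell s + (l2norm X Z)\<^sup>2" for s
  proof -
    have "(l2norm X (\<lambda>x. W x - Z (x + s)))\<^sup>2 = l2ip X W (\<lambda>x. W x - Z (x + s)) - l2ip X (\<lambda>x. Z (x + s)) (\<lambda>x. W x - Z (x + s))"
      unfolding l2ip_self[symmetric] by (rule l2ip_diff_left[OF W Zs l2per_diff(1)[OF W Zs]])
    also have "l2ip X W (\<lambda>x. W x - Z (x + s)) = (l2norm X W)\<^sup>2 - ell s"
      unfolding ell_def l2ip_commute[of X W] l2ip_diff_left[OF W Zs W] l2ip_self ..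
    also have "l2ip X (\<lambda>x. Z (x + s)) (\<lambda>x. W x - Z (x + s)) = ell s - (l2norm X Z)\<^sup>2"
      unfolding ell_def l2ip_commute[of X "\<lambda>x. Z (x + s)" "\<lambda>x. W x - Z (x + s)"] l2ip_diff_left[OF W Zs Zs] l2ip_self l2per_shift(2)[OF X Zl] ..
    finally show ?thesis by simp
  qed
  have quad: "\<bar>ell (s + h) - ell s - h * ell' s\<bar> \<le> (C2 * sqrt X * l2norm X W) * h\<^sup>2" for s h
  proof -
    define R where "R x = Z (x + (s + h)) - Z (x + s) - h *\<^sub>R \<Phi> (x + s)" for x
    have Rl: "R \<in> l2per X" unfolding R_def by (intro l2per_diff(1) Zs l2per_scaleR(1) \<Phi>s)
    have Rle: "norm (R x) \<le> C2 * h\<^sup>2" for x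
    proof -
      have \<Phi>L: "norm (\<Phi> (x + s + h') - \<Phi> (x + s)) \<le> C2 * \<bar>h'\<bar>" for h'
        using vector_mean_value_bound[OF d(2), of "x + s" "x + s + h'" C2] C2(2) by simp
      have dR: "((\<lambda>h. Z (x + s + h) - h *\<^sub>R \<Phi> (x + s)) has_vector_derivative (\<Phi> (x + s + h') - \<Phi> (x + s))) (at h')" for h'
      proof (rule has_vector_derivative_diff)
        have "((\<lambda>h. x + s + h) has_vector_derivative 1) (at h')" by (auto intro!: derivative_eq_intros)
        from vector_diff_chain_at[OF this d(1)]
        show "((\<lambda>h. Z (x + s + h)) has_vector_derivative \<Phi> (x + s + h')) (at h')" by (simp add: o_def)
      qed (auto intro!: derivative_eq_intros)
      have "norm (Z (x + s + h) - h *\<^sub>R \<Phi> (x + s) - (Z (x + s + 0) - 0 *\<^sub>R \<Phi> (x + s))) \<le> (C2 * \<bar>h\<bar>) * \<bar>h - 0\<bar>"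
      proof (rule vector_mean_value_bound[OF dR])
        fix h' assume "min 0 h \<le> h'" "h' \<le> max 0 h"
        hence "\<bar>h'\<bar> \<le> \<bar>h\<bar>" by linarith
        hence "C2 * \<bar>h'\<bar> \<le> C2 * \<bar>h\<bar>" using C2(1) by simp
        thus "norm (\<Phi> (x + s + h') - \<Phi> (x + s)) \<le> C2 * \<bar>h\<bar>" using \<Phi>L[of h'] by linarith
      qed
      thus ?thesis by (simp add: R_def power2_eq_square algebra_simps abs_mult_self_eq)
    qed
    have "l2ip X R W = ell (s + h) - ell s - h * ell' s"
      unfolding R_def l2ip_diff_left[OF l2per_diff(1)[OF Zs Zs] l2per_scaleR(1)[OF \<Phi>s] W] l2ip_diff_left[OF Zs Zs W] l2ip_scaleR_left
      by (simp add: ell_def ell'_def l2ip_commute[of X W])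
    hence "\<bar>ell (s + h) - ell s - h * ell' s\<bar> \<le> l2norm X R * l2norm X W" using l2ip_bound[OF Rl W] by simp
    also have "\<dots> \<le> (C2 * h\<^sup>2 * sqrt X) * l2norm X W"
      using l2per_norm_bounded[OF X Rl _ Rle] C2(1) by (intro mult_right_mono) auto
    finally show ?thesis by (simp add: ac_simps)
  qed
  have lip: "\<bar>ell s' - ell s\<bar> \<le> (C1 * sqrt X * l2norm X W) * \<bar>s' - s\<bar>" for s s'
  proof -
    have Rl: "(\<lambda>x. Z (x + s') - Z (x + s)) \<in> l2per X" by (intro l2per_diff(1) Zs)
    have "norm (Z (x + s') - Z (x + s)) \<le> C1 * \<bar>s' - s\<bar>" for x
      using vector_mean_value_bound[OF d(1), of "x + s" "x + s'" C1] C1(2) by simp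
    hence n: "l2norm X (\<lambda>x. Z (x + s') - Z (x + s)) \<le> C1 * \<bar>s' - s\<bar> * sqrt X"
      using l2per_norm_bounded[OF X Rl, of "C1 * \<bar>s' - s\<bar>"] C1(1) by simp
    have "ell s' - ell s = l2ip X (\<lambda>x. Z (x + s') - Z (x + s)) W"
      unfolding l2ip_diff_left[OF Zs Zs W] by (simp add: ell_def l2ip_commute[of X W])
    hence "\<bar>ell s' - ell s\<bar> \<le> l2norm X (\<lambda>x. Z (x + s') - Z (x + s)) * l2norm X W" using l2ip_bound[OF Rl W] by simp
    also have "\<dots> \<le> (C1 * \<bar>s' - s\<bar> * sqrt X) * l2norm X W" by (rule mult_right_mono[OF n]) simp
    finally show ?thesis by (simp add: ac_simps)
  qed
  define L where "L = C1 * sqrt X * l2norm X W"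
  have L0: "0 \<le> L" using C1 X by (simp add: L_def)
  have "continuous_on {0..X} ell"
  proof (rule continuous_onI)
    fix s e :: real assume e: "0 < e"
    show "\<exists>d>0. \<forall>s'\<in>{0..X}. dist s' s < d \<longrightarrow> dist (ell s') (ell s) \<le> e"
    proof (intro exI conjI ballI impI)
      show "0 < e / (L + 1)" using e L0 by simp
      fix s' assume "dist s' s < e / (L + 1)"
      hence "L * \<bar>s' - s\<bar> \<le> L * (e / (L + 1))" using L0 by (intro mult_left_mono) (auto simp: dist_real_def)
      also have "\<dots> \<le> e" using L0 e by (simp add: field_simps)
      finally show "dist (ell s') (ell s) \<le> e" using lip[of s' s] by (simp add: dist_real_def L_def)
    qed
  qed
  moreover have "{0..X} \<noteq> {}" using X by simp
  ultimately obtain s where s: "s \<in> {0..X}" "\<And>s'. s' \<in> {0..X} \<Longrightarrow> ell s' \<le> ell s"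
    using continuous_attains_sup[of "{0..X}" ell] by auto
  have max: "ell s' \<le> ell s" for s'
  proof -
    have fp: "frac_part X s' = s' + of_int (- \<lfloor>s' / X\<rfloor>) * X" by (simp add: frac_part_def)
    have "Z (x + frac_part X s') = Z (x + s')" for x
      using periodic_shift_int[OF per(1), of "x + s'" "- \<lfloor>s' / X\<rfloor>"] unfolding fp by (simp add: algebra_simps)
    hence "ell (frac_part X s') = ell s'" by (simp add: ell_def)
    moreover have "frac_part X s' \<in> {0..X}" using frac_part(1,2)[OF X, of s'] by simp
    ultimately show ?thesis using s(2) by metis
  qed
  have "ell' s = 0"
  proof (rule linear_le_quadratic_imp_zero)
    show "0 \<le> C2 * sqrt X * l2norm X W" using C2 X by simp
    show "h * ell' s \<le> C2 * sqrt X * l2norm X W * h\<^sup>2" for h using quad[of s h] max[of "s + h"] by linarith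
  qed
  moreover have "l2ip X (\<lambda>x. Z (x + s)) (\<lambda>x. \<Phi> (x + s)) = 0"
  proof -
    have dz: "((\<lambda>x. Z x \<bullet> Z x) has_real_derivative 2 * (Z x \<bullet> \<Phi> x)) (at x)" for x
      using bounded_bilinear.has_vector_derivative[OF bounded_bilinear_inner d(1) d(1)]
      by (simp add: has_real_derivative_iff_has_vector_derivative inner_commute)
    have sd: "sobolev_deriv (\<lambda>x. Z x \<bullet> Z x) (\<lambda>x. 2 * (Z x \<bullet> \<Phi> x))"
      by (rule sobolev_derivI[OF dz]) (intro continuous_intros cZ c\<Phi>)
    have "periodic X (\<lambda>x. Z (x + s) \<bullet> Z (x + s))" using periodic_shift[OF per(1), of s] by (simp add: periodic_def)
    from periodic_sobolev_mean_zero[OF X sobolev_deriv_shift[OF sd] this] show ?thesis by (simp add: l2ip_def)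
  qed
  ultimately have "l2ip X (\<lambda>x. W x - Z (x + s)) (\<lambda>x. \<Phi> (x + s)) = 0"
    by (simp add: l2ip_diff_left[OF W Zs \<Phi>s] ell'_def)
  moreover have "l2norm X (\<lambda>x. W x - Z (x + s)) \<le> l2norm X (\<lambda>x. W x - Z (x + s'))" for s'
  proof (rule power2_le_imp_le[OF _ l2norm_nonneg])
    show "(l2norm X (\<lambda>x. W x - Z (x + s)))\<^sup>2 \<le> (l2norm X (\<lambda>x. W x - Z (x + s')))\<^sup>2"
      unfolding sq using max[of s'] by linarith
  qed
  ultimately show thesis using that by blast
qed

section \<open>Expansion of the Lagrangian functional at the wave\<close>

context wave
begin

definition Zb :: "real \<Rightarrow> 'n state" where "Zb x = (u (p, x), wb p x)"
definition Ham where "Ham Z = mean_int X (\<lambda>x. H (Z x))"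
definition Imp where "Imp Z = mean_int X (\<lambda>x. impulse B (fst (Z x)))"
definition Mass where "Mass Z = mean_int X (\<lambda>x. fst (Z x))" for Z :: "real \<Rightarrow> 'n state"
definition Lag where "Lag Z = Ham Z + snd (snd p) * Imp Z + fst (snd p) \<bullet> Mass Z"

lemma Zb_derivatives:
  "(Zb has_vector_derivative (ux (p, x), wb' p x)) (at x)"
  "(Zbx has_vector_derivative (uxx (p, x), dd (0, 1) uxx (p, x) $ iv)) (at x)"
proof -
  have c: "((\<lambda>x. y x $ iv) has_vector_derivative y' $ iv) (at x)" if "(y has_vector_derivative y') (at x)" for y :: "real \<Rightarrow> real ^ 'n" and y'
    using has_derivative_inner_vec(2)[OF that, of iv] by (simp add: has_real_derivative_iff_has_vector_derivative)
  show "(Zb has_vector_derivative (ux (p, x), wb' p x)) (at x)"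
    unfolding Zb_def[abs_def] by (intro has_vector_derivative_Pair u_x[OF p] c[OF ux_x[OF p]])
  show "(Zbx has_vector_derivative (uxx (p, x), dd (0, 1) uxx (p, x) $ iv)) (at x)"
    by (intro has_vector_derivative_Pair ux_x[OF p] c[OF x_derivative[OF uxx_smooth p]])
qed

lemma Zb_continuous: "continuous_on UNIV Zb"
  using Zb_derivatives(1) by (meson continuous_at_imp_continuous_on has_vector_derivative_continuous)

lemma Zb_periodic: "periodic X Zb" "periodic X Zbx" "periodic X (\<lambda>x. (uxx (p, x), dd (0, 1) uxx (p, x) $ iv))"
proof -
  have "dd (0, 1) uxx (p, x + X) = dd (0, 1) uxx (p, x)" for x
    using period_derivative[OF p uxx_smooth uxx_per, of 0 1 x] by (simp add: dd_zero_\<Xi>[OF p])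
  thus "periodic X Zb" "periodic X Zbx" "periodic X (\<lambda>x. (uxx (p, x), dd (0, 1) uxx (p, x) $ iv))"
    by (simp_all add: periodic_def Zb_def u_per[OF p] ux_per[OF p] uxx_per[OF p])
qed

lemma Zb_jets: "Zb \<in> jets iv X"
proof -
  have "sobolev_deriv (\<lambda>x. fst (Zb x) $ iv) (\<lambda>x. snd (Zb x))" unfolding Zb_def fst_conv snd_conv
    by (rule sobolev_derivI[OF u_x_comp[OF p]]) (intro continuous_intros x_continuous[OF ux_smooth p])
  thus ?thesis using l2per_continuous[OF Zb_periodic(1) Zb_continuous] by (simp add: jets_def)
qed

lemma jet_integrable:
  assumes Z: "Z \<in> jets iv X"
  shows "per_integrable X (\<lambda>x. H (Z x))" "per_integrable X (\<lambda>x. impulse B (fst (Z x)))"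
    "per_integrable X (\<lambda>x. y \<bullet> fst (Z x))" "per_integrable X (\<lambda>x. fst (Z x))"
proof -
  note Zl = jetsD(1)[OF Z]
  have vc: "continuous_on UNIV (\<lambda>x. fst (Z x) $ iv)" by (rule sobolev_deriv_continuous[OF jetsD(2)[OF Z]])
  have cc: "continuous_on UNIV (\<lambda>x. g (fst (Z x) $ iv))" if "continuous_on UNIV g" for g :: "real \<Rightarrow> real"
    by (rule continuous_on_compose2[OF that vc]) simp
  have y: "per_integrable X (\<lambda>x. y \<bullet> fst (Z x))" for y
  proof -
    have "(\<lambda>x. y) \<in> l2per X" by (intro l2per_continuous) (auto simp: periodic_def)
    from l2ip_integrable[OF this l2per_fst(1)[OF Zl]] show ?thesis .
  qed
  have g: "per_integrable X (\<lambda>x. snd (Z x))" by (rule l2per_integrable[OF l2per_snd(1)[OF Zl]])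
  have g2: "per_integrable X (\<lambda>x. (snd (Z x))\<^sup>2)" using l2perD(3)[OF l2per_snd(1)[OF Zl]] by simp
  have UU: "per_integrable X (\<lambda>x. fst (Z x) \<bullet> fst (Z x))" by (rule l2ip_integrable[OF l2per_fst(1)[OF Zl] l2per_fst(1)[OF Zl]])
  note i1 = continuous_set_integrable[OF cc[OF cont0(1)], of 0 X]
  note i2 = set_integrable_continuous_mult[OF g cc[OF cont0(2)]]
  note i3 = set_integrable_continuous_mult[OF set_integrable_continuous_mult[OF g2 cc[OF cont0(3)]] continuous_on_const[of UNIV "1 / 2 :: real"]]
  note i4 = set_integrable_continuous_mult[OF y[of or] cc[OF cont0(5)]]
  note i5 = set_integrable_continuous_mult[OF set_integrable_continuous_mult[OF UU cc[OF cont0(4)]] continuous_on_const[of UNIV "1 / 2 :: real"]]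
  have "per_integrable X (\<lambda>x. f (fst (Z x) $ iv) + e (fst (Z x) $ iv) * snd (Z x) + (1 / 2) * (\<kappa> (fst (Z x) $ iv) * (snd (Z x))\<^sup>2)
      + t (fst (Z x) $ iv) * (or \<bullet> fst (Z x)) + (1 / 2) * (\<tau> (fst (Z x) $ iv) * (fst (Z x) \<bullet> fst (Z x))))"
    by (rule set_integral_add(1)[OF set_integral_add(1)[OF set_integral_add(1)[OF set_integral_add(1)[OF i1 i2] i3] i4] i5])
  moreover have "H (Z x) = f (fst (Z x) $ iv) + e (fst (Z x) $ iv) * snd (Z x) + (1 / 2) * (\<kappa> (fst (Z x) $ iv) * (snd (Z x))\<^sup>2)
      + t (fst (Z x) $ iv) * (or \<bullet> fst (Z x)) + (1 / 2) * (\<tau> (fst (Z x) $ iv) * (fst (Z x) \<bullet> fst (Z x)))" for x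
    using H_eq[of "fst (Z x)" "snd (Z x)"] by simp
  ultimately show "per_integrable X (\<lambda>x. H (Z x))" by simp
  show "per_integrable X (\<lambda>x. impulse B (fst (Z x)))" unfolding impulse_eq
    by (rule set_integrable_continuous_mult[OF y vc])
  show "per_integrable X (\<lambda>x. y \<bullet> fst (Z x))" by (rule y)
  show "per_integrable X (\<lambda>x. fst (Z x))" by (rule l2per_integrable[OF l2per_fst(1)[OF Zl]])
qed

lemma inner_Mass: "Z \<in> jets iv X \<Longrightarrow> y \<bullet> Mass Z = mean_int X (\<lambda>x. y \<bullet> fst (Z x))"
  using jet_integrable(4)[of Z] integral_inner_right[of y lebesgue "\<lambda>x. indicator {0..X} x *\<^sub>R fst (Z x)"]
  unfolding Mass_def set_lebesgue_integral_def set_integrable_def by (simp add: inner_scaleR_right)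

definition Lag_density where "Lag_density z = H z + snd (snd p) * impulse B (fst z) + fst (snd p) \<bullet> fst z"

lemma Lag_eq:
  assumes Z: "Z \<in> jets iv X"
  shows "per_integrable X (\<lambda>x. Lag_density (Z x))" "Lag Z = mean_int X (\<lambda>x. Lag_density (Z x))"
proof -
  note i = jet_integrable[OF Z]
  have c: "per_integrable X (\<lambda>x. snd (snd p) * impulse B (fst (Z x)))" using i(2) by simp
  show "per_integrable X (\<lambda>x. Lag_density (Z x))" unfolding Lag_density_def
    by (rule set_integral_add(1)[OF set_integral_add(1)[OF i(1) c] i(3)])
  show "Lag Z = mean_int X (\<lambda>x. Lag_density (Z x))"
    unfolding Lag_density_def set_integral_add(2)[OF set_integral_add(1)[OF i(1) c] i(3)] set_integral_add(2)[OF i(1) c]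
    by (simp add: Lag_def Ham_def Imp_def inner_Mass[OF Z])
qed

text \<open>The second derivative of the Lagrangian density differs from \<open>bd\<close> by the total derivative of
\<open>(e' + \<kappa>' v\<^sub>x) v\<^sup>2\<close>, which arises from integrating the mixed terms \<open>v v\<^sub>x\<close> by parts.\<close>

lemma second_variation_identity:
  fixes x :: real and z :: "'n state"
  defines "v0 \<equiv> vb p x" and "w \<equiv> wb p x" and "w' \<equiv> wb' p x" and "v \<equiv> fst z $ iv" and "g \<equiv> snd z"
  shows "D2H (Zb x) z + 2 * snd (snd p) * (v * (k \<bullet> fst z)) = J.bd x z z
    + ((deriv e v0 + deriv \<kappa> v0 * w) * (v * g + g * v) + (deriv (deriv e) v0 * w + deriv (deriv \<kappa>) v0 * w\<^sup>2 + deriv \<kappa> v0 * w') * (v * v))"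
proof -
  define y V c where "y = u (p, x)" and "V = fst z" and "c = snd (snd p)"
  have yv: "y $ iv = v0" and Vv: "V $ iv = v" by (simp_all add: y_def v0_def V_def v_def)
  have "nx p x \<bullet> V = deriv t v0 * (or \<bullet> V) + deriv \<tau> v0 * (y \<bullet> V) + c * (k \<bullet> V)
    + ((deriv (deriv f) v0 - deriv (deriv \<kappa>) v0 * w\<^sup>2 / 2 - deriv \<kappa> v0 * w'
         + deriv (deriv t) v0 * (or \<bullet> y) + deriv (deriv \<tau>) v0 * (y \<bullet> y) / 2) / 2) * v"
    unfolding nx_def nvec_def y_def[symmetric] w_def[symmetric] w'_def[symmetric] c_def[symmetric] yv
    by (simp add: inner_add_left inner_axis' v_def V_def)
  hence bd: "J.bd x z z = \<kappa> v0 * g * g + \<tau> v0 * (V \<bullet> V) + 2 * (v * (deriv t v0 * (or \<bullet> V) + deriv \<tau> v0 * (y \<bullet> V) + c * (k \<bullet> V)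
    + ((deriv (deriv f) v0 - deriv (deriv \<kappa>) v0 * w\<^sup>2 / 2 - deriv \<kappa> v0 * w'
         + deriv (deriv t) v0 * (or \<bullet> y) + deriv (deriv \<tau>) v0 * (y \<bullet> y) / 2) / 2) * v))"
    unfolding J.bd_def using Vv by (simp add: V_def[symmetric] g_def[symmetric] v0_def[symmetric])
  have D: "D2H (Zb x) z = deriv (deriv f) v0 * v\<^sup>2 + (deriv (deriv e) v0 * v\<^sup>2 * w + 2 * deriv e v0 * v * g)
     + (deriv (deriv \<kappa>) v0 * v\<^sup>2 * w\<^sup>2 / 2 + 2 * deriv \<kappa> v0 * v * w * g + \<kappa> v0 * g\<^sup>2)
     + (deriv (deriv t) v0 * v\<^sup>2 * (or \<bullet> y) + 2 * deriv t v0 * v * (or \<bullet> V))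
     + (deriv (deriv \<tau>) v0 * v\<^sup>2 * (y \<bullet> y) / 2 + 2 * deriv \<tau> v0 * v * (y \<bullet> V) + \<tau> v0 * (V \<bullet> V))"
    by (simp add: D2H_def Zb_def Let_def v0_def v_def w_def g_def y_def V_def)
  show ?thesis unfolding bd D V_def[symmetric] c_def[symmetric] by (simp add: field_simps power2_eq_square)
qed

text \<open>In the density, the first variation is a total derivative by the Euler equation (\<open>h1\<close>), and the second one is \<open>bd\<close> up to
another (\<open>h2\<close>).\<close>

theorem Lag_expansion:
  obtains C r where "0 < C" "0 < r"
    "\<And>Z. Z \<in> jets iv X \<Longrightarrow> l2norm X Z \<le> r \<Longrightarrow>
       \<bar>Lag (\<lambda>x. Zb x + Z x) - Lag Zb - J.b Z Z / 2\<bar> \<le> C * (l2norm X Z) ^ 3"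
proof -
  obtain R where R: "0 < R" "\<And>x. norm (Zb x) \<le> R"
    using periodic_continuous_bounded[OF \<Xi>_pos[OF p] Zb_periodic(1) Zb_continuous] by blast
  obtain C0 where C0: "0 < C0" "\<And>y z. norm y \<le> R \<Longrightarrow> \<bar>fst z $ iv\<bar> \<le> 1 \<Longrightarrow>
       \<bar>H (y + z) - H y - DH y z - D2H y z / 2\<bar> \<le> C0 * (\<bar>fst z $ iv\<bar> * (norm z)\<^sup>2)"
    by (rule H_Taylor[OF less_imp_le[OF R(1)]]) blast
  define Cs where "Cs = 1 / sqrt X + 2 * sqrt X"
  have Cs: "0 < Cs" using \<Xi>_pos[OF p] by (simp add: Cs_def add_pos_pos)
  show thesis
  proof (rule that[of "C0 * Cs" "1 / Cs"])
    show "0 < C0 * Cs" "0 < 1 / Cs" using C0 Cs by auto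
    fix Z assume Z: "Z \<in> jets iv X" and small: "l2norm X Z \<le> 1 / Cs"
    define v g where "v x = fst (Z x) $ iv" and "g x = snd (Z x)" for x
    define S where "S = Cs * l2norm X Z"
    have vS: "\<bar>v x\<bar> \<le> S" for x using jets_sup_bound[OF \<Xi>_pos[OF p] Z, of x] by (simp add: v_def S_def Cs_def)
    have S1: "S \<le> 1" using small Cs by (simp add: S_def field_simps)
    have sv: "sobolev_deriv v g" using jetsD(2)[OF Z] by (simp add: v_def[abs_def] g_def[abs_def])
    have vp: "v (x + X) = v x" for x using l2perD(1)[OF jetsD(1)[OF Z]] by (simp add: periodic_def v_def)
    note uc = coefficient_continuous[OF p] and wc = x_continuous[OF ux_smooth p] and wc' = x_continuous[OF uxx_smooth p]
    define a a' where "a x = e (vb p x) + \<kappa> (vb p x) * wb p x"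
      and "a' x = deriv e (vb p x) * wb p x + deriv \<kappa> (vb p x) * (wb p x)\<^sup>2 + \<kappa> (vb p x) * wb' p x" for x
    define r r' where "r x = deriv e (vb p x) + deriv \<kappa> (vb p x) * wb p x"
      and "r' x = deriv (deriv e) (vb p x) * wb p x + deriv (deriv \<kappa>) (vb p x) * (wb p x)\<^sup>2 + deriv \<kappa> (vb p x) * wb' p x" for x
    have sa: "sobolev_deriv a a'"
    proof (rule sobolev_derivI)
      show "(a has_real_derivative a' x) (at x)" for x unfolding a_def[abs_def] a'_def
        by (rule smooth[THEN has_real_derivative_comp(1)] u_x_comp[OF p] ux_x_comp[OF p] derivative_eq_intros refl)+
           (simp add: power2_eq_square algebra_simps)
      show "continuous_on UNIV a'" unfolding a'_def[abs_def] by (intro continuous_intros uc cont0 cont1 wc wc')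
    qed
    have sr: "sobolev_deriv r r'"
    proof (rule sobolev_derivI)
      show "(r has_real_derivative r' x) (at x)" for x unfolding r_def[abs_def] r'_def
        by (rule smooth[THEN has_real_derivative_comp(2)] u_x_comp[OF p] ux_x_comp[OF p] derivative_eq_intros refl)+
           (simp add: power2_eq_square algebra_simps)
      show "continuous_on UNIV r'" unfolding r'_def[abs_def] by (intro continuous_intros uc cont1 cont2 wc wc')
    qed
    have zero: "per_integrable X h \<and> mean_int X h = 0" if "sobolev_deriv F h" "periodic X F" for F h
      using that(1) periodic_sobolev_mean_zero[OF \<Xi>_pos[OF p] that] \<Xi>_pos[OF p] unfolding sobolev_deriv_def by (simp add: less_imp_le)
    define h1 where "h1 x = a x * g x + a' x * v x" for x
    define h2 where "h2 x = r x * (v x * g x + g x * v x) + r' x * (v x * v x)" for x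
    have h1: "per_integrable X h1" "mean_int X h1 = 0"
      using zero[OF sobolev_deriv_mult[OF sa sv]] by (auto simp: h1_def[abs_def] periodic_def a_def vp u_per[OF p] ux_per[OF p])
    have h2: "per_integrable X h2" "mean_int X h2 = 0"
      using zero[OF sobolev_deriv_mult[OF sr sobolev_deriv_mult[OF sv sv]]] by (auto simp: h2_def[abs_def] periodic_def r_def vp u_per[OF p] ux_per[OF p])
    define bz where "bz x = J.bd x (Z x) (Z x)" for x
    have bz: "per_integrable X bz" "mean_int X bz = J.b Z Z"
      using J.b_integrable[OF jetsD(1)[OF Z] jetsD(1)[OF Z]] by (simp_all add: bz_def[abs_def] J.b_def)
    have Y: "(\<lambda>x. Zb x + Z x) \<in> jets iv X" by (rule jets_add[OF Zb_jets Z])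
    define rem where "rem x = H (Zb x + Z x) - H (Zb x) - DH (Zb x) (Z x) - D2H (Zb x) (Z x) / 2" for x
    have rem_eq: "rem x = (Lag_density (Zb x + Z x) - Lag_density (Zb x)) - (h1 x + ((1 / 2) * h2 x + (1 / 2) * bz x))" for x
    proof -
      have imp: "impulse B (fst (Zb x + Z x)) - impulse B (fst (Zb x)) =
          (vb p x * (k \<bullet> fst (Z x)) + v x * (k \<bullet> u (p, x))) + v x * (k \<bullet> fst (Z x))"
        by (simp add: impulse_eq Zb_def v_def inner_add_right algebra_simps)
      have DHl: "DH (Zb x) (Z x) + snd (snd p) * (vb p x * (k \<bullet> fst (Z x)) + v x * (k \<bullet> u (p, x))) + fst (snd p) \<bullet> fst (Z x) = h1 x"
      proof -
        have EU0: "EU (u (p, x)) (wb p x) (snd (snd p)) = EU (u (p, x)) (wb p x) 0 + snd (snd p) *\<^sub>R ((vb p x) *\<^sub>R k + (k \<bullet> u (p, x)) *\<^sub>R axis iv 1)"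
          by (simp add: EU_def)
        have "(EU (u (p, x)) (wb p x) (snd (snd p)) + fst (snd p)) \<bullet> fst (Z x) = a' x * v x"
          unfolding EU_flux[OF p] by (simp add: a'_def inner_axis' v_def)
        thus ?thesis unfolding EU0
          by (simp add: DH_def Zb_def h1_def a_def g_def v_def inner_add_left inner_axis' algebra_simps)
      qed
      have sec: "D2H (Zb x) (Z x) + 2 * snd (snd p) * (v x * (k \<bullet> fst (Z x))) = bz x + h2 x"
        using second_variation_identity[of x "Z x"] by (simp add: bz_def h2_def r_def r'_def v_def g_def)
      have "Lag_density (Zb x + Z x) - Lag_density (Zb x) = H (Zb x + Z x) - H (Zb x)
          + snd (snd p) * (impulse B (fst (Zb x + Z x)) - impulse B (fst (Zb x))) + fst (snd p) \<bullet> fst (Z x)"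
        by (simp add: Lag_density_def inner_add_right algebra_simps)
      thus ?thesis unfolding rem_def imp using DHl sec by (simp add: algebra_simps)
    qed
    have i2: "per_integrable X (\<lambda>x. (1 / 2) * h2 x)" "per_integrable X (\<lambda>x. (1 / 2) * bz x)"
      using h2(1) bz(1) by simp_all
    note iA = set_integral_diff[OF Lag_eq(1)[OF Y] Lag_eq(1)[OF Zb_jets]]
    note iC = set_integral_add[OF i2]
    note iB = set_integral_add[OF h1(1) iC(1)]
    have remi: "per_integrable X rem" unfolding rem_eq by (rule set_integral_diff(1)[OF iA(1) iB(1)])
    have "mean_int X rem = Lag (\<lambda>x. Zb x + Z x) - Lag Zb - J.b Z Z / 2"
      unfolding rem_eq set_integral_diff(2)[OF iA(1) iB(1)] iA(2) iB(2) iC(2) Lag_eq(2)[OF Y] Lag_eq(2)[OF Zb_jets] h1(2)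
      using h2(2) bz(2) by simp
    moreover have "\<bar>mean_int X rem\<bar> \<le> (C0 * Cs) * (l2norm X Z) ^ 3"
    proof -
      have le: "\<bar>rem x\<bar> \<le> (C0 * S) * (norm (Z x))\<^sup>2" for x
      proof -
        have "\<bar>fst (Z x) $ iv\<bar> \<le> 1" using vS[of x] S1 by (simp add: v_def)
        from C0(2)[OF R(2) this] have "\<bar>rem x\<bar> \<le> C0 * (\<bar>v x\<bar> * (norm (Z x))\<^sup>2)" by (simp add: rem_def v_def)
        also have "\<dots> \<le> C0 * (S * (norm (Z x))\<^sup>2)" using C0(1) vS[of x] by (intro mult_left_mono mult_right_mono) auto
        finally show ?thesis by (simp add: mult.assoc)
      qed
      have i: "per_integrable X (\<lambda>x. (C0 * S) * (norm (Z x))\<^sup>2)" using l2perD(3)[OF jetsD(1)[OF Z]] by simp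
      have m: "per_integrable X (\<lambda>x. (- (C0 * S)) * (norm (Z x))\<^sup>2)"
        by (rule set_integrable_continuous_mult[OF l2perD(3)[OF jetsD(1)[OF Z]] continuous_on_const])
      have "mean_int X rem \<le> mean_int X (\<lambda>x. (C0 * S) * (norm (Z x))\<^sup>2)"
        by (rule set_integral_mono[OF remi i abs_le_D1[OF le]])
      also have "\<dots> = (C0 * S) * (l2norm X Z)\<^sup>2" by (simp only: l2norm_sq set_integral_mult_right)
      finally have up: "mean_int X rem \<le> (C0 * S) * (l2norm X Z)\<^sup>2" .
      have lo: "(- (C0 * S)) * (norm (Z x))\<^sup>2 \<le> rem x" for x using abs_le_D2[OF le[of x]] by (simp only: minus_le_iff mult_minus_left)
      have "(- (C0 * S)) * (l2norm X Z)\<^sup>2 = mean_int X (\<lambda>x. (- (C0 * S)) * (norm (Z x))\<^sup>2)" by (simp only: l2norm_sq set_integral_mult_right)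
      also have "\<dots> \<le> mean_int X rem" by (rule set_integral_mono[OF m remi lo])
      finally have "- ((C0 * S) * (l2norm X Z)\<^sup>2) \<le> mean_int X rem" by (simp only: mult_minus_left)
      with up have "\<bar>mean_int X rem\<bar> \<le> (C0 * S) * (l2norm X Z)\<^sup>2" by linarith
      thus ?thesis by (simp add: S_def power2_eq_square power3_eq_cube ac_simps)
    qed
    ultimately show "\<bar>Lag (\<lambda>x. Zb x + Z x) - Lag Zb - J.b Z Z / 2\<bar> \<le> (C0 * Cs) * (l2norm X Z) ^ 3" by simp
  qed
qed

end

section \<open>Orbital stability\<close>

lemma square_sum_le: "(a + b)\<^sup>2 \<le> 2 * a\<^sup>2 + 2 * b\<^sup>2" for a b :: real
  using zero_le_power2[of "a - b"] by (simp add: power2_eq_square algebra_simps)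

lemma continuous_AE_eq:
  fixes f g :: "real \<Rightarrow> real"
  assumes "continuous_on UNIV f" "continuous_on UNIV g" and ae: "AE x in lebesgue. f x = g x"
  shows "f = g"
proof (rule ccontr)
  assume "f \<noteq> g"
  have o: "open {x. f x \<noteq> g x}" by (rule open_Collect_neq[OF assms(1,2)])
  have "{x. f x \<noteq> g x} \<noteq> {}" using \<open>f \<noteq> g\<close> by (auto simp: fun_eq_iff)
  hence "\<not> negligible {x. f x \<noteq> g x}" by (rule open_not_negligible[OF o])
  moreover have "{x. f x \<noteq> g x} \<in> null_sets lebesgue"
    using ae AE_iff_null_sets[of "{x. f x \<noteq> g x}" lebesgue] lmeasurable_open o by (auto simp: borel_open)
  ultimately show False by (simp add: negligible_iff_null_sets)
qed

context wave
begin

definition dim_n :: real where "dim_n = real CARD('n)"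

lemma dim_n_nonneg: "0 \<le> dim_n" by (simp add: dim_n_def)

lemma Mass_add: "Z \<in> jets iv X \<Longrightarrow> W \<in> jets iv X \<Longrightarrow> Mass (\<lambda>x. Z x + W x) = Mass Z + Mass W"
  by (simp add: Mass_def set_integral_add(2)[OF jet_integrable(4) jet_integrable(4)])

lemma constraints_Some: "Z \<in> jets iv X \<Longrightarrow> constraints Z $ Some \<alpha> = Mass Z $ \<alpha>"
  using inner_Mass[of Z "axis \<alpha> 1"] by (simp add: constraints_def grad_def inner_axis')

lemma Imp_expansion:
  assumes Z: "Z \<in> jets iv X"
  shows "\<bar>Imp (\<lambda>x. Zb x + Z x) - Imp Zb - constraints Z $ None\<bar> \<le> norm k * (l2norm X Z)\<^sup>2"
proof -
  have Y: "(\<lambda>x. Zb x + Z x) \<in> jets iv X" by (rule jets_add[OF Zb_jets Z])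
  note [measurable] = l2perD(2)[OF l2per_fst(1)[OF jetsD(1)[OF Z]]] l2perD(2)[OF l2per_first_component(1)[OF jetsD(1)[OF Z]]]
  define h where "h x = (fst (Z x) $ iv) * (k \<bullet> fst (Z x))" for x
  have hm: "h \<in> borel_measurable lebesgue" unfolding h_def by measurable
  have hle: "\<bar>h x\<bar> \<le> norm k * (norm (Z x) * norm (Z x))" for x
  proof -
    have 1: "\<bar>fst (Z x) $ iv\<bar> \<le> norm (Z x)" "norm (fst (Z x)) \<le> norm (Z x)"
      using component_le_norm_cart[of "fst (Z x)" iv] norm_fst_le[of "fst (Z x)" "snd (Z x)"] by auto
    have "\<bar>k \<bullet> fst (Z x)\<bar> \<le> norm k * norm (Z x)"
      by (rule order_trans[OF Cauchy_Schwarz_ineq2 mult_left_mono[OF 1(2)]]) simp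
    from mult_mono[OF 1(1) this] show ?thesis by (simp add: h_def abs_mult mult.left_commute)
  qed
  note h = l2_bilinear_bound[OF jetsD(1)[OF Z] jetsD(1)[OF Z] hm norm_ge_zero hle]
  have gi: "per_integrable X (\<lambda>x. grad (check_dir None) (u (p, x)) \<bullet> fst (Z x))"
    by (rule l2ip_integrable[OF l2per_continuous[OF grad_ub(2,1)] l2per_fst(1)[OF jetsD(1)[OF Z]]])
  have eq: "impulse B (fst (Zb x + Z x)) - impulse B (fst (Zb x)) = grad (check_dir None) (u (p, x)) \<bullet> fst (Z x) + h x" for x
    by (simp add: impulse_eq Zb_def h_def grad_def inner_add_right inner_add_left inner_axis' algebra_simps)
  have "Imp (\<lambda>x. Zb x + Z x) - Imp Zb = mean_int X (\<lambda>x. impulse B (fst (Zb x + Z x)) - impulse B (fst (Zb x)))"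
    unfolding Imp_def by (rule set_integral_diff(2)[OF jet_integrable(2)[OF Y] jet_integrable(2)[OF Zb_jets], symmetric])
  also have "\<dots> = constraints Z $ None + mean_int X h"
    unfolding eq set_integral_add(2)[OF gi h(1)] by (simp add: constraints_def)
  finally show ?thesis using h(2) by (simp add: power2_eq_square)
qed

lemma constraints_norm_le:
  assumes Z: "Z \<in> jets iv X"
  shows "norm (constraints Z) \<le> \<bar>constraints Z $ None\<bar> + dim_n * norm (Mass Z)"
proof -
  have "norm (constraints Z) \<le> (\<Sum>i\<in>UNIV. \<bar>constraints Z $ i\<bar>)" by (rule norm_le_l1_cart)
  also have "\<dots> = \<bar>constraints Z $ None\<bar> + (\<Sum>\<alpha>\<in>UNIV. \<bar>Mass Z $ \<alpha>\<bar>)"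
    by (simp add: UNIV_option_conv sum.reindex constraints_Some[OF Z])
  also have "(\<Sum>\<alpha>\<in>UNIV. \<bar>Mass Z $ \<alpha>\<bar>) \<le> (\<Sum>\<alpha>\<in>(UNIV :: 'n set). norm (Mass Z))"
    by (rule sum_mono) (rule component_le_norm_cart)
  finally show ?thesis by (simp add: dim_n_def)
qed

lemma Mass_norm_le:
  assumes Z: "Z \<in> jets iv X"
  shows "norm (Mass Z) \<le> dim_n * norm (constraints Z)"
proof -
  have "norm (Mass Z) \<le> (\<Sum>\<alpha>\<in>UNIV. \<bar>Mass Z $ \<alpha>\<bar>)" by (rule norm_le_l1_cart)
  also have "\<dots> \<le> (\<Sum>\<alpha>\<in>(UNIV :: 'n set). norm (constraints Z))"
    unfolding constraints_Some[OF Z, symmetric] by (rule sum_mono) (rule component_le_norm_cart)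
  finally show ?thesis by (simp add: dim_n_def)
qed

text \<open>\<open>Lyap\<close> is twice the Lagrangian functional, relative to the wave, with a penalty for deviations of the impulse and of the
mass. The solution need not have the same values of these as the wave.\<close>

definition deviation where "deviation Y = \<bar>Imp Y - Imp Zb\<bar> + dim_n * norm (Mass Y - Mass Zb)"
definition Lyap where "Lyap K Y = 2 * (Lag Y - Lag Zb) + 2 * K * (deviation Y)\<^sup>2"

lemma deviation_nonneg: "0 \<le> deviation Y" by (simp add: deviation_def dim_n_nonneg)

lemma Mass_diff: "Z \<in> jets iv X \<Longrightarrow> Mass (\<lambda>x. Zb x + Z x) - Mass Zb = Mass Z"
  by (simp add: Mass_add[OF Zb_jets])

theorem local_coercivity:
  assumes index: index_condition
    and inv: "invertible Cmat"
  obtains \<beta> K r where "0 < \<beta>" "0 \<le> K" "0 < r"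
    "\<And>Z. Z \<in> jets iv X \<Longrightarrow> l2ip X Z Zbx = 0 \<Longrightarrow> l2norm X Z \<le> r \<Longrightarrow>
       \<beta> * (l2norm X Z)\<^sup>2 \<le> Lyap K (\<lambda>x. Zb x + Z x)"
proof -
  obtain \<alpha> K where \<alpha>: "0 < \<alpha>" and K: "0 \<le> K" and co: "\<And>Z. Z \<in> jets iv X \<Longrightarrow> l2ip X Z Zbx = 0 \<Longrightarrow>
       \<alpha> * (l2norm X Z)\<^sup>2 \<le> J.b Z Z + K * (norm (constraints Z))\<^sup>2"
    by (rule wave_coercive[OF index inv]) blast
  obtain C r0 where C: "0 < C" "0 < r0" and ex: "\<And>Z. Z \<in> jets iv X \<Longrightarrow> l2norm X Z \<le> r0 \<Longrightarrow>
       \<bar>Lag (\<lambda>x. Zb x + Z x) - Lag Zb - J.b Z Z / 2\<bar> \<le> C * (l2norm X Z) ^ 3"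
    by (rule Lag_expansion) blast
  \<comment> \<open>The cubic remainder and the quadratic error of the linearised constraints are absorbed for small \<open>L\<close>.\<close>
  define E where "E = 2 * C + 2 * K * (norm k)\<^sup>2"
  have E: "0 < E" using C K by (simp add: E_def add_pos_nonneg)
  define r where "r = min r0 (min 1 (\<alpha> / (2 * E)))"
  show thesis
  proof (rule that[of "\<alpha> / 2" K r])
    show "0 < \<alpha> / 2" "0 \<le> K" "0 < r" using \<alpha> K C E by (auto simp: r_def)
    fix Z assume Z: "Z \<in> jets iv X" and o: "l2ip X Z Zbx = 0" and small: "l2norm X Z \<le> r"
    define L A where "L = l2norm X Z" and "A = deviation (\<lambda>x. Zb x + Z x)"
    have L: "0 \<le> L" "L \<le> r0" "L \<le> 1" "L \<le> \<alpha> / (2 * E)" using small by (auto simp: L_def r_def)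
    have q: "norm (constraints Z) \<le> A + norm k * L\<^sup>2"
      using constraints_norm_le[OF Z] Imp_expansion[OF Z] unfolding A_def deviation_def Mass_diff[OF Z] L_def by linarith
    have "(norm (constraints Z))\<^sup>2 \<le> (A + norm k * L\<^sup>2)\<^sup>2" by (rule power_mono[OF q]) simp
    also have "\<dots> \<le> 2 * A\<^sup>2 + 2 * (norm k * L\<^sup>2)\<^sup>2" by (rule square_sum_le)
    finally have "K * (norm (constraints Z))\<^sup>2 \<le> K * (2 * A\<^sup>2 + 2 * (norm k * L\<^sup>2)\<^sup>2)" using K by (rule mult_left_mono)
    also have "\<dots> = 2 * K * A\<^sup>2 + 2 * K * (norm k)\<^sup>2 * L ^ 4" by (simp add: power_mult_distrib algebra_simps)
    finally have 1: "K * (norm (constraints Z))\<^sup>2 \<le> 2 * K * A\<^sup>2 + 2 * K * (norm k)\<^sup>2 * L ^ 4" .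
    have "L ^ 4 \<le> L ^ 3" using L by (intro power_decreasing) auto
    hence "2 * K * (norm k)\<^sup>2 * L ^ 4 \<le> 2 * K * (norm k)\<^sup>2 * L ^ 3" using K by (intro mult_left_mono) auto
    moreover have "\<alpha> * L\<^sup>2 \<le> J.b Z Z + K * (norm (constraints Z))\<^sup>2" using co[OF Z o] by (simp add: L_def)
    moreover have "J.b Z Z \<le> 2 * (Lag (\<lambda>x. Zb x + Z x) - Lag Zb) + 2 * (C * L ^ 3)"
      using ex[OF Z] L(2) unfolding L_def by (simp add: abs_le_iff)
    ultimately have "\<alpha> * L\<^sup>2 \<le> Lyap K (\<lambda>x. Zb x + Z x) + (2 * (C * L ^ 3) + 2 * K * (norm k)\<^sup>2 * L ^ 3)"
      using 1 unfolding Lyap_def A_def by linarith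
    also have "2 * (C * L ^ 3) + 2 * K * (norm k)\<^sup>2 * L ^ 3 = (E * L) * L\<^sup>2" by (simp add: E_def power2_eq_square power3_eq_cube algebra_simps)
    also have "\<dots> \<le> (\<alpha> / 2) * L\<^sup>2"
      using L(4) E by (intro mult_right_mono) (auto simp: field_simps)
    finally show "\<alpha> / 2 * (l2norm X Z)\<^sup>2 \<le> Lyap K (\<lambda>x. Zb x + Z x)" by (simp add: L_def)
  qed
qed

theorem Lyap_upper_bound:
  assumes K: "0 \<le> K"
  obtains M r where "0 < M" "0 < r"
    "\<And>Z. Z \<in> jets iv X \<Longrightarrow> l2norm X Z \<le> r \<Longrightarrow> Lyap K (\<lambda>x. Zb x + Z x) \<le> M * l2norm X Z"
proof -
  obtain C r0 where C: "0 < C" "0 < r0" and ex: "\<And>Z. Z \<in> jets iv X \<Longrightarrow> l2norm X Z \<le> r0 \<Longrightarrow>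
       \<bar>Lag (\<lambda>x. Zb x + Z x) - Lag Zb - J.b Z Z / 2\<bar> \<le> C * (l2norm X Z) ^ 3"
    by (rule Lag_expansion) blast
  obtain Cb where Cb: "0 < Cb" "\<And>Z W. Z \<in> l2per X \<Longrightarrow> W \<in> l2per X \<Longrightarrow> \<bar>J.b Z W\<bar> \<le> Cb * (l2norm X Z * l2norm X W)"
    by (rule J.b_bound) blast
  define Cq where "Cq = (\<Sum>i\<in>UNIV. l2norm X (\<lambda>x. grad (check_dir i) (u (p, x))))"
  have Cq: "0 \<le> Cq" unfolding Cq_def by (intro sum_nonneg) simp
  define D where "D = (1 + dim_n * dim_n) * Cq + norm k"
  have D: "0 \<le> D" unfolding D_def using Cq dim_n_nonneg by simp
  show thesis
  proof (rule that[of "Cb + 2 * C + 2 * K * D\<^sup>2" "min r0 1"])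
    show "0 < Cb + 2 * C + 2 * K * D\<^sup>2" "0 < min r0 1" using Cb C K by (auto simp: add_pos_nonneg)
    fix Z assume Z: "Z \<in> jets iv X" and small: "l2norm X Z \<le> min r0 1"
    define L A where "L = l2norm X Z" and "A = deviation (\<lambda>x. Zb x + Z x)"
    have L: "0 \<le> L" "L \<le> r0" "L \<le> 1" using small by (auto simp: L_def)
    have L2: "L\<^sup>2 \<le> L" "L ^ 3 \<le> L" using L power_decreasing[of 1 2 L] power_decreasing[of 1 3 L] by auto
    have q: "norm (constraints Z) \<le> Cq * L" using constraints_bound[OF Z] by (simp add: Cq_def L_def)
    have n: "\<bar>constraints Z $ None\<bar> \<le> norm (constraints Z)" by (rule component_le_norm_cart)
    have m: "dim_n * norm (Mass Z) \<le> dim_n * (dim_n * norm (constraints Z))"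
      by (rule mult_left_mono[OF Mass_norm_le[OF Z] dim_n_nonneg])
    have "A \<le> norm (constraints Z) + norm k * L\<^sup>2 + dim_n * (dim_n * norm (constraints Z))"
      using n m Imp_expansion[OF Z] unfolding A_def deviation_def Mass_diff[OF Z] L_def by linarith
    also have "\<dots> \<le> Cq * L + norm k * L + dim_n * (dim_n * (Cq * L))"
      by (intro add_mono mult_left_mono q L2 dim_n_nonneg norm_ge_zero)
    also have "\<dots> = D * L" by (simp add: D_def algebra_simps)
    finally have A: "A \<le> D * L" .
    have "A\<^sup>2 \<le> (D * L)\<^sup>2" using A deviation_nonneg by (intro power_mono) (auto simp: A_def)
    also have "\<dots> \<le> D\<^sup>2 * L" using L2 by (simp add: power_mult_distrib mult_left_mono)
    finally have A2: "2 * K * A\<^sup>2 \<le> 2 * K * (D\<^sup>2 * L)" using K by (intro mult_left_mono) auto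
    have "J.b Z Z \<le> Cb * L\<^sup>2" using Cb(2)[OF jetsD(1)[OF Z] jetsD(1)[OF Z]] by (simp add: L_def power2_eq_square)
    also have "\<dots> \<le> Cb * L" using Cb L2 by (intro mult_left_mono) auto
    finally have b: "J.b Z Z \<le> Cb * L" .
    have "C * L ^ 3 \<le> C * L" using C L2 by (intro mult_left_mono) auto
    hence "2 * (Lag (\<lambda>x. Zb x + Z x) - Lag Zb) \<le> Cb * L + 2 * (C * L)"
      using ex[OF Z] L(2) b unfolding L_def by (simp add: abs_le_iff)
    hence "Lyap K (\<lambda>x. Zb x + Z x) \<le> Cb * L + 2 * (C * L) + 2 * K * (D\<^sup>2 * L)"
      using A2 unfolding Lyap_def A_def by linarith
    thus "Lyap K (\<lambda>x. Zb x + Z x) \<le> (Cb + 2 * C + 2 * K * D\<^sup>2) * l2norm X Z" by (simp add: L_def algebra_simps)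
  qed
qed

lemma shift_invariance:
  assumes Y: "Y \<in> jets iv X"
  shows "Ham (\<lambda>x. Y (x + s)) = Ham Y" "Imp (\<lambda>x. Y (x + s)) = Imp Y" "Mass (\<lambda>x. Y (x + s)) = Mass Y"
proof -
  have per: "periodic X (\<lambda>x. g (Y x))" for g :: "'n state \<Rightarrow> 'b" using l2perD(1)[OF jetsD(1)[OF Y]] by (simp add: periodic_def)
  show "Ham (\<lambda>x. Y (x + s)) = Ham Y" "Imp (\<lambda>x. Y (x + s)) = Imp Y" 
    unfolding Ham_def Imp_def
    using periodic_integral_shift[OF \<Xi>_pos[OF p] per jet_integrable(1)[OF Y]] periodic_integral_shift[OF \<Xi>_pos[OF p] per jet_integrable(2)[OF Y]] by blast+
  have per': "periodic X (\<lambda>x. fst (Y x))" using l2perD(1)[OF jetsD(1)[OF Y]] by (simp add: periodic_def)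
  show "Mass (\<lambda>x. Y (x + s)) = Mass Y" unfolding Mass_def
    by (rule periodic_integral_shift[OF \<Xi>_pos[OF p] per' jet_integrable(4)[OF Y]])
qed

lemma Lyap_cong: "Ham Y = Ham Y' \<Longrightarrow> Imp Y = Imp Y' \<Longrightarrow> Mass Y = Mass Y' \<Longrightarrow> Lyap K Y = Lyap K Y'"
  by (simp add: Lyap_def Lag_def deviation_def)

definition conservative_trajectory :: "real set \<Rightarrow> (real \<Rightarrow> real \<Rightarrow> 'n state) \<Rightarrow> (real \<Rightarrow> 'n state) \<Rightarrow> bool"
  where "conservative_trajectory I W W0 \<longleftrightarrow> 0 \<in> I \<and> W0 \<in> jets iv X \<and> (AE x in lebesgue. W 0 x = W0 x) \<and>
    (\<forall>t\<in>I. 0 \<le> t \<and> {0..t} \<subseteq> I \<and> W t \<in> jets iv X \<and> Ham (W t) = Ham W0 \<and> Imp (W t) = Imp W0 \<and> Mass (W t) = Mass W0 \<and>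
      (\<forall>e>0. \<exists>d>0. \<forall>t'\<in>I. \<bar>t' - t\<bar> < d \<longrightarrow> l2norm X (\<lambda>x. W t' x - W t x) < e))"

text \<open>While the distance to the translates is at most \<open>r\<close>, coercivity at the nearest translate bounds it by the conserved
\<open>Lyap\<close>, hence by \<open>\<epsilon>0 / 2\<close> if it is small initially. A continuous function of time cannot cross the gap
between \<open>\<epsilon>0 / 2\<close> and \<open>\<epsilon>0\<close>.\<close>

theorem nonlinear_stability:
  assumes index: index_condition
    and inv: "invertible Cmat" and \<epsilon>: "0 < \<epsilon>"
  obtains \<delta> where "0 < \<delta>"
    "\<And>I W W0 t. \<lbrakk>conservative_trajectory I W W0; l2norm X (\<lambda>x. W0 x - Zb x) \<le> \<delta>; t \<in> I\<rbrakk> \<Longrightarrow> \<exists>s. l2norm X (\<lambda>x. W t x - Zb (x + s)) \<le> \<epsilon> \<and>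
           (\<forall>s'. l2norm X (\<lambda>x. W t x - Zb (x + s)) \<le> l2norm X (\<lambda>x. W t x - Zb (x + s')))"
proof -
  obtain \<beta> K r where \<beta>: "0 < \<beta>" and K: "0 \<le> K" and r: "0 < r" and co:
    "\<And>Z. Z \<in> jets iv X \<Longrightarrow> l2ip X Z Zbx = 0 \<Longrightarrow> l2norm X Z \<le> r \<Longrightarrow>
       \<beta> * (l2norm X Z)\<^sup>2 \<le> Lyap K (\<lambda>x. Zb x + Z x)"
    by (rule local_coercivity[OF index inv]) blast
  obtain M r1 where M: "0 < M" "0 < r1" and up: "\<And>Z. Z \<in> jets iv X \<Longrightarrow> l2norm X Z \<le> r1 \<Longrightarrow> Lyap K (\<lambda>x. Zb x + Z x) \<le> M * l2norm X Z"
    by (rule Lyap_upper_bound[OF K]) blast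
  define \<epsilon>0 where "\<epsilon>0 = min \<epsilon> r"
  have \<epsilon>0: "0 < \<epsilon>0" "\<epsilon>0 \<le> \<epsilon>" "\<epsilon>0 \<le> r" using \<epsilon> r by (auto simp: \<epsilon>0_def)
  define \<delta> where "\<delta> = min r1 (min (\<epsilon>0 / 2) (\<beta> * (\<epsilon>0 / 2)\<^sup>2 / M))"
  have \<delta>: "0 < \<delta>" "\<delta> \<le> r1" "\<delta> \<le> \<epsilon>0 / 2" "M * \<delta> \<le> \<beta> * (\<epsilon>0 / 2)\<^sup>2"
  proof -
    show "0 < \<delta>" using M \<epsilon>0 \<beta> by (auto simp: \<delta>_def)
    show "\<delta> \<le> r1" unfolding \<delta>_def by (rule min.cobounded1)
    show "\<delta> \<le> \<epsilon>0 / 2" unfolding \<delta>_def by (rule min.coboundedI2[OF min.cobounded1])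
    have "\<delta> \<le> \<beta> * (\<epsilon>0 / 2)\<^sup>2 / M" by (simp add: \<delta>_def)
    thus "M * \<delta> \<le> \<beta> * (\<epsilon>0 / 2)\<^sup>2" using M(1) by (simp add: pos_le_divide_eq mult.commute)
  qed
  show thesis
  proof (rule that[OF \<delta>(1)])
    fix I W W0 t1
    assume tr: "conservative_trajectory I W W0" and small: "l2norm X (\<lambda>x. W0 x - Zb x) \<le> \<delta>" and t1: "t1 \<in> I"
    note defn = tr[unfolded conservative_trajectory_def]
    have I0: "0 \<in> I" and W0: "W0 \<in> jets iv X" and ini: "AE x in lebesgue. W 0 x = W0 x" using defn by blast+
    have I: "0 \<le> t \<and> {0..t} \<subseteq> I" and Wj: "W t \<in> jets iv X"
      and cont: "0 < e \<Longrightarrow> \<exists>d>0. \<forall>t'\<in>I. \<bar>t' - t\<bar> < d \<longrightarrow> l2norm X (\<lambda>x. W t' x - W t x) < e"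
      and cons: "Ham (W t) = Ham W0 \<and> Imp (W t) = Imp W0 \<and> Mass (W t) = Mass W0" if "t \<in> I" for t e
      using defn that by blast+
    define P where "P t s \<longleftrightarrow> (\<forall>s'. l2norm X (\<lambda>x. W t x - Zb (x + s)) \<le> l2norm X (\<lambda>x. W t x - Zb (x + s'))) \<and>
        l2ip X (\<lambda>x. W t x - Zb (x + s)) (\<lambda>x. (ux (p, x + s), uxx (p, x + s) $ iv)) = 0" for t s
    have ex: "\<exists>s. P t s" if "t \<in> I" for t
    proof (rule orbit_minimiser[OF \<Xi>_pos[OF p] jetsD(1)[OF Wj[OF that]] Zb_periodic Zb_derivatives])
      show "continuous_on UNIV (\<lambda>x. (uxx (p, x), dd (0, 1) uxx (p, x) $ iv))"
        by (intro continuous_intros x_continuous[OF uxx_smooth p] x_continuous[OF smooth_on_dd[OF uxx_smooth] p])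
      fix s assume "\<And>s'. l2norm X (\<lambda>x. W t x - Zb (x + s)) \<le> l2norm X (\<lambda>x. W t x - Zb (x + s'))"
        "l2ip X (\<lambda>x. W t x - Zb (x + s)) (\<lambda>x. (ux (p, x + s), uxx (p, x + s) $ iv)) = 0"
      hence "P t s" by (simp add: P_def)
      thus ?thesis by (rule exI)
    qed
    define \<sigma> where "\<sigma> t = (SOME s. P t s)" for t
    have P: "P t (\<sigma> t)" if "t \<in> I" for t unfolding \<sigma>_def by (rule someI_ex[OF ex[OF that]])
    have \<sigma>: "\<And>t s'. t \<in> I \<Longrightarrow> l2norm X (\<lambda>x. W t x - Zb (x + \<sigma> t)) \<le> l2norm X (\<lambda>x. W t x - Zb (x + s'))"
      "\<And>t. t \<in> I \<Longrightarrow> l2ip X (\<lambda>x. W t x - Zb (x + \<sigma> t)) (\<lambda>x. (ux (p, x + \<sigma> t), uxx (p, x + \<sigma> t) $ iv)) = 0"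
      using P unfolding P_def by simp_all
    define dst where "dst t = l2norm X (\<lambda>x. W t x - Zb (x + \<sigma> t))" for t
    have Zbs: "(\<lambda>x. Zb (x + s)) \<in> jets iv X" for s by (rule jets_shift[OF \<Xi>_pos[OF p] Zb_jets])
    have Ly: "Lyap K W0 \<le> \<beta> * (\<epsilon>0 / 2)\<^sup>2"
    proof -
      have Z: "(\<lambda>x. W0 x - Zb x) \<in> jets iv X" by (rule jets_diff[OF W0 Zb_jets])
      have "Lyap K (\<lambda>x. Zb x + (W0 x - Zb x)) \<le> M * l2norm X (\<lambda>x. W0 x - Zb x)" by (rule up[OF Z]) (use small \<delta> in simp)
      also have "\<dots> \<le> M * \<delta>" using small M(1) by simp
      finally show ?thesis using \<delta>(4) by simp
    qed
    have key: "dst t \<le> \<epsilon>0 / 2" if t: "t \<in> I" "dst t \<le> \<epsilon>0" for t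
    proof -
      define E where "E x = W t x - Zb (x + \<sigma> t)" for x
      define Z where "Z x = E (x + - \<sigma> t)" for x
      have Ej: "E \<in> jets iv X" unfolding E_def by (rule jets_diff[OF Wj[OF t(1)] Zbs])
      have Z: "Z \<in> jets iv X" unfolding Z_def by (rule jets_shift[OF \<Xi>_pos[OF p] Ej])
      have n: "l2norm X Z = dst t" unfolding Z_def l2per_shift(2)[OF \<Xi>_pos[OF p] jetsD(1)[OF Ej]] by (simp only: dst_def E_def[abs_def])
      have \<Phi>l: "(\<lambda>x. (ux (p, x + \<sigma> t), uxx (p, x + \<sigma> t) $ iv)) \<in> l2per X"
        by (rule l2per_continuous) (use periodic_shift[OF Zb_periodic(2), of "\<sigma> t"] in \<open>auto intro!: continuous_intros
           continuous_on_compose2[OF x_continuous[OF ux_smooth p, of UNIV]] continuous_on_compose2[OF x_continuous[OF uxx_smooth p, of UNIV]]\<close>)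
      define h where "h x = E x \<bullet> (ux (p, x + \<sigma> t), uxx (p, x + \<sigma> t) $ iv)" for x
      have hp: "periodic X h" using l2perD(1)[OF jetsD(1)[OF Ej]] l2perD(1)[OF \<Phi>l] by (simp add: periodic_def h_def)
      have hi: "per_integrable X h" unfolding h_def by (rule l2ip_integrable[OF jetsD(1)[OF Ej] \<Phi>l])
      have "l2ip X Z Zbx = mean_int X (\<lambda>x. h (x + - \<sigma> t))"
        by (simp add: l2ip_def Z_def h_def)
      also have "\<dots> = mean_int X h" by (rule periodic_integral_shift[OF \<Xi>_pos[OF p] hp hi])
      also have "\<dots> = 0" using \<sigma>(2)[OF t(1)] by (simp add: h_def[abs_def] E_def l2ip_def)
      finally have o: "l2ip X Z Zbx = 0" .
      have ZZ: "(\<lambda>x. Zb x + Z x) = (\<lambda>x. W t (x + - \<sigma> t))" by (simp add: Z_def E_def fun_eq_iff)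
      have "Lyap K (\<lambda>x. Zb x + Z x) = Lyap K W0" unfolding ZZ
        by (rule Lyap_cong) (use shift_invariance[OF Wj[OF t(1)], of "- \<sigma> t"] cons[OF t(1)] in auto)
      hence "\<beta> * (dst t)\<^sup>2 \<le> \<beta> * (\<epsilon>0 / 2)\<^sup>2" using co[OF Z o] t(2) \<epsilon>0(3) Ly n by simp
      hence "(dst t)\<^sup>2 \<le> (\<epsilon>0 / 2)\<^sup>2" using \<beta> by (simp only: mult_le_cancel_left_pos)
      thus ?thesis by (rule power2_le_imp_le) (use \<epsilon>0 in simp)
    qed
    have tri: "dst t \<le> l2norm X (\<lambda>x. W t x - W t' x) + dst t'" if "t \<in> I" "t' \<in> I" for t t'
    proof -
      have "dst t \<le> l2norm X (\<lambda>x. W t x - Zb (x + \<sigma> t'))" unfolding dst_def by (rule \<sigma>(1)[OF that(1)])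
      also have "(\<lambda>x. W t x - Zb (x + \<sigma> t')) = (\<lambda>x. (W t x - W t' x) + (W t' x - Zb (x + \<sigma> t')))" by simp
      also have "l2norm X \<dots> \<le> l2norm X (\<lambda>x. W t x - W t' x) + dst t'" unfolding dst_def
        by (rule l2per_add(2)[OF l2per_diff(1)[OF jetsD(1)[OF Wj[OF that(1)]] jetsD(1)[OF Wj[OF that(2)]]] l2per_diff(1)[OF jetsD(1)[OF Wj[OF that(2)]] jetsD(1)[OF Zbs]]])
      finally show ?thesis .
    qed
    have dc: "continuous_on I dst"
    proof (rule continuous_onI)
      fix t e :: real assume te: "t \<in> I" "0 < e"
      obtain d where d: "0 < d" "\<And>t'. t' \<in> I \<Longrightarrow> \<bar>t' - t\<bar> < d \<Longrightarrow> l2norm X (\<lambda>x. W t' x - W t x) < e"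
        using cont[OF te] by blast
      show "\<exists>d>0. \<forall>t'\<in>I. dist t' t < d \<longrightarrow> dist (dst t') (dst t) \<le> e"
      proof (intro exI conjI ballI impI)
        show "0 < d" by (rule d(1))
        fix t' assume t': "t' \<in> I" "dist t' t < d"
        have l: "l2norm X (\<lambda>x. W t' x - W t x) < e" using d(2)[OF t'(1)] t'(2) by (simp add: dist_real_def)
        have "dst t' \<le> l2norm X (\<lambda>x. W t' x - W t x) + dst t" by (rule tri[OF t'(1) te(1)])
        moreover have "dst t \<le> l2norm X (\<lambda>x. W t' x - W t x) + dst t'"
          using tri[OF te(1) t'(1)] l2norm_diff_commute[of X "W t" "W t'"] by simp
        ultimately show "dist (dst t') (dst t) \<le> e" using l unfolding dist_real_def by linarith
      qed
    qed
    have d0: "dst 0 \<le> \<epsilon>0 / 2"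
    proof -
      have "dst 0 \<le> l2norm X (\<lambda>x. W 0 x - Zb (x + 0))" unfolding dst_def by (rule \<sigma>(1)[OF I0])
      also have "\<dots> = l2norm X (\<lambda>x. W0 x - Zb x)"
        by (rule l2norm_cong_AE) (use ini in \<open>rule AE_mp, simp\<close>)
      finally show ?thesis using small \<delta>(3) by linarith
    qed
    have "dst t1 \<le> \<epsilon>0"
    proof (rule ccontr)
      assume n: "\<not> dst t1 \<le> \<epsilon>0"
      have "\<exists>t. 0 \<le> t \<and> t \<le> t1 \<and> dst t = \<epsilon>0"
        by (rule IVT') (use d0 \<epsilon>0 n I[OF t1] continuous_on_subset[OF dc] in auto)
      then obtain t where t: "t \<in> {0..t1}" "dst t = \<epsilon>0" by auto
      have "t \<in> I" using t(1) I[OF t1] by blast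
      from key[OF this] t(2) \<epsilon>0 show False by simp
    qed
    thus "\<exists>s. l2norm X (\<lambda>x. W t1 x - Zb (x + s)) \<le> \<epsilon> \<and>
           (\<forall>s'. l2norm X (\<lambda>x. W t1 x - Zb (x + s)) \<le> l2norm X (\<lambda>x. W t1 x - Zb (x + s')))"
      using \<sigma>(1)[OF t1] \<epsilon>0(2) unfolding dst_def by (intro exI[of _ "\<sigma> t1"]) auto
  qed
qed

end

context wave
begin

lemma translate_HH1: "(\<lambda>x. U p (x + s)) \<in> HH iv 1 X" "jet iv (\<lambda>x. U p (x + s)) = (\<lambda>x. Zb (x + s))"
proof -
  have c: "continuous_on UNIV (\<lambda>x. g (p, x + s) $ \<alpha>)" if "smooth_on S g" for g :: "'n param \<times> real \<Rightarrow> real ^ 'n" and \<alpha>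
    by (intro continuous_intros continuous_on_compose2[OF x_continuous[OF that p, of UNIV]]) auto
  have ul: "(\<lambda>x. u (p, x + s) $ \<alpha>) \<in> l2per X" for \<alpha>
  proof (rule l2per_continuous[OF _ c[OF u_smooth]])
    have "periodic X (\<lambda>x. u (p, x) $ \<alpha>)" by (simp add: periodic_def u_per[OF p])
    thus "periodic X (\<lambda>x. u (p, x + s) $ \<alpha>)" by (rule periodic_shift)
  qed
  have uxl: "(\<lambda>x. ux (p, x + s) $ iv) \<in> l2per X"
  proof (rule l2per_continuous[OF _ c[OF ux_smooth]])
    have "periodic X (\<lambda>x. wb p x)" by (simp add: periodic_def ux_per[OF p])
    thus "periodic X (\<lambda>x. ux (p, x + s) $ iv)" by (rule periodic_shift)
  qed
  have d: "((\<lambda>x. u (p, x + s) $ iv) has_real_derivative ux (p, x + s) $ iv) (at x)" for x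
    using u_x_comp[OF p, of iv "x + s"] by (simp add: DERIV_shift)
  have sd: "sobolev_deriv (\<lambda>x. u (p, x + s) $ iv) (\<lambda>x. ux (p, x + s) $ iv)" by (rule sobolev_derivI[OF d c[OF ux_smooth]])
  have "\<exists>g\<in>l2per X. sobolev_deriv (\<lambda>x. u (p, x + s) $ iv) g" using uxl sd by blast
  thus "(\<lambda>x. U p (x + s)) \<in> HH iv 1 X" using ul by (simp add: HH_def L2_per_eq_l2per u_apply)
  show "jet iv (\<lambda>x. U p (x + s)) = (\<lambda>x. Zb (x + s))"
    using DERIV_imp_deriv[OF d] by (simp add: fun_eq_iff prod_eq_iff jet_fst jet_snd Zb_def u_apply)
qed

text \<open>The first components are continuous, so they agree everywhere, and so do their derivatives.\<close>

lemma jet_cong_AE: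
  assumes V: "V \<in> HH iv 1 X" and W: "W \<in> HH iv 1 X" and ae: "AE x in lebesgue. V x = W x"
  shows "AE x in lebesgue. jet iv V x = jet iv W x"
proof -
  have c: "continuous_on UNIV (\<lambda>x. V x $ iv)" if "V \<in> HH iv 1 X" for V
    by (rule HH1_weak_derivative[OF that]) (rule sobolev_deriv_continuous)
  have "AE x in lebesgue. V x $ iv = W x $ iv" using ae by (rule AE_mp) simp
  from continuous_AE_eq[OF c[OF V] c[OF W] this] have "(\<lambda>x. V x $ iv) = (\<lambda>x. W x $ iv)" .
  thus ?thesis using ae by (simp add: jet_def x_deriv_component)
qed

theorem wave_orbitally_stable:
  assumes index: index_condition
    and inv: "invertible Cmat"
  shows "conditionally_orbitally_stable iv H B X (U p)"
  unfolding conditionally_orbitally_stable_def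
proof (intro allI impI)
  fix Y T Sol and \<epsilon> :: real
  assume hyp: "function_space iv X Y \<and> locally_well_posed iv H B X Y T Sol \<and>
       conserved_along Y T Sol (\<lambda>U. LINT x:{0..X}|lebesgue. H (U x, x_deriv U x $ iv)) \<and>
       conserved_along Y T Sol (\<lambda>U. LINT x:{0..X}|lebesgue. impulse B (U x)) \<and>
       conserved_along Y T Sol (\<lambda>U. LINT x:{0..X}|lebesgue. U x)" and \<epsilon>: "0 < \<epsilon>"
  have fs: "topspace Y \<subseteq> HH iv 1 X" "\<And>V e. V \<in> topspace Y \<Longrightarrow> 0 < e \<Longrightarrow> \<exists>O'. openin Y O' \<and> V \<in> O' \<and> (\<forall>W\<in>O'. HH1_norm iv X (W - V) < e)"
    using hyp unfolding function_space_def by blast+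
  have wp: "0 < T U0" "solves_cauchy iv H B X Y U0 (T U0) (Sol U0)" if "U0 \<in> topspace Y" for U0
    using hyp that unfolding locally_well_posed_def by blast+
  have jH: "Ham (jet iv V) = (LINT x:{0..X}|lebesgue. H (V x, x_deriv V x $ iv))"
    "Imp (jet iv V) = (LINT x:{0..X}|lebesgue. impulse B (V x))" "Mass (jet iv V) = (LINT x:{0..X}|lebesgue. V x)" for V
    by (simp_all add: Ham_def Imp_def Mass_def jet_def)
  have cons: "Ham (jet iv (Sol U0 t)) = Ham (jet iv U0) \<and> Imp (jet iv (Sol U0 t)) = Imp (jet iv U0) \<and> Mass (jet iv (Sol U0 t)) = Mass (jet iv U0)"
    if "U0 \<in> topspace Y" "t \<in> times_below (T U0)" for U0 t
    unfolding jH using hyp that unfolding conserved_along_def by blast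
  obtain \<delta> where \<delta>: "0 < \<delta>"
    "\<And>I W W0 t. \<lbrakk>conservative_trajectory I W W0; l2norm X (\<lambda>x. W0 x - Zb x) \<le> \<delta>; t \<in> I\<rbrakk> \<Longrightarrow> \<exists>s. l2norm X (\<lambda>x. W t x - Zb (x + s)) \<le> \<epsilon> \<and>
           (\<forall>s'. l2norm X (\<lambda>x. W t x - Zb (x + s)) \<le> l2norm X (\<lambda>x. W t x - Zb (x + s')))"
    by (rule nonlinear_stability[OF index inv \<epsilon>]) blast
  show "\<exists>\<delta>>0. \<forall>U0\<in>topspace Y. HH1_norm iv X (U0 - U p) \<le> \<delta> \<longrightarrow>
         (\<forall>t\<in>times_below (T U0). (INF s. HH1_norm iv X (Sol U0 t - (\<lambda>x. U p (x + s)))) \<le> \<epsilon>)"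
  proof (intro exI[of _ \<delta>] conjI ballI impI \<delta>(1))
    fix U0 t assume U0: "U0 \<in> topspace Y" and small: "HH1_norm iv X (U0 - U p) \<le> \<delta>" and t: "t \<in> times_below (T U0)"
    define I where "I = times_below (T U0)"
    have cm: "continuous_map (top_of_set I) Y (Sol U0)" and ini: "AE x in lebesgue. Sol U0 0 x = U0 x"
      using wp(2)[OF U0] unfolding solves_cauchy_def I_def by blast+
    have SY: "Sol U0 r \<in> topspace Y" if "r \<in> I" for r
      using continuous_map_image_subset_topspace[OF cm] that by auto
    have S1: "Sol U0 r \<in> HH iv 1 X" if "r \<in> I" for r using SY[OF that] fs(1) by blast
    have U01: "U0 \<in> HH iv 1 X" using U0 fs(1) by blast
    have I0: "0 \<in> I" using wp(1)[OF U0] by (simp add: I_def times_below_def zero_ereal_def)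
    have dist: "HH1_norm iv X (V - (\<lambda>x. U p (x + s))) = l2norm X (\<lambda>x. jet iv V x - Zb (x + s))" if "V \<in> HH iv 1 X" for V s
      using HH1_norm_diff[OF that translate_HH1(1)] translate_HH1(2) by simp
    have "\<exists>s. l2norm X (\<lambda>x. jet iv (Sol U0 t) x - Zb (x + s)) \<le> \<epsilon> \<and>
        (\<forall>s'. l2norm X (\<lambda>x. jet iv (Sol U0 t) x - Zb (x + s)) \<le> l2norm X (\<lambda>x. jet iv (Sol U0 t) x - Zb (x + s')))"
    proof (rule \<delta>(2)[of I "\<lambda>t. jet iv (Sol U0 t)" "jet iv U0"], unfold conservative_trajectory_def, intro conjI ballI allI impI)
      show "0 \<in> I" by (rule I0)
      show "0 \<le> r" if "r \<in> I" for r using that by (simp add: I_def times_below_def)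
      show "{0..r} \<subseteq> I" if "r \<in> I" for r
        proof
          fix q assume q: "q \<in> {0..r}"
          have "ereal r < T U0" using that by (simp add: I_def times_below_def)
          moreover have "ereal q \<le> ereal r" using q by simp
          ultimately have "ereal q < T U0" by (rule order.strict_trans1[rotated])
          thus "q \<in> I" using q by (simp add: I_def times_below_def)
        qed
      show "jet iv (Sol U0 r) \<in> jets iv X" if "r \<in> I" for r by (rule jet_jets(1)[OF S1[OF that]])
      show "jet iv U0 \<in> jets iv X" by (rule jet_jets(1)[OF U01])
      show "\<exists>d>0. \<forall>r'\<in>I. \<bar>r' - r\<bar> < d \<longrightarrow> l2norm X (\<lambda>x. jet iv (Sol U0 r') x - jet iv (Sol U0 r) x) < e" if re: "r \<in> I" "0 < e" for r e
      proof -
        obtain O' where O': "openin Y O'" "Sol U0 r \<in> O'" "\<And>W. W \<in> O' \<Longrightarrow> HH1_norm iv X (W - Sol U0 r) < e"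
          using fs(2)[OF SY[OF re(1)] re(2)] by blast
        have "openin (top_of_set I) {r' \<in> topspace (top_of_set I). Sol U0 r' \<in> O'}" by (rule openin_continuous_map_preimage[OF cm O'(1)])
        then obtain G where G: "open G" "{r' \<in> topspace (top_of_set I). Sol U0 r' \<in> O'} = I \<inter> G" by (auto simp: openin_open)
        have "r \<in> G" using G(2) re(1) O'(2) by auto
        then obtain d where d: "0 < d" "ball r d \<subseteq> G" using G(1) openE by blast
        show ?thesis
        proof (intro exI conjI ballI impI)
          show "0 < d" by (rule d(1))
          fix r' assume r': "r' \<in> I" "\<bar>r' - r\<bar> < d"
          have "r' \<in> ball r d" using r'(2) by (simp add: dist_real_def abs_minus_commute)
          hence "r' \<in> I \<inter> G" using d(2) r'(1) by blast
          hence "Sol U0 r' \<in> O'" using G(2) by blast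
          from O'(3)[OF this] show "l2norm X (\<lambda>x. jet iv (Sol U0 r') x - jet iv (Sol U0 r) x) < e"
            by (simp only: HH1_norm_diff[OF S1[OF r'(1)] S1[OF re(1)]])
        qed
      qed
      show "AE x in lebesgue. jet iv (Sol U0 0) x = jet iv U0 x" by (rule jet_cong_AE[OF S1[OF I0] U01 ini])
      show "Ham (jet iv (Sol U0 r)) = Ham (jet iv U0)" "Imp (jet iv (Sol U0 r)) = Imp (jet iv U0)" "Mass (jet iv (Sol U0 r)) = Mass (jet iv U0)" if "r \<in> I" for r
        using cons[OF U0 that[unfolded I_def]] by simp_all
      show "l2norm X (\<lambda>x. jet iv U0 x - Zb x) \<le> \<delta>" using small dist[OF U01, of 0] by simp
      show "t \<in> I" using t by (simp add: I_def)
    qed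
    then obtain s where s: "l2norm X (\<lambda>x. jet iv (Sol U0 t) x - Zb (x + s)) \<le> \<epsilon>"
      "\<And>s'. l2norm X (\<lambda>x. jet iv (Sol U0 t) x - Zb (x + s)) \<le> l2norm X (\<lambda>x. jet iv (Sol U0 t) x - Zb (x + s'))" by blast
    have t': "t \<in> I" using t by (simp add: I_def)
    have "(INF s. HH1_norm iv X (Sol U0 t - (\<lambda>x. U p (x + s)))) = l2norm X (\<lambda>x. jet iv (Sol U0 t) x - Zb (x + s))"
      unfolding dist[OF S1[OF t']] by (rule cInf_eq_minimum) (use s(2) in auto)
    thus "(INF s. HH1_norm iv X (Sol U0 t - (\<lambda>x. U p (x + s)))) \<le> \<epsilon>" using s(1) by simp
  qed
qed

text \<open>By the Euler equation, \<open>B\<close> applied to the variational derivative of \<open>\<H>\<close> is \<open>- c U\<close> up to a constant.\<close>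

theorem wave_classical_solution:
  assumes B: "invertible B"
  shows "classical_solution iv H B (\<lambda>t x. U p (x - snd (snd p) * t))"
  unfolding classical_solution_def
proof (intro allI)
  fix r x :: real
  define c l where "c = snd (snd p)" and "l = fst (snd p)"
  have h0: "ham_impulse iv H B 0 = ham_density iv H" by (simp add: fun_eq_iff ham_impulse_def)
  have shift: "((\<lambda>y. g (p, y - c * r) $ iv) has_real_derivative g' (p, y - c * r) $ iv) (at y)"
    if "\<And>y. ((\<lambda>y. g (p, y) $ iv) has_real_derivative g' (p, y) $ iv) (at y)" for g g' :: "'n param \<times> real \<Rightarrow> real ^ 'n" and y
    using DERIV_shift[of "\<lambda>y. g (p, y) $ iv" "g' (p, y - c * r) $ iv" y "- (c * r)"] that[of "y - c * r"] by simp
  have eu: "B *v euler (ham_density iv H) (\<lambda>y. u (p, y - c * r)) y = - (B *v l) - c *\<^sub>R u (p, y - c * r)" for y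
  proof -
    define y0 where "y0 = y - c * r"
    have "euler (ham_density iv H) (\<lambda>y. u (p, y - c * r)) y = EL (u (p, y0)) (ux (p, y0) $ iv) (uxx (p, y0) $ iv) 0"
      unfolding h0[symmetric] y0_def by (rule euler_formula[OF shift[OF u_x_comp[OF p]] shift[OF ux_x_comp[OF p]]])
    moreover have "EL (u (p, y0)) (ux (p, y0) $ iv) (uxx (p, y0) $ iv) c = EL (u (p, y0)) (ux (p, y0) $ iv) (uxx (p, y0) $ iv) 0 + c *\<^sub>R (matrix_inv B *v u (p, y0))"
      unfolding M_eq by (simp add: EL_def)
    moreover have "EL (u (p, y0)) (ux (p, y0) $ iv) (uxx (p, y0) $ iv) c + l = 0"
      using profile_euler[OF p, of y0] by (simp add: c_def l_def)
    ultimately have "euler (ham_density iv H) (\<lambda>y. u (p, y - c * r)) y = - l - c *\<^sub>R (matrix_inv B *v u (p, y0))"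
      by (simp add: eq_diff_eq eq_neg_iff_add_eq_0 add.assoc)
    hence "B *v euler (ham_density iv H) (\<lambda>y. u (p, y - c * r)) y = - (B *v l) - c *\<^sub>R (B *v (matrix_inv B *v u (p, y0)))"
      by (simp add: matrix_vector_mult_diff_distrib matrix_vector_mult_scaleR vec.neg)
    thus ?thesis by (simp add: invertible_matrix_inv(1)[OF B] y0_def)
  qed
  show "\<exists>d. ((\<lambda>y. B *v euler (ham_density iv H) (\<lambda>x. U p (x - snd (snd p) * r)) y) has_vector_derivative d) (at x) \<and>
      ((\<lambda>s. U p (x - snd (snd p) * s)) has_vector_derivative d) (at r)"
  proof (intro exI[of _ "- c *\<^sub>R ux (p, x - c * r)"] conjI)
    have "((\<lambda>y. y - c * r) has_vector_derivative 1) (at x)" by (auto intro!: derivative_eq_intros)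
    from vector_diff_chain_at[OF this u_x[OF p]]
    have "((\<lambda>y. u (p, y - c * r)) has_vector_derivative 1 *\<^sub>R ux (p, x - c * r)) (at x)" by (simp add: o_def)
    hence "((\<lambda>y. - (B *v l) - c *\<^sub>R u (p, y - c * r)) has_vector_derivative 0 - c *\<^sub>R (1 *\<^sub>R ux (p, x - c * r))) (at x)"
      by (intro has_vector_derivative_diff has_vector_derivative_const bounded_linear.has_vector_derivative[OF bounded_linear_scaleR_right])
    thus "((\<lambda>y. B *v euler (ham_density iv H) (\<lambda>x. U p (x - snd (snd p) * r)) y) has_vector_derivative - c *\<^sub>R ux (p, x - c * r)) (at x)"
      using eu by (simp add: u_apply[symmetric] c_def)
    have "((\<lambda>s. x - c * s) has_vector_derivative - c) (at r)" by (auto intro!: derivative_eq_intros)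
    from vector_diff_chain_at[OF this u_x[OF p]]
    show "((\<lambda>s. U p (x - snd (snd p) * s)) has_vector_derivative - c *\<^sub>R ux (p, x - c * r)) (at r)"
      by (simp add: o_def u_apply c_def)
  qed
qed

end

section \<open>The normal form from the structural conditions\<close>

text \<open>The coefficients of the normal form are restrictions to a line of \<open>H\<close> and its derivatives, hence smooth.\<close>

lemma smooth_line_C3:
  fixes F :: "'a::real_normed_vector \<Rightarrow> real"
  assumes F: "smooth_on UNIV F"
  shows "C3 (\<lambda>v. F (v *\<^sub>R d))"
proof (rule C3I)
  note 1 = smooth_on_dd[OF F, of d]
  note 2 = smooth_on_dd[OF 1, of d]
  note 3 = smooth_on_dd[OF 2, of d]
  show "((\<lambda>v. F (v *\<^sub>R d)) has_real_derivative dd d F (v *\<^sub>R d)) (at v)" for v using smooth_line_real(1)[OF F, of 0 d] by simp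
  show "((\<lambda>v. dd d F (v *\<^sub>R d)) has_real_derivative dd d (dd d F) (v *\<^sub>R d)) (at v)" for v using smooth_line_real(1)[OF 1, of 0 d] by simp
  show "((\<lambda>v. dd d (dd d F) (v *\<^sub>R d)) has_real_derivative dd d (dd d (dd d F)) (v *\<^sub>R d)) (at v)" for v using smooth_line_real(1)[OF 2, of 0 d] by simp
  show "continuous_on UNIV (\<lambda>v. dd d (dd d (dd d F)) (v *\<^sub>R d))" using smooth_line_real(2)[OF 3, of 0 d] by simp
qed

lemma quadratic_of_constant_second_derivative:
  fixes g :: "real \<Rightarrow> real"
  assumes d: "\<And>w. (g has_real_derivative g' w) (at w)" "\<And>w. (g' has_real_derivative q) (at w)"
  shows "g w = g 0 + g' 0 * w + q * w\<^sup>2 / 2"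
proof -
  have e: "g' w - q * w = g' 0 - q * 0" for w
    by (rule DERIV_isconst_all[of "\<lambda>w. g' w - q * w"]) (auto intro!: derivative_eq_intros d)
  have g': "g' w = g' 0 + q * w" for w using e[of w] by linarith
  have "g w - (g' 0 * w + q * w\<^sup>2 / 2) = g 0 - (g' 0 * 0 + q * 0\<^sup>2 / 2)"
  proof (rule DERIV_isconst_all[of "\<lambda>w. g w - (g' 0 * w + q * w\<^sup>2 / 2)"], rule allI)
    fix w
    show "((\<lambda>w. g w - (g' 0 * w + q * w\<^sup>2 / 2)) has_real_derivative 0) (at w)"
      by (auto intro!: derivative_eq_intros d simp: g'[of w])
  qed
  thus ?thesis by simp
qed

lemma quadratic_along_line:
  fixes F :: "'a::real_normed_vector \<Rightarrow> real"
  assumes F: "smooth_on UNIV F" and q: "\<And>s. dd h (dd h F) (a + s *\<^sub>R h) = q"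
  shows "F (a + s *\<^sub>R h) = F a + dd h F a * s + q * s\<^sup>2 / 2"
  using quadratic_of_constant_second_derivative[OF smooth_line_real(1)[OF F, of a h], of q s]
    smooth_line_real(1)[OF smooth_on_dd[OF F, of h], of a h] q by simp

lemma deriv2_along_line:
  fixes F :: "'a::real_normed_vector \<Rightarrow> real"
  assumes F: "smooth_on UNIV F" and g: "\<And>s. F (a + s *\<^sub>R h) = g s + c"
  shows "(deriv ^^ 2) g s = dd h (dd h F) (a + s *\<^sub>R h)"
proof -
  have "g = (\<lambda>s. F (a + s *\<^sub>R h) - c)" using g by (simp add: fun_eq_iff)
  hence "(g has_real_derivative dd h F (a + s *\<^sub>R h)) (at s)" for s
    using DERIV_diff[OF smooth_line_real(1)[OF F, of a h s] DERIV_const[of c]] by simp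
  hence 1: "deriv g = (\<lambda>s. dd h F (a + s *\<^sub>R h))" by (auto intro!: DERIV_imp_deriv)
  have "deriv (deriv g) s = dd h (dd h F) (a + s *\<^sub>R h)" unfolding 1
    by (rule DERIV_imp_deriv[OF smooth_line_real(1)[OF smooth_on_dd[OF F]]])
  thus ?thesis by (simp add: numeral_2_eq_2)
qed

lemma matrix_vector_component: "(M *v U) $ i = (\<Sum>j\<in>UNIV. M $ i $ j * U $ j)" for M :: "real ^ 'n ^ 'n::finite"
  by (simp add: matrix_vector_mult_def)

lemma scalar_normal_form:
  fixes iv :: "'n::finite"
  assumes card: "CARD('n) = 1" and smooth: "smooth_on UNIV H" and str: "scalar_structure iv H"
  obtains f e \<kappa> \<tau> t or k where "ham_form iv H B f e \<kappa> \<tau> t or k"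
proof -
  obtain E \<kappa>0 where E: "\<And>U w. H (U, w) = E (U $ iv) w" "\<And>v w. (deriv ^^ 2) (E v) w = \<kappa>0 v" "\<And>v. \<kappa>0 v > 0"
    using str unfolding scalar_structure_def by blast
  have UN: "(UNIV :: 'n set) = {iv}" using card by (metis card_1_singletonE singletonD UNIV_I)
  have i: "j = iv" for j :: 'n using UN by blast
  define e where "e = (axis iv 1 :: real ^ 'n)"
  define d h where "d = (e, 0::real)" and "h = (0 :: real ^ 'n, 1::real)"
  have eiv: "e $ iv = 1" by (simp add: e_def)
  have pt: "v *\<^sub>R d + w *\<^sub>R h = (v *\<^sub>R e, w)" for v w by (simp add: d_def h_def)
  note H1 = smooth_on_dd[OF smooth, of h] and H2 = smooth_on_dd[OF smooth_on_dd[OF smooth, of h], of h]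
  have \<kappa>: "dd h (dd h H) (v *\<^sub>R d + w *\<^sub>R h) = \<kappa>0 v" for v w
    using deriv2_along_line[OF smooth, of "v *\<^sub>R d" h "E v" 0 w] E(2) by (simp add: pt E(1) eiv)
  have H: "H (U, w) = H ((U $ iv) *\<^sub>R d) + dd h H ((U $ iv) *\<^sub>R d) * w + \<kappa>0 (U $ iv) * w\<^sup>2 / 2" for U w
    using quadratic_along_line[OF smooth \<kappa>, of "U $ iv" w] by (simp only: pt E(1) vector_scaleR_component eiv) simp
  have \<kappa>0: "\<kappa>0 = (\<lambda>v. dd h (dd h H) (v *\<^sub>R d))" using \<kappa>[of _ 0] by (simp add: fun_eq_iff)
  define m where "m = matrix_inv B $ iv $ iv"
  have "ham_form iv H B (\<lambda>v. H (v *\<^sub>R d) - 1 * v\<^sup>2 / 2) (\<lambda>v. dd h H (v *\<^sub>R d)) \<kappa>0 (\<lambda>v. 1) (\<lambda>v. 0) 0 ((m / 2) *\<^sub>R e)"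
  proof
    show "H (U, w) = (H (U $ iv *\<^sub>R d) - 1 * (U $ iv)\<^sup>2 / 2) + dd h H (U $ iv *\<^sub>R d) * w + \<kappa>0 (U $ iv) * w\<^sup>2 / 2
      + 0 * (0 \<bullet> U) + 1 * (U \<bullet> U) / 2" for U w
      unfolding H[of U w] by (simp add: inner_vec_def UN power2_eq_square)
    show "C3 (\<lambda>v. H (v *\<^sub>R d) - 1 * v\<^sup>2 / 2)" by (rule C3_diff_square[OF smooth_line_C3[OF smooth] C3_const])
    show "C3 (\<lambda>v. dd h H (v *\<^sub>R d))" by (rule smooth_line_C3[OF H1])
    show "C3 \<kappa>0" unfolding \<kappa>0 by (rule smooth_line_C3[OF H2])
    show "C3 (\<lambda>v. 1)" "C3 (\<lambda>v. 0)" by (rule C3_const)+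
    show "0 < \<kappa>0 v" for v by (rule E(3))
    show "matrix_inv B *v U = (U $ iv) *\<^sub>R ((m / 2) *\<^sub>R e) + ((m / 2) *\<^sub>R e \<bullet> U) *\<^sub>R axis iv 1" for U
    proof -
      have "(matrix_inv B *v U) $ iv = ((U $ iv) *\<^sub>R ((m / 2) *\<^sub>R e) + ((m / 2) *\<^sub>R e \<bullet> U) *\<^sub>R axis iv 1) $ iv"
        by (simp add: matrix_vector_component UN eiv m_def inner_vec_def)
      thus ?thesis by (simp only: vec_eq_iff) (metis i)
    qed
  qed simp_all
  thus thesis by (rule that)
qed

text \<open>Since \<open>\<H> = \<E> + \<T>\<close>, it is determined by its restrictions to the \<open>v\<^sub>x\<close> and \<open>u\<close> directions through each point
\<open>(v, 0, 0)\<close>, which are quadratic polynomials.\<close>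

lemma system_normal_form:
  fixes iv :: "'n::finite"
  assumes card: "CARD('n) = 2" and smooth: "smooth_on UNIV H" and str: "system_structure iv H B"
  obtains f e \<kappa> \<tau> t or k where "ham_form iv H B f e \<kappa> \<tau> t or k"
proof -
  obtain iu where iu: "iu \<noteq> iv"
    and ex: "\<exists>E T \<kappa> \<tau>. (\<forall>U w. H (U, w) = E (U $ iv) w + T (U $ iv) (U $ iu)) \<and>
           (\<forall>v w. (deriv ^^ 2) (E v) w = \<kappa> v) \<and> (\<forall>v::real. \<kappa> v > 0) \<and>
           (\<forall>v u. (deriv ^^ 2) (T v) u = \<tau> v) \<and> (\<forall>v::real. \<tau> v > 0)"
    and exB: "\<exists>a b. b \<noteq> 0 \<and> matrix_inv B $ iv $ iv = a \<and> matrix_inv B $ iv $ iu = b \<and>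
           matrix_inv B $ iu $ iv = b \<and> matrix_inv B $ iu $ iu = 0"
    using str unfolding system_structure_def by blast
  obtain E T \<kappa>0 \<tau>0 where E: "\<And>U w. H (U, w) = E (U $ iv) w + T (U $ iv) (U $ iu)" "\<And>v w. (deriv ^^ 2) (E v) w = \<kappa>0 v" "\<And>v. \<kappa>0 v > 0"
    "\<And>v u. (deriv ^^ 2) (T v) u = \<tau>0 v" "\<And>v. \<tau>0 v > 0"
    using ex by blast
  obtain a b where M: "matrix_inv B $ iv $ iv = a" "matrix_inv B $ iv $ iu = b" "matrix_inv B $ iu $ iv = b" "matrix_inv B $ iu $ iu = 0"
    using exB by blast
  have UN: "(UNIV :: 'n set) = {iv, iu}" using card iu by (intro card_subset_eq[symmetric]) auto
  define e e' where "e = (axis iv 1 :: real ^ 'n)" and "e' = (axis iu 1 :: real ^ 'n)"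
  define d h h' where "d = (e, 0::real)" and "h = (0 :: real ^ 'n, 1::real)" and "h' = (e', 0::real)"
  have comp: "e $ iv = 1" "e $ iu = 0" "e' $ iv = 0" "e' $ iu = 1" using iu by (simp_all add: e_def e'_def axis_def)
  have pt: "v *\<^sub>R d + w *\<^sub>R h = (v *\<^sub>R e, w)" "v *\<^sub>R d + r *\<^sub>R h' = (v *\<^sub>R e + r *\<^sub>R e', 0)" for v w r by (simp_all add: d_def h_def h'_def)
  note H1 = smooth_on_dd[OF smooth, of h] and H2 = smooth_on_dd[OF smooth_on_dd[OF smooth, of h], of h]
  note T1 = smooth_on_dd[OF smooth, of h'] and T2 = smooth_on_dd[OF smooth_on_dd[OF smooth, of h'], of h']
  have \<kappa>: "dd h (dd h H) (v *\<^sub>R d + w *\<^sub>R h) = \<kappa>0 v" for v w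
    using deriv2_along_line[OF smooth, of "v *\<^sub>R d" h "E v" "T v 0" w] E(2) by (simp add: pt E(1) comp)
  have \<tau>: "dd h' (dd h' H) (v *\<^sub>R d + r *\<^sub>R h') = \<tau>0 v" for v r
    using deriv2_along_line[OF smooth, of "v *\<^sub>R d" h' "T v" "E v 0" r] E(4) by (simp add: pt E(1) comp)
  define H0 where "H0 v = H (v *\<^sub>R d)" for v
  have HE: "H0 v = E v 0 + T v 0" for v by (simp add: H0_def d_def E(1) comp)
  have Ew: "E v w + T v 0 = H0 v + dd h H (v *\<^sub>R d) * w + \<kappa>0 v * w\<^sup>2 / 2" for v w
    using quadratic_along_line[OF smooth \<kappa>, of v w] by (simp add: pt E(1) comp H0_def)
  have Tu: "E v 0 + T v r = H0 v + dd h' H (v *\<^sub>R d) * r + \<tau>0 v * r\<^sup>2 / 2" for v r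
    using quadratic_along_line[OF smooth \<tau>, of v r] by (simp add: pt E(1) comp H0_def)
  have H: "H (U, w) = H0 (U $ iv) + dd h H ((U $ iv) *\<^sub>R d) * w + \<kappa>0 (U $ iv) * w\<^sup>2 / 2
      + dd h' H ((U $ iv) *\<^sub>R d) * U $ iu + \<tau>0 (U $ iv) * (U $ iu)\<^sup>2 / 2" for U w
    using Ew[of "U $ iv" w] Tu[of "U $ iv" "U $ iu"] HE[of "U $ iv"] unfolding E(1) by linarith
  have \<kappa>0: "\<kappa>0 = (\<lambda>v. dd h (dd h H) (v *\<^sub>R d))" using \<kappa>[of _ 0] by (simp add: fun_eq_iff)
  have \<tau>0: "\<tau>0 = (\<lambda>v. dd h' (dd h' H) (v *\<^sub>R d))" using \<tau>[of _ 0] by (simp add: fun_eq_iff)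
  have C\<tau>: "C3 \<tau>0" unfolding \<tau>0 by (rule smooth_line_C3[OF T2])
  have inn: "U \<bullet> W = U $ iv * W $ iv + U $ iu * W $ iu" for U W :: "real ^ 'n"
    using iu by (simp add: inner_vec_def UN)
  have "ham_form iv H B (\<lambda>v. H0 v - \<tau>0 v * v\<^sup>2 / 2) (\<lambda>v. dd h H (v *\<^sub>R d)) \<kappa>0 \<tau>0 (\<lambda>v. dd h' H (v *\<^sub>R d)) e' ((a / 2) *\<^sub>R e + b *\<^sub>R e')"
  proof
    show "H (U, w) = (H0 (U $ iv) - \<tau>0 (U $ iv) * (U $ iv)\<^sup>2 / 2) + dd h H (U $ iv *\<^sub>R d) * w + \<kappa>0 (U $ iv) * w\<^sup>2 / 2
      + dd h' H (U $ iv *\<^sub>R d) * (e' \<bullet> U) + \<tau>0 (U $ iv) * (U \<bullet> U) / 2" for U w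
      unfolding H[of U w] inn comp by (simp add: power2_eq_square algebra_simps)
    show "C3 (\<lambda>v. H0 v - \<tau>0 v * v\<^sup>2 / 2)" unfolding H0_def by (rule C3_diff_square[OF smooth_line_C3[OF smooth] C\<tau>])
    show "C3 (\<lambda>v. dd h H (v *\<^sub>R d))" "C3 (\<lambda>v. dd h' H (v *\<^sub>R d))" by (rule smooth_line_C3[OF H1], rule smooth_line_C3[OF T1])
    show "C3 \<kappa>0" unfolding \<kappa>0 by (rule smooth_line_C3[OF H2])
    show "C3 \<tau>0" by (rule C\<tau>)
    show "0 < \<kappa>0 v" "0 < \<tau>0 v" for v by (rule E)+
    show "e' $ iv = 0" by (rule comp)
    show "matrix_inv B *v U = (U $ iv) *\<^sub>R ((a / 2) *\<^sub>R e + b *\<^sub>R e') + (((a / 2) *\<^sub>R e + b *\<^sub>R e') \<bullet> U) *\<^sub>R axis iv 1" (is "?l = ?r") for U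
    proof -
      have 1: "?l $ iv = ?r $ iv" and 2: "?l $ iu = ?r $ iu"
        using iu unfolding e_def[symmetric] by (simp_all add: matrix_vector_component UN comp M inn)
      have "?l $ j = ?r $ j" for j
      proof (cases "j = iv")
        case True
        show ?thesis unfolding True by (rule 1)
      next
        case False
        hence j: "j = iu" using UN by blast
        show ?thesis unfolding j by (rule 2)
      qed
      thus ?thesis unfolding vec_eq_iff by blast
    qed
  qed
  thus thesis by (rule that)
qed

theorem corollary2:
  fixes iv :: "'n::finite"
    and H :: "(real ^ 'n) \<times> real \<Rightarrow> real"
    and B :: "real ^ 'n ^ 'n"
    and \<Omega> :: "'n param set"
    and U :: "'n param \<Rightarrow> real \<Rightarrow> real ^ 'n"
    and \<Xi> :: "'n param \<Rightarrow> real"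
    and \<mu> c :: real
    and l :: "real ^ 'n"
  assumes "CARD('n) \<in> {1, 2}"
    and "structural_conditions iv H B"
    and "open \<Omega>"
    and "smooth_on \<Omega> \<Xi>"
    and "smooth_on (\<Omega> \<times> UNIV) (\<lambda>(p, x). U p x)"
    and "\<forall>p\<in>\<Omega>. \<Xi> p > 0 \<and> periodic (\<Xi> p) (U p)"
    and "\<forall>(\<mu>, l, c)\<in>\<Omega>. \<forall>x.
           euler (ham_impulse iv H B c) (U (\<mu>, l, c)) x + l = 0 \<and>
           legendre (lagrangian iv H B c l) (U (\<mu>, l, c)) x = \<mu>"
    and "\<forall>p\<in>\<Omega>. U p 0 = U p (\<Xi> p) \<and>
           deriv (\<lambda>x. U p x $ iv) 0 = 0 \<and> deriv (\<lambda>x. U p x $ iv) (\<Xi> p) = 0"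
    and "\<forall>p\<in>\<Omega>. dir_deriv \<Xi> mu_dir p \<noteq> 0"
    and "\<forall>p\<in>\<Omega>. invertible (constraint_matrix (action iv H B U \<Xi>) \<Xi> p)"
    and "(\<mu>, l, c) \<in> \<Omega>"
    and "neg_signature (HH iv 2 (\<Xi> (\<mu>, l, c)))
           (hess_form (ham_impulse iv H B c) (\<Xi> (\<mu>, l, c)) (U (\<mu>, l, c)))
         = enat (matrix_neg_signature (- constraint_matrix (action iv H B U \<Xi>) \<Xi> (\<mu>, l, c)))"
  shows "classical_solution iv H B (\<lambda>t x. U (\<mu>, l, c) (x - c * t)) \<and>
         conditionally_orbitally_stable iv H B (\<Xi> (\<mu>, l, c)) (U (\<mu>, l, c))"
proof -
  have smooth: "smooth_on UNIV H" and B: "invertible B"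
    and N: "CARD('n) = 1 \<Longrightarrow> scalar_structure iv H" "CARD('n) = 2 \<Longrightarrow> system_structure iv H B"
    using assms(2) unfolding structural_conditions_def by blast+
  have "\<exists>f e \<kappa> \<tau> t or k. ham_form iv H B f e \<kappa> \<tau> t or k"
  proof (cases "CARD('n) = 1")
    case True
    show ?thesis by (rule scalar_normal_form[OF True smooth N(1)[OF True]]) blast
  next
    case False
    hence 2: "CARD('n) = 2" using assms(1) by simp
    show ?thesis by (rule system_normal_form[OF 2 smooth N(2)[OF 2]]) blast
  qed
  then obtain f e \<kappa> \<tau> t or k where hf: "ham_form iv H B f e \<kappa> \<tau> t or k" by blast
  interpret W: wave iv H B f e \<kappa> \<tau> t or k \<Omega> U \<Xi> "(\<mu>, l, c)"
  proof (intro wave.intro wave_family.intro hf wave_family_axioms.intro wave_axioms.intro)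
    show "open \<Omega>" "smooth_on \<Omega> \<Xi>" "smooth_on (\<Omega> \<times> UNIV) (\<lambda>(p, x). U p x)" "(\<mu>, l, c) \<in> \<Omega>" by (rule assms)+
    fix q x assume q: "q \<in> \<Omega>"
    show "0 < \<Xi> q" "periodic (\<Xi> q) (U q)" "deriv (\<lambda>x. U q x $ iv) 0 = 0" "dir_deriv \<Xi> mu_dir q \<noteq> 0"
      using assms(6,8,9) q by blast+
    obtain \<mu>' l' c' where qe: "q = (\<mu>', l', c')" by (cases q) blast
    have "euler (ham_impulse iv H B c') (U (\<mu>', l', c')) x + l' = 0 \<and> legendre (lagrangian iv H B c' l') (U (\<mu>', l', c')) x = \<mu>'"
      using assms(7) q unfolding qe by blast
    thus "euler (ham_impulse iv H B (snd (snd q))) (U q) x + fst (snd q) = 0"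
      "legendre (lagrangian iv H B (snd (snd q)) (fst (snd q))) (U q) x = fst q"
      unfolding qe by simp_all
  qed
  have inv: "invertible (constraint_matrix (action iv H B U \<Xi>) \<Xi> (\<mu>, l, c))" using assms(10,11) by blast
  have index: "neg_signature (HH iv 2 (\<Xi> (\<mu>, l, c))) (hess_form (ham_impulse iv H B (snd (snd (\<mu>, l, c)))) (\<Xi> (\<mu>, l, c)) (U (\<mu>, l, c)))
         = enat (matrix_neg_signature (- constraint_matrix (action iv H B U \<Xi>) \<Xi> (\<mu>, l, c)))"
    using assms(12) by simp
  show ?thesis using W.wave_classical_solution[OF B] W.wave_orbitally_stable[OF index inv] by simp
qed

end
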